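(* Suppose that $(\mathbf{L}^0,\mathbf{p})$ is a Brascamp--Lieb datum such that $\mathrm{BL}_{\mathrm{loc}}(\mathbf{L}^0,\mathbf{p})<\infty$. Then there exist $\delta>0$ and a constant $C<\infty$ such that $$\mathrm{BL}_{\mathrm{loc}}(\mathbf{L},\mathbf{p})\leq C$$ for every Brascamp--Lieb datum $(\mathbf{L},\mathbf{p})$ (with the same spaces $H,H_1,\ldots,H_m$ and the same exponents $\mathbf{p}$) satisfying $\|\mathbf{L}-\mathbf{L}^0\|<\delta$.
   Context: Let $m$ be a positive integer and let $H$, $H_1,\ldots,H_m$ be euclidean spaces of finite dimensions $n$ and $n_j\le n$ respectively, equipped with Lebesgue measure. A Brascamp--Lieb datum $(\mathbf{L},\mathbf{p})$ consists of an $m$-tuple $\mathbf{L}=(L_j)_{j=1}^m$ of surjective linear maps $L_j:H\to H_j$ with $\bigcap_{j=1}^m\ker L_j=\{0\}$ and an $m$-tuple $\mathbf{p}=(p_j)_{j=1}^m$ of real exponents $0\le p_j\le 1$. The localised Brascamp--Lieb constant $\mathrm{BL}_{\mathrm{loc}}(\mathbf{L},\mathbf{p})\in[0,\infty]$ is the smallest constant $C$ for which $$\int_{\|x\|_H\le 1}\prod_{j=1}^m (f_j\circ L_j)^{p_j}\leq C\prod_{j=1}^m\Big(\int_{H_j}f_j\Big)^{p_j}$$ holds for all nonnegative $f_j\in L^1(H_j)$, $1\le j\le m$. The norm $\|\cdot\|$ on tuples is any fixed norm on the finite-dimensional space of $m$-tuples of linear maps $H\to H_j$. *)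

theory Defs
  imports "HOL-Analysis.Analysis"
begin

text \<open>
  The space \<open>H\<close> is an arbitrary type \<open>'a::euclidean_space\<close>.  The target spaces \<open>H\<^sub>j\<close> may have
  different dimensions (possibly zero), so they cannot all be one type; they are given as linear
  subspaces \<open>V j\<close> of a common, arbitrary euclidean space \<open>'b\<close>, with the inherited inner product.
  The indices \<open>j\<close> range over an arbitrary finite (nonempty) type \<open>'m\<close>.
\<close>

definition orthonormal_basis_of :: "'b::euclidean_space set \<Rightarrow> 'b set \<Rightarrow> bool" where
  "orthonormal_basis_of V B \<longleftrightarrow>
     pairwise orthogonal B \<and> (\<forall>b\<in>B. norm b = 1) \<and> span B = V"

lemma orthonormal_basis_of_exists:
  fixes V :: "'b::euclidean_space set"
  assumes "subspace V"
  shows "\<exists>B. orthonormal_basis_of V B"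
  using orthonormal_basis_subspace[OF assms] unfolding orthonormal_basis_of_def by metis

lemma orthonormal_basis_of_finite:
  fixes V :: "'b::euclidean_space set"
  assumes "orthonormal_basis_of V B"
  shows "finite B"
  using assms pairwise_orthogonal_imp_finite unfolding orthonormal_basis_of_def by blast

text \<open>
  Lebesgue measure on a subspace \<open>V\<close>: the image of the product Lebesgue measure under orthonormal
  coordinates.  By orthogonal invariance it does not depend on the basis that is chosen.
  It lives on the Borel sets of \<open>V\<close>; every element of \<open>L\<^sup>1(V)\<close> has a Borel representative.
  For \<open>V = {0}\<close> it is the unit point mass.
\<close>

definition lborel_subspace :: "'b::euclidean_space set \<Rightarrow> 'b measure" where
  "lborel_subspace V =
     (let B = (SOME B. orthonormal_basis_of V B)
      in distr (\<Pi>\<^sub>M b\<in>B. (lborel :: real measure)) (restrict_space borel V)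
           (\<lambda>c. \<Sum>b\<in>B. c b *\<^sub>R b))"

text \<open>
  Real powers with \<open>0\<^sup>0 = 1\<close>, so that a factor with exponent \<open>0\<close> disappears from the
  inequality; note that \<open>0 powr 0 = 0\<close>.
\<close>

definition rpow :: "real \<Rightarrow> real \<Rightarrow> real" where
  "rpow x a = (if a = 0 then 1 else x powr a)"

text \<open>
  Since everything is finite-dimensional, the linear maps are exactly the bounded linear ones.
  A linear map \<open>H \<rightarrow> H\<^sub>j\<close> is a map into \<open>'b\<close> with range contained in \<open>V j\<close>.
\<close>

definition linear_tuples ::
  "('m::finite \<Rightarrow> 'b::euclidean_space set) \<Rightarrow> (('a::euclidean_space \<Rightarrow>\<^sub>L 'b) ^ 'm) set" where
  "linear_tuples V = {L. \<forall>j. range (blinfun_apply (L $ j)) \<subseteq> V j}"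

definition brascamp_lieb_datum ::
  "('m::finite \<Rightarrow> 'b::euclidean_space set) \<Rightarrow> ('a::euclidean_space \<Rightarrow>\<^sub>L 'b) ^ 'm \<Rightarrow> real ^ 'm \<Rightarrow> bool"
  where
  "brascamp_lieb_datum V L p \<longleftrightarrow>
     (\<forall>j. range (blinfun_apply (L $ j)) = V j) \<and>
     (\<Inter>j. {x. blinfun_apply (L $ j) x = 0}) = {0} \<and>
     (\<forall>j. 0 \<le> p $ j \<and> p $ j \<le> 1)"

definition BL_loc_bound ::
  "('m::finite \<Rightarrow> 'b::euclidean_space set) \<Rightarrow> ('a::euclidean_space \<Rightarrow>\<^sub>L 'b) ^ 'm \<Rightarrow> real ^ 'm
    \<Rightarrow> ennreal \<Rightarrow> bool" where
  "BL_loc_bound V L p C \<longleftrightarrow>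
     (\<forall>f :: 'm \<Rightarrow> 'b \<Rightarrow> real.
        (\<forall>j. integrable (lborel_subspace (V j)) (f j) \<and> (\<forall>y\<in>V j. 0 \<le> f j y)) \<longrightarrow>
        (\<integral>\<^sup>+x\<in>cball 0 1. ennreal (\<Prod>j\<in>UNIV. rpow (f j (blinfun_apply (L $ j) x)) (p $ j)) \<partial>lborel)
          \<le> C * ennreal (\<Prod>j\<in>UNIV. rpow (\<integral>y. f j y \<partial>lborel_subspace (V j)) (p $ j)))"

definition BL_loc ::
  "('m::finite \<Rightarrow> 'b::euclidean_space set) \<Rightarrow> ('a::euclidean_space \<Rightarrow>\<^sub>L 'b) ^ 'm \<Rightarrow> real ^ 'm
    \<Rightarrow> ennreal" where
  "BL_loc V L p = Inf {C. BL_loc_bound V L p C}"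

definition is_norm_on :: "'v::real_vector set \<Rightarrow> ('v \<Rightarrow> real) \<Rightarrow> bool" where
  "is_norm_on S N \<longleftrightarrow>
     (\<forall>x\<in>S. 0 \<le> N x \<and> (N x = 0 \<longleftrightarrow> x = 0)) \<and>
     (\<forall>x\<in>S. \<forall>c. N (c *\<^sub>R x) = \<bar>c\<bar> * N x) \<and>
     (\<forall>x\<in>S. \<forall>y\<in>S. N (x + y) \<le> N x + N y)"

end

theory Submission
  imports Defs "HOL-Probability.Distributions" "HOL-Real_Asymp.Real_Asymp"
begin

text \<open>
  In orthonormal coordinates \<open>H\<close> is \<open>\<real>\<^sup>n\<close>, and \<open>H\<^sub>j\<close> is the space of vectors supported on a set \<open>K\<^sub>j\<close> of coordinates, so
  that \<open>L\<^sub>j\<close> becomes an \<open>n \<times> n\<close> matrix \<open>A\<^sub>j\<close> whose rows outside \<open>K\<^sub>j\<close> vanish.  A function on \<open>H\<^sub>j\<close> becomes a function of the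
  coordinates in \<open>K\<^sub>j\<close>; multiplied by a Gaussian in the remaining ones it can be integrated over all of \<open>\<real>\<^sup>n\<close>, which changes
  integrals by a constant factor.  Finiteness of the constant is then characterised by a condition that is visibly
  stable.

  The condition (\<open>frame_bounds\<close>) concerns every orthonormal frame \<open>e\<close> of \<open>\<real>\<^sup>n\<close>.  For each \<open>j\<close> one has to select \<open>dim H\<^sub>j\<close> frame
  vectors whose images under \<open>A\<^sub>j\<close> have determinant bounded away from \<open>0\<close>, in such a way that for each \<open>t\<close> the number of
  indices \<open>k \<ge> t\<close> is at least \<open>\<Sum>\<^sub>j p\<^sub>j\<close> times the number of selected indices \<open>k \<ge> t\<close>.

  Sufficiency, with a constant that depends only on the lower bound for the determinants: consider the functional
  \<open>det S exp (- trace S) / \<Prod>\<^sub>j (det G\<^sub>j) powr p\<^sub>j\<close> of a positive definite matrix \<open>S\<close>, where \<open>G\<^sub>j\<close> is \<open>A\<^sub>j S A\<^sub>j\<^sup>T\<close> completed by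
  the identity outside \<open>K\<^sub>j\<close>.  Diagonalise \<open>S\<close> with decreasing eigenvalues; the Cauchy--Binet formula and summation by parts
  bound the functional (\<open>BL_functional_bound\<close>).  If the conditions on the exponents are strict, which is achieved by
  shrinking \<open>p\<close> slightly, there is a maximiser \<open>S = T T\<^sup>T\<close>.  Its criticality (\<open>extremal_covariance\<close>) says that the maps
  \<open>A\<^sub>j T\<close> give rise to orthogonal projections \<open>\<pi>\<^sub>j\<close> with \<open>T\<^sup>T T + \<Sum>\<^sub>j p\<^sub>j \<pi>\<^sub>j = 1\<close>.  In the variable \<open>z\<close> with \<open>x = T z\<close> the
  inequality with the weight \<open>exp (- \<parallel>x\<parallel>\<^sup>2 / 2)\<close> is thereby reduced to
  \<open>\<integral> \<Prod>\<^sub>j (h\<^sub>j \<circ> \<pi>\<^sub>j) powr p\<^sub>j \<le> \<Prod>\<^sub>j (\<integral> h\<^sub>j \<circ> \<pi>\<^sub>j) powr p\<^sub>j\<close> for the standard Gaussian measure (\<open>gaussian_brascamp_lieb\<close>).  This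
  holds because \<open>\<Sum>\<^sub>j p\<^sub>j \<pi>\<^sub>j \<le> 1\<close>: along the heat flow the second-order term in each small step has the right sign.

  Necessity (\<open>admissible_of_bound\<close>): given a frame, select greedily the vectors whose images are independent of the
  preceding ones, and test the inequality on boxes with sides of order \<open>\<delta>\<close> along the frame vectors from \<open>t\<close> on and of
  order \<open>1\<close> along the others.

  Stability (\<open>frame_bounds_near\<close>): the determinants depend continuously on the matrices and on the frame, the set of
  frames is compact, and there are finitely many selections, so a positive lower bound at one datum persists,
  up to a factor, for all data near it.
\<close>

section \<open>The Gaussian measure and the heat flow\<close>

definition gauss_weight :: "'a::euclidean_space \<Rightarrow> real" where
  "gauss_weight z = exp (- ((norm z)\<^sup>2 / 2))"

definition gauss_mass :: "'a::euclidean_space itself \<Rightarrow> real" where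
  "gauss_mass _ = integral\<^sup>L lborel (gauss_weight :: 'a \<Rightarrow> real)"

definition gauss :: "'a::euclidean_space measure" where
  "gauss = density lborel (\<lambda>z. ennreal (gauss_weight z / gauss_mass TYPE('a)))"

lemma gauss_weight_measurable [measurable]: "gauss_weight \<in> borel_measurable borel"
  unfolding gauss_weight_def by measurable

lemma gauss_weight_pos: "gauss_weight z > 0"
  by (simp add: gauss_weight_def)

lemma gauss_weight_eq_prod:
  "gauss_weight (z::'a::euclidean_space) = (\<Prod>b\<in>Basis. exp (- ((z \<bullet> b)\<^sup>2 / 2)))"
proof -
  have "(norm z)\<^sup>2 = (\<Sum>b\<in>Basis. (z \<bullet> b)\<^sup>2)"
    unfolding power2_norm_eq_inner by (subst euclidean_inner) (simp add: power2_eq_square)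
  then show ?thesis
    by (simp add: gauss_weight_def exp_sum sum_negf[symmetric] sum_divide_distrib)
qed

lemma nn_integral_exp_square_real: "(\<integral>\<^sup>+x. ennreal (exp (- (x\<^sup>2 / 2))) \<partial>lborel) = ennreal (sqrt (2 * pi))"
proof -
  have "(\<integral>\<^sup>+x. ennreal (exp (- (x\<^sup>2 / 2))) \<partial>lborel)
      = (\<integral>\<^sup>+x. ennreal (sqrt (2 * pi)) * ennreal (std_normal_density x) \<partial>lborel)"
    by (intro nn_integral_cong) (simp add: std_normal_density_def ennreal_mult[symmetric])
  also have "\<dots> = ennreal (sqrt (2 * pi)) * (\<integral>\<^sup>+x. ennreal (std_normal_density x) \<partial>lborel)"
    by (rule nn_integral_cmult) simp
  also have "(\<integral>\<^sup>+x. ennreal (std_normal_density x) \<partial>lborel) = 1"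
    using prob_space.emeasure_space_1[OF prob_space_normal_density[of 1 0]] by (simp add: emeasure_density)
  finally show ?thesis by simp
qed

lemma nn_integral_gauss_weight:
  "(\<integral>\<^sup>+z. ennreal (gauss_weight (z::'a::euclidean_space)) \<partial>lborel) = ennreal (sqrt (2 * pi) ^ DIM('a))"
proof -
  have "(\<integral>\<^sup>+z. ennreal (gauss_weight (z::'a)) \<partial>lborel)
      = (\<integral>\<^sup>+z. (\<Prod>b\<in>Basis. ennreal (exp (- (((z::'a) \<bullet> b)\<^sup>2 / 2)))) \<partial>lborel)"
    by (simp add: gauss_weight_eq_prod prod_ennreal)
  also have "\<dots> = (\<Prod>b\<in>(Basis::'a set). (\<integral>\<^sup>+x. ennreal (exp (- (x\<^sup>2 / 2))) \<partial>lborel))"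
    by (rule nn_integral_lborel_prod) auto
  finally show ?thesis by (simp add: nn_integral_exp_square_real ennreal_power)
qed

lemma gauss_weight_integrable: "integrable lborel (gauss_weight :: 'a::euclidean_space \<Rightarrow> real)"
  by (rule integrableI_nn_integral_finite[OF _ _ nn_integral_gauss_weight])
     (auto simp: gauss_weight_def)

lemma gauss_mass_eq: "gauss_mass TYPE('a::euclidean_space) = sqrt (2 * pi) ^ DIM('a)"
proof -
  have "ennreal (gauss_mass TYPE('a)) = ennreal (sqrt (2 * pi) ^ DIM('a))"
    unfolding gauss_mass_def nn_integral_gauss_weight[symmetric]
    by (rule nn_integral_eq_integral[symmetric, OF gauss_weight_integrable])
       (simp add: less_imp_le[OF gauss_weight_pos])
  moreover have "gauss_mass TYPE('a) \<ge> 0"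
    unfolding gauss_mass_def by (simp add: less_imp_le[OF gauss_weight_pos])
  ultimately show ?thesis by simp
qed

lemma gauss_mass_pos: "gauss_mass TYPE('a::euclidean_space) > 0"
  by (simp add: gauss_mass_eq)

lemma sets_gauss [simp, measurable_cong]: "sets gauss = sets borel"
  and space_gauss [simp]: "space gauss = UNIV"
  by (simp_all add: gauss_def)

lemma nn_integral_gauss:
  fixes f :: "'a::euclidean_space \<Rightarrow> ennreal"
  assumes [measurable]: "f \<in> borel_measurable borel"
  shows "ennreal (gauss_mass TYPE('a)) * (\<integral>\<^sup>+z. f z \<partial>gauss)
    = (\<integral>\<^sup>+z. ennreal (gauss_weight z) * f z \<partial>lborel)"
proof -
  let ?k = "gauss_mass TYPE('a)"
  have k: "?k > 0" by (rule gauss_mass_pos)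
  have "(\<integral>\<^sup>+z. f z \<partial>gauss) = (\<integral>\<^sup>+z. ennreal (gauss_weight z / ?k) * f z \<partial>lborel)"
    unfolding gauss_def by (rule nn_integral_density) auto
  then have "ennreal ?k * (\<integral>\<^sup>+z. f z \<partial>gauss)
      = (\<integral>\<^sup>+z. ennreal ?k * (ennreal (gauss_weight z / ?k) * f z) \<partial>lborel)"
    by (simp add: nn_integral_cmult)
  also have "\<dots> = (\<integral>\<^sup>+z. ennreal (gauss_weight z) * f z \<partial>lborel)"
    using k by (intro nn_integral_cong)
      (simp add: ennreal_mult[symmetric] mult.assoc[symmetric] less_imp_le[OF gauss_weight_pos])
  finally show ?thesis .
qed

lemma prob_space_gauss: "prob_space (gauss :: 'a::euclidean_space measure)"
proof
  let ?k = "gauss_mass TYPE('a)"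
  have "ennreal ?k * emeasure (gauss::'a measure) (space gauss) = ennreal ?k * 1"
    using nn_integral_gauss[where f="\<lambda>_::'a. 1"] by (simp add: nn_integral_gauss_weight gauss_mass_eq)
  then show "emeasure (gauss::'a measure) (space gauss) = 1"
    using gauss_mass_pos[where 'a='a] by (subst (asm) ennreal_mult_cancel_left) auto
qed

lemma nn_integral_lborel_affine:
  fixes f :: "'a::euclidean_space \<Rightarrow> ennreal"
  assumes [measurable]: "f \<in> borel_measurable borel" and c: "c > 0"
  shows "(\<integral>\<^sup>+z. f z \<partial>lborel) = ennreal (c ^ DIM('a)) * (\<integral>\<^sup>+z. f (x + c *\<^sub>R z) \<partial>lborel)"
proof -
  have "(\<integral>\<^sup>+z. f z \<partial>lborel)
     = (\<integral>\<^sup>+z. f z \<partial>(density (distr lborel borel (\<lambda>z. x + c *\<^sub>R z)) (\<lambda>_. \<bar>c\<bar>^DIM('a))))"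
    using lborel_affine[of c x] c by simp
  also have "\<dots> = (\<integral>\<^sup>+z. ennreal (c ^ DIM('a)) * f (x + c *\<^sub>R z) \<partial>lborel)"
    using c by (subst nn_integral_density) (auto simp: nn_integral_distr)
  also have "\<dots> = ennreal (c ^ DIM('a)) * (\<integral>\<^sup>+z. f (x + c *\<^sub>R z) \<partial>lborel)"
    by (rule nn_integral_cmult) auto
  finally show ?thesis .
qed

lemma nn_integral_gauss_rescaled:
  fixes f :: "'a::euclidean_space \<Rightarrow> ennreal"
  assumes [measurable]: "f \<in> borel_measurable borel" and c: "c > 0"
  shows "ennreal (c ^ DIM('a) * gauss_mass TYPE('a)) * (\<integral>\<^sup>+z. f (x + c *\<^sub>R z) \<partial>gauss)
    = (\<integral>\<^sup>+y. ennreal (gauss_weight ((1 / c) *\<^sub>R (y - x))) * f y \<partial>lborel)"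
proof -
  have "(\<integral>\<^sup>+y. ennreal (gauss_weight ((1 / c) *\<^sub>R (y - x))) * f y \<partial>lborel)
     = ennreal (c ^ DIM('a)) * (\<integral>\<^sup>+z. ennreal (gauss_weight z) * f (x + c *\<^sub>R z) \<partial>lborel)"
    using c by (subst nn_integral_lborel_affine[of _ c x]) (auto intro!: measurable_compose[OF _ gauss_weight_measurable])
  moreover have "ennreal (gauss_mass TYPE('a)) * (\<integral>\<^sup>+z. f (x + c *\<^sub>R z) \<partial>gauss)
     = (\<integral>\<^sup>+z. ennreal (gauss_weight z) * f (x + c *\<^sub>R z) \<partial>lborel)"
    by (subst nn_integral_gauss) auto
  ultimately show ?thesis
    using c gauss_mass_pos[where 'a='a] by (simp add: ennreal_mult mult.assoc)
qed

text \<open>Completing the square in \<open>z\<close> separates the product of the two densities, so variances add; this is the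
  semigroup law of the heat flow.\<close>

lemma nn_integral_gauss_gauss:
  fixes f :: "'a::euclidean_space \<Rightarrow> ennreal"
  assumes [measurable]: "f \<in> borel_measurable borel" and a: "a \<ge> 0" and b: "b > 0"
  shows "(\<integral>\<^sup>+z. (\<integral>\<^sup>+w. f (x + a *\<^sub>R z + b *\<^sub>R w) \<partial>gauss) \<partial>gauss)
    = (\<integral>\<^sup>+z. f (x + sqrt (a\<^sup>2 + b\<^sup>2) *\<^sub>R z) \<partial>gauss)"
proof -
  interpret G: prob_space "gauss :: 'a measure" by (rule prob_space_gauss)
  define k where "k = gauss_mass TYPE('a)"
  define n where "n = DIM('a)"
  define c where "c = sqrt (a\<^sup>2 + b\<^sup>2)"
  have k: "k > 0" unfolding k_def by (rule gauss_mass_pos)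
  have c: "c > 0" and c2: "c\<^sup>2 = a\<^sup>2 + b\<^sup>2" unfolding c_def using b
    by (auto simp: add_nonneg_pos)
  \<comment> \<open>the conditional mean of \<open>z\<close> given \<open>y = x + a z + b w\<close> is \<open>(a / c\<^sup>2) (y - x)\<close>, its standard deviation \<open>b / c\<close>\<close>
  have square: "gauss_weight z * gauss_weight ((1/b) *\<^sub>R (y - (x + a *\<^sub>R z)))
      = gauss_weight ((c / b) *\<^sub>R (z - (a / c\<^sup>2) *\<^sub>R (y - x))) * gauss_weight ((1/c) *\<^sub>R (y - x))" for z y :: 'a
  proof -
    define v where "v = y - x"
    have bne: "b \<noteq> 0" "c \<noteq> 0" using b c by auto
    have e1: "(norm ((1/b) *\<^sub>R (y - (x + a *\<^sub>R z))))\<^sup>2 = (norm (v - a *\<^sub>R z))\<^sup>2 / b\<^sup>2"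
      by (simp add: v_def power_divide diff_diff_eq power_mult_distrib del: scaleR_right_diff_distrib)
    have e2: "(norm ((c / b) *\<^sub>R (z - (a / c\<^sup>2) *\<^sub>R v)))\<^sup>2 = c\<^sup>2 / b\<^sup>2 * (norm (z - (a / c\<^sup>2) *\<^sub>R v))\<^sup>2"
      by (simp add: power_mult_distrib power_divide)
    have e3: "(norm ((1 / c) *\<^sub>R v))\<^sup>2 = (norm v)\<^sup>2 / c\<^sup>2"
      by (simp add: power_divide)
    have e4: "(norm (v - a *\<^sub>R z))\<^sup>2 = (norm v)\<^sup>2 - 2 * a * (v \<bullet> z) + a\<^sup>2 * (norm z)\<^sup>2"
      unfolding power2_norm_eq_inner by (simp add: inner_simps power2_eq_square inner_commute algebra_simps)
    have e5: "(norm (z - (a / c\<^sup>2) *\<^sub>R v))\<^sup>2 = (norm z)\<^sup>2 - 2 * (a / c\<^sup>2) * (v \<bullet> z) + (a / c\<^sup>2)\<^sup>2 * (norm v)\<^sup>2"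
      unfolding power2_norm_eq_inner by (simp add: inner_simps power2_eq_square inner_commute algebra_simps)
    have "(norm z)\<^sup>2 + (norm v)\<^sup>2 / b\<^sup>2 - 2 * a * (v \<bullet> z) / b\<^sup>2 + a\<^sup>2 * (norm z)\<^sup>2 / b\<^sup>2
       = c\<^sup>2 / b\<^sup>2 * (norm z)\<^sup>2 - 2 * a * (v \<bullet> z) / b\<^sup>2 + (norm v)\<^sup>2 * (a\<^sup>2 / (b\<^sup>2 * c\<^sup>2) + 1 / c\<^sup>2)"
    proof -
      have "a\<^sup>2 / (b\<^sup>2 * c\<^sup>2) + 1 / c\<^sup>2 = (a\<^sup>2 + b\<^sup>2) / (b\<^sup>2 * c\<^sup>2)"
        using bne by (simp add: field_simps)
      then have "1 / b\<^sup>2 = a\<^sup>2 / (b\<^sup>2 * c\<^sup>2) + 1 / c\<^sup>2"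
        using bne by (simp add: c2[symmetric])
      moreover have "c\<^sup>2 / b\<^sup>2 = 1 + a\<^sup>2 / b\<^sup>2" using bne by (simp add: c2 field_simps)
      ultimately show ?thesis by (simp add: algebra_simps divide_inverse)
    qed
    also have "\<dots> = c\<^sup>2 / b\<^sup>2 * (norm (z - (a / c\<^sup>2) *\<^sub>R v))\<^sup>2 + (norm v)\<^sup>2 / c\<^sup>2"
      unfolding e5 using bne by (simp add: field_simps power2_eq_square)
    finally have "(norm z)\<^sup>2 + (norm ((1/b) *\<^sub>R (y - (x + a *\<^sub>R z))))\<^sup>2
       = (norm ((c / b) *\<^sub>R (z - (a / c\<^sup>2) *\<^sub>R v)))\<^sup>2 + (norm ((1 / c) *\<^sub>R v))\<^sup>2"
      unfolding e1 e2 e3 e4 by (simp add: algebra_simps add_divide_distrib diff_divide_distrib)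
    then show ?thesis
      unfolding gauss_weight_def exp_add[symmetric] v_def[symmetric] by (simp add: field_simps)
  qed
  have gz: "(\<integral>\<^sup>+z. ennreal (gauss_weight ((c / b) *\<^sub>R (z - v))) \<partial>lborel) = ennreal ((b / c) ^ n * k)" for v :: 'a
    using nn_integral_gauss_rescaled[of "\<lambda>_. 1" "b / c" v] b c G.emeasure_space_1
    by (simp add: n_def k_def)
  have "ennreal (b ^ n * k) * (ennreal k * (\<integral>\<^sup>+z. (\<integral>\<^sup>+w. f (x + a *\<^sub>R z + b *\<^sub>R w) \<partial>gauss) \<partial>gauss))
      = ennreal (b ^ n * k) * (\<integral>\<^sup>+z. ennreal (gauss_weight z) * (\<integral>\<^sup>+w. f (x + a *\<^sub>R z + b *\<^sub>R w) \<partial>gauss) \<partial>lborel)"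
    unfolding k_def by (subst nn_integral_gauss) auto
  also have "\<dots> = (\<integral>\<^sup>+z. ennreal (gauss_weight z) * (ennreal (b ^ n * k) * (\<integral>\<^sup>+w. f (x + a *\<^sub>R z + b *\<^sub>R w) \<partial>gauss)) \<partial>lborel)"
    by (subst nn_integral_cmult[symmetric]) (auto simp: mult_ac)
  also have "\<dots> = (\<integral>\<^sup>+z. (\<integral>\<^sup>+y. ennreal (gauss_weight z) * (ennreal (gauss_weight ((1/b) *\<^sub>R (y - (x + a *\<^sub>R z)))) * f y) \<partial>lborel) \<partial>lborel)"
    unfolding n_def k_def using b by (subst nn_integral_gauss_rescaled) (auto intro!: nn_integral_cong nn_integral_cmult[symmetric])
  also have "\<dots> = (\<integral>\<^sup>+y. (\<integral>\<^sup>+z. ennreal (gauss_weight z) * (ennreal (gauss_weight ((1/b) *\<^sub>R (y - (x + a *\<^sub>R z)))) * f y) \<partial>lborel) \<partial>lborel)"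
    by (rule lborel_pair.Fubini'[symmetric]) auto
  also have "\<dots> = (\<integral>\<^sup>+y. (\<integral>\<^sup>+z. ennreal (gauss_weight ((c / b) *\<^sub>R (z - (a / c\<^sup>2) *\<^sub>R (y - x)))) * (ennreal (gauss_weight ((1/c) *\<^sub>R (y - x))) * f y) \<partial>lborel) \<partial>lborel)"
    by (intro nn_integral_cong)
       (simp add: mult.assoc[symmetric] ennreal_mult[symmetric] square less_imp_le[OF gauss_weight_pos])
  also have "\<dots> = (\<integral>\<^sup>+y. ennreal ((b / c) ^ n * k) * (ennreal (gauss_weight ((1/c) *\<^sub>R (y - x))) * f y) \<partial>lborel)"
    by (intro nn_integral_cong) (subst nn_integral_multc, auto simp: gz)
  also have "\<dots> = ennreal ((b / c) ^ n * k) * (ennreal (c ^ n * k) * (\<integral>\<^sup>+z. f (x + c *\<^sub>R z) \<partial>gauss))"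
    unfolding n_def k_def using c by (subst nn_integral_gauss_rescaled) (auto intro!: nn_integral_cmult)
  also have "\<dots> = ennreal (b ^ n * k) * (ennreal k * (\<integral>\<^sup>+z. f (x + c *\<^sub>R z) \<partial>gauss))"
    using b c k by (simp add: mult.assoc[symmetric] ennreal_mult[symmetric] power_divide)
  finally show ?thesis
    unfolding c_def[symmetric] using b k by (simp add: ennreal_mult_cancel_left ennreal_mult_eq_top_iff)
qed

text \<open>The parameter is the standard deviation: \<open>heat s\<close> is the heat semigroup at time \<open>s\<^sup>2 / 2\<close>, and composition adds
  the squares of the parameters.\<close>

definition heat :: "real \<Rightarrow> ('a::euclidean_space \<Rightarrow> real) \<Rightarrow> 'a \<Rightarrow> real" where
  "heat s u x = (\<integral>z. u (x + s *\<^sub>R z) \<partial>gauss)"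

lemma integrable_gauss_bounded:
  fixes u :: "'a::euclidean_space \<Rightarrow> real"
  assumes "u \<in> borel_measurable borel" "\<And>x. \<bar>u x\<bar> \<le> B"
  shows "integrable gauss u"
proof -
  interpret G: prob_space "gauss :: 'a measure" by (rule prob_space_gauss)
  show ?thesis by (rule G.integrable_const_bound[of _ B]) (use assms in auto)
qed

lemma heat_measurable [measurable]:
  fixes u :: "'a::euclidean_space \<Rightarrow> real"
  assumes [measurable]: "u \<in> borel_measurable borel"
  shows "heat s u \<in> borel_measurable borel"
proof -
  interpret G: prob_space "gauss :: 'a measure" by (rule prob_space_gauss)
  show ?thesis unfolding heat_def[abs_def] by measurable
qed

lemma integrable_gauss_affine:
  fixes u :: "'a::euclidean_space \<Rightarrow> real"
  assumes [measurable]: "u \<in> borel_measurable borel" and "\<And>x. a \<le> u x \<and> u x \<le> b"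
  shows "integrable gauss (\<lambda>z. u (x + s *\<^sub>R z))"
proof (rule integrable_gauss_bounded[of _ "\<bar>a\<bar> + \<bar>b\<bar>"])
  show "\<bar>u (x + s *\<^sub>R z)\<bar> \<le> \<bar>a\<bar> + \<bar>b\<bar>" for z
    using assms(2)[of "x + s *\<^sub>R z"] by linarith
qed simp

lemma heat_bounds:
  fixes u :: "'a::euclidean_space \<Rightarrow> real"
  assumes [measurable]: "u \<in> borel_measurable borel" and ab: "\<And>x. a \<le> u x \<and> u x \<le> b"
  shows "a \<le> heat s u x \<and> heat s u x \<le> b"
proof -
  interpret G: prob_space "gauss :: 'a measure" by (rule prob_space_gauss)
  have i: "integrable gauss (\<lambda>z. u (x + s *\<^sub>R z))"
    by (rule integrable_gauss_affine[OF assms])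
  have "(\<integral>z. a \<partial>(gauss::'a measure)) \<le> heat s u x" "heat s u x \<le> (\<integral>z. b \<partial>(gauss::'a measure))"
    unfolding heat_def by (rule integral_mono[OF _ i]; use ab in simp) (rule integral_mono[OF i]; use ab in simp)
  then show ?thesis using G.prob_space by simp
qed

lemma heat_eq_nn_integral:
  fixes u :: "'a::euclidean_space \<Rightarrow> real"
  assumes [measurable]: "u \<in> borel_measurable borel" and ab: "\<And>x. 0 \<le> u x \<and> u x \<le> b"
  shows "ennreal (heat s u x) = (\<integral>\<^sup>+z. ennreal (u (x + s *\<^sub>R z)) \<partial>gauss)"
  unfolding heat_def
  by (rule nn_integral_eq_integral[symmetric, OF integrable_gauss_affine[OF assms]]) (use ab in auto)

lemma heat_heat:
  fixes u :: "'a::euclidean_space \<Rightarrow> real"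
  assumes [measurable]: "u \<in> borel_measurable borel" and ab: "\<And>x. 0 \<le> u x \<and> u x \<le> B"
    and s: "s \<ge> 0" "t > 0"
  shows "heat s (heat t u) x = heat (sqrt (s\<^sup>2 + t\<^sup>2)) u x"
proof -
  have "ennreal (heat s (heat t u) x) = (\<integral>\<^sup>+z. ennreal (heat t u (x + s *\<^sub>R z)) \<partial>gauss)"
    by (rule heat_eq_nn_integral) (use heat_bounds[OF assms(1) ab] in auto)
  also have "\<dots> = (\<integral>\<^sup>+z. (\<integral>\<^sup>+w. ennreal (u (x + s *\<^sub>R z + t *\<^sub>R w)) \<partial>gauss) \<partial>gauss)"
    by (simp add: heat_eq_nn_integral[OF assms(1) ab])
  also have "\<dots> = ennreal (heat (sqrt (s\<^sup>2 + t\<^sup>2)) u x)"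
    using s by (simp add: heat_eq_nn_integral[OF assms(1) ab] nn_integral_gauss_gauss[where f="\<lambda>x. ennreal (u x)"])
  finally show ?thesis
    by (subst (asm) ennreal_inj)
       (use heat_bounds[OF assms(1) ab] heat_bounds[OF heat_measurable[OF assms(1)] heat_bounds[OF assms(1) ab]] in auto)
qed

lemma integrable_gauss_exp_norm:
  "integrable gauss (\<lambda>z::'a::euclidean_space. exp (c * norm z))"
proof (rule integrableI_bounded)
  interpret G: prob_space "gauss :: 'a measure" by (rule prob_space_gauss)
  define k where "k = gauss_mass TYPE('a)"
  have k: "k > 0" unfolding k_def by (rule gauss_mass_pos)
  have "gauss_weight z * exp (c * norm z) \<le> exp (c\<^sup>2) * gauss_weight ((1 / sqrt 2) *\<^sub>R (z - 0))" for z :: 'a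
  proof -
    have "0 \<le> (c - norm z / 2)\<^sup>2" by simp
    then have "c * norm z - (norm z)\<^sup>2 / 2 \<le> c\<^sup>2 - (norm z)\<^sup>2 / 4"
      by (simp add: power2_eq_square field_simps)
    then show ?thesis
      by (simp add: gauss_weight_def exp_add[symmetric] power_divide)
  qed
  then have "ennreal k * (\<integral>\<^sup>+z. ennreal (exp (c * norm z)) \<partial>(gauss::'a measure))
      \<le> (\<integral>\<^sup>+z. ennreal (exp (c\<^sup>2)) * ennreal (gauss_weight ((1 / sqrt 2) *\<^sub>R (z - 0::'a))) \<partial>lborel)"
    unfolding k_def by (subst nn_integral_gauss)
      (auto simp: ennreal_mult[symmetric] less_imp_le[OF gauss_weight_pos] intro!: nn_integral_mono ennreal_leI)
  also have "\<dots> = ennreal (exp (c\<^sup>2)) * ennreal (sqrt 2 ^ DIM('a) * k)"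
    using nn_integral_gauss_rescaled[of "\<lambda>_::'a. 1" "sqrt 2" 0] G.emeasure_space_1
    by (subst nn_integral_cmult) (auto simp: k_def)
  also have "\<dots> < \<infinity>" by (simp add: ennreal_mult_less_top)
  finally show "(\<integral>\<^sup>+z. ennreal (norm (exp (c * norm (z::'a)))) \<partial>gauss) < \<infinity>"
    using k by (auto simp: ennreal_mult_less_top)
qed simp

lemma power_le_exp: "0 \<le> (x::real) \<Longrightarrow> x ^ k \<le> fact k * exp x"
proof -
  assume x: "0 \<le> x"
  have "x ^ k /\<^sub>R fact k \<le> (\<Sum>n. x ^ n /\<^sub>R fact n)"
    using x sum_le_suminf[OF summable_exp_generic[of x], of "{k}"] by simp
  then have "x ^ k / fact k \<le> exp x" by (simp add: exp_def divide_inverse mult.commute)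
  then show ?thesis by (simp add: field_simps)
qed

lemma integrable_gauss_power_norm:
  "integrable gauss (\<lambda>z::'a::euclidean_space. norm z ^ k)"
  by (rule Bochner_Integration.integrable_bound[OF integrable_mult_right[OF integrable_gauss_exp_norm[of 1], of "fact k"]])
     (auto simp: power_le_exp)

text \<open>The Cameron--Martin formula: a translation is absorbed by an exponential density.\<close>

lemma nn_integral_gauss_shift:
  fixes f :: "'a::euclidean_space \<Rightarrow> ennreal"
  assumes [measurable]: "f \<in> borel_measurable borel"
  shows "(\<integral>\<^sup>+z. f (z + v) \<partial>gauss) = (\<integral>\<^sup>+z. f z * ennreal (exp (z \<bullet> v - (norm v)\<^sup>2 / 2)) \<partial>gauss)"
proof -
  have w: "gauss_weight (z - v) = gauss_weight z * exp (z \<bullet> v - (norm v)\<^sup>2 / 2)" for z :: 'a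
    by (simp add: gauss_weight_def exp_add[symmetric] power2_norm_eq_inner inner_simps inner_commute diff_divide_distrib add_divide_distrib)
  have "ennreal (gauss_mass TYPE('a)) * (\<integral>\<^sup>+z. f (z + v) \<partial>gauss)
     = (\<integral>\<^sup>+z. ennreal (gauss_weight z) * f (z + v) \<partial>lborel)"
    by (subst nn_integral_gauss) auto
  also have "\<dots> = (\<integral>\<^sup>+z. ennreal (gauss_weight (z - v)) * f z \<partial>lborel)"
    by (subst nn_integral_lborel_affine[of "\<lambda>z. ennreal (gauss_weight (z - v)) * f z" 1 v]) (auto simp: add.commute)
  also have "\<dots> = (\<integral>\<^sup>+z. ennreal (gauss_weight z) * (f z * ennreal (exp (z \<bullet> v - (norm v)\<^sup>2 / 2))) \<partial>lborel)"
    by (simp add: w ennreal_mult less_imp_le[OF gauss_weight_pos] mult_ac)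
  also have "\<dots> = ennreal (gauss_mass TYPE('a)) * (\<integral>\<^sup>+z. f z * ennreal (exp (z \<bullet> v - (norm v)\<^sup>2 / 2)) \<partial>gauss)"
    by (subst nn_integral_gauss) auto
  finally show ?thesis
    using gauss_mass_pos[where 'a='a] by (subst (asm) ennreal_mult_cancel_left) auto
qed

lemma exp_second_order_bound:
  fixes y :: real shows "\<bar>exp y - 1 - y\<bar> \<le> y\<^sup>2 * exp \<bar>y\<bar>"
proof -
  obtain t where "\<bar>t\<bar> \<le> \<bar>y\<bar>" and "exp y = (\<Sum>m<2. y ^ m / fact m) + exp t / fact 2 * y ^ 2"
    using Maclaurin_exp_le[of y 2] by auto
  then have t: "\<bar>t\<bar> \<le> \<bar>y\<bar>" and eq: "exp y - 1 - y = exp t / 2 * y\<^sup>2"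
    by (simp_all add: numeral_2_eq_2)
  have "exp t / 2 \<le> exp \<bar>y\<bar>" using t exp_le_cancel_iff[of t "\<bar>y\<bar>"] exp_gt_zero[of t] by linarith
  then have "exp t / 2 * y\<^sup>2 \<le> exp \<bar>y\<bar> * y\<^sup>2" by (rule mult_right_mono) simp
  moreover have "exp t / 2 * y\<^sup>2 \<ge> 0" by simp
  ultimately show ?thesis unfolding eq by (simp add: mult.commute)
qed

text \<open>Averaging over a Gaussian gives a bounded function a first-order expansion with quadratic remainder: move the
  translation to the Gaussian density and expand that.  The constant depends on the function only through its bound,
  so that it is the same at each of many successive steps of the heat flow.\<close>

lemma heat_first_order:
  fixes b \<tau> :: real
  assumes \<tau>: "\<tau> > 0" and b: "b \<ge> 0"
  shows "\<exists>K\<ge>0. \<forall>h :: 'a::euclidean_space \<Rightarrow> real. h \<in> borel_measurable borel \<longrightarrow> (\<forall>x. 0 \<le> h x \<and> h x \<le> b) \<longrightarrow>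
     (\<forall>x. \<exists>g. norm g \<le> K \<and> (\<forall>v. \<bar>heat \<tau> h (x + v) - heat \<tau> h x - g \<bullet> v\<bar> \<le> K * (norm v)\<^sup>2))"
proof -
  interpret G: prob_space "gauss :: 'a measure" by (rule prob_space_gauss)
  define M where "M = (\<integral>z. norm z \<partial>(gauss::'a measure))"
  define Q where "Q = (\<lambda>z::'a. 1 + 2 * exp 2 * exp (2 * norm z))"
  define N where "N = (\<integral>z. Q z \<partial>gauss)"
  have Qi: "integrable gauss Q" unfolding Q_def
    by (intro Bochner_Integration.integrable_add integrable_mult_right integrable_gauss_exp_norm) simp
  have M0: "M \<ge> 0" unfolding M_def by simp
  have N0: "N \<ge> 0" unfolding N_def Q_def by simp
  have Mi: "integrable gauss (\<lambda>z::'a. norm z)" using integrable_gauss_power_norm[of 1] by simp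
  define K0 where "K0 = b * N + 2 * b + b * M"
  define K where "K = K0 / \<tau>\<^sup>2 + b * M / \<tau>"
  have K00: "K0 \<ge> 0" unfolding K0_def using b M0 N0 by simp
  have K0: "K \<ge> 0" unfolding K_def using b M0 N0 \<tau> K00 by simp
  have "\<exists>g. norm g \<le> K \<and> (\<forall>v. \<bar>heat \<tau> h (x + v) - heat \<tau> h x - g \<bullet> v\<bar> \<le> K * (norm v)\<^sup>2)"
    if h[measurable]: "h \<in> borel_measurable borel" and hb: "\<And>x. 0 \<le> h x \<and> h x \<le> b" for h :: "'a \<Rightarrow> real" and x
  proof -
    define g where "g = (\<integral>z. h (x + \<tau> *\<^sub>R z) *\<^sub>R z \<partial>gauss)"
    have gi: "integrable gauss (\<lambda>z. h (x + \<tau> *\<^sub>R z) *\<^sub>R z)"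
      by (rule Bochner_Integration.integrable_bound[OF integrable_mult_right[OF Mi, of b]])
         (use hb b in \<open>auto simp: mult_right_mono\<close>)
    have gn: "norm g \<le> b * M"
    proof -
      have "norm g \<le> (\<integral>z. norm (h (x + \<tau> *\<^sub>R z) *\<^sub>R z) \<partial>gauss)" unfolding g_def by (rule integral_norm_bound)
      also have "\<dots> \<le> (\<integral>z. b * norm z \<partial>(gauss::'a measure))"
      proof (rule integral_mono)
        show "integrable gauss (\<lambda>z. norm (h (x + \<tau> *\<^sub>R z) *\<^sub>R z))" using gi by (rule integrable_norm)
        show "norm (h (x + \<tau> *\<^sub>R z) *\<^sub>R z) \<le> b * norm z" for z
          using hb[of "x + \<tau> *\<^sub>R z"] by (simp add: mult_right_mono)
      qed (use Mi in simp)
      finally show ?thesis by (simp add: M_def)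
    qed
    have bd: "\<bar>heat \<tau> h y\<bar> \<le> b" for y using heat_bounds[OF h hb, of \<tau> y] by simp
    have main: "\<bar>heat \<tau> h (x + \<tau> *\<^sub>R v) - heat \<tau> h x - g \<bullet> v\<bar> \<le> K0 * (norm v)\<^sup>2" for v
    \<comment> \<open>for long translations crude bounds suffice, for short ones the density is expanded\<close>
    proof (cases "norm v \<le> 1")
      case False
      then have v: "1 \<le> norm v" by simp
      then have v2: "norm v \<le> (norm v)\<^sup>2" "1 \<le> (norm v)\<^sup>2" using mult_mono[OF v v] mult_mono[OF v order_refl[of "norm v"]] by (simp_all add: power2_eq_square)
      have "\<bar>g \<bullet> v\<bar> \<le> b * M * norm v"
        using Cauchy_Schwarz_ineq2[of g v] gn by (meson mult_right_mono norm_ge_zero order_trans)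
      also have "\<dots> \<le> b * M * (norm v)\<^sup>2" using v2 b M0 by (intro mult_left_mono) auto
      finally have "\<bar>heat \<tau> h (x + \<tau> *\<^sub>R v) - heat \<tau> h x - g \<bullet> v\<bar> \<le> b + b + b * M * (norm v)\<^sup>2"
        using bd[of "x + \<tau> *\<^sub>R v"] bd[of x] by linarith
      also have "b + b \<le> (2 * b) * (norm v)\<^sup>2" using v2 b mult_left_mono[of 1 "(norm v)\<^sup>2" "2 * b"] by simp
      finally have "\<bar>heat \<tau> h (x + \<tau> *\<^sub>R v) - heat \<tau> h x - g \<bullet> v\<bar> \<le> (2 * b + b * M) * (norm v)\<^sup>2"
        by (simp add: algebra_simps)
      also have "\<dots> \<le> K0 * (norm v)\<^sup>2" unfolding K0_def using b N0 by (intro mult_right_mono) auto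
      finally show ?thesis .
    next
      case True
      define E where "E = (\<lambda>z::'a. exp (z \<bullet> v - (norm v)\<^sup>2 / 2))"
      have Ei: "integrable gauss (\<lambda>z. h (x + \<tau> *\<^sub>R z) * E z)"
      proof (rule Bochner_Integration.integrable_bound[OF integrable_mult_right[OF integrable_gauss_exp_norm[of "norm v"], of b]])
        have "z \<bullet> v - (norm v)\<^sup>2 / 2 \<le> norm v * norm z" for z
        proof -
          have "\<bar>z \<bullet> v\<bar> \<le> norm v * norm z" using Cauchy_Schwarz_ineq2[of z v] by (simp add: mult.commute)
          then show ?thesis using zero_le_power2[of "norm v"] by linarith
        qed
        then show "AE z in gauss. norm (h (x + \<tau> *\<^sub>R z) * E z) \<le> norm (b * exp (norm v * norm z))"
          using hb b by (auto simp: abs_mult E_def intro!: mult_mono)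
      qed (simp add: E_def)
      have "ennreal (heat \<tau> h (x + \<tau> *\<^sub>R v)) = (\<integral>\<^sup>+z. ennreal (h (x + \<tau> *\<^sub>R (z + v))) \<partial>gauss)"
        by (simp add: heat_eq_nn_integral[OF h hb] algebra_simps)
      also have "\<dots> = (\<integral>\<^sup>+z. ennreal (h (x + \<tau> *\<^sub>R z) * E z) \<partial>gauss)"
        by (subst nn_integral_gauss_shift[where f="\<lambda>z. ennreal (h (x + \<tau> *\<^sub>R z))"]) (auto simp: E_def ennreal_mult hb)
      also have "\<dots> = ennreal (\<integral>z. h (x + \<tau> *\<^sub>R z) * E z \<partial>gauss)"
        by (rule nn_integral_eq_integral[OF Ei]) (auto simp: hb E_def)
      finally have s: "heat \<tau> h (x + \<tau> *\<^sub>R v) = (\<integral>z. h (x + \<tau> *\<^sub>R z) * E z \<partial>gauss)"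
        using heat_bounds[OF h hb] by (subst (asm) ennreal_inj) (auto simp: hb E_def)
      have hi: "integrable gauss (\<lambda>z. h (x + \<tau> *\<^sub>R z))" by (rule integrable_gauss_affine[OF h hb])
      have gv: "g \<bullet> v = (\<integral>z. h (x + \<tau> *\<^sub>R z) * (z \<bullet> v) \<partial>gauss)"
        and gvi: "integrable gauss (\<lambda>z. h (x + \<tau> *\<^sub>R z) * (z \<bullet> v))"
        unfolding g_def using integral_inner_left[OF gi, of v] integrable_inner_left[OF gi, of v] by (auto)
      have "heat \<tau> h (x + \<tau> *\<^sub>R v) - heat \<tau> h x - g \<bullet> v
          = (\<integral>z. h (x + \<tau> *\<^sub>R z) * E z - h (x + \<tau> *\<^sub>R z) - h (x + \<tau> *\<^sub>R z) * (z \<bullet> v) \<partial>gauss)"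
        unfolding s gv using Ei hi gvi by (simp add: heat_def)
      also have "\<bar>\<dots>\<bar> \<le> (\<integral>z. b * (norm v)\<^sup>2 * Q z \<partial>gauss)"
      proof (rule order_trans[OF integral_abs_bound integral_mono])
        show "integrable gauss (\<lambda>z. \<bar>h (x + \<tau> *\<^sub>R z) * E z - h (x + \<tau> *\<^sub>R z) - h (x + \<tau> *\<^sub>R z) * (z \<bullet> v)\<bar>)"
          using Ei hi gvi by (intro integrable_abs Bochner_Integration.integrable_diff)
        show "integrable gauss (\<lambda>z. b * (norm v)\<^sup>2 * Q z)" using Qi by simp
        fix z :: 'a
        define y where "y = z \<bullet> v - (norm v)\<^sup>2 / 2"
        have ya: "\<bar>y\<bar> \<le> norm v * (norm z + 1)"
        proof -
          have "(norm v)\<^sup>2 \<le> norm v" using True by (simp add: power2_eq_square mult_left_le)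
          then have "\<bar>(norm v)\<^sup>2 / 2\<bar> \<le> norm v" using zero_le_power2[of "norm v"] by linarith
          moreover have "\<bar>z \<bullet> v\<bar> \<le> norm v * norm z" using Cauchy_Schwarz_ineq2[of z v] by (simp add: mult.commute)
          ultimately have "\<bar>z \<bullet> v - (norm v)\<^sup>2 / 2\<bar> \<le> norm v * norm z + norm v" by linarith
          then show ?thesis unfolding y_def by (simp add: algebra_simps)
        qed
        have yb: "\<bar>y\<bar> \<le> norm z + 1"
          using ya mult_right_mono[OF True, of "norm z + 1"] by simp
        have y2: "y\<^sup>2 \<le> (norm v)\<^sup>2 * (norm z + 1)\<^sup>2"
          using power_mono[OF ya, of 2] by (simp add: power_mult_distrib)
        have "\<bar>E z - 1 - z \<bullet> v\<bar> \<le> \<bar>exp y - 1 - y\<bar> + (norm v)\<^sup>2 / 2"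
        proof -
          have tri: "\<bar>e - 1 - t\<bar> \<le> \<bar>e - 1 - (t - q)\<bar> + q" if "q \<ge> 0" for e t q :: real using that by linarith
          show ?thesis unfolding E_def y_def by (rule tri) simp
        qed
        also have "\<bar>exp y - 1 - y\<bar> \<le> y\<^sup>2 * exp \<bar>y\<bar>" by (rule exp_second_order_bound)
        also have "\<dots> \<le> ((norm v)\<^sup>2 * (norm z + 1)\<^sup>2) * exp (norm z + 1)"
          using y2 yb by (intro mult_mono) auto
        also have "\<dots> \<le> ((norm v)\<^sup>2 * (2 * exp (norm z + 1))) * exp (norm z + 1)"
          using power_le_exp[of "norm z + 1" 2] by (intro mult_right_mono mult_left_mono) (auto simp: fact_2)
        also have "\<dots> + (norm v)\<^sup>2 / 2 \<le> (norm v)\<^sup>2 * Q z"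
        proof -
          have "exp (norm z + 1) * exp (norm z + 1) = exp 2 * exp (2 * norm z)"
            by (simp only: exp_add[symmetric]) (simp add: algebra_simps)
          then have "((norm v)\<^sup>2 * (2 * exp (norm z + 1))) * exp (norm z + 1) = (norm v)\<^sup>2 * (2 * exp 2 * exp (2 * norm z))"
            by (simp only: mult.assoc)
          then show ?thesis unfolding Q_def distrib_left mult_1_right using zero_le_power2[of "norm v"] by linarith
        qed
        finally have e: "\<bar>E z - 1 - z \<bullet> v\<bar> \<le> (norm v)\<^sup>2 * Q z" by simp
        have "\<bar>h (x + \<tau> *\<^sub>R z) * E z - h (x + \<tau> *\<^sub>R z) - h (x + \<tau> *\<^sub>R z) * (z \<bullet> v)\<bar>
            = h (x + \<tau> *\<^sub>R z) * \<bar>E z - 1 - z \<bullet> v\<bar>"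
        proof -
          have "h (x + \<tau> *\<^sub>R z) * E z - h (x + \<tau> *\<^sub>R z) - h (x + \<tau> *\<^sub>R z) * (z \<bullet> v) = h (x + \<tau> *\<^sub>R z) * (E z - 1 - z \<bullet> v)"
            by (simp add: algebra_simps)
          then show ?thesis using hb[of "x + \<tau> *\<^sub>R z"] by (simp only: abs_mult abs_of_nonneg)
        qed
        also have "\<dots> \<le> b * ((norm v)\<^sup>2 * Q z)" using hb b e by (intro mult_mono) auto
        finally show "\<bar>h (x + \<tau> *\<^sub>R z) * E z - h (x + \<tau> *\<^sub>R z) - h (x + \<tau> *\<^sub>R z) * (z \<bullet> v)\<bar> \<le> b * (norm v)\<^sup>2 * Q z"
          by (simp add: mult.assoc)
      qed
      also have "\<dots> = b * N * (norm v)\<^sup>2" by (simp add: N_def)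
      also have "\<dots> \<le> K0 * (norm v)\<^sup>2" unfolding K0_def using b M0 by (intro mult_right_mono) auto
      finally show ?thesis .
    qed
    show ?thesis
    proof (intro exI[of _ "g /\<^sub>R \<tau>"] conjI allI)
      show "norm (g /\<^sub>R \<tau>) \<le> K"
        using gn \<tau> K00 divide_right_mono[OF gn, of \<tau>] by (simp add: K_def divide_inverse_commute add_increasing)
      fix v
      have "\<bar>heat \<tau> h (x + v) - heat \<tau> h x - (g /\<^sub>R \<tau>) \<bullet> v\<bar> \<le> K0 * (norm (v /\<^sub>R \<tau>))\<^sup>2"
        using main[of "v /\<^sub>R \<tau>"] \<tau> by simp
      also have "\<dots> = K0 / \<tau>\<^sup>2 * (norm v)\<^sup>2" using \<tau> by (simp add: power_mult_distrib power_inverse divide_inverse)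
      also have "\<dots> \<le> K * (norm v)\<^sup>2" unfolding K_def using b M0 \<tau> by (intro mult_right_mono) auto
      finally show "\<bar>heat \<tau> h (x + v) - heat \<tau> h x - (g /\<^sub>R \<tau>) \<bullet> v\<bar> \<le> K * (norm v)\<^sup>2" .
    qed
  qed
  then show ?thesis using K0 by blast
qed

lemma integral_gauss_minus:
  fixes u :: "'a::euclidean_space \<Rightarrow> real"
  assumes [measurable]: "u \<in> borel_measurable borel"
  shows "(\<integral>z. u (- z) \<partial>gauss) = (\<integral>z. u z \<partial>gauss)"
proof -
  have eq: "distr gauss borel (\<lambda>z::'a. - z) = gauss"
  proof (rule measure_eqI)
    fix A :: "'a set" assume "A \<in> sets (distr gauss borel (\<lambda>z::'a. - z))"
    then have [measurable]: "A \<in> sets borel" by simp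
    have lb: "(\<integral>\<^sup>+z. f z \<partial>lborel) = (\<integral>\<^sup>+z. f (- z) \<partial>lborel)" if [measurable]: "f \<in> borel_measurable borel" for f :: "'a \<Rightarrow> ennreal"
    proof -
      have "lborel = density (distr lborel borel (uminus :: 'a \<Rightarrow> 'a)) (\<lambda>_. 1)"
        using lborel_affine[of "-1" "0::'a"] by simp
      then have "(\<integral>\<^sup>+z. f z \<partial>lborel) = (\<integral>\<^sup>+z. f z \<partial>(distr lborel borel uminus))"
        unfolding density_1 by metis
      also have "\<dots> = (\<integral>\<^sup>+z. f (- z) \<partial>lborel)" by (simp add: nn_integral_distr)
      finally show ?thesis .
    qed
    have "ennreal (gauss_mass TYPE('a)) * (\<integral>\<^sup>+z. indicator A (- z) \<partial>gauss) = ennreal (gauss_mass TYPE('a)) * (\<integral>\<^sup>+z. indicator A z \<partial>gauss)"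
      by (subst (1 2) nn_integral_gauss) (auto simp: gauss_weight_def lb[of "\<lambda>z. ennreal (exp (- ((norm z)\<^sup>2 / 2))) * indicator A z"])
    then have "(\<integral>\<^sup>+z. indicator A (- z) \<partial>gauss) = (\<integral>\<^sup>+z. indicator A z \<partial>(gauss::'a measure))"
      using gauss_mass_pos[where 'a='a] by (subst (asm) ennreal_mult_cancel_left) auto
    then show "emeasure (distr gauss borel (\<lambda>z::'a. - z)) A = emeasure gauss A"
      using nn_integral_distr[of "\<lambda>z::'a. - z" gauss borel "indicator A"] by simp
  qed simp
  show ?thesis by (subst (2) eq[symmetric]) (simp add: integral_distr)
qed

lemma integral_gauss_inner: "(\<integral>z. g \<bullet> z \<partial>gauss) = 0"
  using integral_gauss_minus[of "\<lambda>z. g \<bullet> z"] by simp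

section \<open>The Gaussian inequality for projections\<close>

lemma ln_one_plus_le_cubic:
  fixes y :: real assumes "y > -1"
  shows "ln (1 + y) \<le> y - y\<^sup>2 / 2 + y ^ 3 / 3"
proof -
  define f where "f = (\<lambda>y::real. y - y\<^sup>2 / 2 + y ^ 3 / 3 - ln (1 + y))"
  have d: "(f has_real_derivative x ^ 3 / (1 + x)) (at x)" if "x > -1" for x
    unfolding f_def using that
    by (auto intro!: derivative_eq_intros simp: field_simps power2_eq_square power3_eq_cube)
  have "f 0 \<le> f y"
  proof (cases "y \<ge> 0")
    case True
    then show ?thesis by (rule DERIV_nonneg_imp_nondecreasing) (auto intro!: d exI conjI)
  next
    case False
    then have "y \<le> 0" by simp
    then show ?thesis
    proof (rule DERIV_nonpos_imp_nonincreasing)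
      fix x assume x: "y \<le> x" "x \<le> 0"
      have "x ^ 3 \<le> 0" using x by (simp add: power3_eq_cube mult_nonneg_nonpos)
      then have "x ^ 3 / (1 + x) \<le> 0" using x assms by (simp add: divide_nonpos_pos)
      then show "\<exists>y. (f has_real_derivative y) (at x) \<and> y \<le> 0" using d[of x] x assms by auto
    qed
  qed
  then show ?thesis by (simp add: f_def)
qed

lemma exp_third_order_bound:
  fixes y :: real shows "exp y \<le> 1 + y + y\<^sup>2 / 2 + \<bar>y\<bar> ^ 3 * exp \<bar>y\<bar>"
proof -
  obtain t where "\<bar>t\<bar> \<le> \<bar>y\<bar>" and "exp y = (\<Sum>m<3. y ^ m / fact m) + exp t / fact 3 * y ^ 3"
    using Maclaurin_exp_le[of y 3] by auto
  then have t: "\<bar>t\<bar> \<le> \<bar>y\<bar>" and eq: "exp y = 1 + y + y\<^sup>2 / 2 + exp t / 6 * y ^ 3"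
    by (simp_all add: numeral_3_eq_3 numeral_2_eq_2 fact_numeral)
  have "exp t / 6 \<le> exp \<bar>y\<bar>" using t exp_le_cancel_iff[of t "\<bar>y\<bar>"] exp_gt_zero[of t] by linarith
  then have "exp t / 6 * \<bar>y\<bar> ^ 3 \<le> exp \<bar>y\<bar> * \<bar>y\<bar> ^ 3" by (rule mult_right_mono) simp
  moreover have "exp t / 6 * y ^ 3 \<le> exp t / 6 * \<bar>y\<bar> ^ 3"
    by (rule mult_left_mono) (use abs_ge_self[of "y ^ 3"] in \<open>simp_all add: power_abs\<close>)
  ultimately have "exp t / 6 * y ^ 3 \<le> exp \<bar>y\<bar> * \<bar>y\<bar> ^ 3" by linarith
  then show ?thesis unfolding eq by (simp add: mult.commute)
qed

text \<open>Second-order expansion of a weighted geometric mean around \<open>1\<close>, obtained by expanding its logarithm.  The cubic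
  upper bound for the logarithm holds all the way down to \<open>-1\<close>, so the remainder stays uniform when some
  \<open>Y j\<close> approaches \<open>-1\<close>.\<close>

lemma prod_powr_expansion:
  fixes p :: "'m::finite \<Rightarrow> real"
  assumes p: "\<And>j. p j \<ge> 0" and D: "D \<ge> 0"
  shows "\<exists>C\<ge>0. \<forall>Y \<theta>. (\<forall>j. -1 < Y j \<and> \<bar>Y j\<bar> \<le> \<theta>) \<longrightarrow> \<theta> \<le> D \<longrightarrow>
    (\<Prod>j\<in>UNIV. (1 + Y j) powr p j)
      \<le> 1 + (\<Sum>j\<in>UNIV. p j * Y j) + ((\<Sum>j\<in>UNIV. p j * Y j)\<^sup>2 - (\<Sum>j\<in>UNIV. p j * (Y j)\<^sup>2)) / 2 + C * \<theta> ^ 3"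
proof -
  define P where "P = (\<Sum>j\<in>UNIV. p j)"
  define E where "E = 1 + D + D\<^sup>2"
  define C where "C = P / 3 + P\<^sup>2 * (1 + D) * (E + 1) / 2 + (P * E) ^ 3 * exp (P * E * D)"
  have P: "P \<ge> 0" unfolding P_def by (simp add: p sum_nonneg)
  have E: "E \<ge> 0" unfolding E_def using D by simp
  have C: "C \<ge> 0" unfolding C_def using P E D by simp
  have "(\<Prod>j\<in>UNIV. (1 + Y j) powr p j)
      \<le> 1 + (\<Sum>j\<in>UNIV. p j * Y j) + ((\<Sum>j\<in>UNIV. p j * Y j)\<^sup>2 - (\<Sum>j\<in>UNIV. p j * (Y j)\<^sup>2)) / 2 + C * \<theta> ^ 3"
    if Y: "\<And>j. -1 < Y j \<and> \<bar>Y j\<bar> \<le> \<theta>" and \<theta>: "\<theta> \<le> D" for Y \<theta>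
  proof -
    have \<theta>0: "\<theta> \<ge> 0" using Y[of undefined] by linarith
    define A where "A = (\<Sum>j\<in>UNIV. p j * Y j)"
    define B where "B = (\<Sum>j\<in>UNIV. p j * (Y j)\<^sup>2)"
    define G where "G = (\<Sum>j\<in>UNIV. p j * (Y j)^3) / 3"
    define t where "t = A - B / 2 + G"
    have sumb: "\<bar>\<Sum>j\<in>UNIV. p j * (Y j)^k\<bar> \<le> P * \<theta> ^ k" for k
    proof -
      have "\<bar>\<Sum>j\<in>UNIV. p j * (Y j)^k\<bar> \<le> (\<Sum>j\<in>UNIV. \<bar>p j * (Y j)^k\<bar>)" by (rule sum_abs)
      also have "\<dots> \<le> (\<Sum>j\<in>UNIV. p j * \<theta> ^ k)"
        using p Y by (intro sum_mono) (auto simp: abs_mult power_abs intro!: mult_left_mono power_mono)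
      finally show ?thesis by (simp add: P_def sum_distrib_right)
    qed
    have A: "\<bar>A\<bar> \<le> P * \<theta>" using sumb[of 1] by (simp add: A_def)
    have B: "\<bar>B\<bar> \<le> P * \<theta>\<^sup>2" using sumb[of 2] by (simp add: B_def)
    have G: "\<bar>G\<bar> \<le> P * \<theta> ^ 3 / 3" using sumb[of 3] by (simp add: G_def)
    have th3: "\<theta> ^ 3 \<le> D * \<theta>\<^sup>2" "\<theta>\<^sup>2 \<le> D * \<theta>" "\<theta> ^ 3 \<le> D\<^sup>2 * \<theta>"
    proof -
      show "\<theta>\<^sup>2 \<le> D * \<theta>" using mult_right_mono[OF \<theta> \<theta>0] by (simp add: power2_eq_square)
      show "\<theta> ^ 3 \<le> D * \<theta>\<^sup>2" using mult_right_mono[OF \<theta>, of "\<theta>\<^sup>2"] by (simp add: power3_eq_cube power2_eq_square mult.assoc)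
      show "\<theta> ^ 3 \<le> D\<^sup>2 * \<theta>" using mult_right_mono[OF mult_mono[OF \<theta> \<theta> D \<theta>0] \<theta>0] by (simp add: power3_eq_cube power2_eq_square)
    qed
    have "\<bar>t - A\<bar> \<le> P * \<theta>\<^sup>2 / 2 + P * \<theta> ^ 3 / 3" unfolding t_def using B G by linarith
    also have "\<dots> \<le> P * \<theta>\<^sup>2 + P * (D * \<theta>\<^sup>2)"
    proof -
      have "P * \<theta> ^ 3 \<le> P * (D * \<theta>\<^sup>2)" using th3 P by (intro mult_left_mono)
      moreover have "0 \<le> P * \<theta>\<^sup>2" "0 \<le> P * (D * \<theta>\<^sup>2)" using P D by auto
      ultimately show ?thesis by linarith
    qed
    finally have tA: "\<bar>t - A\<bar> \<le> P * (1 + D) * \<theta>\<^sup>2" by (simp add: algebra_simps)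
    have t: "\<bar>t\<bar> \<le> P * E * \<theta>"
    proof -
      have "\<bar>t\<bar> \<le> P * \<theta> + P * \<theta>\<^sup>2 / 2 + P * \<theta> ^ 3 / 3" unfolding t_def using A B G by linarith
      moreover have "P * \<theta> ^ 3 \<le> P * (D\<^sup>2 * \<theta>)" "P * \<theta>\<^sup>2 \<le> P * (D * \<theta>)" using th3 P by (auto intro: mult_left_mono)
      moreover have "0 \<le> P * (D\<^sup>2 * \<theta>)" "0 \<le> P * (D * \<theta>)" using P D \<theta>0 by auto
      ultimately have "\<bar>t\<bar> \<le> P * \<theta> + P * (D * \<theta>) + P * (D\<^sup>2 * \<theta>)" by linarith
      then show ?thesis by (simp add: E_def algebra_simps)
    qed
    have "(1 + Y j) powr p j \<le> exp (p j * (Y j - (Y j)\<^sup>2 / 2 + (Y j)^3 / 3))" for j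
      using Y[of j] p[of j] ln_one_plus_le_cubic[of "Y j"] by (simp add: powr_def mult_left_mono)
    then have "(\<Prod>j\<in>UNIV. (1 + Y j) powr p j) \<le> (\<Prod>j\<in>UNIV. exp (p j * (Y j - (Y j)\<^sup>2 / 2 + (Y j)^3 / 3)))"
      by (intro prod_mono) auto
    also have "\<dots> = exp t"
      by (simp add: exp_sum[symmetric] t_def A_def B_def G_def sum_divide_distrib algebra_simps sum.distrib sum_subtractf)
    also have "\<dots> \<le> 1 + t + t\<^sup>2 / 2 + \<bar>t\<bar> ^ 3 * exp \<bar>t\<bar>" by (rule exp_third_order_bound)
    also have "\<bar>t\<bar> ^ 3 * exp \<bar>t\<bar> \<le> (P * E * \<theta>) ^ 3 * exp (P * E * D)"
    proof (intro mult_mono power_mono)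
      have "P * E * \<theta> \<le> P * E * D" using \<theta> P E by (intro mult_left_mono) auto
      then show "exp \<bar>t\<bar> \<le> exp (P * E * D)" using t by simp
    qed (use t in auto)
    also have "t\<^sup>2 \<le> A\<^sup>2 + (P * (1 + D) * \<theta>\<^sup>2) * (P * (E + 1) * \<theta>)"
    proof -
      have "t\<^sup>2 - A\<^sup>2 \<le> \<bar>t - A\<bar> * \<bar>t + A\<bar>" by (simp add: abs_mult[symmetric] power2_eq_square algebra_simps) 
      also have "\<dots> \<le> (P * (1 + D) * \<theta>\<^sup>2) * (P * (E + 1) * \<theta>)"
        using tA t A by (intro mult_mono) (auto simp: algebra_simps)
      finally show ?thesis by simp
    qed
    also have "1 + t + (A\<^sup>2 + (P * (1 + D) * \<theta>\<^sup>2) * (P * (E + 1) * \<theta>)) / 2 + (P * E * \<theta>) ^ 3 * exp (P * E * D)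
       \<le> 1 + A + (A\<^sup>2 - B) / 2 + C * \<theta> ^ 3"
      using G unfolding t_def C_def by (simp add: power3_eq_cube power2_eq_square field_simps)
    finally show ?thesis unfolding A_def B_def by simp
  qed
  then show ?thesis using C by blast
qed

text \<open>Reflecting one coordinate shows that distinct coordinates are uncorrelated, and all coordinates have the same
  second moment.\<close>

lemma integral_gauss_inner_square:
  "\<exists>c\<ge>0. \<forall>\<alpha>::'a::euclidean_space. (\<integral>z. (\<alpha> \<bullet> z)\<^sup>2 \<partial>gauss) = c * (norm \<alpha>)\<^sup>2"
proof -
  interpret G: prob_space "gauss :: 'a measure" by (rule prob_space_gauss)
  have int: "integrable gauss (\<lambda>z. (z \<bullet> b) * (z \<bullet> b'))" for b b' :: 'a
  proof (rule Bochner_Integration.integrable_bound[OF integrable_mult_right[OF integrable_gauss_power_norm[of 2], of "norm b * norm b'"]])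
    show "AE z in gauss. norm ((z \<bullet> b) * (z \<bullet> b')) \<le> norm (norm b * norm b' * norm z ^ 2)"
      by (auto simp: abs_mult power2_eq_square intro!: AE_I2 order_trans[OF mult_mono[OF Cauchy_Schwarz_ineq2 Cauchy_Schwarz_ineq2]])
  qed simp
  have off: "(\<integral>z. (z \<bullet> b) * (z \<bullet> b') \<partial>gauss) = 0" if b: "b \<in> Basis" "b' \<in> Basis" "b \<noteq> b'" for b b' :: 'a
  proof -
    \<comment> \<open>the reflection in the hyperplane orthogonal to \<open>b\<close>\<close>
    define T where "T = (\<lambda>z::'a. \<Sum>j\<in>Basis. ((if j = b then -1 else 1) * (z \<bullet> j)) *\<^sub>R j)"
    have Tb: "T z \<bullet> j = (if j = b then -1 else 1) * (z \<bullet> j)" if "j \<in> Basis" for z j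
      unfolding T_def using that by simp
    have [measurable]: "T \<in> borel \<rightarrow>\<^sub>M borel" unfolding T_def by measurable
    have "lborel = distr lborel borel T"
    proof -
      have "lborel = density (distr lborel borel T) (\<lambda>_. ennreal (\<Prod>j\<in>(Basis::'a set). \<bar>if j = b then -1 else 1\<bar>))"
        using lborel_affine_euclidean[of "\<lambda>j. if j = b then -1 else 1" "0::'a"]
        by (simp only: T_def add_0_left) simp
      moreover have "(\<Prod>j\<in>(Basis::'a set). \<bar>if j = b then -1 else 1\<bar>) = (1::real)"
        by (rule prod.neutral) auto
      ultimately show ?thesis by (simp only: ennreal_1 density_1)
    qed
    moreover have w: "gauss_weight (T z) = gauss_weight z" for z
    proof -
      have "(T z \<bullet> c)\<^sup>2 = (z \<bullet> c)\<^sup>2" if "c \<in> Basis" for c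
        using that by (simp add: Tb)
      then show ?thesis by (simp add: gauss_weight_eq_prod)
    qed
    ultimately have "distr gauss borel T = gauss"
    proof -
      assume l: "lborel = distr lborel borel T"
      have "density (distr lborel borel T) (\<lambda>z. ennreal (gauss_weight z / gauss_mass TYPE('a)))
         = distr (density lborel (\<lambda>z. ennreal (gauss_weight (T z) / gauss_mass TYPE('a)))) borel T"
        by (rule density_distr) auto
      then show ?thesis using l w by (simp add: gauss_def)
    qed
    then have "(\<integral>z. (z \<bullet> b) * (z \<bullet> b') \<partial>gauss) = (\<integral>z. (z \<bullet> b) * (z \<bullet> b') \<partial>(distr gauss borel T))"
      by simp
    also have "\<dots> = (\<integral>z. (T z \<bullet> b) * (T z \<bullet> b') \<partial>gauss)"
      by (rule integral_distr) auto
    finally have "(\<integral>z. (z \<bullet> b) * (z \<bullet> b') \<partial>gauss) = (\<integral>z. (T z \<bullet> b) * (T z \<bullet> b') \<partial>gauss)" .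
    then show ?thesis using b by (simp add: Tb)
  qed
  obtain b0 :: 'a where b0: "b0 \<in> Basis" using nonempty_Basis by blast
  define c where "c = (\<integral>z. (z \<bullet> b0)\<^sup>2 \<partial>gauss)"
  have diag: "(\<integral>z. (z \<bullet> b)\<^sup>2 \<partial>gauss) = c" if b: "b \<in> Basis" for b :: 'a
  proof -
    have nn: "ennreal (gauss_mass TYPE('a)) * (\<integral>\<^sup>+z. ennreal ((z \<bullet> b)\<^sup>2) \<partial>gauss)
        = (\<integral>\<^sup>+x. ennreal (x\<^sup>2 * exp (- (x\<^sup>2 / 2))) \<partial>lborel) * (\<integral>\<^sup>+x. ennreal (exp (- (x\<^sup>2 / 2))) \<partial>lborel) ^ (DIM('a) - 1)"
      if b: "b \<in> Basis" for b :: 'a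
    proof -
      define f where "f = (\<lambda>j x. ennreal ((if j = b then x\<^sup>2 else 1) * exp (- (x\<^sup>2 / 2))))"
      have "ennreal (gauss_mass TYPE('a)) * (\<integral>\<^sup>+z. ennreal ((z \<bullet> b)\<^sup>2) \<partial>gauss)
         = (\<integral>\<^sup>+z. ennreal (gauss_weight z) * ennreal ((z \<bullet> b)\<^sup>2) \<partial>lborel)"
        by (rule nn_integral_gauss) simp
      also have "\<dots> = (\<integral>\<^sup>+z. (\<Prod>j\<in>Basis. f j (z \<bullet> j)) \<partial>lborel)"
      proof (rule nn_integral_cong)
        fix z :: 'a
        have "(\<Prod>j\<in>Basis. if j = b then (z \<bullet> j)\<^sup>2 else 1) = (z \<bullet> b)\<^sup>2"
          using b by (simp add: prod.delta)
        then show "ennreal (gauss_weight z) * ennreal ((z \<bullet> b)\<^sup>2) = (\<Prod>j\<in>Basis. f j (z \<bullet> j))"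
          unfolding f_def by (subst prod_ennreal)
            (auto simp: gauss_weight_eq_prod prod.distrib ennreal_mult[symmetric] prod_nonneg mult.commute simp del: prod.delta)
      qed
      also have "\<dots> = (\<Prod>j\<in>Basis. \<integral>\<^sup>+x. f j x \<partial>lborel)"
        unfolding f_def by (rule nn_integral_lborel_prod) auto
      also have "\<dots> = (\<integral>\<^sup>+x. f b x \<partial>lborel) * (\<Prod>j\<in>Basis - {b}. \<integral>\<^sup>+x. f j x \<partial>lborel)"
        using b by (subst prod.remove[of _ b]) auto
      also have "(\<Prod>j\<in>Basis - {b}. \<integral>\<^sup>+x. f j x \<partial>lborel) = (\<Prod>j\<in>Basis - {b}. \<integral>\<^sup>+x. ennreal (exp (- (x\<^sup>2 / 2))) \<partial>lborel)"
        by (intro prod.cong) (auto simp: f_def)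
      finally show ?thesis using b by (simp add: f_def card_Diff_singleton)
    qed
    have "ennreal (gauss_mass TYPE('a)) * (\<integral>\<^sup>+z. ennreal ((z \<bullet> b)\<^sup>2) \<partial>gauss) = ennreal (gauss_mass TYPE('a)) * (\<integral>\<^sup>+z. ennreal ((z \<bullet> b0)\<^sup>2) \<partial>gauss)"
      unfolding nn[OF b] nn[OF b0] ..
    then have "(\<integral>\<^sup>+z. ennreal ((z \<bullet> b)\<^sup>2) \<partial>gauss) = (\<integral>\<^sup>+z. ennreal ((z \<bullet> b0)\<^sup>2) \<partial>gauss)"
      using gauss_mass_pos[where 'a='a] by (subst (asm) ennreal_mult_cancel_left) auto
    then show ?thesis
      unfolding c_def by (simp add: integral_eq_nn_integral)
  qed
  have "(\<integral>z. (\<alpha> \<bullet> z)\<^sup>2 \<partial>gauss) = c * (norm \<alpha>)\<^sup>2" for \<alpha> :: 'a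
  proof -
    have "(\<alpha> \<bullet> z)\<^sup>2 = (\<Sum>b\<in>Basis. \<Sum>b'\<in>Basis. (\<alpha> \<bullet> b) * (\<alpha> \<bullet> b') * ((z \<bullet> b) * (z \<bullet> b')))" for z
      by (subst euclidean_inner) (simp add: power2_eq_square sum_product mult_ac)
    then have "(\<integral>z. (\<alpha> \<bullet> z)\<^sup>2 \<partial>gauss) = (\<Sum>b\<in>Basis. \<Sum>b'\<in>Basis. (\<alpha> \<bullet> b) * (\<alpha> \<bullet> b') * (\<integral>z. (z \<bullet> b) * (z \<bullet> b') \<partial>gauss))"
      using int by (simp add: Bochner_Integration.integral_sum)
    also have "\<dots> = (\<Sum>b\<in>Basis. \<Sum>b'\<in>Basis. if b = b' then (\<alpha> \<bullet> b)\<^sup>2 * c else 0)"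
      using off diag by (intro sum.cong) (auto simp: power2_eq_square)
    also have "\<dots> = c * (norm \<alpha>)\<^sup>2"
    proof -
      have "(\<Sum>b'\<in>Basis. if b = b' then (\<alpha> \<bullet> b)\<^sup>2 * c else 0) = (\<alpha> \<bullet> b)\<^sup>2 * c" if "b \<in> Basis" for b
        using that by (simp add: sum.delta)
      then have "(\<Sum>b\<in>Basis. \<Sum>b'\<in>Basis. if b = b' then (\<alpha> \<bullet> b)\<^sup>2 * c else 0) = c * (\<Sum>b\<in>Basis. (\<alpha> \<bullet> b) * (\<alpha> \<bullet> b))"
        by (simp add: sum_distrib_left power2_eq_square mult.commute)
      then show ?thesis unfolding power2_norm_eq_inner euclidean_inner[of \<alpha> \<alpha>] .
    qed
    finally show ?thesis .
  qed
  moreover have "c \<ge> 0" by (simp add: c_def)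
  ultimately show ?thesis by blast
qed

text \<open>The last assumption is the operator inequality \<open>\<Sum>\<^sub>j p\<^sub>j \<pi>\<^sub>j \<le> 1\<close>, stated for quadratic forms.\<close>

locale weighted_projections =
  fixes p :: "'m::finite \<Rightarrow> real" and \<pi> :: "'m \<Rightarrow> 'a::euclidean_space \<Rightarrow> 'a"
  assumes p_nonneg: "p j \<ge> 0"
    and \<pi>_linear: "linear (\<pi> j)"
    and \<pi>_idem: "\<pi> j (\<pi> j x) = \<pi> j x"
    and \<pi>_selfadj: "\<pi> j x \<bullet> y = x \<bullet> \<pi> j y"
    and \<pi>_sum_le: "(\<Sum>j\<in>UNIV. p j * (norm (\<pi> j x))\<^sup>2) \<le> (norm x)\<^sup>2"
begin

lemma \<pi>_norm_le: "norm (\<pi> j x) \<le> norm x"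
proof -
  have "(norm (\<pi> j x))\<^sup>2 = x \<bullet> \<pi> j x"
    unfolding power2_norm_eq_inner by (simp add: \<pi>_selfadj \<pi>_idem)
  also have "\<dots> \<le> norm x * norm (\<pi> j x)" by (rule norm_cauchy_schwarz)
  finally show ?thesis
    by (cases "norm (\<pi> j x) = 0") (auto simp: power2_eq_square)
qed

lemma \<pi>_measurable [measurable]: "\<pi> j \<in> borel \<rightarrow>\<^sub>M borel"
  by (rule borel_measurable_continuous_onI) (simp add: \<pi>_linear linear_continuous_on linear_conv_bounded_linear[symmetric])

text \<open>The dual form of \<open>\<Sum>\<^sub>j p\<^sub>j \<pi>\<^sub>j \<le> 1\<close>: the map \<open>(\<beta>\<^sub>j) \<mapsto> \<Sum>\<^sub>j p\<^sub>j \<pi>\<^sub>j \<beta>\<^sub>j\<close> is adjoint to \<open>x \<mapsto> (\<pi>\<^sub>j x)\<close> with respect to the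
  inner product weighted by \<open>p\<close>, so both are contractions.\<close>

lemma weighted_sum_of_ranges:
  "(norm (\<Sum>j\<in>UNIV. p j *\<^sub>R \<pi> j (\<beta> j)))\<^sup>2 \<le> (\<Sum>j\<in>UNIV. p j * (norm (\<pi> j (\<beta> j)))\<^sup>2)"
proof -
  define w where "w = (\<Sum>j\<in>UNIV. p j *\<^sub>R \<pi> j (\<beta> j))"
  have "(norm w)\<^sup>2 = (\<Sum>j\<in>UNIV. p j * (\<pi> j (\<beta> j) \<bullet> w))"
    unfolding power2_norm_eq_inner by (subst (1) w_def) (simp add: inner_sum_left)
  also have "\<dots> = (\<Sum>j\<in>UNIV. p j * (\<pi> j (\<beta> j) \<bullet> \<pi> j w))"
    by (metis \<pi>_idem \<pi>_selfadj)
  also have "\<dots> \<le> (\<Sum>j\<in>UNIV. p j * (((norm (\<pi> j (\<beta> j)))\<^sup>2 + (norm (\<pi> j w))\<^sup>2) / 2))"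
  proof (intro sum_mono mult_left_mono p_nonneg)
    fix j
    have "0 \<le> (norm (\<pi> j (\<beta> j) - \<pi> j w))\<^sup>2" by simp
    then show "\<pi> j (\<beta> j) \<bullet> \<pi> j w \<le> ((norm (\<pi> j (\<beta> j)))\<^sup>2 + (norm (\<pi> j w))\<^sup>2) / 2"
      unfolding power2_norm_eq_inner by (simp add: inner_simps inner_commute)
  qed
  also have "\<dots> = ((\<Sum>j\<in>UNIV. p j * (norm (\<pi> j (\<beta> j)))\<^sup>2) + (\<Sum>j\<in>UNIV. p j * (norm (\<pi> j w))\<^sup>2)) / 2"
    by (simp add: sum.distrib[symmetric] sum_divide_distrib distrib_left)
  finally have 1: "(norm w)\<^sup>2 \<le> \<dots>" .
  have "A \<le> S" if "A \<le> (S + B) / 2" "B \<le> A" for A B S :: real using that by (simp add: field_simps)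
  from this[OF 1 \<pi>_sum_le] show ?thesis unfolding w_def .
qed

text \<open>One small step of the heat flow.  After normalising each factor to have mean \<open>1\<close> the first-order terms integrate
  to \<open>0\<close>, and the second-order term is nonpositive by \<open>weighted_sum_of_ranges\<close>, because the gradient of the
  \<open>j\<close>-th factor lies in the range of \<open>\<pi> j\<close>; what is left is of third order in the step size.\<close>

lemma heat_one_step:
  assumes a: "0 < a" "a \<le> b" and K: "K \<ge> 0"
  shows "\<exists>C\<ge>0. \<forall>(u :: 'm \<Rightarrow> 'a \<Rightarrow> real) x s. (\<forall>j. u j \<in> borel_measurable borel \<and>
       (\<forall>y. a \<le> u j y \<and> u j y \<le> b \<and> u j (\<pi> j y) = u j y \<and>
         (\<exists>g. norm g \<le> K \<and> (\<forall>v. \<bar>u j (y + v) - u j y - g \<bullet> v\<bar> \<le> K * (norm v)\<^sup>2)))) \<longrightarrow> 0 \<le> s \<longrightarrow> s \<le> 1 \<longrightarrow>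
     (\<integral>z. (\<Prod>j\<in>UNIV. u j (x + s *\<^sub>R z) powr p j) \<partial>gauss) \<le> (1 + C * s ^ 3) * (\<Prod>j\<in>UNIV. heat s (u j) x powr p j)"
proof -
  interpret G: prob_space "gauss :: 'a measure" by (rule prob_space_gauss)
  define P where "P = (\<Sum>j\<in>UNIV. p j)"
  have P: "P \<ge> 0" unfolding P_def by (simp add: p_nonneg sum_nonneg)
  define M where "M = (\<integral>z. (norm z)\<^sup>2 \<partial>(gauss::'a measure))"
  have M: "M \<ge> 0" unfolding M_def by simp
  \<comment> \<open>a common majorant for the powers of \<open>norm z\<close> in the error terms\<close>
  define w where "w = (\<lambda>z::'a. 1 + (norm z)\<^sup>2)"
  have w1: "w z \<ge> 1" "(norm z)\<^sup>2 \<le> w z" "norm z \<le> w z" for z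
  proof -
    have "0 \<le> (norm z - 1)\<^sup>2" by simp
    then have "2 * norm z \<le> 1 + (norm z)\<^sup>2" by (simp add: power2_eq_square algebra_simps)
    then show "norm z \<le> w z" unfolding w_def using norm_ge_zero[of z] by linarith
  qed (auto simp: w_def)
  have wi: "integrable gauss (\<lambda>z. w z ^ 3)"
  proof -
    have "w z ^ 3 = 1 + 3 * norm z ^ 2 + 3 * norm z ^ 4 + norm z ^ 6" for z
      by (simp add: w_def power3_eq_cube algebra_simps power2_eq_square numeral_eq_Suc)
    then show ?thesis using integrable_gauss_power_norm[where 'a='a] by simp
  qed
  define W where "W = (\<integral>z. w z ^ 3 \<partial>gauss)"
  have W: "W \<ge> 0" unfolding W_def using w1 by (intro integral_nonneg_AE AE_I2) (auto simp: w_def)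
  define D where "D = K / a * (1 + M)"
  have D: "D \<ge> 0" unfolding D_def using K M a by simp
  have KD: "K / a \<le> D" unfolding D_def using K M a by (simp add: field_simps)
  have ba: "b / a \<ge> 0" using a by simp
  from prod_powr_expansion[of p, OF p_nonneg ba]
  obtain C1 where C1: "C1 \<ge> 0" and exp': "\<forall>Y \<theta>. (\<forall>j. -1 < Y j \<and> \<bar>Y j\<bar> \<le> \<theta>) \<longrightarrow> \<theta> \<le> b / a \<longrightarrow>
    (\<Prod>j\<in>UNIV. (1 + Y j) powr p j)
      \<le> 1 + (\<Sum>j\<in>UNIV. p j * Y j) + ((\<Sum>j\<in>UNIV. p j * Y j)\<^sup>2 - (\<Sum>j\<in>UNIV. p j * (Y j)\<^sup>2)) / 2 + C1 * \<theta> ^ 3"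
    by (elim exE conjE) (rule that)
  define C2 where "C2 = 8 * C1 * D ^ 3 + (3 * P\<^sup>2 * D\<^sup>2 + 3 * P * D\<^sup>2) / 2"
  have C2: "C2 \<ge> 0" unfolding C2_def using C1 D P by simp
  obtain c where c: "c \<ge> 0" and cov: "\<And>\<alpha>::'a. (\<integral>z. (\<alpha> \<bullet> z)\<^sup>2 \<partial>gauss) = c * (norm \<alpha>)\<^sup>2"
    using integral_gauss_inner_square by blast
  have "(\<integral>z. (\<Prod>j\<in>UNIV. u j (x + s *\<^sub>R z) powr p j) \<partial>gauss) \<le> (1 + (C2 * W) * s ^ 3) * (\<Prod>j\<in>UNIV. heat s (u j) x powr p j)"
    if um[measurable]: "\<And>j. u j \<in> borel_measurable borel"
      and ub: "\<And>j y. a \<le> u j y \<and> u j y \<le> b" and ui: "\<And>j y. u j (\<pi> j y) = u j y"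
      and ug: "\<And>j y. \<exists>g. norm g \<le> K \<and> (\<forall>v. \<bar>u j (y + v) - u j y - g \<bullet> v\<bar> \<le> K * (norm v)\<^sup>2)"
      and s: "0 \<le> s" "s \<le> 1" for u :: "'m \<Rightarrow> 'a \<Rightarrow> real" and x s
  proof -
    obtain g where g: "\<And>j. norm (g j) \<le> K" and gv: "\<And>j v. \<bar>u j (x + v) - u j x - g j \<bullet> v\<bar> \<le> K * (norm v)\<^sup>2"
      using ug[of _ x] by metis
    define U where "U = (\<lambda>j. heat s (u j) x)"
    have U: "a \<le> U j \<and> U j \<le> b" for j unfolding U_def by (rule heat_bounds[OF um ub])
    have U0: "U j > 0" for j using U[of j] a by linarith
    \<comment> \<open>since \<open>u j\<close> factors through \<open>\<pi> j\<close>, its gradient may be replaced by \<open>\<pi> j (g j)\<close>\<close>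
    define r where "r = (\<lambda>j z. u j (x + s *\<^sub>R z) - u j x - s * (\<pi> j (g j) \<bullet> z))"
    have r: "\<bar>r j z\<bar> \<le> K * s\<^sup>2 * (norm z)\<^sup>2" for j z
    proof -
      have l: "\<pi> j (y + z) = \<pi> j y + \<pi> j z" "\<pi> j (t *\<^sub>R y) = t *\<^sub>R \<pi> j y" for y z t
        using linear_add[OF \<pi>_linear[of j]] linear_scale[OF \<pi>_linear[of j]] by auto
      have "u j (x + s *\<^sub>R z) = u j (\<pi> j (x + s *\<^sub>R \<pi> j z))"
        by (subst ui[symmetric]) (simp add: l \<pi>_idem)
      then have "r j z = u j (x + s *\<^sub>R \<pi> j z) - u j x - g j \<bullet> (s *\<^sub>R \<pi> j z)"
        by (simp add: r_def ui \<pi>_selfadj)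
      then have "\<bar>r j z\<bar> \<le> K * (norm (s *\<^sub>R \<pi> j z))\<^sup>2" using gv[of j "s *\<^sub>R \<pi> j z"] by simp
      also have "\<dots> \<le> K * (s * norm z)\<^sup>2"
        using K s \<pi>_norm_le[of j z] by (intro mult_left_mono power_mono) (auto intro: mult_left_mono)
      finally show ?thesis by (simp add: power_mult_distrib mult.assoc)
    qed
    have ri: "integrable gauss (r j)" for j
    proof (rule Bochner_Integration.integrable_bound[OF integrable_mult_right[OF integrable_gauss_power_norm[of 2], of "K * s\<^sup>2"]])
      show "AE z in gauss. norm (r j z) \<le> norm (K * s\<^sup>2 * norm z ^ 2)" using r K by (auto simp: mult_ac)
    qed (simp add: r_def)
    have ini: "integrable gauss (\<lambda>z. \<alpha> \<bullet> z)" for \<alpha> :: 'a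
    proof (rule Bochner_Integration.integrable_bound[OF integrable_mult_right[OF integrable_gauss_power_norm[of 1], of "norm \<alpha>"]])
      show "AE z in gauss. norm (\<alpha> \<bullet> z) \<le> norm (norm \<alpha> * norm z ^ 1)" by (auto simp: Cauchy_Schwarz_ineq2)
    qed simp
    have Ur: "U j = u j x + (\<integral>z. r j z \<partial>gauss)" for j
    proof -
      have "U j = (\<integral>z. u j x + (s * (\<pi> j (g j) \<bullet> z) + r j z) \<partial>gauss)" unfolding U_def heat_def r_def by simp
      also have "\<dots> = u j x + (s * (\<integral>z. \<pi> j (g j) \<bullet> z \<partial>gauss) + (\<integral>z. r j z \<partial>gauss))"
        using ri[of j] ini[of "\<pi> j (g j)"] G.prob_space by simp
      finally show ?thesis by (simp add: integral_gauss_inner)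
    qed
    have Ux: "\<bar>U j - u j x\<bar> \<le> K * s\<^sup>2 * M" for j
    proof -
      have "\<bar>\<integral>z. r j z \<partial>gauss\<bar> \<le> (\<integral>z. \<bar>r j z\<bar> \<partial>gauss)" by (rule integral_abs_bound)
      also have "\<dots> \<le> (\<integral>z. K * s\<^sup>2 * (norm z)\<^sup>2 \<partial>(gauss::'a measure))"
        using r ri integrable_gauss_power_norm[of 2, where 'a='a] by (intro integral_mono) auto
      finally show ?thesis by (simp add: Ur M_def)
    qed
    \<comment> \<open>\<open>Y j\<close> is the relative deviation of the \<open>j\<close>-th factor from its mean, and \<open>s * X j\<close> its linear part\<close>
    define \<alpha> where "\<alpha> = (\<lambda>j. \<pi> j (g j /\<^sub>R U j))"
    define Y where "Y = (\<lambda>j z. u j (x + s *\<^sub>R z) / U j - 1)"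
    define X where "X = (\<lambda>j z. \<alpha> j \<bullet> z)"
    have \<alpha>: "norm (\<alpha> j) \<le> D" for j
    proof -
      have "norm (\<alpha> j) \<le> norm (g j) / U j" unfolding \<alpha>_def using \<pi>_norm_le[of j "g j /\<^sub>R U j"] U0[of j] by (simp add: divide_inverse_commute)
      also have "\<dots> \<le> K / a" using g[of j] U[of j] a K by (intro frac_le) auto
      finally show ?thesis using KD by linarith
    qed
    have Xb: "\<bar>X j z\<bar> \<le> D * w z" for j z
    proof -
      have "\<bar>X j z\<bar> \<le> norm (\<alpha> j) * norm z" unfolding X_def by (rule Cauchy_Schwarz_ineq2)
      also have "\<dots> \<le> D * w z" using \<alpha>[of j] w1[of z] D by (intro mult_mono) auto
      finally show ?thesis .
    qed
    have YX: "\<bar>Y j z - s * X j z\<bar> \<le> D * s\<^sup>2 * w z" for j z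
    proof -
      have "Y j z - s * X j z = (r j z + (u j x - U j)) / U j"
        unfolding Y_def X_def \<alpha>_def r_def using U0[of j] linear_scale[OF \<pi>_linear[of j]] by (simp add: field_simps)
      also have "\<bar>\<dots>\<bar> \<le> (K * s\<^sup>2 * (norm z)\<^sup>2 + K * s\<^sup>2 * M) / a"
        unfolding abs_divide using r[of j z] Ux[of j] U[of j] a by (intro frac_le) auto
      also have "\<dots> = K / a * s\<^sup>2 * ((norm z)\<^sup>2 + M)" by (simp add: algebra_simps add_divide_distrib)
      also have "\<dots> \<le> K / a * s\<^sup>2 * ((1 + M) * w z)"
      proof (rule mult_left_mono)
        have "M \<le> M * w z" using w1(1)[of z] M mult_left_mono[of 1 "w z" M] by simp
        then show "(norm z)\<^sup>2 + M \<le> (1 + M) * w z" using w1(2)[of z] by (simp add: algebra_simps)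
      qed (use K a in simp)
      finally show ?thesis by (simp add: D_def mult_ac)
    qed
    have Yw: "\<bar>Y j z\<bar> \<le> 2 * D * s * w z" for j z
    proof -
      have "s\<^sup>2 \<le> s" using s by (simp add: power2_eq_square mult_left_le)
      then have "D * s\<^sup>2 * w z \<le> D * s * w z" using D w1[of z] by (intro mult_right_mono mult_left_mono) auto
      moreover have "\<bar>s * X j z\<bar> \<le> D * s * w z" using Xb[of j z] s mult_left_mono[OF Xb[of j z] s(1)] by (simp add: abs_mult mult_ac)
      ultimately show ?thesis using YX[of j z] by linarith
    qed
    have Yb: "-1 < Y j z" "\<bar>Y j z\<bar> \<le> b / a" for j z
    proof -
      have q: "0 < u j (x + s *\<^sub>R z) / U j" using ub[of j "x + s *\<^sub>R z"] U0[of j] a by (intro divide_pos_pos) auto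
      then show "-1 < Y j z" by (simp add: Y_def)
      have "u j (x + s *\<^sub>R z) / U j \<le> b / a" using ub[of j "x + s *\<^sub>R z"] U[of j] a by (intro frac_le) auto
      moreover have "1 \<le> b / a" using a by simp
      ultimately show "\<bar>Y j z\<bar> \<le> b / a" using q unfolding Y_def by linarith
    qed
    have Yi: "integrable gauss (Y j)" and Ym: "(\<integral>z. Y j z \<partial>gauss) = 0" for j
      using integrable_gauss_affine[OF um ub, of j x s] U0[of j] G.prob_space
      by (simp_all add: Y_def heat_def[symmetric]) (simp add: U_def)
    define q where "q = (\<lambda>z. (\<Sum>j\<in>UNIV. p j * X j z)\<^sup>2 - (\<Sum>j\<in>UNIV. p j * (X j z)\<^sup>2))"
    have point: "(\<Prod>j\<in>UNIV. (1 + Y j z) powr p j)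
       \<le> 1 + (\<Sum>j\<in>UNIV. p j * Y j z) + s\<^sup>2 / 2 * q z + C2 * s ^ 3 * w z ^ 3" for z
    proof -
      \<comment> \<open>the first bound makes the error of third order in \<open>s\<close>, the second one puts \<open>\<theta>\<close> in the range of the expansion\<close>
      define \<theta> where "\<theta> = min (2 * D * s * w z) (b / a)"
      have th: "\<theta> ^ 3 \<le> (2 * D * s * w z) ^ 3"
        unfolding \<theta>_def using D s w1[of z] a by (intro power_mono) auto
      have "(\<Prod>j\<in>UNIV. (1 + Y j z) powr p j)
        \<le> 1 + (\<Sum>j\<in>UNIV. p j * Y j z) + ((\<Sum>j\<in>UNIV. p j * Y j z)\<^sup>2 - (\<Sum>j\<in>UNIV. p j * (Y j z)\<^sup>2)) / 2 + C1 * \<theta> ^ 3"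
        by (rule exp'[rule_format]) (auto simp: \<theta>_def Yb Yw)
      moreover have "C1 * \<theta> ^ 3 \<le> 8 * C1 * D ^ 3 * s ^ 3 * w z ^ 3"
        using mult_left_mono[OF th C1] by (simp add: power_mult_distrib mult_ac)
      moreover have "(\<Sum>j\<in>UNIV. p j * Y j z)\<^sup>2 \<le> s\<^sup>2 * (\<Sum>j\<in>UNIV. p j * X j z)\<^sup>2 + 3 * P\<^sup>2 * D\<^sup>2 * s ^ 3 * w z ^ 2"
      proof -
        define A where "A = (\<Sum>j\<in>UNIV. p j * Y j z)"
        define B where "B = s * (\<Sum>j\<in>UNIV. p j * X j z)"
        have "\<bar>A - B\<bar> = \<bar>\<Sum>j\<in>UNIV. p j * (Y j z - s * X j z)\<bar>"
          unfolding A_def B_def by (simp add: sum_distrib_left sum_subtractf[symmetric] algebra_simps)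
        also have "\<dots> \<le> (\<Sum>j\<in>UNIV. p j * (D * s\<^sup>2 * w z))"
          by (rule order_trans[OF sum_abs]) (intro sum_mono, simp add: abs_mult p_nonneg YX mult_left_mono)
        finally have AB: "\<bar>A - B\<bar> \<le> P * (D * s\<^sup>2 * w z)" by (simp add: P_def sum_distrib_right)
        have "\<bar>A\<bar> \<le> (\<Sum>j\<in>UNIV. p j * (2 * D * s * w z))" unfolding A_def
          by (rule order_trans[OF sum_abs]) (intro sum_mono, simp add: abs_mult p_nonneg Yw mult_left_mono)
        then have A: "\<bar>A\<bar> \<le> P * (2 * D * s * w z)" by (simp add: P_def sum_distrib_right)
        have "\<bar>B\<bar> \<le> s * (\<Sum>j\<in>UNIV. p j * (D * w z))" unfolding B_def abs_mult using s
          by (intro mult_mono order_trans[OF sum_abs]) (auto simp: abs_mult p_nonneg Xb intro!: sum_mono mult_left_mono)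
        then have B: "\<bar>B\<bar> \<le> P * (D * s * w z)" by (simp add: P_def sum_distrib_right sum_distrib_left mult_ac)
        have "A\<^sup>2 - B\<^sup>2 \<le> \<bar>A - B\<bar> * \<bar>A + B\<bar>" by (simp add: abs_mult[symmetric] power2_eq_square algebra_simps)
        also have "\<dots> \<le> (P * (D * s\<^sup>2 * w z)) * (3 * (P * (D * s * w z)))"
          using AB A B P D s w1(1)[of z] by (intro mult_mono) auto
        also have "\<dots> = 3 * P\<^sup>2 * D\<^sup>2 * s ^ 3 * w z ^ 2" by (simp add: power2_eq_square power3_eq_cube)
        finally show ?thesis unfolding A_def B_def by (simp add: power_mult_distrib)
      qed
      moreover have "(\<Sum>j\<in>UNIV. p j * (Y j z)\<^sup>2) \<ge> s\<^sup>2 * (\<Sum>j\<in>UNIV. p j * (X j z)\<^sup>2) - 3 * P * D\<^sup>2 * s ^ 3 * w z ^ 2"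
      proof -
        have "s\<^sup>2 * (X j z)\<^sup>2 - 3 * D\<^sup>2 * s ^ 3 * w z ^ 2 \<le> (Y j z)\<^sup>2" for j
        proof -
          have sX: "\<bar>s * X j z\<bar> \<le> D * s * w z" using Xb[of j z] s mult_left_mono[OF Xb[of j z] s(1)] by (simp add: abs_mult mult_ac)
          have "(s * X j z)\<^sup>2 - (Y j z)\<^sup>2 \<le> \<bar>Y j z - s * X j z\<bar> * \<bar>Y j z + s * X j z\<bar>"
            by (simp add: abs_mult[symmetric] power2_eq_square algebra_simps)
          also have "\<dots> \<le> (D * s\<^sup>2 * w z) * (3 * (D * s * w z))"
            using YX[of j z] Yw[of j z] sX D s w1(1)[of z] by (intro mult_mono) auto
          also have "\<dots> = 3 * D\<^sup>2 * s ^ 3 * w z ^ 2" by (simp add: power2_eq_square power3_eq_cube)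
          finally show ?thesis by (simp add: power_mult_distrib)
        qed
        then have "(\<Sum>j\<in>UNIV. p j * (s\<^sup>2 * (X j z)\<^sup>2 - 3 * D\<^sup>2 * s ^ 3 * w z ^ 2)) \<le> (\<Sum>j\<in>UNIV. p j * (Y j z)\<^sup>2)"
          by (intro sum_mono mult_left_mono p_nonneg)
        moreover have "(\<Sum>j\<in>UNIV. p j * (s\<^sup>2 * (X j z)\<^sup>2 - 3 * D\<^sup>2 * s ^ 3 * w z ^ 2)) = s\<^sup>2 * (\<Sum>j\<in>UNIV. p j * (X j z)\<^sup>2) - 3 * P * D\<^sup>2 * s ^ 3 * w z ^ 2"
          by (simp add: P_def right_diff_distrib sum_subtractf sum_distrib_left sum_distrib_right mult_ac)
        ultimately show ?thesis by linarith
      qed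
      moreover have "(3 * P\<^sup>2 * D\<^sup>2 + 3 * P * D\<^sup>2) / 2 * s ^ 3 * w z ^ 2 \<le> (3 * P\<^sup>2 * D\<^sup>2 + 3 * P * D\<^sup>2) / 2 * s ^ 3 * w z ^ 3"
        using P D s w1(1)[of z] by (intro mult_left_mono power_increasing) auto
      ultimately show ?thesis unfolding q_def C2_def by (simp add: algebra_simps add_divide_distrib diff_divide_distrib)
    qed
    have X2i: "integrable gauss (\<lambda>z. (\<beta> \<bullet> z)\<^sup>2)" for \<beta> :: 'a
    proof (rule Bochner_Integration.integrable_bound[OF integrable_mult_right[OF integrable_gauss_power_norm[of 2], of "(norm \<beta>)\<^sup>2"]])
      have "(\<beta> \<bullet> z)\<^sup>2 \<le> (norm \<beta> * norm z)\<^sup>2" for z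
        using power_mono[OF Cauchy_Schwarz_ineq2[of \<beta> z], of 2] by simp
      then show "AE z in gauss. norm ((\<beta> \<bullet> z)\<^sup>2) \<le> norm ((norm \<beta>)\<^sup>2 * norm z ^ 2)" by (simp add: power_mult_distrib)
    qed simp
    have qe: "q z = ((\<Sum>j\<in>UNIV. p j *\<^sub>R \<alpha> j) \<bullet> z)\<^sup>2 - (\<Sum>j\<in>UNIV. p j * (\<alpha> j \<bullet> z)\<^sup>2)" for z
      by (simp add: q_def X_def inner_sum_left)
    have qi: "integrable gauss q"
      unfolding qe using X2i by (intro Bochner_Integration.integrable_diff Bochner_Integration.integrable_sum integrable_mult_right)
    have q0: "(\<integral>z. q z \<partial>gauss) \<le> 0"
    proof -
      have "(\<integral>z. q z \<partial>gauss) = c * (norm (\<Sum>j\<in>UNIV. p j *\<^sub>R \<alpha> j))\<^sup>2 - (\<Sum>j\<in>UNIV. p j * (c * (norm (\<alpha> j))\<^sup>2))"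
        unfolding qe using X2i by (subst Bochner_Integration.integral_diff) (auto simp: cov Bochner_Integration.integral_sum)
      also have "\<dots> = c * ((norm (\<Sum>j\<in>UNIV. p j *\<^sub>R \<alpha> j))\<^sup>2 - (\<Sum>j\<in>UNIV. p j * (norm (\<alpha> j))\<^sup>2))"
        by (simp add: right_diff_distrib sum_distrib_left mult_ac)
      also have "\<dots> \<le> 0" using c weighted_sum_of_ranges[of "\<lambda>j. g j /\<^sub>R U j"]
        unfolding \<alpha>_def by (intro mult_nonneg_nonpos) auto
      finally show ?thesis .
    qed
    have int: "(\<integral>z. (\<Prod>j\<in>UNIV. (1 + Y j z) powr p j) \<partial>gauss) \<le> 1 + C2 * W * s ^ 3"
    proof -
      have "(\<integral>z. (\<Prod>j\<in>UNIV. (1 + Y j z) powr p j) \<partial>gauss)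
         \<le> (\<integral>z. 1 + (\<Sum>j\<in>UNIV. p j * Y j z) + s\<^sup>2 / 2 * q z + C2 * s ^ 3 * w z ^ 3 \<partial>gauss)"
      proof (rule integral_mono_AE')
        show "integrable gauss (\<lambda>z. 1 + (\<Sum>j\<in>UNIV. p j * Y j z) + s\<^sup>2 / 2 * q z + C2 * s ^ 3 * w z ^ 3)"
          using Yi qi wi by simp
        have "0 \<le> (\<Prod>j\<in>UNIV. (1 + Y j z) powr p j)" for z by (intro prod_nonneg) simp
        then show "AE z in gauss. 0 \<le> 1 + (\<Sum>j\<in>UNIV. p j * Y j z) + s\<^sup>2 / 2 * q z + C2 * s ^ 3 * w z ^ 3"
          using point by (intro AE_I2) (meson order_trans)
      qed (use point in auto)
      also have "\<dots> = 1 + (\<Sum>j\<in>UNIV. p j * (\<integral>z. Y j z \<partial>gauss)) + s\<^sup>2 / 2 * (\<integral>z. q z \<partial>gauss) + C2 * s ^ 3 * W"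
        using Yi qi wi G.prob_space by (simp add: W_def Bochner_Integration.integral_sum)
      also have "\<dots> \<le> 1 + C2 * W * s ^ 3"
      proof -
        have "s\<^sup>2 / 2 * (\<integral>z. q z \<partial>gauss) \<le> 0" by (rule mult_nonneg_nonpos[OF _ q0]) simp
        then show ?thesis by (simp only: Ym mult_zero_right sum.neutral_const) (simp add: mult_ac)
      qed
      finally show ?thesis .
    qed
    have "(\<Prod>j\<in>UNIV. u j (x + s *\<^sub>R z) powr p j) = (\<Prod>j\<in>UNIV. (1 + Y j z) powr p j) * (\<Prod>j\<in>UNIV. U j powr p j)" for z
    proof -
      have "u j (x + s *\<^sub>R z) powr p j = (1 + Y j z) powr p j * U j powr p j" for j
      proof -
        have "u j (x + s *\<^sub>R z) = (1 + Y j z) * U j" using U0[of j] by (simp add: Y_def)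
        then show ?thesis using Yb(1)[of j z] U0[of j] by (simp add: powr_mult)
      qed
      then show ?thesis by (simp add: prod.distrib)
    qed
    then have "(\<integral>z. (\<Prod>j\<in>UNIV. u j (x + s *\<^sub>R z) powr p j) \<partial>gauss) = (\<integral>z. (\<Prod>j\<in>UNIV. (1 + Y j z) powr p j) \<partial>gauss) * (\<Prod>j\<in>UNIV. U j powr p j)"
      by simp
    also have "\<dots> \<le> (1 + C2 * W * s ^ 3) * (\<Prod>j\<in>UNIV. U j powr p j)"
      using int by (intro mult_right_mono prod_nonneg) auto
    finally show ?thesis by (simp add: U_def)
  qed
  then show ?thesis using C2 W by (intro exI[of _ "C2 * W"]) simp
qed

end

lemma tendsto_rpow:
  assumes "X \<longlonglongrightarrow> x" "\<And>n. X n \<ge> 0" "a \<ge> 0"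
  shows "(\<lambda>n. rpow (X n) a) \<longlonglongrightarrow> rpow x a"
proof (cases "a = 0")
  case False
  then show ?thesis using assms unfolding rpow_def
    by (auto intro!: tendsto_powr2)
qed (simp add: rpow_def)

lemma rpow_nonneg [simp]: "rpow x a \<ge> 0"
  by (simp add: rpow_def)

lemma rpow_mono: "0 \<le> x \<Longrightarrow> x \<le> y \<Longrightarrow> 0 \<le> a \<Longrightarrow> rpow x a \<le> rpow y a"
  by (simp add: rpow_def powr_mono2)

lemma rpow_pos_eq: "x > 0 \<Longrightarrow> rpow x a = x powr a"
  by (simp add: rpow_def)

lemma rpow_measurable [measurable]: "f \<in> borel_measurable M \<Longrightarrow> (\<lambda>x. rpow (f x) a) \<in> borel_measurable M"
  unfolding rpow_def by (cases "a = 0") auto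

lemma heat_commute:
  fixes u :: "'a::euclidean_space \<Rightarrow> real"
  assumes "u \<in> borel_measurable borel" and "\<And>x. 0 \<le> u x \<and> u x \<le> B" and "s > 0" "t > 0"
  shows "heat s (heat t u) x = heat t (heat s u) x"
  using heat_heat[OF assms(1,2), of s t x] heat_heat[OF assms(1,2), of t s x] assms(3,4)
  by (simp add: add.commute)

context weighted_projections
begin

lemma heat_invariant:
  assumes inv: "\<And>y. h (\<pi> j y) = h y"
  shows "heat s h (\<pi> j y) = heat s h y"
proof -
  have "h (\<pi> j y + s *\<^sub>R z) = h (y + s *\<^sub>R z)" for z
    by (subst (1 2) inv[symmetric]) (simp add: linear_add[OF \<pi>_linear] \<pi>_idem)
  then show ?thesis by (simp add: heat_def)
qed

text \<open>Composing \<open>k\<close> steps of size \<open>s\<close> gives one step of size \<open>s * sqrt k\<close>.  The smoothing at the fixed scale \<open>\<tau>\<close> commutes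
  with the steps and provides the gradient bound of \<open>heat_one_step\<close> at each of them, with one and the same
  constant.\<close>

lemma heat_many_steps:
  assumes a: "0 < a" "a \<le> b" and \<tau>: "\<tau> > 0"
  shows "\<exists>C\<ge>0. \<forall>(h :: 'm \<Rightarrow> 'a \<Rightarrow> real) k s x. (\<forall>j. h j \<in> borel_measurable borel \<and>
       (\<forall>y. a \<le> h j y \<and> h j y \<le> b \<and> h j (\<pi> j y) = h j y)) \<longrightarrow> 0 < s \<longrightarrow> s \<le> 1 \<longrightarrow>
     (\<integral>z. (\<Prod>j\<in>UNIV. heat \<tau> (h j) (x + (s * sqrt (real k)) *\<^sub>R z) powr p j) \<partial>gauss)
       \<le> (1 + C * s ^ 3) ^ k * (\<Prod>j\<in>UNIV. heat (s * sqrt (real k)) (heat \<tau> (h j)) x powr p j)"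
proof -
  interpret G: prob_space "gauss :: 'a measure" by (rule prob_space_gauss)
  have b0: "b \<ge> 0" using a by simp
  from heat_first_order[OF \<tau> b0, where 'a='a]
  obtain K where K: "K \<ge> 0" and Kg: "\<And>h::'a \<Rightarrow> real. h \<in> borel_measurable borel \<Longrightarrow> \<forall>x. 0 \<le> h x \<and> h x \<le> b \<Longrightarrow>
     (\<forall>x. \<exists>g. norm g \<le> K \<and> (\<forall>v. \<bar>heat \<tau> h (x + v) - heat \<tau> h x - g \<bullet> v\<bar> \<le> K * (norm v)\<^sup>2))"
    by (elim exE conjE) (rule that, auto)
  from heat_one_step[OF a K]
  obtain C where C: "C \<ge> 0" and step': "\<forall>(u :: 'm \<Rightarrow> 'a \<Rightarrow> real) x s. (\<forall>j. u j \<in> borel_measurable borel \<and>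
       (\<forall>y. a \<le> u j y \<and> u j y \<le> b \<and> u j (\<pi> j y) = u j y \<and>
         (\<exists>g. norm g \<le> K \<and> (\<forall>v. \<bar>u j (y + v) - u j y - g \<bullet> v\<bar> \<le> K * (norm v)\<^sup>2)))) \<longrightarrow> 0 \<le> s \<longrightarrow> s \<le> 1 \<longrightarrow>
     (\<integral>z. (\<Prod>j\<in>UNIV. u j (x + s *\<^sub>R z) powr p j) \<partial>gauss) \<le> (1 + C * s ^ 3) * (\<Prod>j\<in>UNIV. heat s (u j) x powr p j)"
    by (elim exE conjE) (rule that)
  have "(\<integral>z. (\<Prod>j\<in>UNIV. heat \<tau> (h j) (x + (s * sqrt (real k)) *\<^sub>R z) powr p j) \<partial>gauss)
       \<le> (1 + C * s ^ 3) ^ k * (\<Prod>j\<in>UNIV. heat (s * sqrt (real k)) (heat \<tau> (h j)) x powr p j)"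
    if "\<And>j. h j \<in> borel_measurable borel" "\<And>j y. a \<le> h j y \<and> h j y \<le> b" "\<And>j y. h j (\<pi> j y) = h j y"
       and s: "0 < s" "s \<le> 1" for h :: "'m \<Rightarrow> 'a \<Rightarrow> real" and k s x
    using that(1-3)
  proof (induction k arbitrary: h)
    case 0
    then show ?case by (simp add: heat_def G.prob_space[simplified])
  next
    case (Suc k)
    note [measurable] = Suc.prems(1)
    have hb: "0 \<le> h j y \<and> h j y \<le> b" for j y using Suc.prems(2)[of j y] a by linarith
    have ub: "a \<le> heat \<tau> (h j) y \<and> heat \<tau> (h j) y \<le> b" for j y by (rule heat_bounds[OF Suc.prems(1,2)])
    have ub0: "0 \<le> heat \<tau> (h j) y \<and> heat \<tau> (h j) y \<le> b" for j y using ub[of j y] a by linarith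
    define F where "F = (\<lambda>y. \<Prod>j\<in>UNIV. heat \<tau> (h j) y powr p j)"
    define F' where "F' = (\<lambda>y. \<Prod>j\<in>UNIV. heat \<tau> (heat s (h j)) y powr p j)"
    have [measurable]: "F \<in> borel_measurable borel" "F' \<in> borel_measurable borel" unfolding F_def F'_def by auto
    have Fb: "0 \<le> F y \<and> F y \<le> (\<Prod>j\<in>UNIV. b powr p j)" for y
      unfolding F_def using ub0 p_nonneg by (auto intro!: prod_nonneg prod_mono powr_mono2)
    have sb: "a \<le> heat s (h j) y \<and> heat s (h j) y \<le> b" for j y by (rule heat_bounds[OF Suc.prems(1,2)])
    have F'b: "0 \<le> F' y \<and> F' y \<le> (\<Prod>j\<in>UNIV. b powr p j)" for y
      unfolding F'_def using heat_bounds[OF heat_measurable[OF Suc.prems(1)] sb, of \<tau>] p_nonneg a 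
      by (auto intro!: prod_nonneg prod_mono powr_mono2 intro: order_trans[of 0 a])
    have FF': "heat s F y \<le> (1 + C * s ^ 3) * F' y" for y
    proof -
      have "(\<integral>z. (\<Prod>j\<in>UNIV. heat \<tau> (h j) (y + s *\<^sub>R z) powr p j) \<partial>gauss)
          \<le> (1 + C * s ^ 3) * (\<Prod>j\<in>UNIV. heat s (heat \<tau> (h j)) y powr p j)"
      proof (rule step'[rule_format], intro conjI allI)
        fix j y
        show "\<exists>g. norm g \<le> K \<and> (\<forall>v. \<bar>heat \<tau> (h j) (y + v) - heat \<tau> (h j) y - g \<bullet> v\<bar> \<le> K * (norm v)\<^sup>2)"
          using Kg[OF Suc.prems(1), of j] hb by blast
      qed (use s ub heat_invariant Suc.prems(3) in auto)
      moreover have "heat s F y = (\<integral>z. (\<Prod>j\<in>UNIV. heat \<tau> (h j) (y + s *\<^sub>R z) powr p j) \<partial>gauss)"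
        by (subst heat_def) (simp add: F_def)
      ultimately show ?thesis unfolding F'_def
        by (simp add: heat_commute[OF Suc.prems(1) hb s(1) \<tau>])
    qed
    have sq: "sqrt ((s * sqrt (real k))\<^sup>2 + s\<^sup>2) = s * sqrt (real (Suc k))"
    proof -
      have "(s * sqrt (real k))\<^sup>2 + s\<^sup>2 = s\<^sup>2 * real (Suc k)" by (simp add: power_mult_distrib algebra_simps)
      then show ?thesis using s by (simp only: real_sqrt_mult) simp
    qed
    have hh: "heat (s * sqrt (real k)) (heat s u) x = heat (s * sqrt (real (Suc k))) u x"
      if "u \<in> borel_measurable borel" "\<And>x. 0 \<le> u x \<and> u x \<le> B" for u and B :: real
      using heat_heat[OF that, of "s * sqrt (real k)" s x] s by (simp only: sq) simp
    have "(\<integral>z. (\<Prod>j\<in>UNIV. heat \<tau> (h j) (x + (s * sqrt (real (Suc k))) *\<^sub>R z) powr p j) \<partial>gauss)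
        = heat (s * sqrt (real (Suc k))) F x"
      by (simp only: heat_def[of "s * sqrt (real (Suc k))" F x]) (simp only: F_def)
    also have "\<dots> = heat (s * sqrt (real k)) (heat s F) x" by (rule hh[symmetric, OF _ Fb]) simp
    also have "\<dots> \<le> (\<integral>z. (1 + C * s ^ 3) * F' (x + (s * sqrt (real k)) *\<^sub>R z) \<partial>gauss)"
      unfolding heat_def[of "s * sqrt (real k)"]
      by (intro integral_mono integrable_mult_right integrable_gauss_affine[OF _ F'b] integrable_gauss_affine[OF _ heat_bounds[OF _ Fb]] FF') auto
    also have "\<dots> = (1 + C * s ^ 3) * (\<integral>z. F' (x + (s * sqrt (real k)) *\<^sub>R z) \<partial>gauss)" by simp
    also have "\<dots> \<le> (1 + C * s ^ 3) * ((1 + C * s ^ 3) ^ k * (\<Prod>j\<in>UNIV. heat (s * sqrt (real k)) (heat \<tau> (heat s (h j))) x powr p j))"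
      unfolding F'_def using C s sb heat_invariant Suc.prems(3) by (intro mult_left_mono Suc.IH) auto
    also have "(\<Prod>j\<in>UNIV. heat (s * sqrt (real k)) (heat \<tau> (heat s (h j))) x powr p j)
       = (\<Prod>j\<in>UNIV. heat (s * sqrt (real (Suc k))) (heat \<tau> (h j)) x powr p j)"
    proof (intro prod.cong refl)
      fix j
      have "heat \<tau> (heat s (h j)) = heat s (heat \<tau> (h j))"
        using heat_commute[OF Suc.prems(1) hb \<tau> s(1)] by (intro ext)
      then show "heat (s * sqrt (real k)) (heat \<tau> (heat s (h j))) x powr p j = heat (s * sqrt (real (Suc k))) (heat \<tau> (h j)) x powr p j"
        using hh[OF heat_measurable[OF Suc.prems(1)] ub0] by simp
    qed
    finally show ?case by (simp add: mult_ac)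
  qed
  then show ?thesis using C by (intro exI[of _ C]) simp
qed

text \<open>Take \<open>n\<close> steps of size \<open>1 / sqrt n\<close>: the accumulated error factor \<open>(1 + C n\<^bsup>-3/2\<^esup>)\<^sup>n\<close> tends to \<open>1\<close>.\<close>

lemma gaussian_ineq_smoothed:
  assumes a: "0 < a" "a \<le> b" and \<tau>: "\<tau> > 0"
    and h: "\<And>j. h j \<in> borel_measurable borel" "\<And>j y. a \<le> h j y \<and> h j y \<le> b" "\<And>j y. h j (\<pi> j y) = h j y"
  shows "(\<integral>z. (\<Prod>j\<in>UNIV. heat \<tau> (h j) z powr p j) \<partial>gauss) \<le> (\<Prod>j\<in>UNIV. (\<integral>z. heat \<tau> (h j) z \<partial>gauss) powr p j)"
proof -
  from heat_many_steps[OF a \<tau>]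
  obtain C where C: "C \<ge> 0" and steps: "\<forall>(h :: 'm \<Rightarrow> 'a \<Rightarrow> real) k s x. (\<forall>j. h j \<in> borel_measurable borel \<and>
       (\<forall>y. a \<le> h j y \<and> h j y \<le> b \<and> h j (\<pi> j y) = h j y)) \<longrightarrow> 0 < s \<longrightarrow> s \<le> 1 \<longrightarrow>
     (\<integral>z. (\<Prod>j\<in>UNIV. heat \<tau> (h j) (x + (s * sqrt (real k)) *\<^sub>R z) powr p j) \<partial>gauss)
       \<le> (1 + C * s ^ 3) ^ k * (\<Prod>j\<in>UNIV. heat (s * sqrt (real k)) (heat \<tau> (h j)) x powr p j)"
    by (elim exE conjE) (rule that)
  define I where "I = (\<integral>z. (\<Prod>j\<in>UNIV. heat \<tau> (h j) z powr p j) \<partial>gauss)"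
  define R where "R = (\<Prod>j\<in>UNIV. (\<integral>z. heat \<tau> (h j) z \<partial>gauss) powr p j)"
  have R: "R \<ge> 0" unfolding R_def by (intro prod_nonneg) simp
  have "I \<le> exp (C / sqrt (real (Suc n))) * R" for n
  proof -
    \<comment> \<open>\<open>n + 1\<close> steps of this size make up the full Gaussian\<close>
    define s where "s = 1 / sqrt (real (Suc n))"
    have s: "0 < s" "s \<le> 1" "s * sqrt (real (Suc n)) = 1" by (auto simp: s_def)
    have "I \<le> (1 + C * s ^ 3) ^ Suc n * R"
    proof -
      have "(\<integral>z. (\<Prod>j\<in>UNIV. heat \<tau> (h j) (0 + (s * sqrt (real (Suc n))) *\<^sub>R z) powr p j) \<partial>gauss)
       \<le> (1 + C * s ^ 3) ^ Suc n * (\<Prod>j\<in>UNIV. heat (s * sqrt (real (Suc n))) (heat \<tau> (h j)) 0 powr p j)"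
        using h s by (intro steps[rule_format] conjI allI) auto
      then show ?thesis unfolding s(3) I_def R_def heat_def[of 1] by simp
    qed
    also have "\<dots> \<le> exp (C / sqrt (real (Suc n))) * R"
    proof (rule mult_right_mono[OF _ R])
      have "(1 + C * s ^ 3) ^ Suc n \<le> exp (C * s ^ 3) ^ Suc n"
        using C s by (intro power_mono exp_ge_add_one_self) auto
      also have "\<dots> = exp (real (Suc n) * (C * s ^ 3))" by (simp only: exp_of_nat_mult)
      also have "real (Suc n) * (C * s ^ 3) = C / sqrt (real (Suc n))"
      proof -
        have "real (Suc n) * s ^ 2 = 1" by (simp add: s_def power_divide)
        then have "real (Suc n) * (C * s ^ 3) = C * s" by (simp add: power3_eq_cube power2_eq_square algebra_simps)
        then show ?thesis by (simp add: s_def)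
      qed
      finally show "(1 + C * s ^ 3) ^ Suc n \<le> exp (C / sqrt (real (Suc n)))" .
    qed
    finally show ?thesis .
  qed
  moreover have "(\<lambda>n. exp (C / sqrt (real (Suc n))) * R) \<longlonglongrightarrow> exp 0 * R"
    by (intro tendsto_intros) real_asymp
  ultimately show ?thesis
    unfolding I_def[symmetric] R_def[symmetric] using LIMSEQ_le_const[of _ "exp 0 * R" I] by auto
qed

text \<open>The smoothing scale tends to \<open>0\<close>.\<close>

lemma gaussian_ineq_continuous_pos:
  assumes a: "0 < a" "a \<le> b"
    and h: "\<And>j. continuous_on UNIV (h j)" "\<And>j y. a \<le> h j y \<and> h j y \<le> b" "\<And>j y. h j (\<pi> j y) = h j y"
  shows "(\<integral>z. (\<Prod>j\<in>UNIV. h j z powr p j) \<partial>gauss) \<le> (\<Prod>j\<in>UNIV. (\<integral>z. h j z \<partial>gauss) powr p j)"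
proof -
  interpret G: prob_space "gauss :: 'a measure" by (rule prob_space_gauss)
  have hm[measurable]: "h j \<in> borel_measurable borel" for j
    using h(1) by (rule borel_measurable_continuous_onI)
  define \<tau> where "\<tau> = (\<lambda>n. 1 / real (Suc n))"
  have \<tau>: "\<tau> n > 0" for n by (simp add: \<tau>_def)
  have t0: "\<tau> \<longlonglongrightarrow> 0" unfolding \<tau>_def by real_asymp
  have hb: "\<bar>h j y\<bar> \<le> b" for j y using h(2)[of j y] a by linarith
  have ub: "a \<le> heat (\<tau> n) (h j) y \<and> heat (\<tau> n) (h j) y \<le> b" for n j y by (rule heat_bounds[OF hm h(2)])
  have uba: "\<bar>heat (\<tau> n) (h j) y\<bar> \<le> b" for n j y using ub[of n j y] a by linarith
  have lim: "(\<lambda>n. heat (\<tau> n) (h j) y) \<longlonglongrightarrow> h j y" for j y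
  proof -
    have "(\<lambda>n. \<integral>z. h j (y + \<tau> n *\<^sub>R z) \<partial>gauss) \<longlonglongrightarrow> (\<integral>z. h j y \<partial>(gauss::'a measure))"
    proof (rule integral_dominated_convergence[where w="\<lambda>_. b"])
      show "AE z in gauss. (\<lambda>n. h j (y + \<tau> n *\<^sub>R z)) \<longlonglongrightarrow> h j y"
      proof (rule AE_I2)
        fix z
        have "(\<lambda>n. y + \<tau> n *\<^sub>R z) \<longlonglongrightarrow> y + 0 *\<^sub>R z" by (intro tendsto_intros t0)
        then show "(\<lambda>n. h j (y + \<tau> n *\<^sub>R z)) \<longlonglongrightarrow> h j y"
          using h(1)[of j] by (intro continuous_on_tendsto_compose[of UNIV "h j"]) auto
      qed
    qed (use hb in auto)
    then show ?thesis by (simp add: heat_def G.prob_space[simplified])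
  qed
  have l1: "(\<lambda>n. \<integral>z. (\<Prod>j\<in>UNIV. heat (\<tau> n) (h j) z powr p j) \<partial>gauss) \<longlonglongrightarrow> (\<integral>z. (\<Prod>j\<in>UNIV. h j z powr p j) \<partial>gauss)"
  proof (rule integral_dominated_convergence[where w="\<lambda>_. \<Prod>j\<in>UNIV. b powr p j"])
    show "AE z in gauss. (\<lambda>n. \<Prod>j\<in>UNIV. heat (\<tau> n) (h j) z powr p j) \<longlonglongrightarrow> (\<Prod>j\<in>UNIV. h j z powr p j)"
      using h(2) a by (intro AE_I2 tendsto_prod tendsto_powr lim tendsto_const) (metis less_le_not_le)
    show "AE z in gauss. norm (\<Prod>j\<in>UNIV. heat (\<tau> n) (h j) z powr p j) \<le> (\<Prod>j\<in>UNIV. b powr p j)" for n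
    proof (rule AE_I2)
      fix z
      have "(\<Prod>j\<in>UNIV. heat (\<tau> n) (h j) z powr p j) \<le> (\<Prod>j\<in>UNIV. b powr p j)"
        using ub p_nonneg a by (intro prod_mono) (auto intro!: powr_mono2 intro: order_trans[of 0 a])
      then show "norm (\<Prod>j\<in>UNIV. heat (\<tau> n) (h j) z powr p j) \<le> (\<Prod>j\<in>UNIV. b powr p j)"
        by (simp add: prod_nonneg)
    qed
  qed auto
  have l2: "(\<lambda>n. \<integral>z. heat (\<tau> n) (h j) z \<partial>gauss) \<longlonglongrightarrow> (\<integral>z. h j z \<partial>gauss)" for j
    by (rule integral_dominated_convergence[where w="\<lambda>_. b"])
       (use lim uba in auto)
  have pos: "(\<integral>z. h j z \<partial>gauss) > 0" for j
    using heat_bounds[OF hm h(2), where s=1 and x=0] a by (simp add: heat_def) (meson less_le_trans)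
  have "(\<lambda>n. \<Prod>j\<in>UNIV. (\<integral>z. heat (\<tau> n) (h j) z \<partial>gauss) powr p j) \<longlonglongrightarrow> (\<Prod>j\<in>UNIV. (\<integral>z. h j z \<partial>gauss) powr p j)"
    using pos by (intro tendsto_prod tendsto_powr l2 tendsto_const) (metis less_irrefl)
  then show ?thesis
    by (rule LIMSEQ_le[OF l1]) (use gaussian_ineq_smoothed[OF a \<tau> hm h(2,3)] in auto)
qed

text \<open>Adding a small positive constant to each function removes the positive lower bound.\<close>

lemma gaussian_ineq_continuous:
  assumes h: "\<And>j. continuous_on UNIV (h j)" "\<And>j y. 0 \<le> h j y \<and> h j y \<le> b" "\<And>j y. h j (\<pi> j y) = h j y"
  shows "(\<integral>z. (\<Prod>j\<in>UNIV. rpow (h j z) (p j)) \<partial>gauss) \<le> (\<Prod>j\<in>UNIV. rpow (\<integral>z. h j z \<partial>gauss) (p j))"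
proof -
  interpret G: prob_space "gauss :: 'a measure" by (rule prob_space_gauss)
  have hm[measurable]: "h j \<in> borel_measurable borel" for j
    using h(1) by (rule borel_measurable_continuous_onI)
  have b0: "b \<ge> 0" using h(2)[of undefined undefined] by linarith
  define e where "e = (\<lambda>n. 1 / real (Suc n))"
  have e: "e n > 0" "e n \<le> 1" for n by (auto simp: e_def)
  have e0: "e \<longlonglongrightarrow> 0" unfolding e_def by real_asymp
  have hpos: "h j y + e n > 0" for j y n using h(2)[of j y] e(1)[of n] by linarith
  have hi: "integrable gauss (h j)" for j
    by (rule integrable_gauss_bounded[of _ b]) (use h(2) in auto)
  have ipos: "(\<integral>z. h j z \<partial>gauss) \<ge> 0" for j
    by (rule integral_nonneg_AE) (use h(2) in auto)
  have step: "(\<integral>z. (\<Prod>j\<in>UNIV. rpow (h j z + e n) (p j)) \<partial>gauss) \<le> (\<Prod>j\<in>UNIV. rpow ((\<integral>z. h j z \<partial>gauss) + e n) (p j))" for n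
  proof -
    have "(\<integral>z. (\<Prod>j\<in>UNIV. (h j z + e n) powr p j) \<partial>gauss) \<le> (\<Prod>j\<in>UNIV. (\<integral>z. h j z + e n \<partial>gauss) powr p j)"
    proof (rule gaussian_ineq_continuous_pos[of "e n" "b + 1"])
      show "e n \<le> b + 1" using e(2)[of n] b0 by linarith
      show "e n \<le> h j y + e n \<and> h j y + e n \<le> b + 1" for j y
        using h(2)[of j y] e(2)[of n] by linarith
    qed (use e h in \<open>auto intro!: continuous_intros\<close>)
    moreover have "(\<integral>z. h j z + e n \<partial>gauss) = (\<integral>z. h j z \<partial>gauss) + e n" for j
      using hi G.prob_space by simp
    moreover have "(\<integral>z. h j z \<partial>gauss) + e n > 0" for j using ipos[of j] e(1)[of n] by linarith
    ultimately show ?thesis by (simp add: rpow_pos_eq hpos)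
  qed
  have le: "(\<lambda>n. x + e n) \<longlonglongrightarrow> x" for x
    using tendsto_add[OF tendsto_const e0, of x] by simp
  have l1: "(\<lambda>n. \<integral>z. (\<Prod>j\<in>UNIV. rpow (h j z + e n) (p j)) \<partial>gauss) \<longlonglongrightarrow> (\<integral>z. (\<Prod>j\<in>UNIV. rpow (h j z) (p j)) \<partial>gauss)"
  proof (rule integral_dominated_convergence[where w="\<lambda>_. \<Prod>j\<in>UNIV. rpow (b + 1) (p j)"])
    show "AE z in gauss. (\<lambda>n. \<Prod>j\<in>UNIV. rpow (h j z + e n) (p j)) \<longlonglongrightarrow> (\<Prod>j\<in>UNIV. rpow (h j z) (p j))"
      using hpos p_nonneg by (intro AE_I2 tendsto_prod tendsto_rpow le) (auto simp: less_imp_le)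
    show "AE z in gauss. norm (\<Prod>j\<in>UNIV. rpow (h j z + e n) (p j)) \<le> (\<Prod>j\<in>UNIV. rpow (b + 1) (p j))" for n
    proof (rule AE_I2)
      fix z
      have "h j z + e n \<le> b + 1" for j using h(2)[of j z] e(2)[of n] by linarith
      then have "(\<Prod>j\<in>UNIV. rpow (h j z + e n) (p j)) \<le> (\<Prod>j\<in>UNIV. rpow (b + 1) (p j))"
        using hpos p_nonneg by (intro prod_mono) (auto intro!: rpow_mono simp: less_imp_le)
      then show "norm (\<Prod>j\<in>UNIV. rpow (h j z + e n) (p j)) \<le> (\<Prod>j\<in>UNIV. rpow (b + 1) (p j))"
        by (simp add: prod_nonneg)
    qed
  qed auto
  have "(\<lambda>n. \<Prod>j\<in>UNIV. rpow ((\<integral>z. h j z \<partial>gauss) + e n) (p j)) \<longlonglongrightarrow> (\<Prod>j\<in>UNIV. rpow (\<integral>z. h j z \<partial>gauss) (p j))"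
    using ipos e p_nonneg by (intro tendsto_prod tendsto_rpow le) (auto intro!: add_nonneg_nonneg simp: less_imp_le)
  then show ?thesis by (rule LIMSEQ_le[OF l1]) (use step in auto)
qed

end

lemma indicator_open_continuous_limit:
  fixes U :: "'a::metric_space set"
  assumes "open U"
  shows "\<exists>\<psi>. \<forall>y. (\<lambda>n. \<psi> n y :: real) \<longlonglongrightarrow> indicator U y \<and>
     (\<forall>n::nat. continuous_on UNIV (\<psi> n) \<and> 0 \<le> \<psi> n y \<and> \<psi> n y \<le> indicator U y)"
proof (cases "U = UNIV")
  case True
  then show ?thesis by (intro exI[of _ "\<lambda>_ _. 1"]) auto
next
  case False
  define \<psi> where "\<psi> = (\<lambda>n y. min 1 (real n * infdist y (- U)))"
  have c: "continuous_on UNIV (\<psi> n)" for n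
    unfolding \<psi>_def by (intro continuous_intros)
  have out: "\<psi> n y = 0" if "y \<notin> U" for n y using that by (simp add: \<psi>_def)
  have lim: "(\<lambda>n. \<psi> n y) \<longlonglongrightarrow> 1" if y: "y \<in> U" for y
  proof -
    have d: "infdist y (- U) > 0"
      using y False assms in_closed_iff_infdist_zero[of "- U" y] infdist_nonneg[of y "- U"]
      by (auto simp: less_le closed_Compl)
    obtain N where N: "real N * infdist y (- U) > 1"
      using reals_Archimedean3[OF d] by blast
    have "\<forall>n\<ge>N. \<psi> n y = 1"
    proof (intro allI impI)
      fix n assume "n \<ge> N"
      then have "real N * infdist y (- U) \<le> real n * infdist y (- U)" using d by (intro mult_right_mono) auto
      then show "\<psi> n y = 1" using N by (simp add: \<psi>_def)
    qed
    then show ?thesis by (intro tendsto_eventually) (auto simp: eventually_sequentially)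
  qed
  have "(\<lambda>n. \<psi> n y) \<longlonglongrightarrow> indicator U y" for y
    using lim[of y] out[of y] by (cases "y \<in> U") auto
  moreover have "0 \<le> \<psi> n y \<and> \<psi> n y \<le> indicator U y" for n y
    using out[of y n] infdist_nonneg[of y "- U"] by (cases "y \<in> U") (auto simp: \<psi>_def)
  ultimately show ?thesis using c by (intro exI[of _ \<psi>]) auto
qed

context weighted_projections
begin

text \<open>A bounded Borel function has a slightly larger majorant that is a limit of continuous functions, by outer
  regularity applied to its level sets.  Regularity of the image measure under \<open>\<pi> j\<close> is used, so that the
  approximants still factor through \<open>\<pi> j\<close>.\<close>

lemma semicontinuous_majorant:
  assumes hm[measurable]: "h \<in> borel_measurable borel" and hb: "\<And>y. 0 \<le> h y \<and> h y \<le> b"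
    and hi: "\<And>y. h (\<pi> j y) = h y" and e: "e > 0"
  shows "\<exists>(g :: nat \<Rightarrow> 'a \<Rightarrow> real) G B. \<forall>y. (\<lambda>n. g n y) \<longlonglongrightarrow> G y \<and> h y \<le> G y \<and>
     (\<forall>n. continuous_on UNIV (g n) \<and> 0 \<le> g n y \<and> g n y \<le> B \<and> g n (\<pi> j y) = g n y \<and> (\<integral>z. g n z \<partial>gauss) \<le> (\<integral>z. h z \<partial>gauss) + e)"
proof -
  interpret G: prob_space "gauss :: 'a measure" by (rule prob_space_gauss)
  define \<mu> where "\<mu> = distr gauss borel (\<pi> j)"
  interpret M: prob_space \<mu> unfolding \<mu>_def by (rule G.prob_space_distr) simp
  have b0: "b \<ge> 0" using hb[of undefined] by linarith
  obtain N :: nat where N: "N > 0" "b / real N \<le> e / 2"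
  proof -
    obtain N :: nat where "real N > b / (e / 2)" using reals_Archimedean2 by blast
    then have "real N > 0" "b \<le> e / 2 * real N" using b0 e divide_nonneg_pos[of b "e/2"] by (linarith, simp add: field_simps)
    then show ?thesis using that[of N] by (simp add: field_simps)
  qed
  \<comment> \<open>levels at distance \<open>d\<close>: rounding costs at most \<open>e / 2\<close>, and so do the \<open>N\<close> regularity errors together\<close>
  define d where "d = b / real N"
  have d: "d \<ge> 0" "d \<le> e / 2" using N b0 by (auto simp: d_def)
  define A where "A = (\<lambda>i. {y. h y > real i * d})"
  have Am[measurable]: "A i \<in> sets borel" for i unfolding A_def by measurable
  have "\<exists>U. open U \<and> A i \<subseteq> U \<and> measure \<mu> U \<le> measure \<mu> (A i) + e / (2 * (b + 1))" for i
  proof -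
    have "emeasure \<mu> (A i) = (INF U \<in> {U. A i \<subseteq> U \<and> open U}. emeasure \<mu> U)"
      by (rule outer_regular) (auto simp: \<mu>_def M.emeasure_eq_measure[unfolded \<mu>_def])
    moreover have "emeasure \<mu> (A i) < emeasure \<mu> (A i) + ennreal (e / (2 * (b + 1)))"
      using e b0
      by (simp add: M.emeasure_eq_measure ennreal_plus[symmetric] del: ennreal_plus) (auto intro!: ennreal_lessI add_nonneg_pos)
    ultimately have "(INF U \<in> {U. A i \<subseteq> U \<and> open U}. emeasure \<mu> U) < emeasure \<mu> (A i) + ennreal (e / (2 * (b + 1)))"
      by simp
    then obtain U where "A i \<subseteq> U" "open U" and U: "emeasure \<mu> U < emeasure \<mu> (A i) + ennreal (e / (2 * (b + 1)))"
      unfolding INF_less_iff by blast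
    moreover have "measure \<mu> U \<le> measure \<mu> (A i) + e / (2 * (b + 1))"
      using U e b0 by (simp add: M.emeasure_eq_measure ennreal_plus[symmetric] ennreal_less_iff del: ennreal_plus)
    ultimately show ?thesis by blast
  qed
  then obtain U where U: "\<And>i. open (U i)" "\<And>i. A i \<subseteq> U i" "\<And>i. measure \<mu> (U i) \<le> measure \<mu> (A i) + e / (2 * (b + 1))"
    by metis
  have Um[measurable]: "U i \<in> sets borel" for i using U(1) by auto
  obtain \<psi> where \<psi>: "\<And>i y. (\<lambda>n. \<psi> i n y :: real) \<longlonglongrightarrow> indicator (U i) y" "\<And>i n. continuous_on UNIV (\<psi> i n)"
     "\<And>i n y. 0 \<le> \<psi> i n y" "\<And>i n y. \<psi> i n y \<le> indicator (U i) y"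
    using indicator_open_continuous_limit[OF U(1)] by metis
  define g where "g = (\<lambda>n y. d + (\<Sum>i\<in>{1..N}. d * \<psi> i n (\<pi> j y)))"
  define G where "G = (\<lambda>y. d + (\<Sum>i\<in>{1..N}. d * indicator (U i) (\<pi> j y)))"
  have pc: "continuous_on UNIV (\<pi> j)" using \<pi>_linear by (simp add: linear_continuous_on linear_conv_bounded_linear[symmetric])
  have gc: "continuous_on UNIV (g n)" for n
    unfolding g_def using pc \<psi>(2) by (intro continuous_intros) (auto intro: continuous_on_compose2)
  have glim: "(\<lambda>n. g n y) \<longlonglongrightarrow> G y" for y
    unfolding g_def G_def by (intro tendsto_intros \<psi>)
  have g0: "0 \<le> g n y" for n y unfolding g_def using d \<psi>(3) by (intro add_nonneg_nonneg sum_nonneg) auto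
  have gG: "g n y \<le> G y" for n y unfolding g_def G_def using d \<psi>(4) by (intro add_mono sum_mono mult_left_mono) auto
  have GB: "G y \<le> d + real N * d" for y
  proof -
    have "(\<Sum>i\<in>{1..N}. d * indicator (U i) (\<pi> j y)) \<le> (\<Sum>i\<in>{1..N}. d * 1)"
      using d by (intro sum_mono mult_left_mono) (auto simp: indicator_def)
    then show ?thesis by (simp add: G_def)
  qed
  \<comment> \<open>a sum over level sets represents \<open>h\<close> from below up to the error \<open>d\<close>\<close>
  have layer: "h y - d \<le> (\<Sum>i\<in>{1..N}. d * indicator (A i) y) \<and> (\<Sum>i\<in>{1..N}. d * indicator (A i) y) \<le> h y" for y
  proof (cases "d = 0")
    case True
    then have "b = 0" using N by (simp add: d_def)
    then show ?thesis using True hb[of y] by simp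
  next
    case False
    then have dp: "d > 0" using d by simp
    define k where "k = nat (\<lceil>h y / d\<rceil>) - 1"
    define m where "m = card {i\<in>{1..N}. real i * d < h y}"
    have "(\<Sum>i\<in>{1..N}. d * indicator (A i) y) = (\<Sum>i\<in>{1..N}. if real i * d < h y then d else 0)"
      by (intro sum.cong) (auto simp: A_def)
    also have "\<dots> = (\<Sum>i\<in>{i\<in>{1..N}. real i * d < h y}. d)" by (rule sum.inter_filter[symmetric]) simp
    also have "\<dots> = d * real m" by (simp add: m_def)
    finally have "(\<Sum>i\<in>{1..N}. d * indicator (A i) y) = d * real m" .
    moreover have "{i\<in>{1..N}. real i * d < h y} = {1..k}"
    proof -
      have hN: "h y \<le> real N * d" using hb[of y] N by (simp add: d_def)
      have iff: "real i * d < h y \<longleftrightarrow> int i < \<lceil>h y / d\<rceil>" for i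
        using dp by (simp add: less_ceiling_iff pos_less_divide_eq)
      have cN: "\<lceil>h y / d\<rceil> \<le> int N" using hN dp by (simp add: ceiling_le_iff pos_divide_le_eq)
      have "1 \<le> i \<and> i \<le> N \<and> int i < c \<longleftrightarrow> 1 \<le> i \<and> i \<le> nat c - 1" if "c \<le> int N" for c i
        using that by linarith
      from this[OF cN] show ?thesis unfolding k_def iff by (simp only: set_eq_iff mem_Collect_eq atLeastAtMost_iff conj_assoc) blast
    qed
    ultimately have eq: "(\<Sum>i\<in>{1..N}. d * indicator (A i) y) = d * real k" by (simp add: m_def)
    show ?thesis
    proof (cases "h y = 0")
      case True
      then show ?thesis using eq dp by (simp add: k_def)
    next
      case False
      then have "h y / d > 0" using hb[of y] dp by simp
      then have c1: "\<lceil>h y / d\<rceil> \<ge> 1" by (simp add: less_ceiling_iff int_one_le_iff_zero_less)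
      have "real (nat c - 1) = of_int c - 1" if "c \<ge> 1" for c using that by linarith
      from this[OF c1] have "real k = of_int \<lceil>h y / d\<rceil> - 1" unfolding k_def .
      then have "h y / d - 1 \<le> real k" "real k \<le> h y / d"
        using ceiling_correct[of "h y / d"] by linarith+
      then show ?thesis unfolding eq using dp by (simp add: field_simps)
    qed
  qed
  have Ai: "y \<in> A i \<longleftrightarrow> \<pi> j y \<in> A i" for i y by (simp add: A_def hi)
  have hG: "h y \<le> G y" for y
  proof -
    have "h y \<le> d + (\<Sum>i\<in>{1..N}. d * indicator (A i) y)" using layer[of y] by linarith
    also have "\<dots> \<le> G y" unfolding G_def using d U(2) Ai
      by (intro add_left_mono sum_mono mult_left_mono) (auto simp: indicator_def)
    finally show ?thesis .
  qed
  have hint: "integrable gauss h" by (rule integrable_gauss_bounded[of _ b]) (use hb in auto)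
  have gint: "(\<integral>z. g n z \<partial>gauss) \<le> (\<integral>z. h z \<partial>gauss) + e" for n
  proof -
    have layers: "integrable gauss (\<lambda>z. c + (\<Sum>i\<in>{1..N}. d * indicat_real (S i) (\<pi> j z)))
        \<and> (\<integral>z. c + (\<Sum>i\<in>{1..N}. d * indicat_real (S i) (\<pi> j z)) \<partial>gauss) = c + (\<Sum>i\<in>{1..N}. d * measure \<mu> (S i))"
      if [measurable]: "\<And>i. S i \<in> sets borel" for S :: "nat \<Rightarrow> 'a set" and c
    proof -
      define X where "X = (\<lambda>i z. indicat_real (S i) (\<pi> j z))"
      have Xi: "integrable gauss (X i)" for i unfolding X_def
        by (rule integrable_gauss_bounded[of _ 1]) (auto simp: indicator_def)
      have "(\<integral>z. X i z \<partial>gauss) = measure \<mu> (S i)" for i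
        unfolding \<mu>_def X_def using integral_distr[of "\<pi> j" gauss borel "indicator (S i) :: 'a \<Rightarrow> real"] by simp
      moreover have "indicat_real (S i) (\<pi> j z) = X i z" for i z by (simp add: X_def)
      ultimately show ?thesis
        using Xi G.prob_space by (simp add: Bochner_Integration.integral_sum)
    qed
    have "(\<integral>z. g n z \<partial>gauss) \<le> (\<integral>z. G z \<partial>gauss)"
    proof (rule integral_mono_AE')
      show "integrable gauss G" unfolding G_def using layers[of U d, OF Um] by blast
    qed (use gG g0 order_trans[OF g0 gG] in auto)
    also have "\<dots> = d + (\<Sum>i\<in>{1..N}. d * measure \<mu> (U i))"
      unfolding G_def using layers[of U d, OF Um] by blast
    also have "\<dots> \<le> d + (\<Sum>i\<in>{1..N}. d * (measure \<mu> (A i) + e / (2 * (b + 1))))"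
      using d U(3) by (intro add_left_mono sum_mono mult_left_mono) auto
    also have "\<dots> = d + (\<Sum>i\<in>{1..N}. d * measure \<mu> (A i)) + real N * d * (e / (2 * (b + 1)))"
      by (simp add: sum.distrib distrib_left)
    also have "real N * d * (e / (2 * (b + 1))) \<le> e / 2"
    proof -
      have "real N * d = b" using N by (simp add: d_def)
      then show ?thesis using b0 e by (simp add: field_simps)
    qed
    also have "(\<Sum>i\<in>{1..N}. d * measure \<mu> (A i)) = (\<integral>z. (\<Sum>i\<in>{1..N}. d * indicator (A i) (\<pi> j z)) \<partial>gauss)"
      using conjunct2[OF layers[of A 0, OF Am]] unfolding add_0_left by (rule sym)
    also have "\<dots> \<le> (\<integral>z. h z \<partial>gauss)"
    proof (rule integral_mono)
      show "integrable gauss (\<lambda>z. \<Sum>i\<in>{1..N}. d * indicator (A i) (\<pi> j z))" using layers[of A 0, OF Am] unfolding add_0_left by (rule conjunct1)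
      show "(\<Sum>i\<in>{1..N}. d * indicator (A i) (\<pi> j z)) \<le> h z" for z using layer[of "\<pi> j z"] hi by simp
    qed (rule hint)
    finally show ?thesis using d by linarith
  qed
  have gi: "g n (\<pi> j y) = g n y" for n y by (simp add: g_def \<pi>_idem)
  show ?thesis
    by (rule exI[of _ g], rule exI[of _ G], rule exI[of _ "d + real N * d"])
       (use glim hG gc g0 order_trans[OF gG GB] gi gint in blast)
qed

text \<open>The majorants of \<open>semicontinuous_majorant\<close> inherit the inequality from their continuous approximants, at the cost
  of an arbitrarily small error in the integrals on the right.\<close>

lemma gaussian_ineq_bounded:
  assumes h: "\<And>j. h j \<in> borel_measurable borel" "\<And>j y. 0 \<le> h j y \<and> h j y \<le> b" "\<And>j y. h j (\<pi> j y) = h j y"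
  shows "(\<integral>z. (\<Prod>j\<in>UNIV. rpow (h j z) (p j)) \<partial>gauss) \<le> (\<Prod>j\<in>UNIV. rpow (\<integral>z. h j z \<partial>gauss) (p j))"
proof -
  interpret G: prob_space "gauss :: 'a measure" by (rule prob_space_gauss)
  note [measurable] = h(1)
  have ipos: "(\<integral>z. h j z \<partial>gauss) \<ge> 0" for j
    by (rule integral_nonneg_AE) (use h(2) in auto)
  have step: "(\<integral>z. (\<Prod>j\<in>UNIV. rpow (h j z) (p j)) \<partial>gauss) \<le> (\<Prod>j\<in>UNIV. rpow ((\<integral>z. h j z \<partial>gauss) + e) (p j))" if e: "e > 0" for e
  proof -
    have "\<forall>j. \<exists>(g :: nat \<Rightarrow> 'a \<Rightarrow> real) G B. \<forall>y. (\<lambda>n. g n y) \<longlonglongrightarrow> G y \<and> h j y \<le> G y \<and>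
     (\<forall>n. continuous_on UNIV (g n) \<and> 0 \<le> g n y \<and> g n y \<le> B \<and> g n (\<pi> j y) = g n y \<and> (\<integral>z. g n z \<partial>gauss) \<le> (\<integral>z. h j z \<partial>gauss) + e)"
      using semicontinuous_majorant[OF h(1) h(2) h(3) e] by blast
    then obtain g :: "'m \<Rightarrow> nat \<Rightarrow> 'a \<Rightarrow> real" and G B' where gG: "\<forall>j y. (\<lambda>n. g j n y) \<longlonglongrightarrow> G j y \<and> h j y \<le> G j y \<and>
     (\<forall>n. continuous_on UNIV (g j n) \<and> 0 \<le> g j n y \<and> g j n y \<le> B' j \<and> g j n (\<pi> j y) = g j n y \<and> (\<integral>z. g j n z \<partial>gauss) \<le> (\<integral>z. h j z \<partial>gauss) + e)"
      unfolding choice_iff by blast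
    define B where "B = Max (range B')"
    have g: "\<And>j y. (\<lambda>n. g j n y) \<longlonglongrightarrow> G j y" "\<And>j y. h j y \<le> G j y" "\<And>j n. continuous_on UNIV (g j n)"
      "\<And>j n y. 0 \<le> g j n y" "\<And>j n y. g j n (\<pi> j y) = g j n y" "\<And>j n. (\<integral>z. g j n z \<partial>gauss) \<le> (\<integral>z. h j z \<partial>gauss) + e"
      using gG by blast+
    have gB: "g j n y \<le> B" for j n y
    proof -
      have "g j n y \<le> B' j" using gG by blast
      also have "B' j \<le> B" unfolding B_def by (rule Max_ge) auto
      finally show ?thesis .
    qed
    have [measurable]: "g j n \<in> borel_measurable borel" for j n using g(3) by (rule borel_measurable_continuous_onI)
    have [measurable]: "G j \<in> borel_measurable borel" for j
      by (rule borel_measurable_LIMSEQ_real[where u="g j"]) (use g(1) in auto)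
    have G0: "0 \<le> G j y" for j y using g(2)[of j y] h(2)[of j y] by linarith
    have GB: "G j y \<le> B" for j y by (rule LIMSEQ_le_const2[OF g(1)]) (use gB in auto)
    have bounds: "0 \<le> (\<Prod>j\<in>UNIV. rpow (f j) (p j)) \<and> (\<Prod>j\<in>UNIV. rpow (f j) (p j)) \<le> (\<Prod>j\<in>UNIV. rpow B (p j))"
      if "\<And>j. 0 \<le> f j \<and> f j \<le> B" for f
      using that p_nonneg by (auto intro!: prod_nonneg prod_mono rpow_mono)
    have "(\<integral>z. (\<Prod>j\<in>UNIV. rpow (h j z) (p j)) \<partial>gauss) \<le> (\<integral>z. (\<Prod>j\<in>UNIV. rpow (G j z) (p j)) \<partial>gauss)"
    proof (rule integral_mono_AE')
      show "integrable gauss (\<lambda>z. \<Prod>j\<in>UNIV. rpow (G j z) (p j))"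
        by (rule integrable_gauss_bounded[of _ "\<Prod>j\<in>UNIV. rpow B (p j)"]) (use bounds[of "\<lambda>j. G j _"] G0 GB in \<open>auto simp: prod_nonneg\<close>)
    qed (use h(2) g(2) p_nonneg in \<open>auto intro!: prod_mono rpow_mono prod_nonneg\<close>)
    also have "\<dots> \<le> (\<Prod>j\<in>UNIV. rpow ((\<integral>z. h j z \<partial>gauss) + e) (p j))"
    proof (rule LIMSEQ_le_const2)
      show "(\<lambda>n. \<integral>z. (\<Prod>j\<in>UNIV. rpow (g j n z) (p j)) \<partial>gauss) \<longlonglongrightarrow> (\<integral>z. (\<Prod>j\<in>UNIV. rpow (G j z) (p j)) \<partial>gauss)"
      proof (rule integral_dominated_convergence[where w="\<lambda>_. \<Prod>j\<in>UNIV. rpow B (p j)"])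
        show "AE z in gauss. (\<lambda>n. \<Prod>j\<in>UNIV. rpow (g j n z) (p j)) \<longlonglongrightarrow> (\<Prod>j\<in>UNIV. rpow (G j z) (p j))"
          using g p_nonneg by (intro AE_I2 tendsto_prod tendsto_rpow) auto
        show "AE z in gauss. norm (\<Prod>j\<in>UNIV. rpow (g j n z) (p j)) \<le> (\<Prod>j\<in>UNIV. rpow B (p j))" for n
          using bounds[of "\<lambda>j. g j n _"] g(4) gB by (auto simp: prod_nonneg)
      qed auto
      have "(\<integral>z. (\<Prod>j\<in>UNIV. rpow (g j n z) (p j)) \<partial>gauss) \<le> (\<Prod>j\<in>UNIV. rpow ((\<integral>z. h j z \<partial>gauss) + e) (p j))" for n
      proof -
        have "(\<integral>z. (\<Prod>j\<in>UNIV. rpow (g j n z) (p j)) \<partial>gauss) \<le> (\<Prod>j\<in>UNIV. rpow (\<integral>z. g j n z \<partial>gauss) (p j))"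
          by (rule gaussian_ineq_continuous[where b=B]) (use g gB in auto)
        also have "\<dots> \<le> (\<Prod>j\<in>UNIV. rpow ((\<integral>z. h j z \<partial>gauss) + e) (p j))"
          using g(4,6) p_nonneg by (intro prod_mono conjI rpow_mono) (auto intro!: integral_nonneg_AE)
        finally show ?thesis .
      qed
      then show "\<exists>N. \<forall>n\<ge>N. (\<integral>z. (\<Prod>j\<in>UNIV. rpow (g j n z) (p j)) \<partial>gauss) \<le> (\<Prod>j\<in>UNIV. rpow ((\<integral>z. h j z \<partial>gauss) + e) (p j))"
        by blast
    qed
    finally show ?thesis .
  qed
  define e where "e = (\<lambda>n. 1 / real (Suc n))"
  have e: "e n > 0" for n by (auto simp: e_def)
  have e0: "e \<longlonglongrightarrow> 0" unfolding e_def by real_asymp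
  have le: "(\<lambda>n. x + e n) \<longlonglongrightarrow> x" for x
    using tendsto_add[OF tendsto_const e0, of x] by simp
  have "(\<lambda>n. \<Prod>j\<in>UNIV. rpow ((\<integral>z. h j z \<partial>gauss) + e n) (p j)) \<longlonglongrightarrow> (\<Prod>j\<in>UNIV. rpow (\<integral>z. h j z \<partial>gauss) (p j))"
    using ipos e p_nonneg by (intro tendsto_prod tendsto_rpow le) (auto intro!: add_nonneg_nonneg simp: less_imp_le)
  then show ?thesis by (rule LIMSEQ_le_const) (use step e in auto)
qed

text \<open>The geometric Brascamp--Lieb inequality for the Gaussian measure, with constant \<open>1\<close>; truncation and Fatou's lemma
  give the unbounded case.\<close>

theorem gaussian_brascamp_lieb:
  assumes h: "\<And>j. h j \<in> borel_measurable borel" "\<And>j y. 0 \<le> h j y" "\<And>j y. h j (\<pi> j y) = h j y"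
    and hi: "\<And>j. integrable gauss (h j)"
  shows "(\<integral>\<^sup>+z. ennreal (\<Prod>j\<in>UNIV. rpow (h j z) (p j)) \<partial>gauss) \<le> ennreal (\<Prod>j\<in>UNIV. rpow (\<integral>z. h j z \<partial>gauss) (p j))"
proof -
  interpret G: prob_space "gauss :: 'a measure" by (rule prob_space_gauss)
  note [measurable] = h(1)
  define t where "t = (\<lambda>j n z. min (h j z) (real n))"
  have [measurable]: "t j n \<in> borel_measurable borel" for j n unfolding t_def by measurable
  have t: "0 \<le> t j n z" "t j n z \<le> real n" "t j n z \<le> h j z" for j n z using h(2) by (auto simp: t_def)
  define F where "F = (\<lambda>n z. \<Prod>j\<in>UNIV. rpow (t j n z) (p j))"
  have F0: "0 \<le> F n z" for n z by (simp add: F_def prod_nonneg)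
  have Fb: "F n z \<le> (\<Prod>j\<in>UNIV. rpow (real n) (p j))" for n z
    unfolding F_def using t p_nonneg by (auto intro!: prod_mono rpow_mono)
  have [measurable]: "F n \<in> borel_measurable borel" for n unfolding F_def by measurable
  have step: "(\<integral>\<^sup>+z. ennreal (F n z) \<partial>gauss) \<le> ennreal (\<Prod>j\<in>UNIV. rpow (\<integral>z. h j z \<partial>gauss) (p j))" for n
  proof -
    have "(\<integral>\<^sup>+z. ennreal (F n z) \<partial>gauss) = ennreal (\<integral>z. F n z \<partial>gauss)"
    proof (rule nn_integral_eq_integral)
      show "integrable gauss (F n)"
        by (rule integrable_gauss_bounded[of _ "\<Prod>j\<in>UNIV. rpow (real n) (p j)"]) (use F0 Fb in auto)
    qed (use F0 in auto)
    also have "(\<integral>z. F n z \<partial>gauss) \<le> (\<Prod>j\<in>UNIV. rpow (\<integral>z. t j n z \<partial>gauss) (p j))"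
      unfolding F_def by (rule gaussian_ineq_bounded[where b="real n"]) (use t h(3) in \<open>auto simp: t_def\<close>)
    also have "\<dots> \<le> (\<Prod>j\<in>UNIV. rpow (\<integral>z. h j z \<partial>gauss) (p j))"
      using t p_nonneg hi h(2)
      by (intro prod_mono conjI rpow_mono) (auto intro!: integral_nonneg_AE integral_mono_AE')
    finally show ?thesis by (simp add: ennreal_leI)
  qed
  have lim: "ennreal (\<Prod>j\<in>UNIV. rpow (h j z) (p j)) = liminf (\<lambda>n. ennreal (F n z))" for z
  proof -
    have "(\<lambda>n. t j n z) \<longlonglongrightarrow> h j z" for j
    proof -
      obtain N :: nat where N: "h j z \<le> real N" using real_arch_simple by blast
      have "\<forall>n\<ge>N. t j n z = h j z" using N by (auto simp: t_def min_def intro: order_trans)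
      then show ?thesis by (intro tendsto_eventually) (auto simp: eventually_sequentially)
    qed
    then have "(\<lambda>n. F n z) \<longlonglongrightarrow> (\<Prod>j\<in>UNIV. rpow (h j z) (p j))"
      unfolding F_def using t p_nonneg by (intro tendsto_prod tendsto_rpow)
    then have "(\<lambda>n. ennreal (F n z)) \<longlonglongrightarrow> ennreal (\<Prod>j\<in>UNIV. rpow (h j z) (p j))"
      by (intro tendsto_ennrealI)
    then show ?thesis by (intro lim_imp_Liminf[symmetric]) auto
  qed
  have "(\<integral>\<^sup>+z. ennreal (\<Prod>j\<in>UNIV. rpow (h j z) (p j)) \<partial>gauss) \<le> liminf (\<lambda>n. \<integral>\<^sup>+z. ennreal (F n z) \<partial>gauss)"
    unfolding lim by (rule nn_integral_liminf) simp
  also have "\<dots> \<le> liminf (\<lambda>n::nat. ennreal (\<Prod>j\<in>UNIV. rpow (\<integral>z. h j z \<partial>gauss) (p j)))"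
    by (rule Liminf_mono) (use step in auto)
  also have "\<dots> = ennreal (\<Prod>j\<in>UNIV. rpow (\<integral>z. h j z \<partial>gauss) (p j))"
    by (rule Liminf_const) simp
  finally show ?thesis .
qed

end

section \<open>Determinants and positive definite matrices\<close>

lemma matrix_inv_mult:
  assumes "invertible A"
  shows "A ** matrix_inv A = mat 1" "matrix_inv A ** A = mat 1"
  using someI_ex[OF assms[unfolded invertible_def]] unfolding matrix_inv_def by auto

lemma distr_lborel_matrix:
  fixes M :: "real^'n::{finite,wellorder}^'n::_"
  assumes "det M \<noteq> 0"
  shows "lborel = density (distr lborel borel ((*v) M)) (\<lambda>_. ennreal \<bar>det M\<bar>)"
proof (rule lborel_eqI)
  have inv: "invertible M" using assms by (simp add: invertible_det_nz)
  define N where "N = matrix_inv M"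
  have MN: "M ** N = mat 1" "N ** M = mat 1"
    unfolding N_def using inv by (auto simp: matrix_inv_mult)
  have [measurable]: "(*v) M \<in> borel \<rightarrow>\<^sub>M borel"
    by (intro borel_measurable_continuous_onI matrix_vector_mult_linear_continuous_on)
  have dN: "\<bar>det M\<bar> * \<bar>det N\<bar> = 1"
    using arg_cong[OF MN(1), of det] by (simp add: det_mul abs_mult[symmetric])
  fix l u :: "real^'n::_" assume le: "\<And>b. b \<in> Basis \<Longrightarrow> l \<bullet> b \<le> u \<bullet> b"
  have vim: "(*v) M -` box l u = (*v) N ` box l u"
  proof (intro set_eqI iffI)
    fix x assume "x \<in> (*v) M -` box l u"
    moreover have "x = N *v (M *v x)" by (simp add: matrix_vector_mul_assoc MN)
    ultimately show "x \<in> (*v) N ` box l u" by (metis imageI vimageE)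
  next
    fix x assume "x \<in> (*v) N ` box l u"
    then show "x \<in> (*v) M -` box l u" by (auto simp: matrix_vector_mul_assoc MN)
  qed
  have lm: "(*v) N ` box l u \<in> lmeasurable" and me: "measure lebesgue ((*v) N ` box l u) = \<bar>det N\<bar> * measure lebesgue (box l u)"
    using measurable_linear_image[of "(*v) N" "box l u"] measure_linear_image[of "(*v) N" "box l u"]
    by (auto simp: matrix_of_matrix_vector_mul)
  have "emeasure lborel ((*v) M -` box l u) = emeasure lebesgue ((*v) N ` box l u)"
  proof -
    have "(*v) M -` box l u \<in> sets lborel" by (simp add: measurable_sets_borel[of "(*v) M" borel])
    then show ?thesis unfolding vim[symmetric] by simp
  qed
  also have "\<dots> = ennreal (\<bar>det N\<bar> * measure lebesgue (box l u))"
    unfolding emeasure_eq_measure2[OF lm] me ..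
  finally have em: "emeasure lborel ((*v) M -` box l u) = ennreal (\<bar>det N\<bar> * measure lebesgue (box l u))" .
  have "emeasure (density (distr lborel borel ((*v) M)) (\<lambda>_. ennreal \<bar>det M\<bar>)) (box l u)
     = ennreal \<bar>det M\<bar> * emeasure lborel ((*v) M -` box l u)"
    by (subst emeasure_density) (auto simp: nn_integral_cmult_indicator emeasure_distr)
  also have "\<dots> = ennreal (\<bar>det M\<bar> * \<bar>det N\<bar> * measure lebesgue (box l u))"
    unfolding em by (simp add: ennreal_mult[symmetric] mult.assoc)
  also have "\<dots> = (\<Prod>b\<in>Basis. (u - l) \<bullet> b)"
    using le by (simp add: dN measure_lborel_box_eq)
  finally show "emeasure (density (distr lborel borel ((*v) M)) (\<lambda>_. ennreal \<bar>det M\<bar>)) (box l u) = (\<Prod>b\<in>Basis. (u - l) \<bullet> b)" .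
qed simp

lemma matrix_vector_mult_measurable [measurable]: "(*v) (M :: real^'n^'m) \<in> borel \<rightarrow>\<^sub>M borel"
  by (intro borel_measurable_continuous_onI matrix_vector_mult_linear_continuous_on)

lemma nn_integral_matrix:
  fixes M :: "real^'n::{finite,wellorder}^'n::_"
  assumes "det M \<noteq> 0" and [measurable]: "f \<in> borel_measurable borel"
  shows "(\<integral>\<^sup>+y. f y \<partial>lborel) = ennreal \<bar>det M\<bar> * (\<integral>\<^sup>+x. f (M *v x) \<partial>lborel)"
proof -
  have "(\<integral>\<^sup>+y. f y \<partial>lborel) = (\<integral>\<^sup>+y. f y \<partial>(density (distr lborel borel ((*v) M)) (\<lambda>_. ennreal \<bar>det M\<bar>)))"
    using distr_lborel_matrix[OF assms(1)] by simp
  also have "\<dots> = (\<integral>\<^sup>+x. ennreal \<bar>det M\<bar> * f (M *v x) \<partial>lborel)"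
    by (subst nn_integral_density) (auto simp: nn_integral_distr)
  also have "\<dots> = ennreal \<bar>det M\<bar> * (\<integral>\<^sup>+x. f (M *v x) \<partial>lborel)"
    by (rule nn_integral_cmult) auto
  finally show ?thesis .
qed

definition outer :: "real^'n \<Rightarrow> real^'n \<Rightarrow> real^'n^'n" where
  "outer u v = (\<chi> i j. u $ i * v $ j)"

lemma outer_mult_vector: "outer u v *v x = (v \<bullet> x) *\<^sub>R u"
  by (simp add: vec_eq_iff outer_def matrix_vector_mult_def inner_vec_def sum_distrib_left sum_distrib_right mult_ac)

lemma matrix_mul_outer: "X ** outer u v = outer (X *v u) v"
  by (simp add: vec_eq_iff outer_def matrix_vector_mult_def matrix_matrix_mult_def sum_distrib_left sum_distrib_right mult_ac)

text \<open>The matrix determinant lemma.  By multilinearity each row \<open>e\<^sub>i + u\<^sub>i v\<close> is split; a term with two rows proportional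
  to \<open>v\<close> vanishes.\<close>

lemma det_one_plus_outer:
  fixes u v :: "real^'n"
  shows "det (mat 1 + outer u v) = 1 + u \<bullet> v"
proof -
  define R where "R = (\<lambda>S k. if k \<in> S then axis k 1 + u $ k *\<^sub>R v else axis k (1::real))"
  have base: "det (\<chi> i. if i = k then v else axis i 1) = v $ k" for k
  proof -
    have "det (\<chi> i. if i = k then (\<Sum>l\<in>UNIV. v $ l *s row l (mat 1)) else row i (mat 1)) = v $ k * det (mat 1 :: real^'n^'n)"
      by (rule cramer_lemma_transpose)
    moreover have r: "row i (mat 1 :: real^'n^'n) = axis i 1" for i
      by (simp add: vec_eq_iff row_def mat_def axis_def)
    moreover have b: "(\<Sum>l\<in>UNIV. v $ l *s axis l 1) = v"
      by (rule basis_expansion)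
    ultimately show ?thesis by (simp only: r b det_I mult_1_right)
  qed
  have aux: "det (\<chi> i. if i = k then v else R S i) = v $ k" if "finite S" "k \<notin> S" for S k
    using that
  proof (induction S rule: finite_induct)
    case empty
    have "R {} = (\<lambda>i. axis i 1)" by (simp add: R_def)
    then show ?case by (simp only: base)
  next
    case (insert m S)
    have mk: "m \<noteq> k" using insert by auto
    have e: "(\<chi> i. if i = k then v else R (insert m S) i) = (\<chi> i. if i = m then axis m 1 + u $ m *s v else (if i = k then v else R S i))"
      using mk by (simp add: vec_eq_iff R_def scalar_mult_eq_scaleR)
    have "det (\<chi> i. if i = k then v else R (insert m S) i)
       = det (\<chi> i. if i = m then axis m 1 else (if i = k then v else R S i)) + det (\<chi> i. if i = m then u $ m *s v else (if i = k then v else R S i))"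
      unfolding e by (rule det_row_add)
    also have "det (\<chi> i. if i = m then u $ m *s v else (if i = k then v else R S i)) = u $ m * det (\<chi> i. if i = m then v else (if i = k then v else R S i))"
      by (rule det_row_mul)
    also have "det (\<chi> i. if i = m then v else (if i = k then v else R S i)) = 0"
      by (rule det_identical_rows[of m k]) (use mk in \<open>auto simp: row_def vec_eq_iff\<close>)
    also have "(\<chi> i. if i = m then axis m 1 else (if i = k then v else R S i)) = (\<chi> i. if i = k then v else R S i)"
      using mk insert by (simp add: vec_eq_iff R_def)
    finally show ?case using insert by simp
  qed
  have main: "det (\<chi> i. R S i) = 1 + (\<Sum>k\<in>S. u $ k * v $ k)" if "finite S" for S
    using that
  proof (induction S rule: finite_induct)
    case empty
    have "(\<chi> i. R {} i) = (mat 1 :: real^'n^'n)" by (simp add: vec_eq_iff R_def mat_def axis_def)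
    then show ?case by simp
  next
    case (insert m S)
    have e: "(\<chi> i. R (insert m S) i) = (\<chi> i. if i = m then axis m 1 + u $ m *s v else R S i)"
      by (simp add: vec_eq_iff R_def scalar_mult_eq_scaleR)
    have "det (\<chi> i. R (insert m S) i) = det (\<chi> i. if i = m then axis m 1 else R S i) + det (\<chi> i. if i = m then u $ m *s v else R S i)"
      unfolding e by (rule det_row_add)
    also have "det (\<chi> i. if i = m then u $ m *s v else R S i) = u $ m * det (\<chi> i. if i = m then v else R S i)"
      by (rule det_row_mul)
    also have "(\<chi> i. if i = m then axis m 1 else R S i) = (\<chi> i. R S i)"
      using insert by (simp add: vec_eq_iff R_def)
    finally show ?case using insert aux[OF insert(1,2)] by simp
  qed
  have "mat 1 + outer u v = (\<chi> i. R UNIV i)"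
    by (simp add: vec_eq_iff R_def mat_def axis_def outer_def)
  then show ?thesis using main[of UNIV] by (simp add: inner_vec_def)
qed

definition posdef :: "real^'n^'n \<Rightarrow> bool" where
  "posdef X \<longleftrightarrow> transpose X = X \<and> (\<forall>x. x \<noteq> 0 \<longrightarrow> x \<bullet> (X *v x) > 0)"

lemma symmetric_inner: "transpose X = X \<Longrightarrow> x \<bullet> (X *v y) = (X *v x) \<bullet> (y::real^'n)"
  by (metis dot_lmul_matrix transpose_matrix_vector)

lemma posdef_det_nz:
  assumes "posdef X" shows "det X \<noteq> 0"
proof
  assume "det X = 0"
  then have "\<not> invertible X" by (simp add: invertible_det_nz)
  then obtain x where "x \<noteq> 0" "X *v x = 0"
    by (metis invertible_left_inverse matrix_left_invertible_ker)
  then show False using assms unfolding posdef_def by (metis inner_zero_right less_irrefl)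
qed

lemma posdef_inv:
  assumes "posdef X"
  shows "X ** matrix_inv X = mat 1" "matrix_inv X ** X = mat 1"
  using posdef_det_nz[OF assms] by (simp_all add: invertible_det_nz[symmetric] matrix_inv_mult)

lemma posdef_inv_apply:
  assumes "posdef X"
  shows "X *v (matrix_inv X *v x) = x" "matrix_inv X *v (X *v x) = x"
  by (simp_all add: matrix_vector_mul_assoc posdef_inv[OF assms])

lemma posdef_inv_symmetric:
  assumes "posdef X" shows "transpose (matrix_inv X) = matrix_inv X"
proof -
  have "transpose (matrix_inv X) ** X = mat 1"
    using arg_cong[OF posdef_inv(1)[OF assms], of transpose] assms
    by (simp add: matrix_transpose_mul posdef_def)
  then show ?thesis
    using posdef_inv(1)[OF assms] by (metis matrix_mul_assoc matrix_mul_lid matrix_mul_rid)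
qed

lemma posdef_inv_nonneg:
  assumes "posdef X" shows "x \<bullet> (matrix_inv X *v x) \<ge> 0"
proof -
  define y where "y = matrix_inv X *v x"
  have "x = X *v y" by (simp add: y_def posdef_inv_apply[OF assms])
  then have "x \<bullet> (matrix_inv X *v x) = y \<bullet> (X *v y)"
    by (simp add: y_def posdef_inv_apply[OF assms] inner_commute)
  then show ?thesis using assms unfolding posdef_def by (metis inner_zero_left less_eq_real_def)
qed

lemma transpose_outer_self [simp]: "transpose (outer w w) = outer w w"
  by (simp add: vec_eq_iff transpose_def outer_def mult.commute)

lemma det_plus_outer:
  assumes "posdef X"
  shows "det (X + c *\<^sub>R outer w w) = det X * (1 + c * (w \<bullet> (matrix_inv X *v w)))"
proof -
  have "X + c *\<^sub>R outer w w = X ** (mat 1 + outer (c *\<^sub>R (matrix_inv X *v w)) w)"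
    by (simp add: matrix_add_ldistrib matrix_mul_outer matrix_vector_mult_scaleR posdef_inv_apply[OF assms])
       (simp add: vec_eq_iff outer_def mult.assoc)
  then have "det (X + c *\<^sub>R outer w w) = det X * (1 + (c *\<^sub>R (matrix_inv X *v w)) \<bullet> w)"
    by (simp add: det_mul det_one_plus_outer)
  then show ?thesis by (simp add: inner_commute)
qed

lemma transpose_add: "transpose (X + Y) = transpose X + transpose Y"
  by (simp add: vec_eq_iff transpose_def)

lemma posdef_plus_outer:
  assumes "posdef X" "c \<ge> 0"
  shows "posdef (X + c *\<^sub>R outer w w)"
  unfolding posdef_def
proof (intro conjI allI impI)
  show "transpose (X + c *\<^sub>R outer w w) = X + c *\<^sub>R outer w w"
    using assms by (simp add: transpose_add transpose_scalar posdef_def)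
  fix x :: "real^'a" assume "x \<noteq> 0"
  then have "x \<bullet> (X *v x) > 0" using assms by (simp add: posdef_def)
  moreover have "x \<bullet> ((c *\<^sub>R outer w w) *v x) = c * (w \<bullet> x)\<^sup>2"
    by (simp add: scaleR_matrix_vector_assoc[symmetric] outer_mult_vector power2_eq_square inner_commute)
  ultimately show "x \<bullet> ((X + c *\<^sub>R outer w w) *v x) > 0"
    using assms by (simp add: matrix_vector_mult_add_rdistrib inner_add_right add_pos_nonneg)
qed

lemma det_plus_outer_ge:
  assumes "posdef X" "c \<ge> 0" "det X > 0"
  shows "det X \<le> det (X + c *\<^sub>R outer w w)"
  using assms posdef_inv_nonneg[OF assms(1), of w] by (simp add: det_plus_outer)

lemma det_plus_sum_outer_ge:
  assumes "finite I" "posdef X" "det X > 0" "\<And>k. k \<in> I \<Longrightarrow> c k \<ge> 0"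
  shows "posdef (X + (\<Sum>k\<in>I. c k *\<^sub>R outer (w k) (w k))) \<and> det X \<le> det (X + (\<Sum>k\<in>I. c k *\<^sub>R outer (w k) (w k)))"
  using assms(1,4)
proof (induction I rule: finite_induct)
  case (insert k I)
  let ?Y = "X + (\<Sum>k\<in>I. c k *\<^sub>R outer (w k) (w k))"
  have Y: "posdef ?Y" "det X \<le> det ?Y" using insert by auto
  have e: "X + (\<Sum>k\<in>insert k I. c k *\<^sub>R outer (w k) (w k)) = ?Y + c k *\<^sub>R outer (w k) (w k)"
    using insert by (simp add: add_ac)
  show ?case unfolding e
    using posdef_plus_outer[OF Y(1), of "c k" "w k"] det_plus_outer_ge[OF Y(1), of "c k" "w k"] Y assms(3) insert.prems
    by force
qed (use assms in auto)

section \<open>Spectral decomposition\<close>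

lemma orthogonal_matrix_rows_iff:
  fixes e :: "real^'n^'n"
  shows "orthogonal_matrix e \<longleftrightarrow> (\<forall>k l. e $ k \<bullet> e $ l = (if k = l then 1 else 0))"
proof -
  have "row k e = e $ k" for k by (simp add: row_def vec_eq_iff)
  then show ?thesis
    unfolding orthogonal_matrix_orthonormal_rows by (auto simp: norm_eq_1 orthogonal_def)
qed

lemma compact_orthogonal_matrices: "compact {e :: real^'n^'n. orthogonal_matrix e}"
  unfolding compact_eq_bounded_closed
proof
  show "closed {e :: real^'n^'n. orthogonal_matrix e}"
    unfolding orthogonal_matrix_rows_iff
    by (intro closed_Collect_all closed_Collect_eq continuous_intros)
  have "norm e \<le> real CARD('n)" if "orthogonal_matrix e" for e :: "real^'n^'n"
  proof -
    have "norm (e $ k) = 1" for k using that by (simp add: orthogonal_matrix_rows_iff norm_eq_1)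
    then show ?thesis unfolding norm_vec_def[of e] by (intro order_trans[OF L2_set_le_sum]) auto
  qed
  then show "bounded {e :: real^'n^'n. orthogonal_matrix e}" by (auto simp: bounded_iff)
qed

lemma orthonormal_expansion:
  fixes e :: "real^'n^'n"
  assumes "orthogonal_matrix e"
  shows "(\<Sum>k\<in>UNIV. (e $ k \<bullet> x) *\<^sub>R e $ k) = x"
proof -
  have "transpose e *v (e *v x) = x"
    using assms by (simp add: orthogonal_matrix matrix_vector_mul_assoc del: transpose_matrix_vector)
  moreover have "(transpose e *v (e *v x)) $ i = (\<Sum>k\<in>UNIV. (e $ k \<bullet> x) *\<^sub>R e $ k) $ i" for i
    by (simp add: matrix_vector_mult_def transpose_def inner_vec_def mult.commute del: transpose_matrix_vector)
  ultimately show ?thesis by (metis vec_eq_iff)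
qed

text \<open>Diagonalisation with eigenvalues in decreasing order: among all orthonormal frames, take one that maximises
  \<open>\<Sum>\<^sub>k w\<^sub>k \<langle>S e\<^sub>k, e\<^sub>k\<rangle>\<close> with decreasing weights \<open>w\<close>, and compare it with its plane rotations.\<close>

lemma spectral_theorem_sorted:
  fixes S :: "real^'n::{finite,wellorder}^'n::_"
  assumes S: "transpose S = S"
  obtains e where "orthogonal_matrix e" "\<And>k l. k \<noteq> l \<Longrightarrow> e $ k \<bullet> (S *v e $ l) = 0"
    "\<And>k l. k \<le> l \<Longrightarrow> e $ l \<bullet> (S *v e $ l) \<le> e $ k \<bullet> (S *v e $ k)"
proof -
  define w where "w = (\<lambda>k::'n. real (card {l. k < l}))"
  have w: "w l < w k" if "k < l" for k l
  proof -
    have "{i. l < i} \<subset> {i. k < i}" using that by auto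
    then show ?thesis unfolding w_def by (simp add: psubset_card_mono)
  qed
  define \<phi> where "\<phi> = (\<lambda>e :: real^'n::_^'n::_. \<Sum>k\<in>UNIV. w k * (e $ k \<bullet> (S *v e $ k)))"
  have "continuous_on {e. orthogonal_matrix e} \<phi>"
    unfolding \<phi>_def by (intro continuous_intros continuous_on_compose2[OF matrix_vector_mult_linear_continuous_on[of UNIV S]]) auto
  moreover have "{e :: real^'n::_^'n::_. orthogonal_matrix e} \<noteq> {}" using orthogonal_matrix_id by blast
  ultimately obtain e where e: "orthogonal_matrix e" and max: "\<And>e'. orthogonal_matrix e' \<Longrightarrow> \<phi> e' \<le> \<phi> e"
    using continuous_attains_sup[OF compact_orthogonal_matrices, of \<phi>] by auto
  have on: "e $ k \<bullet> e $ l = (if k = l then 1 else 0)" for k l using e by (simp add: orthogonal_matrix_rows_iff)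
  have sym: "x \<bullet> (S *v y) = y \<bullet> (S *v x)" for x y
    using symmetric_inner[OF S, of x y] by (simp add: inner_commute)
  \<comment> \<open>maximality against the rotation by cosine \<open>c\<close> and sine \<open>s\<close> in the plane of \<open>e\<^sub>k\<close> and \<open>e\<^sub>l\<close>\<close>
  have rot: "s\<^sup>2 * (e $ l \<bullet> (S *v e $ l) - e $ k \<bullet> (S *v e $ k)) + 2 * c * s * (e $ k \<bullet> (S *v e $ l)) \<le> 0"
    if kl: "k < l" and cs: "c\<^sup>2 + s\<^sup>2 = 1" for k l c s
  proof -
    define e' where "e' = (\<chi> i. if i = k then c *\<^sub>R e $ k + s *\<^sub>R e $ l else if i = l then c *\<^sub>R e $ l - s *\<^sub>R e $ k else e $ i)"
    have ne: "k \<noteq> l" using kl by auto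
    have "orthogonal_matrix e'"
      unfolding orthogonal_matrix_rows_iff e'_def using ne cs
      by (auto simp: on inner_simps power2_eq_square algebra_simps)
    then have "\<phi> e' \<le> \<phi> e" by (rule max)
    moreover have "\<phi> f = w k * (f $ k \<bullet> (S *v f $ k)) + (w l * (f $ l \<bullet> (S *v f $ l)) + (\<Sum>i\<in>UNIV - {k} - {l}. w i * (f $ i \<bullet> (S *v f $ i))))" for f
      unfolding \<phi>_def using ne by (subst sum.remove[of _ k], simp, simp, subst sum.remove[of _ l]) auto
    moreover have "(\<Sum>i\<in>UNIV - {k} - {l}. w i * (e' $ i \<bullet> (S *v e' $ i))) = (\<Sum>i\<in>UNIV - {k} - {l}. w i * (e $ i \<bullet> (S *v e $ i)))"
      by (intro sum.cong) (auto simp: e'_def)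
    moreover define a where "a = e $ k \<bullet> (S *v e $ k)"
    moreover define d where "d = e $ l \<bullet> (S *v e $ l)"
    moreover define m where "m = e $ k \<bullet> (S *v e $ l)"
    moreover have "e' $ k \<bullet> (S *v e' $ k) = c\<^sup>2 * a + 2 * c * s * m + s\<^sup>2 * d"
      by (simp add: e'_def a_def d_def m_def matrix_vector_right_distrib matrix_vector_mult_scaleR inner_simps sym[of "e $ l" "e $ k"] power2_eq_square algebra_simps)
    moreover have "e' $ l \<bullet> (S *v e' $ l) = s\<^sup>2 * a - 2 * c * s * m + c\<^sup>2 * d"
      using ne by (simp add: e'_def a_def d_def m_def matrix_vector_mult_diff_distrib matrix_vector_mult_scaleR inner_simps sym[of "e $ l" "e $ k"] power2_eq_square algebra_simps)
    ultimately have le: "w k * (c\<^sup>2 * a + 2 * c * s * m + s\<^sup>2 * d) + w l * (s\<^sup>2 * a - 2 * c * s * m + c\<^sup>2 * d) \<le> w k * a + w l * d"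
      by simp
    have c2: "c\<^sup>2 = 1 - s\<^sup>2" using cs by simp
    have "w k * (c\<^sup>2 * a + 2 * c * s * m + s\<^sup>2 * d) + w l * (s\<^sup>2 * a - 2 * c * s * m + c\<^sup>2 * d) - (w k * a + w l * d)
        = (w k - w l) * (s\<^sup>2 * (d - a) + 2 * c * s * m)"
      unfolding c2 by (simp add: algebra_simps)
    with le have "(w k - w l) * (s\<^sup>2 * (d - a) + 2 * c * s * m) \<le> 0" by linarith
    then show ?thesis using w[OF kl] unfolding a_def d_def m_def by (simp add: mult_le_0_iff)
  qed
  have mono: "e $ l \<bullet> (S *v e $ l) \<le> e $ k \<bullet> (S *v e $ k)" if "k \<le> l" for k l
  proof (cases "k = l")
    case False
    then show ?thesis using rot[of k l 0 1] that by simp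
  qed simp
  have off: "e $ k \<bullet> (S *v e $ l) = 0" if kl: "k < l" for k l
  proof (rule ccontr)
    assume m: "e $ k \<bullet> (S *v e $ l) \<noteq> 0"
    define m where "m = e $ k \<bullet> (S *v e $ l)"
    define D where "D = e $ k \<bullet> (S *v e $ k) - e $ l \<bullet> (S *v e $ l)"
    have D: "D \<ge> 0" unfolding D_def using mono[of k l] kl by simp
    \<comment> \<open>the tangent of an angle that would increase the maximum: \<open>2 t m - t\<^sup>2 D = t\<^sup>2 (D + 2)\<close>\<close>
    define t where "t = m / (D + 1)"
    define h where "h = sqrt (1 + t\<^sup>2)"
    have h: "h > 0" "h\<^sup>2 = 1 + t\<^sup>2" unfolding h_def by (auto simp: add_pos_nonneg)
    have "(t / h)\<^sup>2 * (- D) + 2 * (1 / h) * (t / h) * m \<le> 0"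
    proof -
      have cs: "(1 / h)\<^sup>2 + (t / h)\<^sup>2 = 1"
        using h(1) by (simp add: power_divide add_divide_distrib[symmetric] h(2)[symmetric])
      show ?thesis using rot[OF kl cs] unfolding D_def m_def minus_diff_eq .
    qed
    moreover have "(t\<^sup>2 * (- D) + 2 * t * m) / h\<^sup>2 = (t / h)\<^sup>2 * (- D) + 2 * (1 / h) * (t / h) * m"
      by (simp add: power2_eq_square add_divide_distrib diff_divide_distrib)
    ultimately have "(t\<^sup>2 * (- D) + 2 * t * m) / h\<^sup>2 \<le> 0" by simp
    then have "t\<^sup>2 * (- D) + 2 * t * m \<le> 0" using h(1) zero_less_power[OF h(1), of 2] by (simp only: divide_le_0_iff) linarith
    moreover have "m = t * (D + 1)" using D by (simp add: t_def)
    ultimately have "t\<^sup>2 * (D + 2) \<le> 0" by (simp add: power2_eq_square algebra_simps)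
    moreover have "t \<noteq> 0" using m D by (simp add: t_def m_def)
    ultimately show False using D by (simp add: mult_le_0_iff)
  qed
  show ?thesis
  proof (rule that[OF e])
    show "e $ k \<bullet> (S *v e $ l) = 0" if "k \<noteq> l" for k l
      using off[of k l] off[of l k] sym[of "e $ k" "e $ l"] that by (metis neqE)
  qed (rule mono)
qed

text \<open>The covariance with eigenvalues \<open>\<sigma>\<close> along the orthonormal frame formed by the rows of \<open>e\<close>.\<close>

definition cov :: "real^'n^'n \<Rightarrow> real^'n \<Rightarrow> real^'n^'n" where
  "cov e \<sigma> = (\<Sum>k\<in>UNIV. (\<sigma> $ k) *\<^sub>R outer (e $ k) (e $ k))"

lemma sum_matrix_vector_mult: "(\<Sum>k\<in>I. X k) *v (x::real^'n) = (\<Sum>k\<in>I. X k *v x)"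
  by (induction I rule: infinite_finite_induct) (simp_all add: matrix_vector_mult_add_rdistrib)

lemma cov_mult_vector: "cov e \<sigma> *v x = (\<Sum>k\<in>UNIV. (\<sigma> $ k * (e $ k \<bullet> x)) *\<^sub>R e $ k)"
  by (simp add: cov_def sum_matrix_vector_mult scaleR_matrix_vector_assoc[symmetric] outer_mult_vector)

lemma cov_frame:
  assumes "orthogonal_matrix e" shows "cov e \<sigma> *v (e $ l) = (\<sigma> $ l) *\<^sub>R e $ l"
proof -
  have "cov e \<sigma> *v (e $ l) = (\<Sum>k\<in>UNIV. if k = l then (\<sigma> $ k) *\<^sub>R e $ k else 0)"
    unfolding cov_mult_vector using assms by (intro sum.cong) (auto simp: orthogonal_matrix_rows_iff)
  then show ?thesis by simp
qed

lemma cov_eq_mult: "cov e \<sigma> = transpose e ** (\<chi> i j. if i = j then \<sigma> $ i else 0) ** e"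
proof -
  have "(\<Sum>j\<in>UNIV. e $ j $ i * (if j = k then \<sigma> $ j else 0)) = e $ k $ i * \<sigma> $ k" for i k
    by (simp add: if_distrib cong: if_cong)
  then show ?thesis
    by (simp add: vec_eq_iff cov_def matrix_matrix_mult_def transpose_def outer_def mult_ac)
qed

lemma transpose_cov: "transpose (cov e \<sigma>) = cov e \<sigma>"
  by (simp add: vec_eq_iff cov_def transpose_def outer_def mult_ac)

lemma det_cov:
  assumes "orthogonal_matrix e" shows "det (cov e \<sigma>) = (\<Prod>k\<in>UNIV. \<sigma> $ k)"
proof -
  have "det (transpose e ** e) = 1" using assms by (simp add: orthogonal_matrix)
  then have "det e * det e = 1" by (simp add: det_mul)
  then show ?thesis unfolding cov_eq_mult
  proof -
    assume d: "det e * det e = 1"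
    have "det (transpose e ** (\<chi> i j. if i = j then \<sigma> $ i else 0) ** e) = (det e * det e) * (\<Prod>k\<in>UNIV. \<sigma> $ k)"
      by (simp add: det_mul det_diagonal)
    then show "det (transpose e ** (\<chi> i j. if i = j then \<sigma> $ i else 0) ** e) = (\<Prod>k\<in>UNIV. \<sigma> $ k)"
      by (simp only: d mult_1_left)
  qed
qed

lemma posdef_cov:
  assumes e: "orthogonal_matrix e" and s: "\<And>k. \<sigma> $ k > 0"
  shows "posdef (cov e \<sigma>)"
  unfolding posdef_def
proof (intro conjI allI impI transpose_cov)
  fix x :: "real^'a" assume x: "x \<noteq> 0"
  have "\<exists>k. e $ k \<bullet> x \<noteq> 0"
  proof (rule ccontr)
    assume "\<not> ?thesis"
    then have "(\<Sum>k\<in>UNIV. (e $ k \<bullet> x) *\<^sub>R e $ k) = 0" by simp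
    then show False using orthonormal_expansion[OF e, of x] x by simp
  qed
  then obtain k where k: "e $ k \<bullet> x \<noteq> 0" by blast
  have "x \<bullet> (cov e \<sigma> *v x) = (\<Sum>k\<in>UNIV. \<sigma> $ k * (e $ k \<bullet> x)\<^sup>2)"
    by (simp add: cov_mult_vector inner_sum_right power2_eq_square inner_commute mult.assoc)
  also have "\<dots> > 0"
    by (rule sum_pos2[of _ k]) (use k s in \<open>auto simp: less_imp_le\<close>)
  finally show "0 < x \<bullet> (cov e \<sigma> *v x)" .
qed

lemma posdef_eq_cov:
  fixes S :: "real^'n::{finite,wellorder}^'n::_"
  assumes "posdef S"
  obtains e \<sigma> where "orthogonal_matrix e" "\<And>k. \<sigma> $ k > 0" "\<And>k l. k \<le> l \<Longrightarrow> \<sigma> $ l \<le> \<sigma> $ k" "S = cov e \<sigma>"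
proof -
  have S: "transpose S = S" using assms by (simp add: posdef_def)
  obtain e where e: "orthogonal_matrix e" "\<And>k l. k \<noteq> l \<Longrightarrow> e $ k \<bullet> (S *v e $ l) = 0"
    "\<And>k l. k \<le> l \<Longrightarrow> e $ l \<bullet> (S *v e $ l) \<le> e $ k \<bullet> (S *v e $ k)"
    using spectral_theorem_sorted[OF S] by metis
  define \<sigma> where "\<sigma> = (\<chi> k. e $ k \<bullet> (S *v e $ k))"
  have pos: "\<sigma> $ k > 0" for k
  proof -
    have "e $ k \<noteq> 0" using e(1) by (metis inner_zero_left orthogonal_matrix_rows_iff zero_neq_one)
    then show ?thesis using assms by (simp add: \<sigma>_def posdef_def)
  qed
  have Se: "S *v e $ l = (\<sigma> $ l) *\<^sub>R e $ l" for l
  proof -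
    have "S *v e $ l = (\<Sum>k\<in>UNIV. (e $ k \<bullet> (S *v e $ l)) *\<^sub>R e $ k)" by (rule orthonormal_expansion[OF e(1), symmetric])
    also have "\<dots> = (\<Sum>k\<in>UNIV. if k = l then (\<sigma> $ k) *\<^sub>R e $ k else 0)"
      by (intro sum.cong) (auto simp: \<sigma>_def e(2))
    finally show ?thesis by simp
  qed
  have "S *v x = cov e \<sigma> *v x" for x
  proof -
    have "S *v x = S *v (\<Sum>k\<in>UNIV. (e $ k \<bullet> x) *\<^sub>R e $ k)" by (simp add: orthonormal_expansion[OF e(1)])
    also have "\<dots> = (\<Sum>k\<in>UNIV. (e $ k \<bullet> x) *\<^sub>R (S *v e $ k))"
      by (simp add: linear_sum[OF matrix_vector_mul_linear] matrix_vector_mult_scaleR)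
    also have "\<dots> = cov e \<sigma> *v x" by (simp add: cov_mult_vector Se mult.commute)
    finally show ?thesis .
  qed
  then have eq: "S = cov e \<sigma>" by (simp add: matrix_eq)
  have "\<sigma> $ l \<le> \<sigma> $ k" if "k \<le> l" for k l using e(3)[OF that] by (simp add: \<sigma>_def)
  then show ?thesis by (rule that[OF e(1) pos _ eq])
qed

lemma posdef_det_pos:
  fixes S :: "real^'n::{finite,wellorder}^'n::_"
  assumes "posdef S" shows "det S > 0"
proof -
  obtain e \<sigma> where "orthogonal_matrix e" "\<And>k. \<sigma> $ k > 0" "S = cov e \<sigma>"
    by (rule posdef_eq_cov[OF assms]) (rule that)
  then show ?thesis by (simp add: det_cov prod_pos)
qed

lemma cov_inv_frame:
  assumes "orthogonal_matrix e" "\<And>k. \<sigma> $ k > 0"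
  shows "matrix_inv (cov e \<sigma>) *v (e $ k) = (1 / \<sigma> $ k) *\<^sub>R e $ k"
proof -
  have "e $ k = cov e \<sigma> *v ((1 / \<sigma> $ k) *\<^sub>R e $ k)"
    using assms(2)[of k] by (simp add: matrix_vector_mult_scaleR cov_frame[OF assms(1)])
  then show ?thesis using posdef_inv_apply(2)[OF posdef_cov[OF assms]] by metis
qed

lemma trace_cov:
  assumes "orthogonal_matrix e" shows "trace (cov e \<sigma>) = (\<Sum>k\<in>UNIV. \<sigma> $ k)"
proof -
  have "trace (cov e \<sigma>) = (\<Sum>i\<in>UNIV. \<Sum>k\<in>UNIV. \<sigma> $ k * (e $ k $ i * e $ k $ i))"
    by (simp add: trace_def cov_def outer_def)
  also have "\<dots> = (\<Sum>k\<in>UNIV. \<sigma> $ k * (e $ k \<bullet> e $ k))"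
    by (subst sum.swap) (simp add: inner_vec_def sum_distrib_left)
  finally show ?thesis using assms by (simp add: orthogonal_matrix_rows_iff)
qed

lemma trace_plus_outer: "trace (S + c *\<^sub>R outer w w) = trace S + c * (norm w)\<^sup>2"
  by (simp add: trace_def outer_def power2_norm_eq_inner inner_vec_def sum.distrib sum_distrib_left)

section \<open>Gram matrices\<close>

definition complement_proj :: "'n set \<Rightarrow> real^'n^'n" where
  "complement_proj K = (\<chi> i j. if i = j \<and> i \<notin> K then 1 else 0)"

text \<open>If the rows of \<open>A\<close> outside \<open>K\<close> vanish, then \<open>A S A\<^sup>T\<close> is a matrix on the coordinates in \<open>K\<close>; the identity on the other
  coordinates extends it to an \<open>n \<times> n\<close> matrix with the same determinant.\<close>

definition gram :: "real^'n^'n \<Rightarrow> 'n set \<Rightarrow> real^'n^'n \<Rightarrow> real^'n^'n" where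
  "gram A K S = A ** S ** transpose A + complement_proj K"

text \<open>The bijection \<open>\<beta>\<close> selects the frame vectors \<open>e\<^sub>k\<close> with \<open>\<beta> k \<in> K\<close>.  Their images are the columns of this matrix, and the
  missing coordinate vectors fill the other columns, so that the determinant is up to sign the minor of \<open>A\<close> on the
  selected vectors.\<close>

definition completed_frame :: "real^'n^'n \<Rightarrow> real^'n^'n \<Rightarrow> 'n set \<Rightarrow> ('n \<Rightarrow> 'n) \<Rightarrow> real^'n^'n" where
  "completed_frame A e K \<beta> = (\<chi> i k. (if \<beta> k \<in> K then A *v e $ k else axis (\<beta> k) 1) $ i)"

lemma conjugate_outer: "A ** outer u u ** transpose A = outer (A *v u) (A *v u)"
  by (simp add: vec_eq_iff matrix_mul_outer)
     (simp add: outer_def matrix_matrix_mult_def matrix_vector_mult_def transpose_def sum_distrib_left mult_ac)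

lemma matrix_mul_add_rdistrib: "(A + B) ** C = A ** C + B ** (C :: real^'n^'n)"
  by (simp add: vec_eq_iff matrix_matrix_mult_def distrib_right sum.distrib)

lemma gram_plus_outer: "gram A K (S + c *\<^sub>R outer w w) = gram A K S + c *\<^sub>R outer (A *v w) (A *v w)"
proof -
  have "A ** (c *\<^sub>R outer w w) ** transpose A = c *\<^sub>R outer (A *v w) (A *v w)"
    by (simp add: conjugate_outer[symmetric] matrix_scalar_ac scalar_matrix_assoc[symmetric] scalar_mult_eq_scaleR)
  then show ?thesis by (simp add: gram_def matrix_add_ldistrib matrix_mul_add_rdistrib)
qed

lemma gram_cov: "gram A K (cov e \<sigma>) = complement_proj K + (\<Sum>k\<in>UNIV. (\<sigma> $ k) *\<^sub>R outer (A *v e $ k) (A *v e $ k))"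
proof -
  have "gram A K (0 + (\<Sum>k\<in>I. (\<sigma> $ k) *\<^sub>R outer (e $ k) (e $ k))) = complement_proj K + (\<Sum>k\<in>I. (\<sigma> $ k) *\<^sub>R outer (A *v e $ k) (A *v e $ k))"
    if "finite I" for I
    using that
  proof (induction I rule: finite_induct)
    case empty
    then show ?case by (simp add: gram_def)
  next
    case (insert k I)
    then show ?case using gram_plus_outer[of A K "\<Sum>k\<in>I. (\<sigma> $ k) *\<^sub>R outer (e $ k) (e $ k)" "\<sigma> $ k" "e $ k"]
      by (simp add: add_ac)
  qed
  from this[of UNIV] show ?thesis by (simp add: cov_def)
qed

text \<open>By Cauchy--Binet the determinant of \<open>gram A K (cov e \<sigma>)\<close> is a sum of nonnegative terms, one for each choice of
  \<open>card K\<close> frame vectors, and each term is a lower bound.  The proof isolates the selected vectors; the remaining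
  rank-one summands can only increase the determinant.\<close>

lemma gram_cov_lower_bound:
  fixes A :: "real^'n::{finite,wellorder}^'n::_"
  assumes \<beta>: "bij \<beta>" and s: "\<And>k. \<sigma> $ k > 0" and d: "det (completed_frame A e K \<beta>) \<noteq> 0"
  shows "posdef (gram A K (cov e \<sigma>)) \<and>
    (det (completed_frame A e K \<beta>))\<^sup>2 * (\<Prod>k\<in>{k. \<beta> k \<in> K}. \<sigma> $ k) \<le> det (gram A K (cov e \<sigma>))"
proof -
  define M where "M = completed_frame A e K \<beta>"
  define \<tau> where "\<tau> = (\<chi> k. if \<beta> k \<in> K then \<sigma> $ k else 1)"
  define X where "X = complement_proj K + (\<Sum>k\<in>{k. \<beta> k \<in> K}. (\<sigma> $ k) *\<^sub>R outer (A *v e $ k) (A *v e $ k))"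
  have \<tau>: "\<tau> $ k > 0" for k using s by (simp add: \<tau>_def)
  have Xsum: "X = (\<Sum>k\<in>UNIV. (\<tau> $ k) *\<^sub>R outer (column k M) (column k M))"
  proof -
    have "(\<Sum>k\<in>UNIV. (\<tau> $ k) *\<^sub>R outer (column k M) (column k M))
       = (\<Sum>k\<in>{k. \<beta> k \<in> K}. (\<tau> $ k) *\<^sub>R outer (column k M) (column k M)) + (\<Sum>k\<in>{k. \<beta> k \<notin> K}. (\<tau> $ k) *\<^sub>R outer (column k M) (column k M))"
      by (subst sum.union_disjoint[symmetric]) (auto intro: sum.cong)
    also have "(\<Sum>k\<in>{k. \<beta> k \<in> K}. (\<tau> $ k) *\<^sub>R outer (column k M) (column k M)) = (\<Sum>k\<in>{k. \<beta> k \<in> K}. (\<sigma> $ k) *\<^sub>R outer (A *v e $ k) (A *v e $ k))"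
      by (intro sum.cong) (auto simp: \<tau>_def M_def completed_frame_def column_def)
    also have "(\<Sum>k\<in>{k. \<beta> k \<notin> K}. (\<tau> $ k) *\<^sub>R outer (column k M) (column k M)) = (\<Sum>k\<in>{k. \<beta> k \<notin> K}. outer (axis (\<beta> k) 1) (axis (\<beta> k) 1))"
      by (intro sum.cong) (auto simp: \<tau>_def M_def completed_frame_def column_def)
    also have "\<dots> = (\<Sum>i\<in>-K. outer (axis i 1) (axis i 1))"
    proof (rule sum.reindex_bij_betw)
      have "bij_betw \<beta> {k. \<beta> k \<notin> K} (\<beta> ` {k. \<beta> k \<notin> K})"
        using \<beta> by (intro inj_on_imp_bij_betw) (auto simp: bij_def inj_on_def)
      moreover have "\<beta> ` {k. \<beta> k \<notin> K} = - K"
        using \<beta> by (auto simp: bij_def surj_def image_iff)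
      ultimately show "bij_betw \<beta> {k. \<beta> k \<notin> K} (- K)" by simp
    qed
    also have "\<dots> = complement_proj K"
    proof -
      have "(\<Sum>l\<in>-K. outer (axis l 1) (axis l 1) $ i $ j) = (if i = j \<and> i \<notin> K then 1 else 0 :: real)" for i j :: 'n
      proof -
        have "(\<Sum>l\<in>-K. outer (axis l 1) (axis l 1) $ i $ j) = (\<Sum>l\<in>-K. if l = i then (if i = j then 1 else 0) else 0 :: real)"
          by (intro sum.cong) (auto simp: outer_def axis_def)
        then show ?thesis by simp
      qed
      then show ?thesis by (simp add: vec_eq_iff complement_proj_def)
    qed
    finally show ?thesis by (simp add: X_def add.commute)
  qed
  have Xc: "X = cov (transpose M) \<tau>"
    unfolding Xsum cov_def by (simp add: column_def transpose_def)
  have "det X = (det M)\<^sup>2 * (\<Prod>k\<in>UNIV. \<tau> $ k)"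
    unfolding Xc cov_eq_mult by (simp add: det_mul det_diagonal power2_eq_square)
  also have "(\<Prod>k\<in>UNIV. \<tau> $ k) = (\<Prod>k\<in>{k. \<beta> k \<in> K}. \<sigma> $ k)"
    unfolding \<tau>_def by (simp add: prod.If_cases)
  finally have dX: "det X = (det M)\<^sup>2 * (\<Prod>k\<in>{k. \<beta> k \<in> K}. \<sigma> $ k)" .
  then have dXp: "det X > 0" using d s unfolding M_def[symmetric] by (auto intro!: mult_pos_pos prod_pos)
  have "posdef X"
    unfolding posdef_def
  proof (intro conjI allI impI)
    show "transpose X = X" unfolding Xc by (rule transpose_cov)
    fix x :: "real^'n::_" assume x: "x \<noteq> 0"
    have "\<exists>k. column k M \<bullet> x \<noteq> 0"
    proof (rule ccontr)
      assume "\<not> ?thesis"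
      then have "(transpose M *v x) = 0"
        by (simp add: vec_eq_iff matrix_vector_mult_def transpose_def column_def inner_vec_def del: transpose_matrix_vector)
      moreover have "invertible (transpose M)" using d by (simp add: invertible_det_nz M_def)
      ultimately show False using x by (metis invertible_left_inverse matrix_left_invertible_ker)
    qed
    then obtain k where k: "column k M \<bullet> x \<noteq> 0" by blast
    have "x \<bullet> (X *v x) = (\<Sum>k\<in>UNIV. \<tau> $ k * (column k M \<bullet> x)\<^sup>2)"
      unfolding Xsum by (simp add: sum_matrix_vector_mult scaleR_matrix_vector_assoc[symmetric] outer_mult_vector inner_sum_right power2_eq_square inner_commute mult.assoc)
    also have "\<dots> > 0"
      by (rule sum_pos2[of _ k]) (use k \<tau> in \<open>auto simp: less_imp_le\<close>)
    finally show "0 < x \<bullet> (X *v x)" .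
  qed
  then have "posdef (X + (\<Sum>k\<in>{k. \<beta> k \<notin> K}. (\<sigma> $ k) *\<^sub>R outer (A *v e $ k) (A *v e $ k)))
      \<and> det X \<le> det (X + (\<Sum>k\<in>{k. \<beta> k \<notin> K}. (\<sigma> $ k) *\<^sub>R outer (A *v e $ k) (A *v e $ k)))"
    by (intro det_plus_sum_outer_ge dXp) (auto simp: less_imp_le[OF s])
  moreover have "X + (\<Sum>k\<in>{k. \<beta> k \<notin> K}. (\<sigma> $ k) *\<^sub>R outer (A *v e $ k) (A *v e $ k)) = gram A K (cov e \<sigma>)"
  proof -
    have "(\<Sum>k\<in>UNIV. (\<sigma> $ k) *\<^sub>R outer (A *v e $ k) (A *v e $ k))
      = (\<Sum>k\<in>{k. \<beta> k \<in> K}. (\<sigma> $ k) *\<^sub>R outer (A *v e $ k) (A *v e $ k)) + (\<Sum>k\<in>{k. \<beta> k \<notin> K}. (\<sigma> $ k) *\<^sub>R outer (A *v e $ k) (A *v e $ k))"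
      by (subst sum.union_disjoint[symmetric]) (auto intro: sum.cong)
    then show ?thesis by (simp add: gram_cov X_def add.assoc)
  qed
  ultimately show ?thesis by (simp add: dX M_def)
qed

section \<open>Maximisation over covariances\<close>

text \<open>Summation by parts: coefficients with nonnegative tails, against a decreasing sequence.\<close>

lemma abel_sum_le:
  fixes q a :: "'k::linorder \<Rightarrow> real"
  assumes "finite X" "X \<noteq> {}" "\<And>t. t \<in> X \<Longrightarrow> (\<Sum>k\<in>{k\<in>X. t \<le> k}. q k) \<ge> 0"
    "\<And>k l. k \<in> X \<Longrightarrow> l \<in> X \<Longrightarrow> k \<le> l \<Longrightarrow> a l \<le> a k"
  shows "(\<Sum>k\<in>X. q k * a k) \<le> (\<Sum>k\<in>X. q k) * a (Min X)"
  using assms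
proof (induction X rule: finite_linorder_min_induct)
  case empty
  then show ?case by simp
next
  case (insert b A)
  show ?case
  proof (cases "A = {}")
    case False
    have bA: "b \<notin> A" using insert.hyps by auto
    have Min: "Min (insert b A) = b"
      using insert.hyps by (intro Min_eqI) (auto simp: less_imp_le)
    have tails: "(\<Sum>k\<in>{k\<in>A. t \<le> k}. q k) \<ge> 0" if "t \<in> A" for t
    proof -
      have "{k \<in> insert b A. t \<le> k} = {k\<in>A. t \<le> k}" using insert.hyps that by (auto simp: not_le)
      then show ?thesis using insert.prems(2)[of t] that by simp
    qed
    have IH: "(\<Sum>k\<in>A. q k * a k) \<le> (\<Sum>k\<in>A. q k) * a (Min A)"
      using insert.prems(3) by (intro insert.IH False tails) auto
    have MA: "Min A \<in> A" using False insert.hyps by simp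
    have "{k\<in>A. Min A \<le> k} = A" using insert.hyps by auto
    then have QA: "(\<Sum>k\<in>A. q k) \<ge> 0" using tails[OF MA] by simp
    have "a (Min A) \<le> a b" using MA insert.hyps by (intro insert.prems(3)) (auto simp: less_imp_le)
    then have "(\<Sum>k\<in>A. q k) * a (Min A) \<le> (\<Sum>k\<in>A. q k) * a b" using QA by (rule mult_left_mono)
    then show ?thesis using IH bA insert.hyps by (simp add: Min distrib_right)
  qed simp
qed

definition frame_exponent :: "('m::finite \<Rightarrow> real) \<Rightarrow> ('m \<Rightarrow> 'n set) \<Rightarrow> ('m \<Rightarrow> 'n \<Rightarrow> 'n) \<Rightarrow> 'n \<Rightarrow> real" where
  "frame_exponent p K \<beta> k = (\<Sum>j\<in>UNIV. if \<beta> j k \<in> K j then p j else 0)"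

text \<open>When \<open>\<beta> j\<close> selects each frame vector whose image is independent of the preceding images, as in \<open>greedy_frame\<close>,
  and \<open>U\<close> is the span of the frame vectors before \<open>t\<close>, the condition reads
  \<open>codim U \<ge> (\<Sum>\<^sub>j p\<^sub>j codim (A\<^sub>j U)) + \<eta>\<close>.\<close>

definition admissible :: "real \<Rightarrow> ('m::finite \<Rightarrow> real) \<Rightarrow> ('m \<Rightarrow> 'n set) \<Rightarrow> ('m \<Rightarrow> 'n \<Rightarrow> 'n::{finite,wellorder}) \<Rightarrow> bool" where
  "admissible \<eta> p K \<beta> \<longleftrightarrow> (\<forall>j. bij (\<beta> j)) \<and> (\<forall>t. (\<Sum>k\<in>{t..}. 1 - frame_exponent p K \<beta> k) \<ge> \<eta>)"

text \<open>The trace takes the place of the cut-off to the unit ball: it penalises large covariances.\<close>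

definition BL_functional :: "('m::finite \<Rightarrow> real) \<Rightarrow> ('m \<Rightarrow> real^'n^'n) \<Rightarrow> ('m \<Rightarrow> 'n set) \<Rightarrow> real^'n^'n \<Rightarrow> real" where
  "BL_functional p A K S = det S * exp (- trace S) * (\<Prod>j\<in>UNIV. det (gram (A j) (K j) S) powr (- p j))"

definition first_index :: "'n::{finite,wellorder}" where "first_index = Min UNIV"
definition last_index :: "'n::{finite,wellorder}" where "last_index = Max UNIV"

text \<open>Insert the lower bounds for the Gram determinants, and sum by parts: for admissible selections all eigenvalues may
  be replaced by the largest one, and the margin \<open>\<eta>\<close> leaves a power of the smallest one.\<close>

lemma BL_functional_cov_le:
  fixes A :: "'m::finite \<Rightarrow> real^'n::{finite,wellorder}^'n::_"
  assumes e: "orthogonal_matrix e" and s: "\<And>k. \<sigma> $ k > 0" "\<And>k l. k \<le> l \<Longrightarrow> \<sigma> $ l \<le> \<sigma> $ k"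
    and \<beta>: "admissible \<eta> p K \<beta>" and c: "0 < c" "\<And>j. (det (completed_frame (A j) e (K j) (\<beta> j)))\<^sup>2 \<ge> c"
    and p: "\<And>j. p j \<ge> 0" and \<eta>: "\<eta> \<ge> 0"
  shows "\<exists>a. 0 \<le> a \<and> a + \<eta> \<le> CARD('n) \<and>
    BL_functional p A K (cov e \<sigma>) \<le> c powr (- (\<Sum>j\<in>UNIV. p j)) * (\<sigma> $ first_index powr a * \<sigma> $ last_index powr \<eta> * exp (- \<sigma> $ first_index))"
proof -
  define P where "P = (\<Sum>j\<in>UNIV. p j)"
  define x where "x = frame_exponent p K \<beta>"
  have x0: "x k \<ge> 0" for k unfolding x_def frame_exponent_def by (auto intro!: sum_nonneg p)
  define Q where "Q = (\<Sum>k\<in>UNIV. 1 - x k)"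
  have Qn: "Q \<le> CARD('n)"
  proof -
    have "Q \<le> (\<Sum>k\<in>(UNIV::'n set). 1)" unfolding Q_def using x0 by (intro sum_mono) auto
    then show ?thesis by simp
  qed
  have tail: "(\<Sum>k\<in>{t..}. 1 - x k) \<ge> \<eta>" for t using \<beta> by (simp add: admissible_def x_def)
  have Fm: "first_index \<le> k" "k \<le> last_index" for k :: 'n by (simp_all add: first_index_def last_index_def)
  have "{first_index..} = (UNIV::'n set)" using Fm by auto
  then have Q\<eta>: "Q \<ge> \<eta>" using tail[of first_index] by (simp add: Q_def)
  \<comment> \<open>moving the margin \<open>\<eta>\<close> to the last index keeps all tails nonnegative\<close>
  define q where "q = (\<lambda>k. 1 - x k - (if k = last_index then \<eta> else 0))"
  have qs: "(\<Sum>k\<in>{t..}. q k) = (\<Sum>k\<in>{t..}. 1 - x k) - \<eta>" for t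
    using Fm by (simp add: q_def sum_subtractf)
  have "(\<Sum>k\<in>UNIV. q k * ln (\<sigma> $ k)) \<le> (\<Sum>k\<in>UNIV. q k) * ln (\<sigma> $ Min UNIV)"
  proof (rule abel_sum_le)
    show "0 \<le> (\<Sum>k\<in>{k \<in> UNIV. t \<le> k}. q k)" for t
      using qs[of t] tail[of t] by (simp add: atLeast_def)
    show "ln (\<sigma> $ l) \<le> ln (\<sigma> $ k)" if "k \<le> l" for k l using s that by simp
  qed auto
  moreover have "(\<Sum>k\<in>UNIV. q k) = Q - \<eta>"
    by (simp add: q_def Q_def sum_subtractf)
  moreover have "(\<Sum>k\<in>UNIV. q k * ln (\<sigma> $ k)) = (\<Sum>k\<in>UNIV. (1 - x k) * ln (\<sigma> $ k)) - \<eta> * ln (\<sigma> $ last_index)"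
  proof -
    have "q k * ln (\<sigma> $ k) = (1 - x k) * ln (\<sigma> $ k) - (if k = last_index then \<eta> * ln (\<sigma> $ last_index) else 0)" for k
      by (simp add: q_def left_diff_distrib)
    then show ?thesis by (simp add: sum_subtractf)
  qed
  ultimately have ln: "(\<Sum>k\<in>UNIV. (1 - x k) * ln (\<sigma> $ k)) \<le> (Q - \<eta>) * ln (\<sigma> $ first_index) + \<eta> * ln (\<sigma> $ last_index)"
    by (simp add: first_index_def)
  have gr: "c powr (- p j) * (\<Prod>k\<in>{k. \<beta> j k \<in> K j}. \<sigma> $ k) powr (- p j) \<ge> det (gram (A j) (K j) (cov e \<sigma>)) powr (- p j)" for j
  proof -
    have d: "det (completed_frame (A j) e (K j) (\<beta> j)) \<noteq> 0" using c(2)[of j] c(1) by auto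
    have pp: "(\<Prod>k\<in>{k. \<beta> j k \<in> K j}. \<sigma> $ k) > 0" using s by (intro prod_pos) auto
    have "c * (\<Prod>k\<in>{k. \<beta> j k \<in> K j}. \<sigma> $ k) \<le> (det (completed_frame (A j) e (K j) (\<beta> j)))\<^sup>2 * (\<Prod>k\<in>{k. \<beta> j k \<in> K j}. \<sigma> $ k)"
      using c(2)[of j] pp by (intro mult_right_mono) auto
    also have "\<dots> \<le> det (gram (A j) (K j) (cov e \<sigma>))"
      using gram_cov_lower_bound[of "\<beta> j" \<sigma> "A j" e "K j"] \<beta> s d by (auto simp: admissible_def)
    finally have "det (gram (A j) (K j) (cov e \<sigma>)) powr (- p j) \<le> (c * (\<Prod>k\<in>{k. \<beta> j k \<in> K j}. \<sigma> $ k)) powr (- p j)"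
      using c(1) pp p[of j] by (intro powr_mono2') auto
    then show ?thesis using c(1) pp by (simp add: powr_mult)
  qed
  have "(\<Prod>j\<in>UNIV. det (gram (A j) (K j) (cov e \<sigma>)) powr (- p j)) \<le> (\<Prod>j\<in>UNIV. c powr (- p j) * (\<Prod>k\<in>{k. \<beta> j k \<in> K j}. \<sigma> $ k) powr (- p j))"
    using gr by (intro prod_mono) auto
  also have "\<dots> = c powr (- P) * (\<Prod>j\<in>UNIV. (\<Prod>k\<in>{k. \<beta> j k \<in> K j}. \<sigma> $ k) powr (- p j))"
    using c(1) by (simp add: prod.distrib P_def powr_sum[symmetric] sum_negf[symmetric])
  also have "(\<Prod>j\<in>UNIV. (\<Prod>k\<in>{k. \<beta> j k \<in> K j}. \<sigma> $ k) powr (- p j)) = exp (- (\<Sum>k\<in>UNIV. x k * ln (\<sigma> $ k)))"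
  proof -
    have "(\<Prod>k\<in>{k. \<beta> j k \<in> K j}. \<sigma> $ k) powr (- p j) = exp (- (\<Sum>k\<in>UNIV. (if \<beta> j k \<in> K j then p j else 0) * ln (\<sigma> $ k)))" for j
    proof -
      have pp: "(\<Prod>k\<in>{k. \<beta> j k \<in> K j}. \<sigma> $ k) > 0" using s by (intro prod_pos) auto
      have "ln (\<Prod>k\<in>{k. \<beta> j k \<in> K j}. \<sigma> $ k) = (\<Sum>k\<in>{k. \<beta> j k \<in> K j}. ln (\<sigma> $ k))"
        by (intro ln_prod) (auto simp: less_imp_neq[OF s(1), symmetric])
      also have "\<dots> = (\<Sum>k\<in>UNIV. if \<beta> j k \<in> K j then ln (\<sigma> $ k) else 0)"
        by (simp add: sum.If_cases)
      finally have "p j * ln (\<Prod>k\<in>{k. \<beta> j k \<in> K j}. \<sigma> $ k) = (\<Sum>k\<in>UNIV. (if \<beta> j k \<in> K j then p j else 0) * ln (\<sigma> $ k))"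
        by (simp add: sum_distrib_left if_distrib if_distribR cong: if_cong)
      then show ?thesis by (simp only: powr_def less_imp_neq[OF pp, symmetric] if_False) simp
    qed
    then have "(\<Prod>j\<in>UNIV. (\<Prod>k\<in>{k. \<beta> j k \<in> K j}. \<sigma> $ k) powr (- p j)) = exp (\<Sum>j\<in>UNIV. - (\<Sum>k\<in>UNIV. (if \<beta> j k \<in> K j then p j else 0) * ln (\<sigma> $ k)))"
      by (simp add: exp_sum)
    also have "(\<Sum>j\<in>UNIV. - (\<Sum>k\<in>UNIV. (if \<beta> j k \<in> K j then p j else 0) * ln (\<sigma> $ k))) = - (\<Sum>k\<in>UNIV. x k * ln (\<sigma> $ k))"
      unfolding x_def frame_exponent_def by (simp add: sum_negf sum_distrib_right) (rule sum.swap)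
    finally show ?thesis .
  qed
  finally have grams: "(\<Prod>j\<in>UNIV. det (gram (A j) (K j) (cov e \<sigma>)) powr (- p j)) \<le> c powr (- P) * exp (- (\<Sum>k\<in>UNIV. x k * ln (\<sigma> $ k)))" .
  have dS: "det (cov e \<sigma>) = exp (\<Sum>k\<in>UNIV. ln (\<sigma> $ k))"
    using s by (simp add: det_cov[OF e] exp_sum)
  have tr: "exp (- trace (cov e \<sigma>)) \<le> exp (- \<sigma> $ first_index)"
  proof -
    have "\<sigma> $ first_index \<le> (\<Sum>k\<in>UNIV. \<sigma> $ k)" using s by (intro member_le_sum) (auto simp: less_imp_le)
    then show ?thesis by (simp add: trace_cov[OF e])
  qed
  have "BL_functional p A K (cov e \<sigma>) \<le> det (cov e \<sigma>) * exp (- \<sigma> $ first_index) * (c powr (- P) * exp (- (\<Sum>k\<in>UNIV. x k * ln (\<sigma> $ k))))"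
    unfolding BL_functional_def using grams tr dS by (intro mult_mono) (auto intro!: prod_nonneg mult_nonneg_nonneg)
  also have "\<dots> = c powr (- P) * (exp (\<Sum>k\<in>UNIV. (1 - x k) * ln (\<sigma> $ k)) * exp (- \<sigma> $ first_index))"
    unfolding dS by (simp add: exp_add[symmetric] left_diff_distrib sum_subtractf exp_diff exp_minus field_simps)
  also have "\<dots> \<le> c powr (- P) * (exp ((Q - \<eta>) * ln (\<sigma> $ first_index) + \<eta> * ln (\<sigma> $ last_index)) * exp (- \<sigma> $ first_index))"
    using ln by (intro mult_left_mono mult_right_mono) auto
  also have "exp ((Q - \<eta>) * ln (\<sigma> $ first_index) + \<eta> * ln (\<sigma> $ last_index)) = \<sigma> $ first_index powr (Q - \<eta>) * \<sigma> $ last_index powr \<eta>"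
    using s(1) by (simp add: powr_def exp_add less_imp_neq[OF s(1), symmetric])
  finally show ?thesis using Q\<eta> Qn unfolding P_def by (intro exI[of _ "Q - \<eta>"]) auto
qed

lemma powr_le_one_plus_power:
  assumes "0 < (s::real)" "0 \<le> a" "a \<le> real n" shows "s powr a \<le> 1 + s ^ n"
proof (cases "s \<le> 1")
  case True
  then have "s powr a \<le> 1" using assms by (simp add: powr_le1)
  then show ?thesis using assms by (simp add: add_increasing2)
next
  case False
  then have "s powr a \<le> s powr real n" using assms by (intro powr_mono) auto
  also have "s powr real n = s ^ n" using assms by (simp add: powr_realpow)
  finally show ?thesis by simp
qed

lemma powr_exp_bound:
  assumes "0 < (s::real)" "0 \<le> a" "a \<le> real n" shows "s powr a * exp (- s) \<le> 1 + fact n"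
proof -
  have "s powr a \<le> exp s + fact n * exp s"
    using powr_le_one_plus_power[OF assms] power_le_exp[of s n] assms(1) one_le_exp_iff[of s] by linarith
  then have "s powr a * exp (- s) \<le> (1 + fact n) * exp s * exp (- s)"
    by (intro mult_right_mono) (auto simp: algebra_simps)
  then show ?thesis by (simp add: mult.assoc exp_minus_inverse)
qed

lemma continuous_on_det:
  fixes f :: "'c::topological_space \<Rightarrow> real^'n^'n"
  assumes "continuous_on X f" shows "continuous_on X (\<lambda>x. det (f x))"
  unfolding det_def using assms by (intro continuous_intros) auto

lemma continuous_on_matrix_mult:
  fixes f g :: "'c::topological_space \<Rightarrow> real^'n^'n"
  assumes "continuous_on X f" "continuous_on X g" shows "continuous_on X (\<lambda>x. f x ** g x)"
  unfolding matrix_matrix_mult_def using assms by (intro continuous_intros) auto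

lemma continuous_on_outer:
  fixes f g :: "'c::topological_space \<Rightarrow> real^'n"
  assumes "continuous_on X f" "continuous_on X g" shows "continuous_on X (\<lambda>x. outer (f x) (g x))"
  unfolding outer_def using assms by (intro continuous_intros) auto

lemma continuous_on_cov: "continuous_on X (\<lambda>z. cov (fst z) (snd z))"
  unfolding cov_def by (intro continuous_intros continuous_on_outer)

lemma continuous_on_trace:
  fixes f :: "'c::topological_space \<Rightarrow> real^'n^'n"
  assumes "continuous_on X f" shows "continuous_on X (\<lambda>x. trace (f x))"
  unfolding trace_def using assms by (intro continuous_intros) auto

text \<open>A quantitative form of the conditions on \<open>(A, p)\<close> under which the inequality holds: the selection may depend on the
  frame, but the lower bound \<open>c\<close> for the determinants may not.\<close>

definition frame_bounds :: "real \<Rightarrow> real \<Rightarrow> ('m::finite \<Rightarrow> real) \<Rightarrow> ('m \<Rightarrow> real^'n::{finite,wellorder}^'n::_) \<Rightarrow> ('m \<Rightarrow> 'n set) \<Rightarrow> bool" where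
  "frame_bounds c \<eta> p A K \<longleftrightarrow> (\<forall>e. orthogonal_matrix e \<longrightarrow>
     (\<exists>\<beta>. admissible \<eta> p K \<beta> \<and> (\<forall>j. (det (completed_frame (A j) e (K j) (\<beta> j)))\<^sup>2 \<ge> c)))"

lemma posdef_gram:
  fixes A :: "'m::finite \<Rightarrow> real^'n::{finite,wellorder}^'n::_"
  assumes "frame_bounds c \<eta> p A K" "c > 0" "posdef S"
  shows "posdef (gram (A j) (K j) S)"
proof -
  obtain e \<sigma> where e: "orthogonal_matrix e" "\<And>k. \<sigma> $ k > 0" "S = cov e \<sigma>"
    by (rule posdef_eq_cov[OF assms(3)]) (rule that)
  obtain \<beta> where "admissible \<eta> p K \<beta>" and d: "\<And>j. (det (completed_frame (A j) e (K j) (\<beta> j)))\<^sup>2 \<ge> c"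
    using assms(1) e(1) unfolding frame_bounds_def by blast
  moreover have "det (completed_frame (A j) e (K j) (\<beta> j)) \<noteq> 0" using d[of j] assms(2) by auto
  ultimately show ?thesis using gram_cov_lower_bound[of "\<beta> j" \<sigma> "A j" e "K j"] e by (auto simp: admissible_def)
qed

lemma BL_functional_pos:
  fixes A :: "'m::finite \<Rightarrow> real^'n::{finite,wellorder}^'n::_"
  assumes "frame_bounds c \<eta> p A K" "c > 0" "posdef S"
  shows "BL_functional p A K S > 0"
proof -
  have "det (gram (A j) (K j) S) \<noteq> 0" for j
    by (rule posdef_det_nz[OF posdef_gram[OF assms]])
  then show ?thesis unfolding BL_functional_def
    using posdef_det_pos[OF assms(3)] by (intro mult_pos_pos prod_pos) auto
qed

text \<open>The bound depends on the data only through \<open>c\<close>; the uniformity of the final constant comes from here.\<close>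

lemma BL_functional_bound:
  fixes A :: "'m::finite \<Rightarrow> real^'n::{finite,wellorder}^'n::_"
  assumes fb: "frame_bounds c \<eta> p A K" and c: "c > 0" and p: "\<And>j. p j \<ge> 0" and \<eta>: "\<eta> \<ge> 0" and S: "posdef S"
  shows "BL_functional p A K S \<le> c powr (- (\<Sum>j\<in>UNIV. p j)) * (1 + fact CARD('n))"
proof -
  obtain e \<sigma> where e: "orthogonal_matrix e" "\<And>k. \<sigma> $ k > 0" "\<And>k l. k \<le> l \<Longrightarrow> \<sigma> $ l \<le> \<sigma> $ k" "S = cov e \<sigma>"
    by (rule posdef_eq_cov[OF S]) (rule that)
  obtain \<beta> where \<beta>: "admissible \<eta> p K \<beta>" "\<And>j. (det (completed_frame (A j) e (K j) (\<beta> j)))\<^sup>2 \<ge> c"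
    using fb e(1) unfolding frame_bounds_def by blast
  obtain a where a: "0 \<le> a" "a + \<eta> \<le> CARD('n)" and le: "BL_functional p A K S \<le> c powr (- (\<Sum>j\<in>UNIV. p j)) *
      (\<sigma> $ first_index powr a * \<sigma> $ last_index powr \<eta> * exp (- \<sigma> $ first_index))"
    using BL_functional_cov_le[OF e(1,2,3) \<beta>(1) c \<beta>(2) p \<eta>] unfolding e(4) by blast
  have "\<sigma> $ last_index powr \<eta> \<le> \<sigma> $ first_index powr \<eta>"
    using e(2)[of last_index] e(3)[of first_index last_index] \<eta> by (intro powr_mono2) (auto simp: first_index_def last_index_def)
  then have "\<sigma> $ first_index powr a * \<sigma> $ last_index powr \<eta> * exp (- \<sigma> $ first_index)
      \<le> \<sigma> $ first_index powr a * \<sigma> $ first_index powr \<eta> * exp (- \<sigma> $ first_index)"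
    by (intro mult_right_mono mult_left_mono) auto
  also have "\<dots> \<le> 1 + fact CARD('n)"
    unfolding powr_add[symmetric] using a \<eta> e(2) by (intro powr_exp_bound) auto
  finally show ?thesis using le by (meson mult_left_mono order_trans powr_ge_zero)
qed

text \<open>Strict subcriticality (\<open>\<eta> > 0\<close>) makes the functional decay when the covariance degenerates.\<close>

lemma BL_functional_coercive:
  fixes A :: "'m::finite \<Rightarrow> real^'n::{finite,wellorder}^'n::_"
  assumes fb: "frame_bounds c \<eta> p A K" and c: "c > 0" and p: "\<And>j. p j \<ge> 0" and \<eta>: "\<eta> > 0" and t: "t > 0"
  shows "\<exists>\<alpha> b. 0 < \<alpha> \<and> \<alpha> \<le> 1 \<and> 1 \<le> b \<and> (\<forall>e \<sigma>. orthogonal_matrix e \<longrightarrow> (\<forall>k. \<sigma> $ k > 0) \<longrightarrow> (\<forall>k l. k \<le> l \<longrightarrow> \<sigma> $ l \<le> \<sigma> $ k) \<longrightarrow>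
     t \<le> BL_functional p A K (cov e \<sigma>) \<longrightarrow> (\<forall>k. \<alpha> \<le> \<sigma> $ k \<and> \<sigma> $ k \<le> b))"
proof -
  define n where "n = CARD('n)"
  define D where "D = c powr (- (\<Sum>j\<in>UNIV. p j))"
  have D: "D > 0" using c by (simp add: D_def)
  define \<alpha>0 where "\<alpha>0 = (t / (D * (1 + fact n))) powr (1 / \<eta>)"
  define b0 where "b0 = 2 * ln (D * (1 + 2 ^ n * fact n) / t)"
  have f0: "(0::real) < 1 + fact n" "(0::real) < 1 + 2 ^ n * fact n" by (auto intro!: add_pos_pos)
  have \<alpha>0: "\<alpha>0 > 0" unfolding \<alpha>0_def using t D f0 by simp
  have key: "\<alpha>0 \<le> \<sigma> $ k \<and> \<sigma> $ k \<le> b0" if e: "orthogonal_matrix e" "\<And>k. \<sigma> $ k > 0" "\<And>k l. k \<le> l \<Longrightarrow> \<sigma> $ l \<le> \<sigma> $ k"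
     and te: "t \<le> BL_functional p A K (cov e \<sigma>)" for e \<sigma> k
  proof -
    obtain \<beta> where \<beta>: "admissible \<eta> p K \<beta>" "\<And>j. (det (completed_frame (A j) e (K j) (\<beta> j)))\<^sup>2 \<ge> c"
      using fb e(1) unfolding frame_bounds_def by blast
    define s where "s = \<sigma> $ first_index"
    define u where "u = \<sigma> $ last_index"
    obtain a where a: "0 \<le> a" "a + \<eta> \<le> n" and le: "BL_functional p A K (cov e \<sigma>) \<le> D * (s powr a * u powr \<eta> * exp (- s))"
      using BL_functional_cov_le[OF e(1,2,3) \<beta>(1) c \<beta>(2) p less_imp_le[OF \<eta>]] unfolding D_def s_def u_def n_def by blast
    have su: "0 < u" "u \<le> s" "0 < s" and k: "u \<le> \<sigma> $ k" "\<sigma> $ k \<le> s"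
      using e by (auto simp: s_def u_def first_index_def last_index_def)
    have t1: "t \<le> D * (s powr a * u powr \<eta> * exp (- s))" using te le by simp
    have "s powr a * u powr \<eta> * exp (- s) \<le> (1 + fact n) * u powr \<eta>"
    proof -
      have "(s powr a * exp (- s)) * u powr \<eta> \<le> (1 + fact n) * u powr \<eta>"
        using a \<eta> by (intro mult_right_mono powr_exp_bound su) auto
      then show ?thesis by (simp only: mult_ac)
    qed
    then have "t \<le> D * ((1 + fact n) * u powr \<eta>)" using t1 D by (meson mult_left_mono less_imp_le order_trans)
    then have "t / (D * (1 + fact n)) \<le> u powr \<eta>" using D f0 by (simp add: pos_divide_le_eq mult_ac)
    then have "\<alpha>0 \<le> (u powr \<eta>) powr (1 / \<eta>)" unfolding \<alpha>0_def using \<eta> t D f0 by (intro powr_mono2) (auto intro!: divide_nonneg_nonneg)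
    also have "\<dots> = u" using \<eta> su by (simp add: powr_powr)
    finally have "\<alpha>0 \<le> u" .
    moreover have "s \<le> b0"
    proof -
      have "u powr \<eta> \<le> s powr \<eta>" using su \<eta> by (intro powr_mono2) auto
      then have "s powr a * u powr \<eta> * exp (- s) \<le> s powr (a + \<eta>) * exp (- s)"
        unfolding powr_add by (intro mult_right_mono mult_left_mono) auto
      also have "\<dots> \<le> (1 + s ^ n) * exp (- s)"
        using powr_le_one_plus_power[OF su(3), of "a + \<eta>" n] a \<eta> by (intro mult_right_mono) auto
      also have "\<dots> \<le> ((1 + 2 ^ n * fact n) * exp (s / 2)) * exp (- s)"
      proof -
        have "(s / 2) ^ n \<le> fact n * exp (s / 2)" using su by (intro power_le_exp) auto
        then have "s ^ n \<le> 2 ^ n * (fact n * exp (s / 2))" by (simp add: power_divide field_simps)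
        moreover have "1 \<le> exp (s / 2)" using su by simp
        moreover have "(1 + 2 ^ n * fact n) * exp (s / 2) = exp (s / 2) + 2 ^ n * (fact n * exp (s / 2))"
          by (simp add: algebra_simps)
        ultimately have "1 + s ^ n \<le> (1 + 2 ^ n * fact n) * exp (s / 2)" by linarith
        then show ?thesis by (intro mult_right_mono) auto
      qed
      also have "\<dots> = (1 + 2 ^ n * fact n) * exp (- (s / 2))"
      proof -
        have "exp (s / 2) * exp (- s) = exp (- (s / 2))" by (simp add: exp_add[symmetric])
        then show ?thesis by (simp add: mult.assoc)
      qed
      finally have "t \<le> D * ((1 + 2 ^ n * fact n) * exp (- (s / 2)))" using t1 D by (meson mult_left_mono less_imp_le order_trans)
      then have "exp (s / 2) \<le> D * (1 + 2 ^ n * fact n) / t"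
        using t by (simp add: exp_minus field_simps)
      then have "s / 2 \<le> ln (D * (1 + 2 ^ n * fact n) / t)"
        using D t f0 by (subst ln_ge_iff) (auto intro!: divide_pos_pos mult_pos_pos)
      then show ?thesis by (simp add: b0_def)
    qed
    ultimately show ?thesis using k by linarith
  qed
  show ?thesis
    by (rule exI[of _ "min \<alpha>0 1"], rule exI[of _ "max b0 1"])
       (use \<alpha>0 key in \<open>auto simp: min_le_iff_disj le_max_iff_disj\<close>)
qed

text \<open>By coercivity it is enough to compare covariances whose eigenvalues lie in a compact interval of positive numbers.\<close>

lemma BL_functional_maximiser:
  fixes A :: "'m::finite \<Rightarrow> real^'n::{finite,wellorder}^'n::_"
  assumes fb: "frame_bounds c \<eta> p A K" and c: "c > 0" and p: "\<And>j. p j \<ge> 0" and \<eta>: "\<eta> > 0"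
  shows "\<exists>S. posdef S \<and> (\<forall>S'. posdef S' \<longrightarrow> BL_functional p A K S' \<le> BL_functional p A K S)"
proof -
  have one: "orthogonal_matrix (mat 1 :: real^'n::_^'n::_)" by (rule orthogonal_matrix_id)
  \<comment> \<open>covariances on which the functional is below its value at the identity can be ignored\<close>
  define t where "t = BL_functional p A K (cov (mat 1) 1)"
  have p1: "posdef (cov (mat 1) (1 :: real^'n::_))" by (rule posdef_cov[OF one]) simp
  have t: "t > 0" unfolding t_def by (rule BL_functional_pos[OF fb c p1])
  from BL_functional_coercive[OF fb c p \<eta> t]
  obtain \<alpha> b where ab: "0 < \<alpha> \<and> \<alpha> \<le> 1 \<and> 1 \<le> b \<and> (\<forall>e \<sigma>. orthogonal_matrix e \<longrightarrow> (\<forall>k. \<sigma> $ k > 0) \<longrightarrow> (\<forall>k l. k \<le> l \<longrightarrow> \<sigma> $ l \<le> \<sigma> $ k) \<longrightarrow>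
     t \<le> BL_functional p A K (cov e \<sigma>) \<longrightarrow> (\<forall>k. \<alpha> \<le> \<sigma> $ k \<and> \<sigma> $ k \<le> b))"
    by (elim exE) (rule that)
  then have co: "\<And>e \<sigma> k. orthogonal_matrix e \<Longrightarrow> (\<forall>k. \<sigma> $ k > 0) \<Longrightarrow> (\<forall>k l. k \<le> l \<longrightarrow> \<sigma> $ l \<le> \<sigma> $ k) \<Longrightarrow>
     t \<le> BL_functional p A K (cov e \<sigma>) \<Longrightarrow> \<alpha> \<le> \<sigma> $ k \<and> \<sigma> $ k \<le> b" by simp
  have ab: "0 < \<alpha>" "\<alpha> \<le> 1" "1 \<le> b" using ab by auto
  define Z where "Z = {e :: real^'n::_^'n::_. orthogonal_matrix e} \<times> cbox ((\<chi> k. \<alpha>) :: real^'n::_) (\<chi> k. b)"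
  have Zc: "compact Z" unfolding Z_def by (intro compact_Times compact_orthogonal_matrices compact_cbox)
  have Zm: "z \<in> Z \<longleftrightarrow> orthogonal_matrix (fst z) \<and> (\<forall>k. \<alpha> \<le> snd z $ k \<and> snd z $ k \<le> b)" for z
    by (cases z) (auto simp: Z_def mem_box_cart)
  have Zp: "posdef (cov (fst z) (snd z))" if "z \<in> Z" for z
    using that ab by (intro posdef_cov) (auto simp: Zm intro: less_le_trans)
  have "continuous_on Z (\<lambda>z. BL_functional p A K (cov (fst z) (snd z)))"
    unfolding BL_functional_def
  proof (intro continuous_intros continuous_on_det continuous_on_trace continuous_on_cov)
    show "continuous_on Z (\<lambda>z. gram (A j) (K j) (cov (fst z) (snd z)))" for j
      unfolding gram_def by (intro continuous_intros continuous_on_matrix_mult continuous_on_cov)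
    show "\<forall>z\<in>Z. det (gram (A j) (K j) (cov (fst z) (snd z))) \<noteq> 0" for j
      using posdef_det_nz[OF posdef_gram[OF fb c Zp]] by blast
  qed
  moreover have "(mat 1, 1) \<in> Z" using ab one by (auto simp: Zm)
  ultimately obtain z where z: "z \<in> Z" and max: "\<And>z'. z' \<in> Z \<Longrightarrow> BL_functional p A K (cov (fst z') (snd z')) \<le> BL_functional p A K (cov (fst z) (snd z))"
    using continuous_attains_sup[OF Zc] by blast
  have "BL_functional p A K S' \<le> BL_functional p A K (cov (fst z) (snd z))" if S': "posdef S'" for S'
  proof -
    obtain e \<sigma> where e: "orthogonal_matrix e" "\<And>k. \<sigma> $ k > 0" "\<And>k l. k \<le> l \<Longrightarrow> \<sigma> $ l \<le> \<sigma> $ k" "S' = cov e \<sigma>"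
      by (rule posdef_eq_cov[OF S']) (rule that)
    show ?thesis
    proof (cases "t \<le> BL_functional p A K S'")
      case True
      then have "(e, \<sigma>) \<in> Z" using co[of e \<sigma>] e by (auto simp: Zm)
      then show ?thesis using max[of "(e, \<sigma>)"] e by simp
    next
      case False
      then show ?thesis using max[OF \<open>(mat 1, 1) \<in> Z\<close>] by (simp add: t_def)
    qed
  qed
  then show ?thesis using Zp[OF z] by blast
qed

text \<open>At a maximiser the derivative in the direction of every rank-one perturbation \<open>x x\<^sup>T\<close> vanishes, which is the stated
  identity.  At an eigenvector the identity bounds the eigenvalue of \<open>S\<close> by \<open>1\<close>, and hence the trace by the dimension.\<close>

lemma extremal_covariance:
  fixes A :: "'m::finite \<Rightarrow> real^'n::{finite,wellorder}^'n::_"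
  assumes fb: "frame_bounds c \<eta> p A K" and c: "c > 0" and p: "\<And>j. p j \<ge> 0" and \<eta>: "\<eta> > 0"
  shows "\<exists>S. posdef S \<and>
     (\<forall>x. x \<bullet> (matrix_inv S *v x) = (norm x)\<^sup>2 + (\<Sum>j\<in>UNIV. p j * ((A j *v x) \<bullet> (matrix_inv (gram (A j) (K j) S) *v (A j *v x))))) \<and>
     det S * (\<Prod>j\<in>UNIV. det (gram (A j) (K j) S) powr (- p j)) \<le> c powr (- (\<Sum>j\<in>UNIV. p j)) * (1 + fact CARD('n)) * exp (real CARD('n))"
proof -
  obtain S where S: "posdef S" and max: "\<And>S'. posdef S' \<Longrightarrow> BL_functional p A K S' \<le> BL_functional p A K S"
    using BL_functional_maximiser[OF assms] by blast
  have G: "posdef (gram (A j) (K j) S)" for j by (rule posdef_gram[OF fb c S])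
  have dS: "det S > 0" and dG: "det (gram (A j) (K j) S) > 0" for j
    using posdef_det_pos[OF S] posdef_det_pos[OF G] by auto
  have id: "x \<bullet> (matrix_inv S *v x) = (norm x)\<^sup>2 + (\<Sum>j\<in>UNIV. p j * ((A j *v x) \<bullet> (matrix_inv (gram (A j) (K j) S) *v (A j *v x))))" for x
  proof -
    define a where "a = x \<bullet> (matrix_inv S *v x)"
    define b where "b = (\<lambda>j. (A j *v x) \<bullet> (matrix_inv (gram (A j) (K j) S) *v (A j *v x)))"
    \<comment> \<open>the change of the logarithm of the functional along \<open>S + h x x\<^sup>T\<close>\<close>
    define F where "F = (\<lambda>h::real. ln (1 + h * a) - h * (norm x)\<^sup>2 - (\<Sum>j\<in>UNIV. p j * ln (1 + h * b j)))"
    have D: "(F has_real_derivative (a - (norm x)\<^sup>2 - (\<Sum>j\<in>UNIV. p j * b j))) (at 0)"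
      unfolding F_def by (auto intro!: derivative_eq_intros simp: mult.commute)
    obtain e \<sigma> where e: "orthogonal_matrix e" "\<And>k. \<sigma> $ k > 0" "\<And>k l. k \<le> l \<Longrightarrow> \<sigma> $ l \<le> \<sigma> $ k" "S = cov e \<sigma>"
      by (rule posdef_eq_cov[OF S]) (rule that)
    \<comment> \<open>The perturbation \<open>S + h x x\<^sup>T\<close> stays positive definite while \<open>\<bar>h\<bar> \<parallel>x\<parallel>\<^sup>2\<close> is below the least eigenvalue.\<close>
    define m where "m = \<sigma> $ last_index"
    have m: "m > 0" using e by (simp add: m_def)
    define d where "d = m / ((norm x)\<^sup>2 + 1)"
    have d: "d > 0" using m by (simp add: d_def add_nonneg_pos)
    have pert: "posdef (S + h *\<^sub>R outer x x)" if h: "\<bar>h\<bar> < d" for h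
      unfolding posdef_def
    proof (intro conjI allI impI)
      show "transpose (S + h *\<^sub>R outer x x) = S + h *\<^sub>R outer x x"
        using S by (simp add: transpose_add transpose_scalar posdef_def)
      fix y :: "real^'n::_" assume y: "y \<noteq> 0"
      have "y \<bullet> (S *v y) = (\<Sum>k\<in>UNIV. \<sigma> $ k * (e $ k \<bullet> y)\<^sup>2)"
        unfolding e(4) by (simp add: cov_mult_vector inner_sum_right power2_eq_square inner_commute mult.assoc)
      also have "\<dots> \<ge> (\<Sum>k\<in>UNIV. m * (e $ k \<bullet> y)\<^sup>2)"
        unfolding m_def by (intro sum_mono mult_right_mono e(3)) (auto simp: last_index_def)
      also have "(\<Sum>k\<in>UNIV. m * (e $ k \<bullet> y)\<^sup>2) = m * (norm y)\<^sup>2"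
      proof -
        have "y \<bullet> y = (\<Sum>k\<in>UNIV. (e $ k \<bullet> y) *\<^sub>R e $ k) \<bullet> y" by (simp add: orthonormal_expansion[OF e(1)])
        then have "(norm y)\<^sup>2 = (\<Sum>k\<in>UNIV. (e $ k \<bullet> y)\<^sup>2)"
          unfolding power2_norm_eq_inner by (simp add: inner_sum_left power2_eq_square)
        then show ?thesis by (simp add: sum_distrib_left)
      qed
      finally have l: "m * (norm y)\<^sup>2 \<le> y \<bullet> (S *v y)" .
      have "(x \<bullet> y)\<^sup>2 \<le> (norm x)\<^sup>2 * (norm y)\<^sup>2"
        using power_mono[OF Cauchy_Schwarz_ineq2[of x y], of 2] by (simp add: power_mult_distrib)
      then have "\<bar>h * (x \<bullet> y)\<^sup>2\<bar> \<le> \<bar>h\<bar> * ((norm x)\<^sup>2 * (norm y)\<^sup>2)" by (simp add: abs_mult mult_left_mono)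
      also have "\<dots> < m * (norm y)\<^sup>2"
      proof -
        have "\<bar>h\<bar> * (norm x)\<^sup>2 \<le> \<bar>h\<bar> * ((norm x)\<^sup>2 + 1)" by (simp add: mult_left_mono)
        also have "\<dots> < m" using h by (simp add: d_def pos_less_divide_eq add_nonneg_pos)
        finally have "\<bar>h\<bar> * (norm x)\<^sup>2 < m" .
        then show ?thesis using y by (simp add: mult.assoc[symmetric])
      qed
      finally have "0 < y \<bullet> (S *v y) + h * (x \<bullet> y)\<^sup>2" using l by linarith
      then show "0 < y \<bullet> ((S + h *\<^sub>R outer x x) *v y)"
        by (simp add: matrix_vector_mult_add_rdistrib inner_add_right scaleR_matrix_vector_assoc[symmetric] outer_mult_vector power2_eq_square inner_commute)
    qed
    have le: "F h \<le> F 0" if h: "\<bar>h\<bar> < d" for h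
    proof -
      let ?S = "S + h *\<^sub>R outer x x"
      have dS': "det ?S = det S * (1 + h * a)" by (simp add: det_plus_outer[OF S] a_def)
      have dG': "det (gram (A j) (K j) ?S) = det (gram (A j) (K j) S) * (1 + h * b j)" for j
        by (simp add: gram_plus_outer det_plus_outer[OF G] b_def)
      have pa: "1 + h * a > 0" using posdef_det_pos[OF pert[OF h]] dS unfolding dS' by (simp add: zero_less_mult_iff)
      have pb: "1 + h * b j > 0" for j
        using posdef_det_pos[OF posdef_gram[OF fb c pert[OF h], of j]] dG[of j] unfolding dG' by (simp add: zero_less_mult_iff)
      have "BL_functional p A K ?S \<le> BL_functional p A K S" by (rule max[OF pert[OF h]])
      then have l: "ln (BL_functional p A K ?S) \<le> ln (BL_functional p A K S)"
        using BL_functional_pos[OF fb c S] BL_functional_pos[OF fb c pert[OF h]] by simp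
      have lnE: "ln (BL_functional p A K S') = ln (det S') - trace S' - (\<Sum>j\<in>UNIV. p j * ln (det (gram (A j) (K j) S')))"
        if "det S' > 0" "\<And>j. det (gram (A j) (K j) S') > 0" for S'
      proof -
        have "(\<Prod>j\<in>UNIV. det (gram (A j) (K j) S') powr (- p j)) = exp (- (\<Sum>j\<in>UNIV. p j * ln (det (gram (A j) (K j) S'))))"
          using that(2) by (simp add: powr_def exp_sum sum_negf[symmetric] less_imp_neq[OF that(2), symmetric])
        then have "BL_functional p A K S' = exp (ln (det S') - trace S' - (\<Sum>j\<in>UNIV. p j * ln (det (gram (A j) (K j) S'))))"
          using that(1) by (simp add: BL_functional_def exp_diff exp_minus divide_inverse)
        then show ?thesis by simp
      qed
      have "ln (det S) + ln (1 + h * a) - (trace S + h * (norm x)\<^sup>2) - (\<Sum>j\<in>UNIV. p j * (ln (det (gram (A j) (K j) S)) + ln (1 + h * b j)))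
         = ln (BL_functional p A K ?S)"
        using pa pb dS dG by (subst lnE) (auto simp: dS' dG' trace_plus_outer ln_mult less_imp_neq[OF dG, symmetric] less_imp_neq[OF pb, symmetric])
      also have "\<dots> \<le> ln (det S) - trace S - (\<Sum>j\<in>UNIV. p j * ln (det (gram (A j) (K j) S)))"
        using l dS dG by (simp add: lnE)
      finally show ?thesis by (simp add: F_def distrib_left sum.distrib)
    qed
    have "a - (norm x)\<^sup>2 - (\<Sum>j\<in>UNIV. p j * b j) = 0"
      by (rule DERIV_local_max[OF D d]) (use le in \<open>auto simp: dist_real_def\<close>)
    then show ?thesis by (simp add: a_def b_def)
  qed
  have "trace S \<le> real CARD('n)"
  proof -
    obtain e \<sigma> where e: "orthogonal_matrix e" "\<And>k. \<sigma> $ k > 0" "S = cov e \<sigma>"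
      by (rule posdef_eq_cov[OF S]) (rule that)
    have "\<sigma> $ k \<le> 1" for k
    proof -
      have n: "(norm (e $ k))\<^sup>2 = 1" "e $ k \<bullet> e $ k = 1" using e(1) by (simp_all add: orthogonal_matrix_rows_iff power2_norm_eq_inner)
      have "1 / \<sigma> $ k = e $ k \<bullet> (matrix_inv S *v e $ k)"
        unfolding e(3) cov_inv_frame[OF e(1,2)] by (simp add: n)
      also have "\<dots> \<ge> 1"
        unfolding id n using p posdef_inv_nonneg[OF G] by (auto intro!: sum_nonneg)
      finally show ?thesis using e(2)[of k] by (simp add: field_simps)
    qed
    then have "(\<Sum>k\<in>UNIV. \<sigma> $ k) \<le> (\<Sum>k\<in>(UNIV::'n set). 1)" by (intro sum_mono)
    then show ?thesis by (simp add: e(3) trace_cov[OF e(1)])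
  qed
  have "det S * (\<Prod>j\<in>UNIV. det (gram (A j) (K j) S) powr (- p j)) = BL_functional p A K S * exp (trace S)"
    by (simp add: BL_functional_def exp_minus)
  also have "\<dots> \<le> (c powr (- (\<Sum>j\<in>UNIV. p j)) * (1 + fact CARD('n))) * exp (real CARD('n))"
    using \<open>trace S \<le> real CARD('n)\<close> BL_functional_bound[OF fb c p _ S] \<eta> c by (intro mult_mono) (auto intro!: mult_nonneg_nonneg)
  finally show ?thesis using S id by blast
qed

section \<open>From the extremal covariance to projections\<close>

lemma inner_transpose: "x \<bullet> (A *v y) = (transpose A *v x) \<bullet> (y::real^'n)"
  by (simp add: dot_lmul_matrix)

lemma dim_kernel_plus_range:
  fixes B :: "real^'n^'n"
  shows "dim {z. B *v z = 0} + dim (range ((*v) B)) = CARD('n)"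
proof -
  have s: "subspace (range ((*v) (transpose B)))"
    by (intro linear_subspace_image subspace_UNIV matrix_vector_mul_linear)
  have "{z \<in> UNIV. \<forall>x\<in>range ((*v) (transpose B)). orthogonal x z} = {z. B *v z = 0}"
  proof (intro set_eqI iffI)
    fix z assume "z \<in> {z \<in> UNIV. \<forall>x\<in>range ((*v) (transpose B)). orthogonal x z}"
    then have "(transpose B *v (B *v z)) \<bullet> z = 0" by (auto simp: orthogonal_def simp del: transpose_matrix_vector)
    then have "(B *v z) \<bullet> (B *v z) = 0" by (simp add: inner_transpose)
    then show "z \<in> {z. B *v z = 0}" by simp
  qed (auto simp: orthogonal_def inner_transpose[symmetric] simp del: transpose_matrix_vector)
  moreover have "dim {z \<in> UNIV. \<forall>x\<in>range ((*v) (transpose B)). orthogonal x z} + dim (range ((*v) (transpose B))) = dim (UNIV :: (real^'n) set)"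
    by (rule dim_subspace_orthogonal_to_vectors[OF s]) auto
  moreover have "dim (range ((*v) (transpose B))) = dim (range ((*v) B))"
    using rank_transpose[of B] by (simp add: rank_dim_range del: transpose_matrix_vector)
  ultimately show ?thesis by simp
qed

lemma transpose_diff: "transpose (X - Y) = transpose X - transpose Y"
  by (simp add: vec_eq_iff transpose_def)

definition coord_proj :: "'n set \<Rightarrow> real^'n \<Rightarrow> real^'n" where
  "coord_proj K y = (\<chi> i. if i \<in> K then y $ i else 0)"

lemma complement_proj_vec: "complement_proj K *v y = (\<chi> i. if i \<in> K then 0 else y $ i)"
proof -
  have "(\<Sum>j\<in>UNIV. (if i = j \<and> i \<notin> K then 1 else 0) * y $ j) = (\<Sum>j\<in>UNIV. if j = i then (if i \<in> K then 0 else y $ i) else 0)" for i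
    by (intro sum.cong) auto
  then show ?thesis by (simp add: complement_proj_def matrix_vector_mult_def vec_eq_iff)
qed

lemma transpose_complement_proj: "transpose (complement_proj K) = complement_proj K"
  by (simp add: complement_proj_def transpose_def vec_eq_iff)

lemma complement_proj_idem: "complement_proj K *v (complement_proj K *v y) = complement_proj K *v y"
  by (simp add: complement_proj_vec vec_eq_iff)

text \<open>The linear algebra of one map \<open>B = A T\<close>, where \<open>T T\<^sup>T\<close> is the covariance and \<open>G\<close> its Gram matrix.  Then
  \<open>proj = B\<^sup>T G\<^sup>-\<^sup>1 B\<close> is the orthogonal projection along the kernel of \<open>B\<close>.\<close>

locale gram_factor =
  fixes B G :: "real^'n::{finite,wellorder}^'n::_" and K :: "'n set"
  assumes G: "posdef G" and BB: "G = B ** transpose B + complement_proj K" and QB: "\<And>z. complement_proj K *v (B *v z) = 0"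
begin

abbreviation "Q \<equiv> complement_proj K"
definition "H = matrix_inv G"
definition "proj z = transpose B *v (H *v (B *v z))"

lemma G_apply: "G *v y = B *v (transpose B *v y) + Q *v y"
  unfolding BB by (simp add: matrix_vector_mult_add_rdistrib matrix_vector_mul_assoc del: transpose_matrix_vector)

lemma BtQ: "transpose B *v (Q *v y) = 0"
proof -
  have "(transpose B *v (Q *v y)) \<bullet> z = 0" for z
  proof -
    have "(transpose B *v (Q *v y)) \<bullet> z = (Q *v y) \<bullet> (B *v z)" by (rule inner_transpose[symmetric])
    also have "\<dots> = y \<bullet> (Q *v (B *v z))" by (simp add: inner_transpose transpose_complement_proj del: transpose_matrix_vector)
    finally show ?thesis by (simp add: QB)
  qed
  then show ?thesis using inner_eq_zero_iff by blast
qed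

lemma GH: "G *v (H *v y) = y" "H *v (G *v y) = y"
  unfolding H_def using posdef_inv_apply[OF G] by auto

lemma HQ: "H *v (Q *v y) = Q *v y"
proof -
  have "G *v (Q *v y) = Q *v y" by (simp add: G_apply BtQ complement_proj_idem del: transpose_matrix_vector)
  then show ?thesis using GH(2)[of "Q *v y"] by simp
qed

lemma H_sym: "x \<bullet> (H *v y) = (H *v x) \<bullet> y"
  unfolding H_def using symmetric_inner[OF posdef_inv_symmetric[OF G]] .

lemma QH: "Q *v (H *v y) = Q *v y"
proof -
  have "(Q *v (H *v y)) \<bullet> x = (Q *v y) \<bullet> x" for x
  proof -
    have q: "(Q *v u) \<bullet> v = u \<bullet> (Q *v v)" for u v by (simp add: inner_transpose transpose_complement_proj del: transpose_matrix_vector)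
    have "(Q *v (H *v y)) \<bullet> x = y \<bullet> (H *v (Q *v x))" by (simp add: q H_sym)
    then show ?thesis by (simp add: HQ q)
  qed
  then have "(Q *v (H *v y) - Q *v y) \<bullet> x = 0" for x by (simp add: inner_diff_left)
  then show ?thesis using inner_eq_zero_iff[of "Q *v (H *v y) - Q *v y"] by simp
qed

lemma B_proj: "B *v proj z = B *v z"
proof -
  have "B *v proj z = G *v (H *v (B *v z)) - Q *v (H *v (B *v z))"
    unfolding proj_def by (simp add: G_apply del: transpose_matrix_vector)
  then show ?thesis by (simp add: GH QH QB)
qed

lemma proj_linear: "linear proj"
proof -
  have "proj = (*v) (transpose B ** H ** B)"
    by (simp add: fun_eq_iff proj_def matrix_vector_mul_assoc matrix_mul_assoc del: transpose_matrix_vector)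
  then show ?thesis by simp
qed

lemma proj_idem: "proj (proj z) = proj z"
  unfolding proj_def[of "proj z"] B_proj by (simp add: proj_def)

lemma proj_inner: "proj x \<bullet> y = (H *v (B *v x)) \<bullet> (B *v y)"
  unfolding proj_def by (rule inner_transpose[symmetric])

lemma proj_selfadj: "proj x \<bullet> y = x \<bullet> proj y"
  using proj_inner[of x y] proj_inner[of y x] H_sym[of "B *v x" "B *v y"] by (simp add: inner_commute)

lemma norm_proj: "(norm (proj z))\<^sup>2 = (B *v z) \<bullet> (H *v (B *v z))"
  unfolding power2_norm_eq_inner by (simp add: proj_inner B_proj inner_commute)

lemma norm_diff_proj: "(norm (z - proj z))\<^sup>2 = (norm z)\<^sup>2 - (norm (proj z))\<^sup>2"
proof -
  have "proj z \<bullet> proj z = z \<bullet> proj z" by (simp add: proj_selfadj proj_idem)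
  then show ?thesis unfolding power2_norm_eq_inner by (simp add: inner_simps inner_commute)
qed

text \<open>Adding to \<open>B\<close> an isometry from its kernel onto the missing coordinates gives a square matrix \<open>M\<close> with \<open>M M\<^sup>T = G\<close>.\<close>

lemma padded_root:
  obtains M where "\<bar>det M\<bar> = sqrt (det G)" "\<And>z. coord_proj K (M *v z) = B *v z" "\<And>z. norm (Q *v (M *v z)) = norm (z - proj z)"
proof -
  have ker: "dim {z. B *v z = 0} = dim (range ((*v) Q))"
  proof -
    have "range ((*v) B) = {y. Q *v y = 0}"
    proof (intro set_eqI iffI)
      fix y assume "y \<in> {y. Q *v y = 0}"
      then have "y = B *v (transpose B *v (H *v y))"
        using G_apply[of "H *v y"] by (simp add: GH QH del: transpose_matrix_vector)
      then show "y \<in> range ((*v) B)" by blast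
    qed (auto simp: QB)
    then show ?thesis using dim_kernel_plus_range[of B] dim_kernel_plus_range[of Q] by simp
  qed
  have s1: "subspace {z. B *v z = 0}" 
    by (auto simp: subspace_def matrix_vector_right_distrib matrix_vector_mult_scaleR)
  have s2: "subspace (range ((*v) Q))" by (intro linear_subspace_image subspace_UNIV matrix_vector_mul_linear)
  obtain f where f: "linear f" "f ` {z. B *v z = 0} = range ((*v) Q)" "\<And>x. x \<in> {z. B *v z = 0} \<Longrightarrow> norm (f x) = norm x"
    using isometries_subspaces[OF s1 s2 ker] by metis
  define N where "N = (\<lambda>z. f (z - proj z))"
  have in_ker: "B *v (z - proj z) = 0" for z by (simp add: matrix_vector_mult_diff_distrib B_proj)
  have Nn: "norm (N z) = norm (z - proj z)" for z unfolding N_def using f(3) in_ker by simp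
  have NQ: "Q *v N z = N z" for z
  proof -
    have "N z \<in> range ((*v) Q)" unfolding N_def using f(2) in_ker by blast
    then show ?thesis by (auto simp: complement_proj_idem)
  qed
  have Nl: "linear N" unfolding N_def using f(1) proj_linear
    using linear_compose[OF linear_compose_sub[OF linear_ident proj_linear] f(1)] by (simp add: o_def)
  define M where "M = matrix (\<lambda>z. B *v z + N z)"
  have M: "M *v z = B *v z + N z" for z
  proof -
    have "linear (\<lambda>z. B *v z + N z)" by (intro linear_compose_add matrix_vector_mul_linear Nl)
    then show ?thesis unfolding M_def by (simp add: matrix_works)
  qed
  have QM: "Q *v (M *v z) = N z" for z by (simp add: M matrix_vector_right_distrib QB NQ)
  have "M *v z = coord_proj K (M *v z) + Q *v (M *v z)" for z
    by (simp add: complement_proj_vec coord_proj_def vec_eq_iff)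
  then have PM: "coord_proj K (M *v z) = B *v z" for z
    using M[of z] QM[of z] by (metis add_right_cancel)
  have form: "(M *v z) \<bullet> (H *v (M *v z)) = z \<bullet> z" for z
  proof -
    have HN: "H *v N z = N z" using HQ[of "N z"] by (simp add: NQ)
    have BN: "(B *v z) \<bullet> N z = 0"
    proof -
      have "(B *v z) \<bullet> N z = (B *v z) \<bullet> (Q *v N z)" by (simp add: NQ)
      also have "\<dots> = (Q *v (B *v z)) \<bullet> N z" by (simp add: inner_transpose transpose_complement_proj del: transpose_matrix_vector)
      finally show ?thesis by (simp add: QB)
    qed
    have "(M *v z) \<bullet> (H *v (M *v z)) = (B *v z) \<bullet> (H *v (B *v z)) + (B *v z) \<bullet> (H *v N z) + (N z) \<bullet> (H *v (B *v z)) + (N z) \<bullet> (H *v N z)"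
      by (simp add: M matrix_vector_right_distrib inner_simps)
    also have "(N z) \<bullet> (H *v (B *v z)) = 0" using BN by (simp add: H_sym HN inner_commute)
    finally show ?thesis using norm_diff_proj[of z] norm_proj[of z] Nn[of z] BN
      by (simp add: HN power2_norm_eq_inner[symmetric])
  qed
  \<comment> \<open>by polarisation\<close>
  have "transpose M ** H ** M = mat 1"
  proof -
    define R where "R = transpose M ** H ** M - mat 1"
    have q: "z \<bullet> (R *v z) = 0" for z
      using form[of z] unfolding R_def
      by (simp add: matrix_vector_mult_diff_rdistrib inner_diff_right matrix_vector_mul_assoc[symmetric] inner_transpose[of z] del: transpose_matrix_vector)
    have tR: "transpose R = R"
      unfolding R_def H_def
      by (simp add: transpose_diff matrix_transpose_mul posdef_inv_symmetric[OF G] matrix_mul_assoc)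
    have sy: "x \<bullet> (R *v y) = y \<bullet> (R *v x)" for x y using symmetric_inner[OF tR, of x y] by (simp add: inner_commute)
    have "x \<bullet> (R *v y) = 0" for x y
      using q[of "x + y"] q[of x] q[of y] sy[of x y] by (simp add: matrix_vector_right_distrib inner_simps)
    then have "R *v y = 0" for y using inner_eq_zero_iff by blast
    then have "R = 0" by (simp add: matrix_eq)
    then show ?thesis by (simp add: R_def)
  qed
  then have "det M * det H * det M = 1" by (metis det_I det_mul det_transpose)
  moreover have "det G * det H = 1" using posdef_inv(1)[OF G] unfolding H_def by (metis det_I det_mul)
  ultimately have "(det M)\<^sup>2 = det G" by (simp add: power2_eq_square) (metis mult.assoc mult.commute mult.right_neutral)
  then have "\<bar>det M\<bar> = sqrt (det G)" by (metis real_sqrt_abs)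
  then show ?thesis using that PM QM Nn by simp
qed

text \<open>Change variables by the padded root \<open>M\<close>.  The part of the Gaussian weight along \<open>proj z\<close> is cancelled by the
  exponential, and the part along the kernel becomes the padding in the missing coordinates.\<close>

lemma gaussian_integral_of_pullback:
  fixes g :: "real^'n::_ \<Rightarrow> real"
  assumes [measurable]: "g \<in> borel_measurable borel" and g: "\<And>y. 0 \<le> g y" "\<And>y. g (coord_proj K y) = g y"
    and I: "(\<integral>\<^sup>+y. ennreal (g y * exp (- ((norm (Q *v y))\<^sup>2 / 2))) \<partial>lborel) = ennreal I" "I \<ge> 0"
  shows "integrable gauss (\<lambda>z. g (B *v z) * exp ((norm (proj z))\<^sup>2 / 2))"
    and "(\<integral>z. g (B *v z) * exp ((norm (proj z))\<^sup>2 / 2) \<partial>gauss) = I / (gauss_mass TYPE(real^'n::_) * sqrt (det G))"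
proof -
  obtain M where M: "\<bar>det M\<bar> = sqrt (det G)" "\<And>z. coord_proj K (M *v z) = B *v z" "\<And>z. norm (Q *v (M *v z)) = norm (z - proj z)"
    using padded_root by blast
  have dG: "det G > 0" by (rule posdef_det_pos[OF G])
  then have dM: "det M \<noteq> 0" using M(1) by auto
  let ?k = "gauss_mass TYPE(real^'n::_)"
  have k: "?k > 0" by (rule gauss_mass_pos)
  have [measurable]: "proj \<in> borel \<rightarrow>\<^sub>M borel"
    by (rule borel_measurable_continuous_onI) (simp add: proj_linear linear_continuous_on linear_conv_bounded_linear[symmetric])
  define h where "h = (\<lambda>z. g (B *v z) * exp ((norm (proj z))\<^sup>2 / 2))"
  have hm[measurable]: "h \<in> borel_measurable borel" unfolding h_def by measurable
  have h0: "h z \<ge> 0" for z using g by (simp add: h_def)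
  have pt: "gauss_weight z * h z = g (M *v z) * exp (- ((norm (Q *v (M *v z)))\<^sup>2 / 2))" for z
  proof -
    have "g (B *v z) = g (M *v z)" using g(2)[of "M *v z"] M(2) by simp
    then show ?thesis
      by (simp add: h_def gauss_weight_def M(3) norm_diff_proj exp_add[symmetric] diff_divide_distrib)
  qed
  have "ennreal (sqrt (det G)) * (ennreal ?k * (\<integral>\<^sup>+z. ennreal (h z) \<partial>gauss)) = ennreal (sqrt (det G)) * (\<integral>\<^sup>+z. ennreal (gauss_weight z) * ennreal (h z) \<partial>lborel)"
    by (subst nn_integral_gauss) auto
  also have "\<dots> = ennreal \<bar>det M\<bar> * (\<integral>\<^sup>+z. ennreal (g (M *v z) * exp (- ((norm (Q *v (M *v z)))\<^sup>2 / 2))) \<partial>lborel)"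
    by (simp add: M(1) ennreal_mult[symmetric] h0 less_imp_le[OF gauss_weight_pos] pt)
  also have "\<dots> = ennreal I"
    unfolding I(1)[symmetric] by (rule nn_integral_matrix[OF dM, symmetric]) measurable
  finally have e1: "ennreal (sqrt (det G)) * (ennreal ?k * (\<integral>\<^sup>+z. ennreal (h z) \<partial>gauss)) = ennreal I" .
  have e2: "ennreal (?k * sqrt (det G)) = ennreal (sqrt (det G)) * ennreal ?k"
    using k dG by (subst mult.commute) (rule ennreal_mult, auto)
  have e3: "ennreal (?k * sqrt (det G)) * ennreal (I / (?k * sqrt (det G))) = ennreal I"
    using k dG I(2) by (subst ennreal_mult[symmetric]) auto
  have "ennreal (?k * sqrt (det G)) * (\<integral>\<^sup>+z. ennreal (h z) \<partial>gauss) = ennreal (?k * sqrt (det G)) * ennreal (I / (?k * sqrt (det G)))"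
    unfolding e3 using e1 unfolding e2 by (simp only: mult.assoc)
  then have nn: "(\<integral>\<^sup>+z. ennreal (h z) \<partial>gauss) = ennreal (I / (?k * sqrt (det G)))"
    using k dG by (subst (asm) ennreal_mult_cancel_left) auto
  show "integrable gauss (\<lambda>z. g (B *v z) * exp ((norm (proj z))\<^sup>2 / 2))"
    unfolding h_def[symmetric] by (rule integrableI_nn_integral_finite[OF _ _ nn]) (auto simp: h0)
  show "(\<integral>z. g (B *v z) * exp ((norm (proj z))\<^sup>2 / 2) \<partial>gauss) = I / (?k * sqrt (det G))"
    unfolding h_def[symmetric] using nn k dG I(2) h0 by (subst integral_eq_nn_integral) auto
qed

end

lemma rpow_mult: "0 \<le> x \<Longrightarrow> 0 \<le> y \<Longrightarrow> rpow (x * y) a = rpow x a * rpow y a"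
  by (simp add: rpow_def powr_mult)

lemma rpow_exp: "rpow (exp t) a = exp (a * t)"
  by (simp add: rpow_def powr_def)

lemma gauss_mass_ge_1: "gauss_mass TYPE('a::euclidean_space) \<ge> 1"
  unfolding gauss_mass_eq by (intro one_le_power) (use pi_ge_two in \<open>simp add: real_le_rsqrt\<close>)

text \<open>Substitute \<open>x = T z\<close>, where \<open>S = T T\<^sup>T\<close> is the extremal covariance.  The identity of \<open>extremal_covariance\<close> becomes
  \<open>\<parallel>z\<parallel>\<^sup>2 = \<parallel>T z\<parallel>\<^sup>2 + \<Sum>\<^sub>j p\<^sub>j \<parallel>\<pi>\<^sub>j z\<parallel>\<^sup>2\<close>.  Hence \<open>\<Sum>\<^sub>j p\<^sub>j \<pi>\<^sub>j \<le> 1\<close>, and the weight \<open>exp (- \<parallel>T z\<parallel>\<^sup>2 / 2)\<close> is the standard Gaussian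
  weight times exponentials that can be distributed among the functions \<open>g j\<close>.\<close>

theorem gaussian_localised_brascamp_lieb:
  fixes A :: "'m::finite \<Rightarrow> real^'n::{finite,wellorder}^'n::_" and g :: "'m \<Rightarrow> real^'n::_ \<Rightarrow> real"
  assumes fb: "frame_bounds c \<eta> p A K" and c: "c > 0" and p: "\<And>j. p j \<ge> 0" and \<eta>: "\<eta> > 0"
    and rows: "\<And>j z. complement_proj (K j) *v (A j *v z) = 0"
    and gm: "\<And>j. g j \<in> borel_measurable borel" and g0: "\<And>j y. 0 \<le> g j y" and gK: "\<And>j y. g j (coord_proj (K j) y) = g j y"
    and I: "\<And>j. (\<integral>\<^sup>+y. ennreal (g j y * exp (- ((norm (complement_proj (K j) *v y))\<^sup>2 / 2))) \<partial>lborel) = ennreal (I j)" and I0: "\<And>j. I j \<ge> 0"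
  shows "(\<integral>\<^sup>+x. ennreal (exp (- ((norm x)\<^sup>2 / 2)) * (\<Prod>j\<in>UNIV. rpow (g j (A j *v x)) (p j))) \<partial>lborel)
    \<le> ennreal (gauss_mass TYPE(real^'n::_) * sqrt (c powr (- (\<Sum>j\<in>UNIV. p j)) * (1 + fact CARD('n)) * exp (real CARD('n)))
        * (\<Prod>j\<in>UNIV. rpow (I j) (p j)))"
proof -
  note [measurable] = gm
  define P where "P = (\<Sum>j\<in>UNIV. p j)"
  define D where "D = c powr (- P) * (1 + fact CARD('n)) * exp (real CARD('n))"
  define k where "k = gauss_mass TYPE(real^'n::_)"
  have k: "k \<ge> 1" unfolding k_def by (rule gauss_mass_ge_1)
  obtain S where S: "posdef S" and Sid: "\<And>x. x \<bullet> (matrix_inv S *v x) = (norm x)\<^sup>2 + (\<Sum>j\<in>UNIV. p j * ((A j *v x) \<bullet> (matrix_inv (gram (A j) (K j) S) *v (A j *v x))))"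
     and SD: "det S * (\<Prod>j\<in>UNIV. det (gram (A j) (K j) S) powr (- p j)) \<le> D"
    using extremal_covariance[OF fb c p \<eta>] by (elim exE conjE) (rule that, simp_all only: D_def P_def)
  obtain e \<sigma> where e: "orthogonal_matrix e" "\<And>k. \<sigma> $ k > 0" "S = cov e \<sigma>"
    by (rule posdef_eq_cov[OF S]) (rule that)
  define T :: "real^'n::_^'n::_" where "T = (\<chi> i l. sqrt (\<sigma> $ l) * e $ l $ i)"
  have TT: "T ** transpose T = S"
  proof -
    have "sqrt (\<sigma> $ l) * e $ l $ i * (sqrt (\<sigma> $ l) * e $ l $ j) = \<sigma> $ l * (e $ l $ i * e $ l $ j)" for i j l
    proof -
      have "sqrt (\<sigma> $ l) * sqrt (\<sigma> $ l) = \<sigma> $ l" using e(2)[of l] by simp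
      then have "(sqrt (\<sigma> $ l) * sqrt (\<sigma> $ l)) * (e $ l $ i * e $ l $ j) = \<sigma> $ l * (e $ l $ i * e $ l $ j)" by simp
      then show ?thesis by (simp only: mult_ac)
    qed
    then have "(\<Sum>l\<in>UNIV. sqrt (\<sigma> $ l) * e $ l $ i * (sqrt (\<sigma> $ l) * e $ l $ j)) = (\<Sum>l\<in>UNIV. \<sigma> $ l * (e $ l $ i * e $ l $ j))" for i j
      by (simp only:)
    then show ?thesis unfolding e(3) by (simp add: vec_eq_iff matrix_matrix_mult_def transpose_def T_def cov_def outer_def)
  qed
  have dS: "det S > 0" by (rule posdef_det_pos[OF S])
  have dTT: "det T * det T = det S" using arg_cong[OF TT, of det] by (simp add: det_mul)
  then have dT: "det T \<noteq> 0" "\<bar>det T\<bar> = sqrt (det S)"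
    using dS by (auto simp: real_sqrt_abs2[symmetric])
  define G where "G = (\<lambda>j. gram (A j) (K j) S)"
  define B where "B = (\<lambda>j. A j ** T)"
  have Bz: "B j *v z = A j *v (T *v z)" for j z by (simp add: B_def matrix_vector_mul_assoc)
  have GF: "gram_factor (B j) (G j) (K j)" for j
  proof
    show "posdef (G j)" unfolding G_def by (rule posdef_gram[OF fb c S])
    show "G j = B j ** transpose (B j) + complement_proj (K j)"
      unfolding G_def gram_def B_def TT[symmetric] by (simp add: matrix_transpose_mul matrix_mul_assoc)
    show "complement_proj (K j) *v (B j *v z) = 0" for z by (simp add: Bz rows)
  qed
  define \<pi> where "\<pi> = (\<lambda>j. gram_factor.proj (B j) (G j))"
  have dG: "det (G j) > 0" for j using GF[of j] unfolding gram_factor_def by (blast intro: posdef_det_pos)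
  have nid: "(norm z)\<^sup>2 = (norm (T *v z))\<^sup>2 + (\<Sum>j\<in>UNIV. p j * (norm (\<pi> j z))\<^sup>2)" for z
  proof -
    define y where "y = matrix_inv S *v (T *v z)"
    have "T *v (transpose T *v y) = S *v y" by (simp add: matrix_vector_mul_assoc TT del: transpose_matrix_vector)
    then have "T *v (transpose T *v y) = T *v z" by (simp add: y_def posdef_inv_apply[OF S])
    moreover have "inj ((*v) T)" using dT(1) by (simp add: inj_matrix_vector_mult invertible_det_nz)
    ultimately have "transpose T *v y = z" by (rule injD[rotated])
    moreover have "(T *v z) \<bullet> y = (transpose T *v y) \<bullet> z" by (metis inner_commute inner_transpose)
    ultimately have "(T *v z) \<bullet> (matrix_inv S *v (T *v z)) = (norm z)\<^sup>2"
      by (simp add: y_def power2_norm_eq_inner)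
    moreover have "(norm (\<pi> j z))\<^sup>2 = (A j *v (T *v z)) \<bullet> (matrix_inv (G j) *v (A j *v (T *v z)))" for j
      unfolding \<pi>_def gram_factor.norm_proj[OF GF] gram_factor.H_def[OF GF] Bz ..
    ultimately show ?thesis using Sid[of "T *v z"] by (simp add: G_def)
  qed
  interpret W: weighted_projections p \<pi>
  proof (rule weighted_projections.intro)
    show "linear (\<pi> j)" for j unfolding \<pi>_def by (rule gram_factor.proj_linear[OF GF])
    show "\<pi> j (\<pi> j x) = \<pi> j x" for j x unfolding \<pi>_def by (rule gram_factor.proj_idem[OF GF])
    show "\<pi> j x \<bullet> y = x \<bullet> \<pi> j y" for j x y unfolding \<pi>_def by (rule gram_factor.proj_selfadj[OF GF])
    show "(\<Sum>j\<in>UNIV. p j * (norm (\<pi> j x))\<^sup>2) \<le> (norm x)\<^sup>2" for x using nid[of x] by simp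
  qed (rule p)
  define h where "h = (\<lambda>j z. g j (B j *v z) * exp ((norm (\<pi> j z))\<^sup>2 / 2))"
  have hm[measurable]: "h j \<in> borel_measurable borel" for j unfolding h_def by measurable
  have h0: "0 \<le> h j z" for j z by (simp add: h_def g0)
  have h\<pi>: "h j (\<pi> j z) = h j z" for j z
    by (simp add: h_def W.\<pi>_idem) (simp add: \<pi>_def gram_factor.B_proj[OF GF])
  have hi: "integrable gauss (h j)" and hI: "(\<integral>z. h j z \<partial>gauss) = I j / (k * sqrt (det (G j)))" for j
    unfolding h_def \<pi>_def k_def
    using gram_factor.gaussian_integral_of_pullback[OF GF gm g0 gK I I0, of j] by auto
  define F where "F = (\<lambda>x. exp (- ((norm x)\<^sup>2 / 2)) * (\<Prod>j\<in>UNIV. rpow (g j (A j *v x)) (p j)))"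
  have [measurable]: "F \<in> borel_measurable borel" unfolding F_def by measurable
  have pt: "F (T *v z) = gauss_weight z * (\<Prod>j\<in>UNIV. rpow (h j z) (p j))" for z
  proof -
    have "(\<Prod>j\<in>UNIV. rpow (h j z) (p j)) = (\<Prod>j\<in>UNIV. rpow (g j (A j *v (T *v z))) (p j) * exp (p j * ((norm (\<pi> j z))\<^sup>2 / 2)))"
      by (simp add: h_def rpow_mult g0 rpow_exp Bz)
    also have "\<dots> = (\<Prod>j\<in>UNIV. rpow (g j (A j *v (T *v z))) (p j)) * exp ((\<Sum>j\<in>UNIV. p j * (norm (\<pi> j z))\<^sup>2) / 2)"
      by (simp add: prod.distrib exp_sum[symmetric] sum_divide_distrib)
    finally have "gauss_weight z * (\<Prod>j\<in>UNIV. rpow (h j z) (p j))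
       = (gauss_weight z * exp ((\<Sum>j\<in>UNIV. p j * (norm (\<pi> j z))\<^sup>2) / 2)) * (\<Prod>j\<in>UNIV. rpow (g j (A j *v (T *v z))) (p j))"
      by simp
    also have "gauss_weight z * exp ((\<Sum>j\<in>UNIV. p j * (norm (\<pi> j z))\<^sup>2) / 2) = exp (- ((norm (T *v z))\<^sup>2 / 2))"
      unfolding gauss_weight_def nid[of z] exp_add[symmetric] by (simp add: add_divide_distrib)
    finally show ?thesis by (simp add: F_def)
  qed
  have "(\<integral>\<^sup>+x. ennreal (F x) \<partial>lborel) = ennreal \<bar>det T\<bar> * (\<integral>\<^sup>+z. ennreal (F (T *v z)) \<partial>lborel)"
    by (rule nn_integral_matrix[OF dT(1)]) measurable
  also have "\<dots> = ennreal \<bar>det T\<bar> * (\<integral>\<^sup>+z. ennreal (gauss_weight z) * ennreal (\<Prod>j\<in>UNIV. rpow (h j z) (p j)) \<partial>lborel)"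
    by (simp add: pt ennreal_mult less_imp_le[OF gauss_weight_pos] prod_nonneg)
  also have "\<dots> = ennreal \<bar>det T\<bar> * (ennreal k * (\<integral>\<^sup>+z. ennreal (\<Prod>j\<in>UNIV. rpow (h j z) (p j)) \<partial>gauss))"
    unfolding k_def by (subst nn_integral_gauss) auto
  also have "\<dots> \<le> ennreal \<bar>det T\<bar> * (ennreal k * ennreal (\<Prod>j\<in>UNIV. rpow (\<integral>z. h j z \<partial>gauss) (p j)))"
    by (intro mult_left_mono W.gaussian_brascamp_lieb hm h0 h\<pi> hi) auto
  also have "\<dots> = ennreal (\<bar>det T\<bar> * k * (\<Prod>j\<in>UNIV. rpow (I j / (k * sqrt (det (G j)))) (p j)))"
    unfolding hI using k by (simp add: ennreal_mult prod_nonneg mult.assoc)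
  also have "\<bar>det T\<bar> * k * (\<Prod>j\<in>UNIV. rpow (I j / (k * sqrt (det (G j)))) (p j)) \<le> k * sqrt D * (\<Prod>j\<in>UNIV. rpow (I j) (p j))"
  proof -
    have r: "rpow (I j / (k * sqrt (det (G j)))) (p j) \<le> rpow (I j) (p j) * sqrt (det (G j) powr (- p j))" for j
    proof -
      have "rpow (I j / (k * sqrt (det (G j)))) (p j) \<le> rpow (I j * (1 / sqrt (det (G j)))) (p j)"
      proof (rule rpow_mono)
        have "sqrt (det (G j)) \<le> k * sqrt (det (G j))" using k dG[of j] mult_right_mono[of 1 k "sqrt (det (G j))"] by simp
        then have "I j / (k * sqrt (det (G j))) \<le> I j / sqrt (det (G j))"
          using dG[of j] I0[of j] by (intro divide_left_mono) (use k in auto)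
        then show "I j / (k * sqrt (det (G j))) \<le> I j * (1 / sqrt (det (G j)))" by simp
      qed (use I0 k dG p in \<open>auto intro!: divide_nonneg_nonneg mult_nonneg_nonneg simp: less_imp_le\<close>)
      also have "\<dots> = rpow (I j) (p j) * rpow (1 / sqrt (det (G j))) (p j)"
        using I0 dG by (intro rpow_mult) (auto simp: less_imp_le)
      also have "rpow (1 / sqrt (det (G j))) (p j) = sqrt (det (G j) powr (- p j))"
      proof -
        have "rpow (1 / sqrt (det (G j))) (p j) = (1 / sqrt (det (G j))) powr p j" using dG[of j] by (intro rpow_pos_eq) simp
        also have "\<dots> = (det (G j) powr (- (1/2))) powr p j"
          using dG[of j] by (simp add: powr_minus_divide powr_half_sqrt)
        also have "\<dots> = (det (G j) powr (- p j)) powr (1/2)" by (simp add: powr_powr)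
        also have "\<dots> = sqrt (det (G j) powr (- p j))" by (simp add: powr_half_sqrt)
        finally show ?thesis .
      qed
      finally show ?thesis .
    qed
    have "(\<Prod>j\<in>UNIV. rpow (I j / (k * sqrt (det (G j)))) (p j)) \<le> (\<Prod>j\<in>UNIV. rpow (I j) (p j) * sqrt (det (G j) powr (- p j)))"
      using r by (intro prod_mono) auto
    also have "\<dots> = (\<Prod>j\<in>UNIV. rpow (I j) (p j)) * sqrt (\<Prod>j\<in>UNIV. det (G j) powr (- p j))"
    proof -
      have "sqrt (\<Prod>j\<in>J. det (G j) powr (- p j)) = (\<Prod>j\<in>J. sqrt (det (G j) powr (- p j)))" if "finite J" for J
        using that by (induction J rule: finite_induct) (auto simp: real_sqrt_mult)
      then show ?thesis by (simp add: prod.distrib)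
    qed
    finally have "\<bar>det T\<bar> * k * (\<Prod>j\<in>UNIV. rpow (I j / (k * sqrt (det (G j)))) (p j))
        \<le> \<bar>det T\<bar> * k * ((\<Prod>j\<in>UNIV. rpow (I j) (p j)) * sqrt (\<Prod>j\<in>UNIV. det (G j) powr (- p j)))"
      using k by (intro mult_left_mono) auto
    also have "\<dots> = k * sqrt (det S * (\<Prod>j\<in>UNIV. det (G j) powr (- p j))) * (\<Prod>j\<in>UNIV. rpow (I j) (p j))"
      unfolding dT(2) by (simp add: real_sqrt_mult mult_ac)
    also have "\<dots> \<le> k * sqrt D * (\<Prod>j\<in>UNIV. rpow (I j) (p j))"
      using SD k unfolding G_def by (intro mult_right_mono mult_left_mono prod_nonneg) auto
    finally show ?thesis .
  qed
  finally show ?thesis unfolding F_def k_def D_def P_def by (simp add: ennreal_leI)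
qed

section \<open>Necessity of the frame conditions\<close>

lemma completed_frame_column: "completed_frame A e K \<beta> *v axis k 1 = (if \<beta> k \<in> K then A *v e $ k else axis (\<beta> k) 1)"
  by (simp add: matrix_vector_mult_basis) (simp add: completed_frame_def column_def vec_eq_iff)

lemma kernel_complement_proj: "complement_proj K *v y = 0 \<longleftrightarrow> (\<forall>i. i \<notin> K \<longrightarrow> y $ i = 0)"
  by (auto simp: complement_proj_vec vec_eq_iff)

lemma bij_extending:
  assumes "card (I :: 'n::finite set) = card (K :: 'n set)"
  obtains \<beta> where "bij \<beta>" "\<And>k. \<beta> k \<in> K \<longleftrightarrow> k \<in> I"
proof -
  obtain f where f: "bij_betw f I K" using assms finite_same_card_bij[of I K] by auto
  have "card (- I) = card (- K)" using assms by (simp add: Compl_eq_Diff_UNIV card_Diff_subset)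
  then obtain g where g: "bij_betw g (- I) (- K)" using finite_same_card_bij[of "- I" "- K"] by auto
  define \<beta> where "\<beta> = (\<lambda>k. if k \<in> I then f k else g k)"
  have "bij_betw \<beta> I K" using f by (rule bij_betw_cong[THEN iffD1, rotated]) (simp add: \<beta>_def)
  moreover have "bij_betw \<beta> (- I) (- K)" using g by (rule bij_betw_cong[THEN iffD1, rotated]) (simp add: \<beta>_def)
  ultimately have "bij_betw \<beta> (I \<union> - I) (K \<union> - K)" by (rule bij_betw_combine) auto
  moreover have "\<beta> k \<in> K \<longleftrightarrow> k \<in> I" for k
    using f g by (auto simp: \<beta>_def bij_betw_def)
  ultimately show ?thesis using that by simp
qed

text \<open>Select the indices \<open>k\<close> for which \<open>A e\<^sub>k\<close> is not in the span of the preceding images.\<close>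

lemma greedy_frame:
  fixes A e :: "real^'n::{finite,wellorder}^'n::_"
  assumes e: "orthogonal_matrix e" and r: "range ((*v) A) = {y. complement_proj K *v y = 0}"
  obtains \<beta> where "bij \<beta>" "det (completed_frame A e K \<beta>) \<noteq> 0"
    "\<And>k. A *v e $ k \<in> span ((\<lambda>i. A *v e $ i) ` {i. \<beta> i \<in> K \<and> i \<le> k})"
proof -
  define v where "v = (\<lambda>k. A *v e $ k)"
  define I where "I = {k. v k \<notin> span (v ` {i. i < k})}"
  have sp: "v k \<in> span (v ` {i. i \<in> I \<and> i \<le> k})" for k
  proof (induction k rule: less_induct)
    case (less k)
    show ?case
    proof (cases "k \<in> I")
      case True
      then show ?thesis by (intro span_base) auto
    next
      case False
      have "span (v ` {i. i < k}) \<subseteq> span (v ` {i. i \<in> I \<and> i \<le> k})"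
      proof (rule span_minimal[OF _ subspace_span], rule image_subsetI)
        fix i assume "i \<in> {i. i < k}"
        then have "span (v ` {l. l \<in> I \<and> l \<le> i}) \<subseteq> span (v ` {l. l \<in> I \<and> l \<le> k})"
          by (intro span_mono) auto
        then show "v i \<in> span (v ` {l. l \<in> I \<and> l \<le> k})" using less.IH[of i] \<open>i \<in> {i. i < k}\<close> by auto
      qed
      then show ?thesis using False by (auto simp: I_def)
    qed
  qed
  have ind: "independent (v ` J) \<and> inj_on v J" if "finite J" "J \<subseteq> I" for J
    using that
  proof (induction J rule: finite_linorder_max_induct)
    case empty
    then show ?case by (simp add: independent_empty)
  next
    case (insert b J)
    have "v ` J \<subseteq> v ` {i. i < b}" using insert.hyps by auto
    then have "span (v ` J) \<subseteq> span (v ` {i. i < b})" by (rule span_mono)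
    moreover have "v b \<notin> span (v ` {i. i < b})" using insert.prems by (simp add: I_def)
    ultimately have b: "v b \<notin> span (v ` J)" by (rule contra_subsetD)
    then have vb: "v b \<notin> v ` J" using span_base[of "v b" "v ` J"] by argo
    have IH: "independent (v ` J)" "inj_on v J" using insert.IH insert.prems by auto
    have "independent (insert (v b) (v ` J))" by (rule independent_insertI[OF b IH(1)])
    moreover have "inj_on v (insert b J)" using IH(2) vb by (auto simp: inj_on_insert)
    ultimately show ?case by simp
  qed
  have span: "span (v ` I) = range ((*v) A)"
  proof
    have "v ` I \<subseteq> range ((*v) A)" by (auto simp: v_def)
    moreover have "subspace (range ((*v) A))" by (intro linear_subspace_image subspace_UNIV matrix_vector_mul_linear)
    ultimately show "span (v ` I) \<subseteq> range ((*v) A)" by (rule span_minimal)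
    show "range ((*v) A) \<subseteq> span (v ` I)"
    proof (rule image_subsetI)
      fix x
      have "A *v x = A *v (\<Sum>k\<in>UNIV. (e $ k \<bullet> x) *\<^sub>R e $ k)" by (simp add: orthonormal_expansion[OF e])
      also have "\<dots> = (\<Sum>k\<in>UNIV. (e $ k \<bullet> x) *\<^sub>R v k)"
        by (simp add: linear_sum[OF matrix_vector_mul_linear] matrix_vector_mult_scaleR v_def)
      also have "\<dots> \<in> span (v ` I)"
      proof (intro span_sum span_scale)
        fix k
        have "span (v ` {i. i \<in> I \<and> i \<le> k}) \<subseteq> span (v ` I)" by (intro span_mono) auto
        then show "v k \<in> span (v ` I)" using sp[of k] by blast
      qed
      finally show "A *v x \<in> span (v ` I)" .
    qed
  qed
  have Ik: "independent (v ` I)" "inj_on v I" using ind[of I] by auto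
  have "card I = card (v ` I)" using Ik by (simp add: card_image)
  also have "\<dots> = dim (span (v ` I))" using Ik(1) by (simp add: dim_eq_card_independent dim_span)
  also have "span (v ` I) = {y. \<forall>i. i \<notin> K \<longrightarrow> y $ i = 0}" unfolding span r by (simp add: kernel_complement_proj)
  also have "dim \<dots> = card K" unfolding dim_vec_eq[symmetric] by (rule dim_substandard_cart)
  finally have "card I = card K" .
  then obtain \<beta> where \<beta>: "bij \<beta>" "\<And>k. \<beta> k \<in> K \<longleftrightarrow> k \<in> I" using bij_extending by blast
  define M where "M = completed_frame A e K \<beta>"
  have sub: "subspace (range ((*v) M))" by (intro linear_subspace_image subspace_UNIV matrix_vector_mul_linear)
  have "y \<in> range ((*v) M)" for y
  proof -
    have "v k \<in> range ((*v) M)" if "k \<in> I" for k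
    proof -
      have "M *v axis k 1 = v k" using completed_frame_column[of A e K \<beta> k] that \<beta>(2)[of k] by (simp add: M_def v_def)
      then show ?thesis using rangeI[of "(*v) M" "axis k 1"] by simp
    qed
    then have "span (v ` I) \<subseteq> range ((*v) M)" by (intro span_minimal sub) auto
    moreover have "coord_proj K y \<in> span (v ` I)"
      unfolding span r by (simp add: complement_proj_vec coord_proj_def vec_eq_iff)
    ultimately have 1: "coord_proj K y \<in> range ((*v) M)" by blast
    have ax: "axis l 1 \<in> range ((*v) M)" if "l \<notin> K" for l
    proof -
      obtain k where k: "l = \<beta> k" using \<beta>(1) by (metis bij_pointE)
      then have "M *v axis k 1 = axis l 1" using completed_frame_column[of A e K \<beta> k] that by (simp add: M_def)
      then show ?thesis using rangeI[of "(*v) M" "axis k 1"] by simp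
    qed
    have "complement_proj K *v y = (\<Sum>l\<in>-K. y $ l *\<^sub>R axis l 1)"
    proof -
      have "(\<Sum>l\<in>-K. y $ l * axis l 1 $ i) = (\<Sum>l\<in>-K. if l = i then y $ i else 0)" for i
        by (intro sum.cong) (auto simp: axis_def)
      then show ?thesis by (simp add: complement_proj_vec vec_eq_iff)
    qed
    also have "\<dots> \<in> range ((*v) M)"
      by (intro subspace_sum[OF sub] subspace_scale[OF sub] ax) auto
    finally have "coord_proj K y + complement_proj K *v y \<in> range ((*v) M)"
      using 1 subspace_add[OF sub] by blast
    moreover have "coord_proj K y + complement_proj K *v y = y"
      by (simp add: complement_proj_vec coord_proj_def vec_eq_iff)
    ultimately show ?thesis by simp
  qed
  then have "surj ((*v) M)" by blast
  then have "invertible M"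
    using matrix_right_invertible_surjective[of M] invertible_right_inverse by auto
  then have "det M \<noteq> 0" by (simp add: invertible_det_nz)
  then show ?thesis using that[of \<beta>] \<beta> sp by (simp add: M_def v_def)
qed

definition diagm :: "('n \<Rightarrow> real) \<Rightarrow> real^'n^'n" where
  "diagm d = (\<chi> i j. if i = j then d i else 0)"

lemma diagm_vec: "diagm d *v z = (\<chi> i. d i * z $ i)"
proof -
  have "(\<Sum>j\<in>UNIV. (if i = j then d i else 0) * z $ j) = (\<Sum>j\<in>UNIV. if j = i then d i * z $ i else 0)" for i
    by (intro sum.cong) auto
  then show ?thesis by (simp add: diagm_def matrix_vector_mult_def vec_eq_iff)
qed

lemma det_diagm: "det (diagm d) = (\<Prod>i\<in>UNIV. d i)"
  unfolding diagm_def by (subst det_diagonal) auto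

text \<open>The test function for one index is the indicator of a parallelepiped with sides proportional to \<open>d\<close> along the
  selected images of the frame.  It contains the image of a box with sides proportional to \<open>d\<close> along the whole frame: an image that
  was not selected is a combination of earlier ones, along which the sides are at least as long.\<close>

lemma box_test_function:
  fixes A e :: "real^'n::{finite,wellorder}^'n::_"
  assumes \<beta>: "bij \<beta>" and det: "det (completed_frame A e K \<beta>) \<noteq> 0"
    and sp: "\<And>k. A *v e $ k \<in> span ((\<lambda>i. A *v e $ i) ` {i. \<beta> i \<in> K \<and> i \<le> k})"
    and QA: "\<And>z. complement_proj K *v (A *v z) = 0"
  shows "\<exists>C>0. \<forall>d. (\<forall>k. 0 < d k) \<and> (\<forall>k l. k \<le> l \<longrightarrow> d l \<le> d k) \<longrightarrow>
    (\<exists>g I. g \<in> borel_measurable borel \<and> (\<forall>y. 0 \<le> g y \<and> g (coord_proj K y) = g y) \<and> 0 \<le> I \<and>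
      (\<integral>\<^sup>+y. ennreal (g y * exp (- ((norm (complement_proj K *v y))\<^sup>2 / 2))) \<partial>lborel) = ennreal I \<and>
      I \<le> C * (\<Prod>k\<in>{k. \<beta> k \<in> K}. d k) \<and>
      (\<forall>t. (\<forall>k. \<bar>t k\<bar> \<le> d k / CARD('n)) \<longrightarrow> g (A *v (\<Sum>k\<in>UNIV. t k *\<^sub>R e $ k)) = (1::real)))"
proof -
  define M where "M = completed_frame A e K \<beta>"
  define N where "N = matrix_inv M"
  have "invertible M" using det by (simp add: invertible_det_nz M_def)
  then have MN: "M *v (N *v x) = x" "N *v (M *v x) = x" for x
    using matrix_inv_mult[of M] by (simp_all add: N_def matrix_vector_mul_assoc)
  have dM: "det M \<noteq> 0" using det by (simp add: M_def)
  have Mcol: "M *v axis k 1 = (if \<beta> k \<in> K then A *v e $ k else axis (\<beta> k) 1)" for k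
    unfolding M_def by (rule completed_frame_column)
  \<comment> \<open>in the coordinates of the completed frame \<open>A e\<^sub>k\<close> only involves selected directions up to \<open>k\<close>\<close>
  have tri: "(N *v (A *v e $ k)) $ i = 0" if "\<not> (\<beta> i \<in> K \<and> i \<le> k)" for i k
  proof -
    have "span ((\<lambda>i. A *v e $ i) ` {i. \<beta> i \<in> K \<and> i \<le> k}) \<subseteq> {y. \<forall>i. \<not> (\<beta> i \<in> K \<and> i \<le> k) \<longrightarrow> (N *v y) $ i = 0}"
    proof (rule span_minimal)
      show "subspace {y. \<forall>i. \<not> (\<beta> i \<in> K \<and> i \<le> k) \<longrightarrow> (N *v y) $ i = 0}"
        by (auto simp: subspace_def matrix_vector_right_distrib matrix_vector_mult_scaleR)
      have "N *v (A *v e $ l) = axis l 1" if "\<beta> l \<in> K" for l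
        using MN(2)[of "axis l 1"] Mcol[of l] that by simp
      then show "(\<lambda>i. A *v e $ i) ` {i. \<beta> i \<in> K \<and> i \<le> k} \<subseteq> {y. \<forall>i. \<not> (\<beta> i \<in> K \<and> i \<le> k) \<longrightarrow> (N *v y) $ i = 0}"
        by (auto simp: axis_def)
    qed
    then show ?thesis using sp[of k] that by blast
  qed
  define R where "R = 1 + (\<Sum>i\<in>UNIV. \<Sum>k\<in>UNIV. \<bar>(N *v (A *v e $ k)) $ i\<bar>)"
  have R: "\<bar>(N *v (A *v e $ k)) $ i\<bar> \<le> R" for i k
  proof -
    have "\<bar>(N *v (A *v e $ k)) $ i\<bar> \<le> (\<Sum>k\<in>UNIV. \<bar>(N *v (A *v e $ k)) $ i\<bar>)"
      by (rule member_le_sum[of k UNIV "\<lambda>k. \<bar>(N *v (A *v e $ k)) $ i\<bar>"]) auto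
    also have "\<dots> \<le> (\<Sum>i\<in>UNIV. \<Sum>k\<in>UNIV. \<bar>(N *v (A *v e $ k)) $ i\<bar>)"
      by (rule member_le_sum[of i UNIV "\<lambda>i. \<Sum>k\<in>UNIV. \<bar>(N *v (A *v e $ k)) $ i\<bar>"]) (auto intro: sum_nonneg)
    finally show ?thesis by (simp add: R_def)
  qed
  have R1: "R \<ge> 1" unfolding R_def by (simp add: sum_nonneg)
  \<comment> \<open>the selected coordinates of \<open>N y\<close> therefore depend only on the coordinates of \<open>y\<close> in \<open>K\<close>\<close>
  have NQ: "(N *v (complement_proj K *v y)) $ i = 0" if i: "\<beta> i \<in> K" for i y
  proof -
    define z :: "real^'n::_" where "z = (\<chi> k. if \<beta> k \<in> K then 0 else y $ \<beta> k)"
    have "M *v z = complement_proj K *v y"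
    proof -
      have "(\<Sum>k\<in>UNIV. M $ l $ k * z $ k) = (if l \<in> K then 0 else y $ l)" for l
      proof -
        obtain k0 where k0: "l = \<beta> k0" using \<beta> by (metis bij_pointE)
        have "M $ l $ k * z $ k = (if k = k0 then (if l \<in> K then 0 else y $ l) else 0)" for k
          using k0 bij_is_inj[OF \<beta>, THEN injD, of k k0] by (auto simp: M_def completed_frame_def z_def axis_def)
        then show ?thesis by simp
      qed
      then show ?thesis by (simp add: complement_proj_vec matrix_vector_mult_def[of M] vec_eq_iff)
    qed
    then have "N *v (complement_proj K *v y) = z" using MN(2)[of z] by simp
    then show ?thesis using i by (simp add: z_def)
  qed
  define C where "C = \<bar>det M\<bar> * exp (CARD('n) * R\<^sup>2 / 2) * gauss_mass TYPE(real^'n::_)"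
  have Cp: "C > 0" unfolding C_def using dM gauss_mass_pos by (intro mult_pos_pos) auto
  have "\<exists>g I. g \<in> borel_measurable borel \<and> (\<forall>y. 0 \<le> g y \<and> g (coord_proj K y) = g y) \<and> 0 \<le> I \<and>
      (\<integral>\<^sup>+y. ennreal (g y * exp (- ((norm (complement_proj K *v y))\<^sup>2 / 2))) \<partial>lborel) = ennreal I \<and>
      I \<le> C * (\<Prod>k\<in>{k. \<beta> k \<in> K}. d k) \<and>
      (\<forall>t. (\<forall>k. \<bar>t k\<bar> \<le> d k / CARD('n)) \<longrightarrow> g (A *v (\<Sum>k\<in>UNIV. t k *\<^sub>R e $ k)) = (1::real))"
    if d: "\<And>k. 0 < d k" "\<And>k l. k \<le> l \<Longrightarrow> d l \<le> d k" for d
  proof -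
    define S where "S = {y. \<forall>i. \<beta> i \<in> K \<longrightarrow> \<bar>(N *v y) $ i\<bar> \<le> R * d i}"
    define g where "g = (indicator S :: real^'n::_ \<Rightarrow> real)"
    have "closed S" unfolding S_def
      by (intro closed_Collect_all closed_Collect_imp open_Collect_const closed_Collect_le continuous_intros
           continuous_on_compose2[OF matrix_vector_mult_linear_continuous_on[of UNIV N]]) auto
    then have Sm[measurable]: "S \<in> sets borel" by (rule borel_closed)
    have gm[measurable]: "g \<in> borel_measurable borel" unfolding g_def by measurable
    have ginv: "g (coord_proj K y) = g y" for y
    proof -
      have "y = coord_proj K y + complement_proj K *v y" by (simp add: complement_proj_vec coord_proj_def vec_eq_iff)
      then have "(N *v y) $ i = (N *v coord_proj K y) $ i" if "\<beta> i \<in> K" for i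
        using NQ[OF that, of y] by (metis add.right_neutral matrix_vector_right_distrib vector_add_component)
      then show ?thesis by (simp add: g_def indicator_def S_def)
    qed
    \<comment> \<open>the substitution \<open>y = M (diagm d') z\<close> turns the parallelepiped into a fixed cube in the selected directions, where the missing Gaussian factor is at least \<open>exp (- n R\<^sup>2 / 2)\<close>\<close>
    define d' where "d' = (\<lambda>k. if \<beta> k \<in> K then d k else 1)"
    have detd: "det (M ** diagm d') = det M * (\<Prod>k\<in>{k. \<beta> k \<in> K}. d k)"
      by (simp add: det_mul det_diagm d'_def prod.If_cases)
    have pp: "(\<Prod>k\<in>{k. \<beta> k \<in> K}. d k) > 0" using d by (intro prod_pos) auto
    then have detd0: "det (M ** diagm d') \<noteq> 0" using dM less_imp_neq[OF pp] unfolding detd mult_eq_0_iff by (auto simp only:)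
    define h where "h = (\<lambda>y. ennreal (g y * exp (- ((norm (complement_proj K *v y))\<^sup>2 / 2))))"
    have [measurable]: "h \<in> borel_measurable borel" unfolding h_def by measurable
    have hle: "h ((M ** diagm d') *v z) \<le> ennreal (exp (CARD('n) * R\<^sup>2 / 2)) * ennreal (gauss_weight z)" for z
    proof (cases "(M ** diagm d') *v z \<in> S")
      case True
      have zi: "\<bar>z $ i\<bar> \<le> R" if i: "\<beta> i \<in> K" for i
      proof -
        have "\<bar>(N *v (M *v (diagm d' *v z))) $ i\<bar> \<le> R * d i"
          using True i by (auto simp: S_def matrix_vector_mul_assoc)
        then have "d i * \<bar>z $ i\<bar> \<le> R * d i" using i d(1)[of i] by (simp add: MN diagm_vec d'_def abs_mult)
        then show ?thesis using d(1)[of i] by (simp add: mult.commute)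
      qed
      have Qn: "(norm (complement_proj K *v ((M ** diagm d') *v z)))\<^sup>2 = (\<Sum>k\<in>{k. \<beta> k \<notin> K}. (z $ k)\<^sup>2)"
      proof -
        define w where "w = diagm d' *v z"
        have w: "w = (\<Sum>k\<in>UNIV. (w $ k) *\<^sub>R axis k 1)" using basis_expansion[of w] by (simp add: scalar_mult_eq_scaleR)
        have "complement_proj K *v (M *v w) = (\<Sum>k\<in>UNIV. (w $ k) *\<^sub>R (complement_proj K *v (M *v axis k 1)))"
          by (subst w) (simp add: linear_sum[OF matrix_vector_mul_linear] matrix_vector_mult_scaleR)
        also have "\<dots> = (\<Sum>k\<in>UNIV. if \<beta> k \<in> K then 0 else (w $ k) *\<^sub>R axis (\<beta> k) 1)"
        proof (intro sum.cong refl)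
          fix k
          have "complement_proj K *v axis (\<beta> k) 1 = (axis (\<beta> k) 1 :: real^'n::_)" if "\<beta> k \<notin> K"
            using that by (auto simp: complement_proj_vec vec_eq_iff axis_def)
          then show "(w $ k) *\<^sub>R (complement_proj K *v (M *v axis k 1)) = (if \<beta> k \<in> K then 0 else (w $ k) *\<^sub>R axis (\<beta> k) 1)"
            by (simp add: Mcol QA)
        qed
        finally have c: "complement_proj K *v (M *v w) = (\<Sum>k\<in>UNIV. if \<beta> k \<in> K then 0 else (w $ k) *\<^sub>R axis (\<beta> k) 1)" .
        have cl: "(complement_proj K *v (M *v w)) $ \<beta> l = (if \<beta> l \<in> K then 0 else w $ l)" for l
        proof -
          have "(if \<beta> k \<in> K then 0 else (w $ k) *\<^sub>R axis (\<beta> k) 1) $ \<beta> l = (if k = l then (if \<beta> l \<in> K then 0 else w $ l) else 0)" for k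
            using bij_is_inj[OF \<beta>, THEN injD, of k l] by (auto simp: axis_def)
          then show ?thesis unfolding c by simp
        qed
        have "(norm (complement_proj K *v (M *v w)))\<^sup>2 = (\<Sum>i\<in>UNIV. ((complement_proj K *v (M *v w)) $ i)\<^sup>2)"
          unfolding power2_norm_eq_inner by (simp add: inner_vec_def power2_eq_square)
        also have "\<dots> = (\<Sum>l\<in>UNIV. ((complement_proj K *v (M *v w)) $ \<beta> l)\<^sup>2)"
          by (rule sum.reindex_bij_betw[OF \<beta>, symmetric])
        also have "\<dots> = (\<Sum>l\<in>UNIV. if \<beta> l \<notin> K then (z $ l)\<^sup>2 else 0)"
        proof (intro sum.cong refl)
          fix l
          have "w $ l = z $ l" if "\<beta> l \<notin> K" using that by (simp add: w_def diagm_vec d'_def)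
          then show "((complement_proj K *v (M *v w)) $ \<beta> l)\<^sup>2 = (if \<beta> l \<notin> K then (z $ l)\<^sup>2 else 0)"
            by (simp add: cl)
        qed
        also have "\<dots> = (\<Sum>k\<in>{k. \<beta> k \<notin> K}. (z $ k)\<^sup>2)" by (simp add: sum.If_cases Collect_neg_eq)
        finally show ?thesis by (simp add: w_def matrix_vector_mul_assoc)
      qed
      have "(norm z)\<^sup>2 = (\<Sum>i\<in>UNIV. (z $ i)\<^sup>2)"
        unfolding power2_norm_eq_inner by (simp add: inner_vec_def power2_eq_square)
      also have "\<dots> = (\<Sum>k\<in>{k. \<beta> k \<in> K}. (z $ k)\<^sup>2) + (\<Sum>k\<in>{k. \<beta> k \<notin> K}. (z $ k)\<^sup>2)"
        by (subst sum.union_disjoint[symmetric]) (auto intro: sum.cong)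
      also have "(\<Sum>k\<in>{k. \<beta> k \<in> K}. (z $ k)\<^sup>2) \<le> (\<Sum>k\<in>{k. \<beta> k \<in> K}. R\<^sup>2)"
      proof (rule sum_mono)
        fix k assume "k \<in> {k. \<beta> k \<in> K}"
        then show "(z $ k)\<^sup>2 \<le> R\<^sup>2" using zi[of k] R1 by (simp add: abs_le_square_iff[symmetric])
      qed
      also have "\<dots> \<le> CARD('n) * R\<^sup>2"
      proof -
        have "card {k. \<beta> k \<in> K} \<le> CARD('n)" by (rule card_mono) auto
        then show ?thesis by (simp add: mult_right_mono)
      qed
      finally have "- (\<Sum>k\<in>{k. \<beta> k \<notin> K}. (z $ k)\<^sup>2) / 2 \<le> CARD('n) * R\<^sup>2 / 2 - (norm z)\<^sup>2 / 2" by simp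
      then have "exp (- ((norm (complement_proj K *v ((M ** diagm d') *v z)))\<^sup>2 / 2)) \<le> exp (CARD('n) * R\<^sup>2 / 2) * gauss_weight z"
        unfolding Qn gauss_weight_def exp_add[symmetric] by simp
      moreover have "g ((M ** diagm d') *v z) = 1" using True by (simp add: g_def)
      ultimately show ?thesis
        unfolding h_def by (simp add: ennreal_mult[symmetric] less_imp_le[OF gauss_weight_pos])
    qed (simp add: h_def g_def)
    have "(\<integral>\<^sup>+y. h y \<partial>lborel) = ennreal \<bar>det (M ** diagm d')\<bar> * (\<integral>\<^sup>+z. h ((M ** diagm d') *v z) \<partial>lborel)"
      by (rule nn_integral_matrix[OF detd0]) measurable
    also have "\<dots> \<le> ennreal \<bar>det (M ** diagm d')\<bar> * (\<integral>\<^sup>+z. ennreal (exp (CARD('n) * R\<^sup>2 / 2)) * ennreal (gauss_weight (z :: real^'n::_)) \<partial>lborel)"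
      by (intro mult_left_mono nn_integral_mono hle) auto
    also have "(\<integral>\<^sup>+z. ennreal (exp (CARD('n) * R\<^sup>2 / 2)) * ennreal (gauss_weight (z :: real^'n::_)) \<partial>lborel) = ennreal (exp (CARD('n) * R\<^sup>2 / 2)) * ennreal (gauss_mass TYPE(real^'n::_))"
      by (subst nn_integral_cmult) (auto simp: nn_integral_gauss_weight gauss_mass_eq)
    also have "ennreal \<bar>det (M ** diagm d')\<bar> * \<dots> = ennreal (C * (\<Prod>k\<in>{k. \<beta> k \<in> K}. d k))"
      using pp less_imp_le[OF gauss_mass_pos[where 'a="real^'n::_"]] by (simp add: detd abs_mult C_def ennreal_mult[symmetric] mult_ac)
    finally have hI: "(\<integral>\<^sup>+y. h y \<partial>lborel) \<le> ennreal (C * (\<Prod>k\<in>{k. \<beta> k \<in> K}. d k))" .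
    define I where "I = enn2real (\<integral>\<^sup>+y. h y \<partial>lborel)"
    have hI': "(\<integral>\<^sup>+y. h y \<partial>lborel) = ennreal I"
      unfolding I_def using hI by (intro ennreal_enn2real[symmetric]) (auto intro: le_less_trans)
    have I: "I \<le> C * (\<Prod>k\<in>{k. \<beta> k \<in> K}. d k)" "I \<ge> 0"
      using hI Cp pp unfolding hI' by (auto simp: I_def)
    have one: "g (A *v (\<Sum>k\<in>UNIV. t k *\<^sub>R e $ k)) = 1" if t: "\<And>k. \<bar>t k\<bar> \<le> d k / CARD('n)" for t
    proof -
      have "\<bar>(N *v (A *v (\<Sum>k\<in>UNIV. t k *\<^sub>R e $ k))) $ i\<bar> \<le> R * d i" for i
      proof -
        have "(N *v (A *v (\<Sum>k\<in>UNIV. t k *\<^sub>R e $ k))) $ i = (\<Sum>k\<in>UNIV. t k * (N *v (A *v e $ k)) $ i)"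
          by (simp add: linear_sum[OF matrix_vector_mul_linear] matrix_vector_mult_scaleR)
        also have "\<bar>\<dots>\<bar> \<le> (\<Sum>k\<in>UNIV. \<bar>t k * (N *v (A *v e $ k)) $ i\<bar>)" by (rule sum_abs)
        also have "\<dots> \<le> (\<Sum>k\<in>(UNIV :: 'n set). (d i / CARD('n)) * R)"
        proof (rule sum_mono)
          fix k
          show "\<bar>t k * (N *v (A *v e $ k)) $ i\<bar> \<le> (d i / CARD('n)) * R"
          proof (cases "i \<le> k")
            case True
            then have "\<bar>t k\<bar> \<le> d i / CARD('n)" using t[of k] d(2)[of i k] by (meson divide_right_mono of_nat_0_le_iff order_trans)
            then show ?thesis unfolding abs_mult using R[of k i] d(1)[of i] by (intro mult_mono) auto
          next
            case False
            then show ?thesis using tri[of i k] d(1)[of i] R1 by simp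
          qed
        qed
        finally show ?thesis by (simp add: mult.commute)
      qed
      then show ?thesis by (simp add: g_def S_def)
    qed
    have g0: "0 \<le> g y" for y by (simp add: g_def)
    show ?thesis
    proof (rule exI[of _ g], rule exI[of _ I], intro conjI allI impI)
      show "g (A *v (\<Sum>k\<in>UNIV. t k *\<^sub>R e $ k)) = 1" if "\<forall>k. \<bar>t k\<bar> \<le> d k / CARD('n)" for t
        by (rule one) (use that in blast)
    qed (rule gm g0 ginv I hI'[unfolded h_def])+
  qed
  then show ?thesis using Cp by (intro exI[of _ C]) auto
qed

text \<open>The localised inequality for functions of the coordinates in \<open>K j\<close>, each padded by a Gaussian in the others.  Naming
  the padded integrals by real numbers \<open>I j\<close> expresses that they are finite.\<close>

definition coord_BL_bound :: "('m::finite \<Rightarrow> real^'n^'n) \<Rightarrow> ('m \<Rightarrow> 'n set) \<Rightarrow> ('m \<Rightarrow> real) \<Rightarrow> real \<Rightarrow> bool" where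
  "coord_BL_bound A K p C \<longleftrightarrow> (\<forall>g I.
     (\<forall>j. g j \<in> borel_measurable borel \<and> (\<forall>y. 0 \<le> g j y \<and> g j (coord_proj (K j) y) = g j y) \<and> 0 \<le> I j \<and>
       (\<integral>\<^sup>+y. ennreal (g j y * exp (- ((norm (complement_proj (K j) *v y))\<^sup>2 / 2))) \<partial>lborel) = ennreal (I j)) \<longrightarrow>
     (\<integral>\<^sup>+x\<in>cball 0 1. ennreal (\<Prod>j\<in>UNIV. rpow (g j (A j *v x)) (p j)) \<partial>lborel)
       \<le> ennreal (C * (\<Prod>j\<in>UNIV. rpow (I j) (p j))))"

lemma lborel_frame_box:
  fixes e :: "real^'n::{finite,wellorder}^'n::_"
  assumes e: "orthogonal_matrix e" and d: "\<And>k. 0 < d k"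
  shows "emeasure lborel {x. \<forall>k. \<bar>e $ k \<bullet> x\<bar> \<le> d k * r} = ennreal ((\<Prod>k\<in>UNIV. d k) * measure lborel (cbox (\<chi> k. - r) (\<chi> k. r) :: (real^'n::_) set))"
proof -
  define S where "S = {x. \<forall>k. \<bar>e $ k \<bullet> x\<bar> \<le> d k * r}"
  define M where "M = transpose e ** diagm d"
  have "closed S" unfolding S_def by (intro closed_Collect_all closed_Collect_le continuous_intros)
  then have [measurable]: "S \<in> sets borel" by (rule borel_closed)
  have "det (transpose e) * det (transpose e) = 1"
    using arg_cong[OF e[unfolded orthogonal_matrix], of det] by (simp add: det_mul)
  then have "\<bar>det (transpose e)\<bar> = 1" by (metis abs_1 abs_mult abs_mult_self_eq real_sqrt_abs2 real_sqrt_one)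
  then have dM: "\<bar>det M\<bar> = (\<Prod>k\<in>UNIV. d k)"
    unfolding M_def det_mul det_diagm abs_mult using d by (simp add: prod_nonneg less_imp_le abs_prod)
  have "(\<Prod>k\<in>UNIV. d k) > 0" using d by (intro prod_pos) auto
  then have dM0: "det M \<noteq> 0" using dM by auto
  have ek: "e $ k \<bullet> (M *v z) = d k * z $ k" for k z
  proof -
    have "e *v (M *v z) = (e ** transpose e) *v (diagm d *v z)"
      by (simp add: M_def matrix_vector_mul_assoc matrix_mul_assoc del: transpose_matrix_vector)
    also have "e ** transpose e = mat 1" using e by (simp add: orthogonal_matrix_def)
    finally have "(e *v (M *v z)) $ k = d k * z $ k" by (simp add: diagm_vec)
    then show ?thesis by (simp add: matrix_vector_mult_def[of e] inner_vec_def)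
  qed
  have pre: "M *v z \<in> S \<longleftrightarrow> z \<in> cbox (\<chi> k. - r) (\<chi> k. r)" for z
  proof -
    have "\<bar>d k * z $ k\<bar> \<le> d k * r \<longleftrightarrow> \<bar>z $ k\<bar> \<le> r" for k using d[of k] by (simp add: abs_mult)
    then have "M *v z \<in> S \<longleftrightarrow> (\<forall>k. \<bar>z $ k\<bar> \<le> r)" by (simp only: S_def mem_Collect_eq ek)
    also have "\<dots> \<longleftrightarrow> z \<in> cbox (\<chi> k. - r) (\<chi> k. r)" by (auto simp: mem_box_cart abs_le_iff minus_le_iff)
    finally show ?thesis .
  qed
  have "emeasure lborel S = (\<integral>\<^sup>+x. indicator S x \<partial>lborel)" by simp
  also have "\<dots> = ennreal \<bar>det M\<bar> * (\<integral>\<^sup>+z. indicator S (M *v z) \<partial>lborel)" by (rule nn_integral_matrix[OF dM0]) simp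
  also have "(\<integral>\<^sup>+z. indicator S (M *v z) \<partial>lborel) = (\<integral>\<^sup>+z. indicator (cbox (\<chi> k. - r) (\<chi> k. r) :: (real^'n::_) set) z \<partial>lborel)"
  proof (rule nn_integral_cong)
    show "indicator S (M *v z) = (indicator (cbox (\<chi> k. - r) (\<chi> k. r)) z :: ennreal)" for z
      using pre[of z] by (auto simp: indicator_def)
  qed
  also have "\<dots> = ennreal (measure lborel (cbox (\<chi> k. - r) (\<chi> k. r) :: (real^'n::_) set))"
    using emeasure_lborel_cbox_finite[of "(\<chi> k. - r) :: real^'n::_" "\<chi> k. r"]
    by (simp add: emeasure_eq_ennreal_measure less_top)
  finally show ?thesis unfolding S_def dM using d by (simp add: ennreal_mult[symmetric] prod_nonneg less_imp_le)
qed

text \<open>Test the inequality on boxes with sides of order \<open>1\<close> along the frame vectors before \<open>t\<close> and \<open>\<delta>\<close> along the others.  The left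
  side is of order \<open>\<delta>\<close> to the number of indices from \<open>t\<close> on, the \<open>j\<close>-th integral on the right of order \<open>\<delta>\<close> to the number
  of selected ones among them; compare the exponents as \<open>\<delta>\<close> tends to \<open>0\<close>.\<close>

lemma admissible_of_bound:
  fixes A :: "'m::finite \<Rightarrow> real^'n::{finite,wellorder}^'n::_"
  assumes BL: "coord_BL_bound A K p C" and C: "C \<ge> 0" and p: "\<And>j. p j \<ge> 0"
    and r: "\<And>j. range ((*v) (A j)) = {y. complement_proj (K j) *v y = 0}"
    and e: "orthogonal_matrix e"
  shows "\<exists>\<beta>. admissible 0 p K \<beta> \<and> (\<forall>j. det (completed_frame (A j) e (K j) (\<beta> j)) \<noteq> 0)"
proof -
  have QA: "complement_proj (K j) *v (A j *v z) = 0" for j z using r[of j] by blast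
  have "\<forall>j. \<exists>\<beta>. bij \<beta> \<and> det (completed_frame (A j) e (K j) \<beta>) \<noteq> 0 \<and>
    (\<forall>k. A j *v e $ k \<in> span ((\<lambda>i. A j *v e $ i) ` {i. \<beta> i \<in> K j \<and> i \<le> k}))"
  proof
    fix j
    obtain \<beta> where "bij \<beta>" "det (completed_frame (A j) e (K j) \<beta>) \<noteq> 0"
      "\<And>k. A j *v e $ k \<in> span ((\<lambda>i. A j *v e $ i) ` {i. \<beta> i \<in> K j \<and> i \<le> k})"
      by (rule greedy_frame[OF e r[of j]]) (rule that)
    then show "\<exists>\<beta>. bij \<beta> \<and> det (completed_frame (A j) e (K j) \<beta>) \<noteq> 0 \<and>
      (\<forall>k. A j *v e $ k \<in> span ((\<lambda>i. A j *v e $ i) ` {i. \<beta> i \<in> K j \<and> i \<le> k}))" by blast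
  qed
  then obtain \<beta> where \<beta>': "\<forall>j. bij (\<beta> j) \<and> det (completed_frame (A j) e (K j) (\<beta> j)) \<noteq> 0 \<and>
    (\<forall>k. A j *v e $ k \<in> span ((\<lambda>i. A j *v e $ i) ` {i. \<beta> j i \<in> K j \<and> i \<le> k}))"
    unfolding choice_iff by (elim exE) (rule that)
  then have \<beta>: "\<And>j. bij (\<beta> j)" "\<And>j. det (completed_frame (A j) e (K j) (\<beta> j)) \<noteq> 0"
    "\<And>j k. A j *v e $ k \<in> span ((\<lambda>i. A j *v e $ i) ` {i. \<beta> j i \<in> K j \<and> i \<le> k})"
    by simp_all
  have "\<forall>j. \<exists>C>0. \<forall>d. (\<forall>k. 0 < d k) \<and> (\<forall>k l. k \<le> l \<longrightarrow> d l \<le> d k) \<longrightarrow>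
    (\<exists>g I. g \<in> borel_measurable borel \<and> (\<forall>y. 0 \<le> g y \<and> g (coord_proj (K j) y) = g y) \<and> 0 \<le> I \<and>
      (\<integral>\<^sup>+y. ennreal (g y * exp (- ((norm (complement_proj (K j) *v y))\<^sup>2 / 2))) \<partial>lborel) = ennreal I \<and>
      I \<le> C * (\<Prod>k\<in>{k. \<beta> j k \<in> K j}. d k) \<and>
      (\<forall>t. (\<forall>k. \<bar>t k\<bar> \<le> d k / CARD('n)) \<longrightarrow> g (A j *v (\<Sum>k\<in>UNIV. t k *\<^sub>R e $ k)) = (1::real)))"
    using box_test_function[OF \<beta>(1) \<beta>(2) \<beta>(3) QA] by blast
  then obtain Cj where Cj: "\<forall>j. Cj j > 0 \<and> (\<forall>d. (\<forall>k. 0 < d k) \<and> (\<forall>k l. k \<le> l \<longrightarrow> d l \<le> d k) \<longrightarrow>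
    (\<exists>g I. g \<in> borel_measurable borel \<and> (\<forall>y. 0 \<le> g y \<and> g (coord_proj (K j) y) = g y) \<and> 0 \<le> I \<and>
      (\<integral>\<^sup>+y. ennreal (g y * exp (- ((norm (complement_proj (K j) *v y))\<^sup>2 / 2))) \<partial>lborel) = ennreal I \<and>
      I \<le> Cj j * (\<Prod>k\<in>{k. \<beta> j k \<in> K j}. d k) \<and>
      (\<forall>t. (\<forall>k. \<bar>t k\<bar> \<le> d k / CARD('n)) \<longrightarrow> g (A j *v (\<Sum>k\<in>UNIV. t k *\<^sub>R e $ k)) = (1::real))))"
    unfolding choice_iff by (elim exE) (rule that)
  have "(\<Sum>k\<in>{t..}. 1 - frame_exponent p K \<beta> k) \<ge> 0" for t
  proof (rule ccontr)
    assume neg: "\<not> ?thesis"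
    define N where "N = card {t..}"
    define Nj where "Nj = (\<lambda>j. card {k. \<beta> j k \<in> K j \<and> t \<le> k})"
    define s where "s = (\<Sum>j\<in>UNIV. p j * Nj j)"
    have "(\<Sum>k\<in>{t..}. frame_exponent p K \<beta> k) = s"
    proof -
      have "(\<Sum>k\<in>{t..}. if \<beta> j k \<in> K j then p j else 0) = p j * Nj j" for j
      proof -
        have "(\<Sum>k\<in>{t..}. if \<beta> j k \<in> K j then p j else 0) = (\<Sum>k\<in>{k \<in> {t..}. \<beta> j k \<in> K j}. p j)"
          by (rule sum.inter_filter[symmetric]) simp
        also have "{k \<in> {t..}. \<beta> j k \<in> K j} = {k. \<beta> j k \<in> K j \<and> t \<le> k}" by auto
        finally show ?thesis by (simp add: Nj_def)
      qed
      then show ?thesis unfolding frame_exponent_def s_def by (subst sum.swap) simp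
    qed
    then have sN: "real N < s" using neg by (simp add: sum_subtractf N_def)
    define v0 where "v0 = measure lborel (cbox (\<chi> k. - (1 / CARD('n))) (\<chi> k. 1 / CARD('n)) :: (real^'n::_) set)"
    have v0: "v0 > 0" unfolding v0_def
      by (rule content_pos_lt) (auto simp: Basis_vec_def inner_axis)
    define D where "D = C * (\<Prod>j\<in>UNIV. rpow (Cj j) (p j))"
    have D: "D \<ge> 0" unfolding D_def using C by (intro mult_nonneg_nonneg prod_nonneg) auto
    have step: "v0 * \<delta> ^ N \<le> D * \<delta> powr s" if \<delta>: "0 < \<delta>" "\<delta> < 1" for \<delta>
    proof -
      define d where "d = (\<lambda>k. if t \<le> k then \<delta> else 1)"
      have d: "\<forall>k. 0 < d k" "\<forall>k l. k \<le> l \<longrightarrow> d l \<le> d k" using \<delta> by (auto simp: d_def intro: order_trans)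
      have d1: "d k \<le> 1" for k using \<delta> by (simp add: d_def)
      have "\<forall>j. \<exists>g I. g \<in> borel_measurable borel \<and> (\<forall>y. 0 \<le> g y \<and> g (coord_proj (K j) y) = g y) \<and> 0 \<le> I \<and>
        (\<integral>\<^sup>+y. ennreal (g y * exp (- ((norm (complement_proj (K j) *v y))\<^sup>2 / 2))) \<partial>lborel) = ennreal I \<and>
        I \<le> Cj j * (\<Prod>k\<in>{k. \<beta> j k \<in> K j}. d k) \<and>
        (\<forall>t. (\<forall>k. \<bar>t k\<bar> \<le> d k / CARD('n)) \<longrightarrow> g (A j *v (\<Sum>k\<in>UNIV. t k *\<^sub>R e $ k)) = (1::real))"
        using Cj d by blast
      then obtain g I where gI: "\<forall>j. g j \<in> borel_measurable borel \<and> (\<forall>y. 0 \<le> g j y \<and> g j (coord_proj (K j) y) = g j y) \<and> 0 \<le> I j \<and>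
        (\<integral>\<^sup>+y. ennreal (g j y * exp (- ((norm (complement_proj (K j) *v y))\<^sup>2 / 2))) \<partial>lborel) = ennreal (I j) \<and>
        I j \<le> Cj j * (\<Prod>k\<in>{k. \<beta> j k \<in> K j}. d k) \<and>
        (\<forall>t. (\<forall>k. \<bar>t k\<bar> \<le> d k / CARD('n)) \<longrightarrow> g j (A j *v (\<Sum>k\<in>UNIV. t k *\<^sub>R e $ k)) = (1::real))"
        unfolding choice_iff by (elim exE) (rule that)
      have le: "(\<integral>\<^sup>+x\<in>cball 0 1. ennreal (\<Prod>j\<in>UNIV. rpow (g j (A j *v x)) (p j)) \<partial>lborel) \<le> ennreal (C * (\<Prod>j\<in>UNIV. rpow (I j) (p j)))"
        using gI by (intro BL[unfolded coord_BL_bound_def, rule_format]) blast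
      define S where "S = {x. \<forall>k. \<bar>e $ k \<bullet> x\<bar> \<le> d k * (1 / CARD('n))}"
      have S: "ennreal (indicator S x) \<le> ennreal (\<Prod>j\<in>UNIV. rpow (g j (A j *v x)) (p j)) * indicator (cball 0 1) x" for x
      proof (cases "x \<in> S")
        case True
        have x: "x = (\<Sum>k\<in>UNIV. (e $ k \<bullet> x) *\<^sub>R e $ k)" by (rule orthonormal_expansion[OF e, symmetric])
        have en: "norm (e $ k) = 1" for k using e by (simp add: orthogonal_matrix_rows_iff norm_eq_1)
        have "norm x \<le> (\<Sum>k\<in>UNIV. norm ((e $ k \<bullet> x) *\<^sub>R e $ k))" by (subst x) (rule norm_sum)
        also have "\<dots> \<le> (\<Sum>k\<in>(UNIV::'n set). 1 / CARD('n))"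
        proof (rule sum_mono)
          fix k
          have "d k * (1 / CARD('n)) \<le> 1 * (1 / CARD('n))" by (rule mult_right_mono[OF d1]) simp
          then show "norm ((e $ k \<bullet> x) *\<^sub>R e $ k) \<le> 1 / CARD('n)" using True by (auto simp: S_def en intro: order_trans)
        qed
        finally have "x \<in> cball 0 1" by simp
        moreover have "g j (A j *v x) = 1" for j
        proof -
          have "g j (A j *v (\<Sum>k\<in>UNIV. (e $ k \<bullet> x) *\<^sub>R e $ k)) = 1" using gI True by (auto simp: S_def)
          then show ?thesis by (simp only: x[symmetric])
        qed
        moreover have "rpow 1 a = 1" for a by (simp add: rpow_def)
        ultimately show ?thesis by (simp add: indicator_def)
      qed simp
      have "closed S" unfolding S_def by (intro closed_Collect_all closed_Collect_le continuous_intros)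
      then have [measurable]: "S \<in> sets borel" by (rule borel_closed)
      have pd: "(\<Prod>k\<in>UNIV. d k) = \<delta> ^ N"
      proof -
        have "(\<Prod>k\<in>UNIV. d k) = (\<Prod>k\<in>{t..}. \<delta>)" unfolding d_def by (simp add: prod.If_cases atLeast_def)
        then show ?thesis by (simp add: N_def)
      qed
      have "ennreal (v0 * \<delta> ^ N) = emeasure lborel S"
        using lborel_frame_box[OF e, of d "1 / CARD('n)"] d(1) by (simp add: S_def v0_def pd mult.commute)
      also have "\<dots> = (\<integral>\<^sup>+x. ennreal (indicator S x) \<partial>lborel)" by (simp add: ennreal_indicator)
      also have "\<dots> \<le> (\<integral>\<^sup>+x\<in>cball 0 1. ennreal (\<Prod>j\<in>UNIV. rpow (g j (A j *v x)) (p j)) \<partial>lborel)"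
        by (intro nn_integral_mono S)
      also note le
      finally have "v0 * \<delta> ^ N \<le> C * (\<Prod>j\<in>UNIV. rpow (I j) (p j))"
        using C by (subst (asm) ennreal_le_iff) (auto intro!: mult_nonneg_nonneg prod_nonneg)
      also have "\<dots> \<le> C * (\<Prod>j\<in>UNIV. rpow (Cj j) (p j) * \<delta> powr (p j * Nj j))"
      proof (intro mult_left_mono[OF _ C] prod_mono conjI)
        fix j
        have pj: "(\<Prod>k\<in>{k. \<beta> j k \<in> K j}. d k) = \<delta> ^ Nj j"
        proof -
          have "(\<Prod>k\<in>{k. \<beta> j k \<in> K j}. d k) = (\<Prod>k\<in>{k\<in>{k. \<beta> j k \<in> K j}. t \<le> k}. \<delta>)"
            unfolding d_def by (rule prod.inter_filter[symmetric]) simp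
          then show ?thesis by (simp add: Nj_def)
        qed
        have "rpow (I j) (p j) \<le> rpow (Cj j * \<delta> ^ Nj j) (p j)"
          using gI p unfolding pj[symmetric] by (intro rpow_mono) auto
        also have "\<dots> = rpow (Cj j) (p j) * rpow (\<delta> ^ Nj j) (p j)"
          using Cj \<delta> by (intro rpow_mult) (auto simp: less_imp_le)
        also have "rpow (\<delta> ^ Nj j) (p j) = \<delta> powr (p j * Nj j)"
          using \<delta> by (simp add: rpow_pos_eq powr_realpow[symmetric] powr_powr mult.commute)
        finally show "rpow (I j) (p j) \<le> rpow (Cj j) (p j) * \<delta> powr (p j * Nj j)" .
      qed simp
      also have "\<dots> = D * \<delta> powr s"
        using \<delta> by (simp add: prod.distrib D_def s_def powr_sum)
      finally show ?thesis .
    qed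
    have "v0 \<le> D * \<delta> powr (s - N)" if \<delta>: "0 < \<delta>" "\<delta> < 1" for \<delta>
    proof -
      have "\<delta> powr s = \<delta> powr (s - N) * \<delta> ^ N" using \<delta> by (simp add: powr_realpow[symmetric] powr_add[symmetric])
      then have "v0 * \<delta> ^ N \<le> (D * \<delta> powr (s - N)) * \<delta> ^ N" using step[OF \<delta>] by (simp add: mult.assoc)
      then show ?thesis using \<delta> by simp
    qed
    then have "v0 \<le> D * (1 / (real n + 2)) powr (s - N)" for n :: nat by simp
    moreover have "(\<lambda>n. D * (1 / (real n + 2)) powr (s - N)) \<longlonglongrightarrow> 0"
    proof -
      have "s - N > 0" using sN by simp
      then have "(\<lambda>n. (1 / (real n + 2)) powr (s - N)) \<longlonglongrightarrow> 0" by real_asymp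
      from tendsto_mult_right_zero[OF this, of D] show ?thesis .
    qed
    ultimately have "v0 \<le> 0" by (meson LIMSEQ_le_const)
    then show False using v0 by simp
  qed
  then show ?thesis using \<beta> by (intro exI[of _ \<beta>]) (simp add: admissible_def)
qed

section \<open>Stability\<close>

text \<open>The set of frames is compact and there are finitely many choices of \<open>\<beta>\<close>, so nondegeneracy at one datum persists with a
  uniform constant near it.\<close>

lemma frame_bounds_near:
  fixes A0 :: "(real^'n::{finite,wellorder}^'n::_)^'m::finite"
  assumes nd: "\<And>e. orthogonal_matrix e \<Longrightarrow> \<exists>\<beta>. admissible 0 p K \<beta> \<and> (\<forall>j. det (completed_frame (A0 $ j) e (K j) (\<beta> j)) \<noteq> 0)"
  shows "\<exists>c \<delta>. 0 < c \<and> c \<le> 1 \<and> 0 < \<delta> \<and> (\<forall>A. norm (A - A0) < \<delta> \<longrightarrow> frame_bounds c 0 p (\<lambda>j. A $ j) K)"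
proof -
  define \<B> where "\<B> = {\<beta>. admissible 0 p K \<beta>}"
  \<comment> \<open>truncation at \<open>1\<close> lets a lower bound for the product pass to every factor; the sum over \<open>\<beta>\<close> is positive if some selection is nondegenerate\<close>
  define f where "f = (\<lambda>\<beta> z. \<Prod>j\<in>UNIV. min 1 ((det (completed_frame (fst z $ j) (snd z) (K j) (\<beta> j)))\<^sup>2))"
  define F where "F = (\<lambda>z :: ((real^'n::_^'n::_)^'m) \<times> (real^'n::_^'n::_). \<Sum>\<beta>\<in>\<B>. f \<beta> z)"
  define Fr where "Fr = {e :: real^'n::_^'n::_. orthogonal_matrix e}"
  define X where "X = cball A0 1 \<times> Fr"
  have Frc: "compact Fr" unfolding Fr_def by (rule compact_orthogonal_matrices)
  have one: "mat 1 \<in> Fr" unfolding Fr_def by (simp add: orthogonal_matrix_id)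
  have fin: "finite \<B>" by (rule finite_subset[OF subset_UNIV]) simp
  have f01: "0 \<le> f \<beta> z" "f \<beta> z \<le> 1" for \<beta> z
    unfolding f_def by (auto intro!: prod_nonneg prod_le_1)
  have cf: "continuous_on UNIV (\<lambda>z :: ((real^'n::_^'n::_)^'m) \<times> (real^'n::_^'n::_). completed_frame (fst z $ j) (snd z) (K j) b)" for j b
  proof -
    have "continuous_on UNIV (\<lambda>z :: ((real^'n::_^'n::_)^'m) \<times> (real^'n::_^'n::_). (if b k \<in> K j then (fst z $ j) *v (snd z $ k) else axis (b k) 1) $ i)" for i k
      by (cases "b k \<in> K j") (auto simp: matrix_vector_mult_def intro!: continuous_intros)
    then show ?thesis unfolding completed_frame_def by (intro continuous_on_vec_lambda)
  qed
  have Fc: "continuous_on UNIV F"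
    unfolding F_def f_def by (intro continuous_intros continuous_on_det cf)
  have Xc: "compact X" unfolding X_def by (intro compact_Times compact_cball Frc)
  have uc: "uniformly_continuous_on X F"
    by (rule compact_uniformly_continuous[OF continuous_on_subset[OF Fc] Xc]) simp
  have Fpos: "F (A0, e) > 0" if eF: "e \<in> Fr" for e
  proof -
    obtain \<beta> where "admissible 0 p K \<beta> \<and> (\<forall>j. det (completed_frame (A0 $ j) e (K j) (\<beta> j)) \<noteq> 0)"
      using nd[of e] eF unfolding Fr_def by blast
    then have \<beta>: "\<beta> \<in> \<B>" "\<And>j. det (completed_frame (A0 $ j) e (K j) (\<beta> j)) \<noteq> 0" by (auto simp: \<B>_def)
    have "0 < f \<beta> (A0, e)" unfolding f_def using \<beta>(2) by (intro prod_pos) auto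
    then show ?thesis unfolding F_def by (intro sum_pos2[OF fin \<beta>(1)]) (auto simp: f01)
  qed
  have "continuous_on Fr (\<lambda>e. F (A0, e))"
    by (rule continuous_on_compose2[OF Fc]) (auto intro!: continuous_intros)
  then obtain e0 where e0: "e0 \<in> Fr" "\<And>e. e \<in> Fr \<Longrightarrow> F (A0, e0) \<le> F (A0, e)"
    using continuous_attains_inf[OF Frc, of "\<lambda>e. F (A0, e)"] one by blast
  define m where "m = F (A0, e0)"
  have m: "m > 0" unfolding m_def by (rule Fpos[OF e0(1)])
  obtain \<delta> where \<delta>: "\<delta> > 0" "\<And>x y. x \<in> X \<Longrightarrow> y \<in> X \<Longrightarrow> dist y x < \<delta> \<Longrightarrow> dist (F y) (F x) < m / 2"
    using uc[unfolded uniformly_continuous_on_def, rule_format, of "m / 2"] m by (auto)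
  \<comment> \<open>by pigeonhole one of the \<open>card \<B>\<close> summands is at least this large\<close>
  define c where "c = min 1 (m / 2 / (1 + card \<B>))"
  have c: "c > 0" "c \<le> 1" unfolding c_def using m by auto
  have "frame_bounds c 0 p (\<lambda>j. A $ j) K" if A: "norm (A - A0) < min 1 \<delta>" for A
    unfolding frame_bounds_def
  proof (intro allI impI)
    fix e :: "real^'n::_^'n::_" assume "orthogonal_matrix e"
    then have e: "e \<in> Fr" by (simp add: Fr_def)
    have "(A, e) \<in> X" "(A0, e) \<in> X" using A e by (auto simp: X_def dist_norm norm_minus_commute)
    moreover have "dist (A, e) (A0, e) < \<delta>" using A by (simp add: dist_Pair_Pair dist_norm)
    ultimately have "dist (F (A, e)) (F (A0, e)) < m / 2" using \<delta>(2) by blast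
    then have FA: "F (A, e) > m / 2" using e0(2)[OF e] unfolding m_def[symmetric] dist_real_def by linarith
    have "\<exists>\<beta>\<in>\<B>. f \<beta> (A, e) \<ge> c"
    proof (rule ccontr)
      assume "\<not> ?thesis"
      then have "F (A, e) \<le> (\<Sum>\<beta>\<in>\<B>. c)" unfolding F_def by (intro sum_mono) (auto simp: not_le less_imp_le)
      also have "\<dots> = card \<B> * c" by simp
      also have "\<dots> \<le> card \<B> * (m / 2 / (1 + card \<B>))"
        by (intro mult_left_mono) (simp_all only: c_def min.cobounded2 of_nat_0_le_iff)
      also have "\<dots> \<le> m / 2" using m by (simp add: field_simps)
      finally show False using FA by simp
    qed
    then obtain \<beta> where \<beta>: "\<beta> \<in> \<B>" "f \<beta> (A, e) \<ge> c" by blast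
    have "c \<le> (det (completed_frame (A $ j) e (K j) (\<beta> j)))\<^sup>2" for j
    proof -
      define q where "q = (\<lambda>j. min 1 ((det (completed_frame (A $ j) e (K j) (\<beta> j)))\<^sup>2))"
      have "f \<beta> (A, e) = q j * (\<Prod>i\<in>UNIV - {j}. q i)"
        unfolding f_def q_def by (subst prod.remove[of _ j]) auto
      also have "\<dots> \<le> q j * 1"
        by (intro mult_left_mono prod_le_1) (auto simp: q_def)
      finally show ?thesis using \<beta>(2) by (simp add: q_def)
    qed
    then show "\<exists>\<beta>. admissible 0 p K \<beta> \<and> (\<forall>j. c \<le> (det (completed_frame (A $ j) e (K j) (\<beta> j)))\<^sup>2)"
      using \<beta>(1) by (auto simp: \<B>_def)
  qed
  then show ?thesis using c \<delta>(1) by (intro exI[of _ c] exI[of _ "min 1 \<delta>"]) auto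
qed

text \<open>Shrinking the exponents makes every condition strict: the tail at \<open>t\<close> gains \<open>\<epsilon>\<close> for each index from \<open>t\<close> on.\<close>

lemma frame_bounds_subcritical:
  assumes "frame_bounds c 0 p A K" and \<epsilon>: "0 \<le> \<epsilon>" "\<epsilon> \<le> 1"
  shows "frame_bounds c \<epsilon> (\<lambda>j. (1 - \<epsilon>) * p j) A K"
proof -
  have "admissible \<epsilon> (\<lambda>j. (1 - \<epsilon>) * p j) K \<beta>" if \<beta>: "admissible 0 p K \<beta>" for \<beta>
    unfolding admissible_def
  proof (intro conjI allI)
    show "bij (\<beta> j)" for j using \<beta> by (simp add: admissible_def)
    fix t
    have fe: "frame_exponent (\<lambda>j. (1 - \<epsilon>) * p j) K \<beta> k = (1 - \<epsilon>) * frame_exponent p K \<beta> k" for k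
      unfolding frame_exponent_def by (simp add: sum_distrib_left if_distrib cong: if_cong)
    have "(\<Sum>k\<in>{t..}. 1 - frame_exponent (\<lambda>j. (1 - \<epsilon>) * p j) K \<beta> k)
        = (\<Sum>k\<in>{t..}. (1 - \<epsilon>) * (1 - frame_exponent p K \<beta> k) + \<epsilon>)"
      unfolding fe by (intro sum.cong refl) (simp add: algebra_simps)
    also have "\<dots> = (1 - \<epsilon>) * (\<Sum>k\<in>{t..}. 1 - frame_exponent p K \<beta> k) + \<epsilon> * card {t..}"
      by (simp add: sum.distrib sum_distrib_left)
    also have "\<dots> \<ge> 0 + \<epsilon> * 1"
    proof (rule add_mono)
      show "0 \<le> (1 - \<epsilon>) * (\<Sum>k\<in>{t..}. 1 - frame_exponent p K \<beta> k)"
        using \<beta> \<epsilon> by (intro mult_nonneg_nonneg) (auto simp: admissible_def)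
      have "card {t..} \<ge> 1" using card_gt_0_iff[of "{t..}"] by (simp add: Suc_le_eq)
      then show "\<epsilon> * 1 \<le> \<epsilon> * card {t..}" using \<epsilon> by (intro mult_left_mono) auto
    qed
    finally show "\<epsilon> \<le> (\<Sum>k\<in>{t..}. 1 - frame_exponent (\<lambda>j. (1 - \<epsilon>) * p j) K \<beta> k)" by simp
  qed
  then show ?thesis using assms(1) unfolding frame_bounds_def by blast
qed

text \<open>On the unit ball the Gaussian weight is at least \<open>exp (- 1/2)\<close>.  For the exponents \<open>(1 - \<epsilon>) p\<close> an extremal covariance
  exists and the constants are bounded as \<open>\<epsilon>\<close> tends to \<open>0\<close>; Fatou's lemma gives the limit.\<close>

lemma coord_BL_bound_of_frame_bounds:
  fixes A :: "'m::finite \<Rightarrow> real^'n::{finite,wellorder}^'n::_"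
  assumes fb: "frame_bounds c 0 p A K" and c: "0 < c" "c \<le> 1" and p: "\<And>j. p j \<ge> 0"
    and rows: "\<And>j z. complement_proj (K j) *v (A j *v z) = 0"
  shows "coord_BL_bound A K p (exp (1/2) * (gauss_mass TYPE(real^'n::_) * sqrt (c powr (- (\<Sum>j\<in>UNIV. p j)) * (1 + fact CARD('n)) * exp (real CARD('n)))))"
  unfolding coord_BL_bound_def
proof (intro allI impI)
  fix g :: "'m \<Rightarrow> real^'n::_ \<Rightarrow> real" and I :: "'m \<Rightarrow> real"
  assume gI: "\<forall>j. g j \<in> borel_measurable borel \<and> (\<forall>y. 0 \<le> g j y \<and> g j (coord_proj (K j) y) = g j y) \<and> 0 \<le> I j \<and>
       (\<integral>\<^sup>+y. ennreal (g j y * exp (- ((norm (complement_proj (K j) *v y))\<^sup>2 / 2))) \<partial>lborel) = ennreal (I j)"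
  have gm[measurable]: "g j \<in> borel_measurable borel" for j using gI by blast
  define D where "D = gauss_mass TYPE(real^'n::_) * sqrt (c powr (- (\<Sum>j\<in>UNIV. p j)) * (1 + fact CARD('n)) * exp (real CARD('n)))"
  have D: "D \<ge> 0" unfolding D_def using gauss_mass_pos[where 'a="real^'n::_"] by (intro mult_nonneg_nonneg) auto
  define \<epsilon> where "\<epsilon> = (\<lambda>k::nat. 1 / (real k + 2))"
  have \<epsilon>: "0 < \<epsilon> k" "\<epsilon> k \<le> 1" for k by (auto simp: \<epsilon>_def)
  have \<epsilon>0: "\<epsilon> \<longlonglongrightarrow> 0" unfolding \<epsilon>_def by real_asymp
  define q where "q = (\<lambda>k j. (1 - \<epsilon> k) * p j)"
  have q: "q k j \<ge> 0" for k j unfolding q_def using \<epsilon>(2)[of k] p[of j] by simp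
  define F where "F = (\<lambda>k x. ennreal (\<Prod>j\<in>UNIV. rpow (g j (A j *v x)) (q k j)) * indicator (cball 0 1) x)"
  have [measurable]: "cball (0::real^'n::_) 1 \<in> sets borel" by (rule borel_closed) simp
  have [measurable]: "F k \<in> borel_measurable borel" for k unfolding F_def by measurable
  have rq: "(\<lambda>k. rpow x (q k j)) \<longlonglongrightarrow> rpow x (p j)" if x: "x \<ge> 0" for x j
  proof (cases "p j = 0")
    case True
    then show ?thesis by (simp add: q_def)
  next
    case False
    then have q0: "q k j \<noteq> 0" for k using \<epsilon>[of k] by (auto simp: q_def \<epsilon>_def)
    then have e: "(\<lambda>k. rpow x (q k j)) = (\<lambda>k. x powr (q k j))" by (simp add: rpow_def)
    have ql: "(\<lambda>k. q k j) \<longlonglongrightarrow> (1 - 0) * p j" unfolding q_def by (intro tendsto_intros \<epsilon>0)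
    show ?thesis
    proof (cases "x = 0")
      case True
      then show ?thesis using False q0 by (simp add: rpow_def)
    next
      case False
      then have "(\<lambda>k. x powr (q k j)) \<longlonglongrightarrow> x powr ((1 - 0) * p j)" by (intro tendsto_powr ql tendsto_const) simp
      then show ?thesis unfolding e using \<open>p j \<noteq> 0\<close> by (simp add: rpow_def)
    qed
  qed
  have step: "(\<integral>\<^sup>+x. F k x \<partial>lborel) \<le> ennreal (exp (1/2) * D * (\<Prod>j\<in>UNIV. rpow (I j) (q k j)))" for k
  proof -
    have fbk: "frame_bounds c (\<epsilon> k) (q k) A K" unfolding q_def by (rule frame_bounds_subcritical[OF fb]) (use \<epsilon>[of k] in auto)
    have "F k x \<le> ennreal (exp (1/2)) * ennreal (exp (- ((norm x)\<^sup>2 / 2)) * (\<Prod>j\<in>UNIV. rpow (g j (A j *v x)) (q k j)))" for x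
    proof (cases "x \<in> cball 0 1")
      case True
      then have "(norm x)\<^sup>2 \<le> 1" by (simp add: power_le_one)
      then have "1 \<le> exp (1/2) * exp (- ((norm x)\<^sup>2 / 2))" unfolding exp_add[symmetric] by simp
      then have "1 * (\<Prod>j\<in>UNIV. rpow (g j (A j *v x)) (q k j)) \<le> (exp (1/2) * exp (- ((norm x)\<^sup>2 / 2))) * (\<Prod>j\<in>UNIV. rpow (g j (A j *v x)) (q k j))"
        by (intro mult_right_mono prod_nonneg) auto
      then show ?thesis using True unfolding F_def by (simp add: ennreal_mult[symmetric] prod_nonneg mult.assoc ennreal_leI)
    qed (simp add: F_def)
    then have "(\<integral>\<^sup>+x. F k x \<partial>lborel) \<le> (\<integral>\<^sup>+x. ennreal (exp (1/2)) * ennreal (exp (- ((norm x)\<^sup>2 / 2)) * (\<Prod>j\<in>UNIV. rpow (g j (A j *v x)) (q k j))) \<partial>lborel)"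
      by (intro nn_integral_mono)
    also have "\<dots> = ennreal (exp (1/2)) * (\<integral>\<^sup>+x. ennreal (exp (- ((norm x)\<^sup>2 / 2)) * (\<Prod>j\<in>UNIV. rpow (g j (A j *v x)) (q k j))) \<partial>lborel)"
      by (rule nn_integral_cmult) measurable
    also have "\<dots> \<le> ennreal (exp (1/2)) * ennreal (gauss_mass TYPE(real^'n::_) * sqrt (c powr (- (\<Sum>j\<in>UNIV. q k j)) * (1 + fact CARD('n)) * exp (real CARD('n)))
        * (\<Prod>j\<in>UNIV. rpow (I j) (q k j)))"
      by (intro mult_left_mono gaussian_localised_brascamp_lieb[OF fbk c(1) q \<epsilon>(1) rows]) (use gI in auto)
    also have "\<dots> \<le> ennreal (exp (1/2)) * ennreal (D * (\<Prod>j\<in>UNIV. rpow (I j) (q k j)))"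
    proof (intro mult_left_mono ennreal_leI mult_right_mono prod_nonneg)
      have "(\<Sum>j\<in>UNIV. q k j) \<le> (\<Sum>j\<in>UNIV. p j)"
        unfolding q_def using \<epsilon>[of k] p by (intro sum_mono mult_left_le_one_le) auto
      then have "c powr (- (\<Sum>j\<in>UNIV. q k j)) \<le> c powr (- (\<Sum>j\<in>UNIV. p j))"
        using c by (intro powr_mono') auto
      then show "gauss_mass TYPE(real^'n::_) * sqrt (c powr (- (\<Sum>j\<in>UNIV. q k j)) * (1 + fact CARD('n)) * exp (real CARD('n))) \<le> D"
        unfolding D_def using gauss_mass_pos[where 'a="real^'n::_"]
        by (intro mult_left_mono real_sqrt_le_mono mult_right_mono) auto
    qed auto
    also have "\<dots> = ennreal (exp (1/2) * D * (\<Prod>j\<in>UNIV. rpow (I j) (q k j)))"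
      using D by (simp add: ennreal_mult[symmetric] prod_nonneg mult.assoc)
    finally show ?thesis .
  qed
  have Flim: "ennreal (\<Prod>j\<in>UNIV. rpow (g j (A j *v x)) (p j)) * indicator (cball 0 1) x = liminf (\<lambda>k. F k x)" for x
  proof -
    have "(\<lambda>k. \<Prod>j\<in>UNIV. rpow (g j (A j *v x)) (q k j)) \<longlonglongrightarrow> (\<Prod>j\<in>UNIV. rpow (g j (A j *v x)) (p j))"
      using gI by (intro tendsto_prod rq) auto
    then have "(\<lambda>k. ennreal (\<Prod>j\<in>UNIV. rpow (g j (A j *v x)) (q k j))) \<longlonglongrightarrow> ennreal (\<Prod>j\<in>UNIV. rpow (g j (A j *v x)) (p j))"
      by (rule tendsto_ennrealI)
    then have "(\<lambda>k. F k x) \<longlonglongrightarrow> ennreal (\<Prod>j\<in>UNIV. rpow (g j (A j *v x)) (p j)) * indicator (cball 0 1) x"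
      unfolding F_def by (cases "x \<in> cball 0 1") auto
    then show ?thesis by (intro lim_imp_Liminf[symmetric]) auto
  qed
  have "(\<integral>\<^sup>+x\<in>cball 0 1. ennreal (\<Prod>j\<in>UNIV. rpow (g j (A j *v x)) (p j)) \<partial>lborel) \<le> liminf (\<lambda>k. \<integral>\<^sup>+x. F k x \<partial>lborel)"
    unfolding Flim by (rule nn_integral_liminf) simp
  also have "\<dots> \<le> liminf (\<lambda>k. ennreal (exp (1/2) * D * (\<Prod>j\<in>UNIV. rpow (I j) (q k j))))"
    by (rule Liminf_mono) (use step in auto)
  also have "\<dots> = ennreal (exp (1/2) * D * (\<Prod>j\<in>UNIV. rpow (I j) (p j)))"
  proof (intro lim_imp_Liminf tendsto_ennrealI tendsto_mult tendsto_const tendsto_prod rq)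
    show "0 \<le> I j" for j using gI by blast
  qed simp
  finally show "(\<integral>\<^sup>+x\<in>cball 0 1. ennreal (\<Prod>j\<in>UNIV. rpow (g j (A j *v x)) (p j)) \<partial>lborel)
     \<le> ennreal (exp (1/2) * (gauss_mass TYPE(real^'n::_) * sqrt (c powr (- (\<Sum>j\<in>UNIV. p j)) * (1 + fact CARD('n)) * exp (real CARD('n)))) * (\<Prod>j\<in>UNIV. rpow (I j) (p j)))"
    by (simp only: D_def)
qed

theorem coord_BL_bound_stable:
  fixes A0 :: "(real^'n::{finite,wellorder}^'n::_)^'m::finite"
  assumes BL: "coord_BL_bound (\<lambda>j. A0 $ j) K p C0" and C0: "C0 \<ge> 0" and p: "\<And>j. p j \<ge> 0"
    and r: "\<And>j. range ((*v) (A0 $ j)) = {y. complement_proj (K j) *v y = 0}"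
  shows "\<exists>\<delta> C. 0 < \<delta> \<and> 0 \<le> C \<and> (\<forall>A. norm (A - A0) < \<delta> \<longrightarrow> (\<forall>j z. complement_proj (K j) *v ((A $ j) *v z) = 0) \<longrightarrow> coord_BL_bound (\<lambda>j. A $ j) K p C)"
proof -
  obtain c \<delta> where c: "0 < c" "c \<le> 1" "0 < \<delta>" and fb: "\<And>A. norm (A - A0) < \<delta> \<Longrightarrow> frame_bounds c 0 p (\<lambda>j. A $ j) K"
    using frame_bounds_near[OF admissible_of_bound[OF BL C0 p r]] by metis
  show ?thesis
    using c coord_BL_bound_of_frame_bounds[OF fb c(1,2) p] gauss_mass_pos[where 'a="real^'n::_"]
    by (intro exI[of _ \<delta>] exI[of _ "exp (1/2) * (gauss_mass TYPE(real^'n::_) * sqrt (c powr (- (\<Sum>j\<in>UNIV. p j)) * (1 + fact CARD('n)) * exp (real CARD('n))))"]) auto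
qed

section \<open>Coordinates\<close>

text \<open>A well-ordered index type with \<open>DIM('a)\<close> elements, which identifies \<open>'a\<close> with a space of vectors on which
  matrices act.\<close>

typedef (overloaded) ('a::euclidean_space) coord = "{..<DIM('a)}"
  using DIM_positive by blast

instantiation coord :: (euclidean_space) wellorder
begin
definition less_eq_coord :: "'a coord \<Rightarrow> 'a coord \<Rightarrow> bool" where "less_eq_coord x y \<longleftrightarrow> Rep_coord x \<le> Rep_coord y"
definition less_coord :: "'a coord \<Rightarrow> 'a coord \<Rightarrow> bool" where "less_coord x y \<longleftrightarrow> Rep_coord x < Rep_coord y"
instance
proof
  fix x y z :: "'a coord"
  show "(x < y) = (x \<le> y \<and> \<not> y \<le> x)" "x \<le> x" "x \<le> y \<or> y \<le> x"
    by (auto simp: less_eq_coord_def less_coord_def)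
  show "x \<le> y \<Longrightarrow> y \<le> z \<Longrightarrow> x \<le> z" by (auto simp: less_eq_coord_def)
  show "x \<le> y \<Longrightarrow> y \<le> x \<Longrightarrow> x = y" by (auto simp: less_eq_coord_def Rep_coord_inject[symmetric])
next
  fix P and a :: "'a coord"
  assume step: "\<And>x :: 'a coord. (\<And>y. y < x \<Longrightarrow> P y) \<Longrightarrow> P x"
  show "P a"
    by (induction a rule: measure_induct_rule[of Rep_coord]) (rule step, simp add: less_coord_def)
qed
end

instance coord :: (euclidean_space) finite
proof
  have eq: "(UNIV :: 'a coord set) = Abs_coord ` {..<DIM('a)}"
    using type_definition.Abs_image[OF type_definition_coord[where 'a='a]] by simp
  show "finite (UNIV :: 'a coord set)" unfolding eq by (intro finite_imageI finite_lessThan)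
qed

lemma card_coord: "CARD('a::euclidean_space coord) = DIM('a)"
  using type_definition.card[OF type_definition_coord[where 'a='a]] by simp

definition basis_vec :: "'a::euclidean_space coord \<Rightarrow> 'a" where
  "basis_vec = (SOME f. bij_betw f UNIV Basis)"

lemma bij_basis_vec: "bij_betw (basis_vec :: 'a::euclidean_space coord \<Rightarrow> 'a) UNIV Basis"
proof -
  have "\<exists>f. bij_betw f (UNIV :: 'a coord set) (Basis :: 'a set)"
    by (rule finite_same_card_bij) (auto simp: card_coord)
  then show ?thesis unfolding basis_vec_def by (rule someI_ex)
qed

definition to_coord :: "'a::euclidean_space \<Rightarrow> real^('a coord)" where
  "to_coord x = (\<chi> k. x \<bullet> basis_vec k)"
definition of_coord :: "real^('a coord) \<Rightarrow> 'a::euclidean_space" where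
  "of_coord y = (\<Sum>k\<in>UNIV. y $ k *\<^sub>R basis_vec k)"

lemma basis_vec_Basis: "basis_vec k \<in> Basis"
  using bij_basis_vec by (auto simp: bij_betw_def)

lemma basis_vec_inner: "basis_vec k \<bullet> basis_vec l = (if k = l then 1 else 0)"
  using bij_basis_vec inner_not_same_Basis[OF basis_vec_Basis basis_vec_Basis, of k l]
  by (auto simp: inner_same_Basis[OF basis_vec_Basis] bij_betw_def inj_on_def)

lemma to_of_coord: "to_coord (of_coord y) = y"
  by (simp add: to_coord_def of_coord_def vec_eq_iff inner_sum_left basis_vec_inner if_distrib cong: if_cong)

lemma of_to_coord: "of_coord (to_coord x) = (x::'a::euclidean_space)"
proof -
  have "of_coord (to_coord x) = (\<Sum>k\<in>UNIV. (x \<bullet> basis_vec k) *\<^sub>R basis_vec k)" by (simp add: of_coord_def to_coord_def)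
  also have "\<dots> = (\<Sum>b\<in>Basis. (x \<bullet> b) *\<^sub>R b)" by (rule sum.reindex_bij_betw[OF bij_basis_vec])
  finally show ?thesis by (simp add: euclidean_representation)
qed

lemma linear_of_coord: "linear of_coord"
  by (rule linearI) (simp_all add: of_coord_def scaleR_add_left sum.distrib scaleR_sum_right)

lemma linear_to_coord: "linear to_coord"
  by (rule linearI) (simp_all add: to_coord_def vec_eq_iff inner_add_left)

lemma norm_of_coord: "norm (of_coord y) = norm y"
proof -
  have "(norm (of_coord y))\<^sup>2 = (norm y)\<^sup>2"
    unfolding power2_norm_eq_inner
    by (simp add: of_coord_def inner_vec_def inner_sum_left inner_sum_right basis_vec_inner if_distrib cong: if_cong)
  then show ?thesis by simp
qed

lemma of_coord_measurable [measurable]: "of_coord \<in> borel \<rightarrow>\<^sub>M borel"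
  by (rule borel_measurable_continuous_onI) (simp add: linear_of_coord linear_continuous_on linear_conv_bounded_linear[symmetric])

lemma prod_Basis_vec: "(\<Prod>b\<in>Basis. f b) = (\<Prod>k\<in>UNIV. f (axis k (1::real) :: real^'n))"
proof -
  have B: "Basis = range (\<lambda>k::'n. axis k (1::real))" by (auto simp: Basis_vec_def)
  have "inj (\<lambda>k::'n. axis k (1::real))" by (auto simp: inj_on_def axis_eq_axis)
  then show ?thesis unfolding B by (simp add: prod.reindex)
qed

lemma distr_of_coord: "lborel = distr lborel borel (of_coord :: real^('a coord) \<Rightarrow> 'a::euclidean_space)"
proof (rule lborel_eqI)
  fix l u :: 'a assume le: "\<And>b. b \<in> Basis \<Longrightarrow> l \<bullet> b \<le> u \<bullet> b"
  have inn: "of_coord y \<bullet> basis_vec k = y $ k" for y and k :: "'a coord"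
    using to_of_coord[of y] by (simp add: to_coord_def vec_eq_iff)
  have all: "(\<forall>b\<in>Basis. P b) \<longleftrightarrow> (\<forall>k. P (basis_vec k))" for P :: "'a \<Rightarrow> bool"
    using bij_basis_vec unfolding bij_betw_def by (metis UNIV_I imageE image_eqI)
  have vim: "of_coord -` box l u = box (to_coord l) (to_coord u)"
  proof (rule set_eqI)
    fix x
    have "of_coord x \<in> box l u \<longleftrightarrow> (\<forall>k. l \<bullet> basis_vec k < x $ k \<and> x $ k < u \<bullet> basis_vec k)"
      unfolding mem_box all inn ..
    then show "x \<in> of_coord -` box l u \<longleftrightarrow> x \<in> box (to_coord l) (to_coord u)"
      by (simp add: mem_box_cart to_coord_def)
  qed
  have "emeasure (distr lborel borel of_coord) (box l u) = emeasure lborel (box (to_coord l) (to_coord u))"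
    by (simp add: emeasure_distr vim)
  also have "\<dots> = ennreal (\<Prod>b\<in>Basis. (to_coord u - to_coord l) \<bullet> b)"
  proof (rule emeasure_lborel_box)
    show "to_coord l \<bullet> b \<le> to_coord u \<bullet> b" if "b \<in> Basis" for b
      using that le[OF basis_vec_Basis] by (auto simp: Basis_vec_def inner_axis to_coord_def)
  qed
  also have "(\<Prod>b\<in>Basis. (to_coord u - to_coord l) \<bullet> b) = (\<Prod>k\<in>UNIV. (u - l) \<bullet> basis_vec k)"
    by (simp add: prod_Basis_vec inner_axis to_coord_def inner_diff_left)
  also have "\<dots> = (\<Prod>b\<in>Basis. (u - l) \<bullet> b)" by (rule prod.reindex_bij_betw[OF bij_basis_vec])
  finally show "emeasure (distr lborel borel of_coord) (box l u) = (\<Prod>b\<in>Basis. (u - l) \<bullet> b)" .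
qed simp

lemma nn_integral_of_coord:
  assumes [measurable]: "f \<in> borel_measurable borel"
  shows "(\<integral>\<^sup>+x. f x \<partial>lborel) = (\<integral>\<^sup>+y. f (of_coord y) \<partial>lborel)"
  by (subst distr_of_coord) (simp add: nn_integral_distr)

section \<open>Lebesgue measure on a subspace\<close>

interpretation real_lborel: product_sigma_finite "\<lambda>_. lborel :: real measure"
  by standard

lemma PiM_reindex:
  assumes "finite K" and \<beta>: "bij_betw \<beta> K B"
  shows "PiM B (\<lambda>_. lborel :: real measure) = distr (PiM K (\<lambda>_. lborel)) (PiM B (\<lambda>_. lborel)) (\<lambda>c. \<lambda>b\<in>B. c (the_inv_into K \<beta> b))"
proof (rule sym, rule real_lborel.PiM_eqI)
  have inj: "inj_on \<beta> K" and im: "\<beta> ` K = B" using \<beta> by (auto simp: bij_betw_def)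
  show "finite B" using assms bij_betw_finite by blast
  have inv: "the_inv_into K \<beta> b \<in> K" "\<beta> (the_inv_into K \<beta> b) = b" if "b \<in> B" for b
    using that inj im by (auto simp: the_inv_into_into f_the_inv_into_f)
  have m[measurable]: "(\<lambda>c. \<lambda>b\<in>B. c (the_inv_into K \<beta> b)) \<in> PiM K (\<lambda>_. lborel :: real measure) \<rightarrow>\<^sub>M PiM B (\<lambda>_. lborel)"
    by (intro measurable_restrict measurable_component_singleton inv)
  fix A :: "'b \<Rightarrow> real set" assume A: "\<And>i. i \<in> B \<Longrightarrow> A i \<in> sets lborel"
  have "(\<lambda>c. \<lambda>b\<in>B. c (the_inv_into K \<beta> b)) -` Pi\<^sub>E B A \<inter> space (PiM K (\<lambda>_. lborel)) = Pi\<^sub>E K (\<lambda>k. A (\<beta> k))"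
  proof (intro set_eqI iffI)
    fix c assume c: "c \<in> (\<lambda>c. \<lambda>b\<in>B. c (the_inv_into K \<beta> b)) -` Pi\<^sub>E B A \<inter> space (PiM K (\<lambda>_. lborel))"
    show "c \<in> Pi\<^sub>E K (\<lambda>k. A (\<beta> k))"
    proof (rule PiE_I)
      fix k assume k: "k \<in> K"
      then have b: "\<beta> k \<in> B" using im by auto
      have "(\<lambda>b\<in>B. c (the_inv_into K \<beta> b)) (\<beta> k) \<in> A (\<beta> k)" using c b by (auto simp: PiE_iff)
      then show "c k \<in> A (\<beta> k)" using b k inj by (simp add: the_inv_into_f_f)
    next
      fix k assume "k \<notin> K"
      then show "c k = undefined" using c by (auto simp: space_PiM PiE_def extensional_def)
    qed
  next
    fix c assume "c \<in> Pi\<^sub>E K (\<lambda>k. A (\<beta> k))"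
    then show "c \<in> (\<lambda>c. \<lambda>b\<in>B. c (the_inv_into K \<beta> b)) -` Pi\<^sub>E B A \<inter> space (PiM K (\<lambda>_. lborel))"
      using inv by (auto simp: space_PiM PiE_iff) metis
  qed
  then have "emeasure (distr (PiM K (\<lambda>_. lborel)) (PiM B (\<lambda>_. lborel)) (\<lambda>c. \<lambda>b\<in>B. c (the_inv_into K \<beta> b))) (Pi\<^sub>E B A)
     = emeasure (PiM K (\<lambda>_. lborel)) (Pi\<^sub>E K (\<lambda>k. A (\<beta> k)))"
    using A by (subst emeasure_distr[OF m]) (auto intro!: sets_PiM_I_finite \<open>finite B\<close>)
  also have "\<dots> = (\<Prod>k\<in>K. emeasure lborel (A (\<beta> k)))"
    using A im assms(1) by (intro real_lborel.emeasure_PiM) auto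
  also have "\<dots> = (\<Prod>b\<in>B. emeasure lborel (A b))" by (rule prod.reindex_bij_betw[OF \<beta>])
  finally show "emeasure (distr (PiM K (\<lambda>_. lborel)) (PiM B (\<lambda>_. lborel)) (\<lambda>c. \<lambda>b\<in>B. c (the_inv_into K \<beta> b))) (Pi\<^sub>E B A)
     = (\<Prod>b\<in>B. emeasure lborel (A b))" .
qed simp

lemma vec_lambda_measurable [measurable]: "vec_lambda \<in> PiM (UNIV :: 'n::finite set) (\<lambda>_. lborel :: real measure) \<rightarrow>\<^sub>M borel"
proof (rule borel_measurable_euclidean_space[THEN iffD2], intro ballI)
  fix b :: "real^'n" assume "b \<in> Basis"
  then obtain i where "b = axis i 1" by (auto simp: Basis_vec_def)
  then show "(\<lambda>c. vec_lambda c \<bullet> b) \<in> borel_measurable (PiM UNIV (\<lambda>_. lborel))" by (simp add: inner_axis)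
qed

lemma lborel_eq_distr_PiM: "lborel = distr (PiM UNIV (\<lambda>_. lborel :: real measure)) borel (vec_lambda :: ('n::finite \<Rightarrow> real) \<Rightarrow> real^'n)"
proof (rule lborel_eqI)
  fix l u :: "real^'n" assume le: "\<And>b. b \<in> Basis \<Longrightarrow> l \<bullet> b \<le> u \<bullet> b"
  have le': "l $ i \<le> u $ i" for i using le[of "axis i 1"] by (simp add: inner_axis)
  have "vec_lambda -` box l u \<inter> space (PiM UNIV (\<lambda>_. lborel :: real measure)) = Pi\<^sub>E UNIV (\<lambda>i. {l $ i<..<u $ i})"
    by (auto simp: space_PiM mem_box_cart PiE_iff)
  then have "emeasure (distr (PiM UNIV (\<lambda>_. lborel :: real measure)) borel vec_lambda) (box l u) = emeasure (PiM UNIV (\<lambda>_. lborel :: real measure)) (Pi\<^sub>E UNIV (\<lambda>i. {l $ i<..<u $ i}))"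
    by (subst emeasure_distr) auto
  also have "\<dots> = (\<Prod>i\<in>UNIV. emeasure lborel {l $ i<..<u $ i})" by (rule real_lborel.emeasure_PiM) auto
  also have "\<dots> = (\<Prod>i\<in>UNIV. ennreal (u $ i - l $ i))" using le' by simp
  also have "\<dots> = ennreal (\<Prod>i\<in>UNIV. u $ i - l $ i)" using le' by (intro prod_ennreal) simp
  also have "(\<Prod>i\<in>UNIV. u $ i - l $ i) = (\<Prod>b\<in>Basis. (u - l) \<bullet> b)"
    by (simp add: prod_Basis_vec inner_axis)
  finally show "emeasure (distr (PiM UNIV (\<lambda>_. lborel :: real measure)) borel vec_lambda) (box l u) = (\<Prod>b\<in>Basis. (u - l) \<bullet> b)" .
qed simp

text \<open>The frame \<open>\<beta>\<close> enumerates, by a set \<open>K\<close> of coordinates, the very basis by which the Lebesgue measure on \<open>V\<close> is defined.  It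
  turns functions on \<open>V\<close> into functions of the coordinates in \<open>K\<close>; padding with a Gaussian in the other coordinates
  multiplies integrals by the constant \<open>pad_mass\<close>.\<close>

locale subspace_frame =
  fixes V :: "'b::euclidean_space set" and K :: "'n::finite set" and \<beta> :: "'n \<Rightarrow> 'b"
  assumes frame: "bij_betw \<beta> K (SOME B. orthonormal_basis_of V B)" and V: "subspace V"
begin

definition "B = (SOME B. orthonormal_basis_of V B)"
definition "lin_comb y = (\<Sum>i\<in>K. y $ i *\<^sub>R \<beta> i)" for y :: "real^'n"
definition "coords v = (\<chi> i. if i \<in> K then \<beta> i \<bullet> v else 0)" for v :: 'b

lemma B: "orthonormal_basis_of V B"
  unfolding B_def using someI_ex[OF orthonormal_basis_of_exists[OF V]] .

lemma bij\<beta>: "bij_betw \<beta> K B" using frame by (simp add: B_def)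

lemma \<beta>_inner: "i \<in> K \<Longrightarrow> j \<in> K \<Longrightarrow> \<beta> i \<bullet> \<beta> j = (if i = j then 1 else 0)"
proof -
  assume i: "i \<in> K" "j \<in> K"
  then have b: "\<beta> i \<in> B" "\<beta> j \<in> B" using bij\<beta> by (auto simp: bij_betw_def)
  have "\<beta> i = \<beta> j \<longleftrightarrow> i = j" using i bij\<beta> by (auto simp: bij_betw_def inj_on_def)
  moreover have "norm (\<beta> i) = 1" using B b by (simp add: orthonormal_basis_of_def)
  moreover have "\<beta> i \<noteq> \<beta> j \<Longrightarrow> \<beta> i \<bullet> \<beta> j = 0" using B b by (auto simp: orthonormal_basis_of_def pairwise_def orthogonal_def)
  ultimately show ?thesis by (auto simp: norm_eq_1)
qed

lemma lin_comb_in: "lin_comb y \<in> V"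
proof -
  have "\<beta> i \<in> V" if "i \<in> K" for i
    using that bij\<beta> B span_base[of "\<beta> i" B] by (auto simp: bij_betw_def orthonormal_basis_of_def)
  then show ?thesis unfolding lin_comb_def by (intro subspace_sum[OF V] subspace_scale[OF V]) auto
qed

lemma linear_lin_comb: "linear lin_comb"
  by (rule linearI) (simp_all add: lin_comb_def scaleR_add_left sum.distrib scaleR_sum_right)

lemma linear_coords: "linear coords"
  by (rule linearI) (simp_all add: coords_def vec_eq_iff inner_add_right)

lemma coords_lin_comb: "coords (lin_comb y) = coord_proj K y"
proof -
  have "\<beta> i \<bullet> lin_comb y = y $ i" if "i \<in> K" for i
  proof -
    have "\<beta> i \<bullet> lin_comb y = (\<Sum>j\<in>K. if j = i then y $ i else 0)"
      unfolding lin_comb_def inner_sum_right using that by (intro sum.cong refl) (auto simp: \<beta>_inner)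
    then show ?thesis using that by simp
  qed
  then show ?thesis by (simp add: coords_def coord_proj_def vec_eq_iff)
qed

lemma lin_comb_coord_proj: "lin_comb (coord_proj K y) = lin_comb y"
  by (simp add: lin_comb_def coord_proj_def)

lemma lin_comb_coords: assumes "v \<in> V" shows "lin_comb (coords v) = v"
proof -
  have fin: "finite B" using B by (rule orthonormal_basis_of_finite)
  have "lin_comb (coords v) = (\<Sum>i\<in>K. (\<beta> i \<bullet> v) *\<^sub>R \<beta> i)" by (simp add: lin_comb_def coords_def)
  also have "\<dots> = (\<Sum>b\<in>B. (b \<bullet> v) *\<^sub>R b)" by (rule sum.reindex_bij_betw[OF bij\<beta>])
  also have "\<dots> = v"
  proof (rule sym, rule vector_eq_dot_span)
    have Vs: "span B = V" using B by (simp add: orthonormal_basis_of_def)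
    show "v \<in> span B" using assms Vs by simp
    show "(\<Sum>b\<in>B. (b \<bullet> v) *\<^sub>R b) \<in> span B" by (intro span_sum span_scale span_base)
    fix b assume b: "b \<in> B"
    have "b \<bullet> (\<Sum>b'\<in>B. (b' \<bullet> v) *\<^sub>R b') = (\<Sum>b'\<in>B. if b' = b then b \<bullet> v else 0)"
      unfolding inner_sum_right using b B
      by (intro sum.cong refl) (auto simp: orthonormal_basis_of_def pairwise_def orthogonal_def norm_eq_1)
    then show "b \<bullet> v = b \<bullet> (\<Sum>b\<in>B. (b \<bullet> v) *\<^sub>R b)" using b fin by simp
  qed
  finally show ?thesis .
qed

definition "pad_mass = sqrt (2 * pi) ^ card (- K)"

lemma pad_mass_pos: "pad_mass > 0" by (simp add: pad_mass_def)

lemma sets_lborel_subspace: "sets (lborel_subspace V) = sets (restrict_space borel V)"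
  and space_lborel_subspace: "space (lborel_subspace V) = V"
  by (simp_all add: lborel_subspace_def Let_def space_restrict_space)

lemma lin_comb_measurable: "lin_comb \<in> borel \<rightarrow>\<^sub>M lborel_subspace V"
proof -
  have "lin_comb \<in> borel \<rightarrow>\<^sub>M restrict_space borel V"
    using lin_comb_in linear_lin_comb
    by (intro measurable_restrict_space2 borel_measurable_continuous_onI) (auto simp: linear_continuous_on linear_conv_bounded_linear[symmetric])
  then show ?thesis by (simp add: measurable_cong_sets[OF refl sets_lborel_subspace])
qed

lemma nn_integral_lborel_subspace:
  assumes f: "f \<in> borel_measurable (lborel_subspace V)"
  shows "(\<integral>\<^sup>+y. f (lin_comb y) * ennreal (exp (- ((norm (complement_proj K *v y))\<^sup>2 / 2))) \<partial>lborel)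
    = ennreal pad_mass * (\<integral>\<^sup>+v. f v \<partial>lborel_subspace V)"
proof -
  have fin: "finite B" using B by (rule orthonormal_basis_of_finite)
  have f': "f \<in> borel_measurable (restrict_space borel V)"
    using f measurable_cong_sets[OF sets_lborel_subspace refl] by blast
  have fe[measurable]: "(\<lambda>y. f (lin_comb y)) \<in> borel_measurable borel"
    by (rule measurable_compose[OF lin_comb_measurable f])
  define J where "J c = (\<Sum>i\<in>K. c i *\<^sub>R \<beta> i)" for c :: "'n \<Rightarrow> real"
  have Je: "J c = lin_comb (vec_lambda c)" for c by (simp add: J_def lin_comb_def)
  have JV: "J c \<in> V" for c unfolding Je by (rule lin_comb_in)
  have Jm: "J \<in> PiM K (\<lambda>_. lborel :: real measure) \<rightarrow>\<^sub>M restrict_space borel V"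
    using JV unfolding J_def by (intro measurable_restrict_space2) auto
  have fJ[measurable]: "(\<lambda>c. f (J c)) \<in> borel_measurable (PiM K (\<lambda>_. lborel :: real measure))"
    by (rule measurable_compose[OF Jm f'])
  have "(\<integral>\<^sup>+v. f v \<partial>lborel_subspace V) = (\<integral>\<^sup>+c. f (J c) \<partial>PiM K (\<lambda>_. lborel :: real measure))"
  proof -
    define E where "E c = (\<Sum>b\<in>B. c b *\<^sub>R b)" for c :: "'b \<Rightarrow> real"
    have EV: "E c \<in> V" for c
    proof -
      have "E c \<in> span B" unfolding E_def by (intro span_sum span_scale span_base)
      then show ?thesis using B by (simp add: orthonormal_basis_of_def)
    qed
    have Em: "E \<in> PiM B (\<lambda>_. lborel :: real measure) \<rightarrow>\<^sub>M restrict_space borel V"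
      using EV unfolding E_def by (intro measurable_restrict_space2) auto
    define \<rho> where "\<rho> c = (\<lambda>b\<in>B. c (the_inv_into K \<beta> b))" for c :: "'n \<Rightarrow> real"
    have inv: "the_inv_into K \<beta> b \<in> K" if "b \<in> B" for b
      using that bij\<beta> by (auto simp: bij_betw_def intro: the_inv_into_into)
    have \<rho>m: "\<rho> \<in> PiM K (\<lambda>_. lborel :: real measure) \<rightarrow>\<^sub>M PiM B (\<lambda>_. lborel)"
      unfolding \<rho>_def by (intro measurable_restrict measurable_component_singleton inv)
    have E\<rho>: "E (\<rho> c) = J c" for c
    proof -
      have "E (\<rho> c) = (\<Sum>i\<in>K. \<rho> c (\<beta> i) *\<^sub>R \<beta> i)"
        unfolding E_def by (rule sum.reindex_bij_betw[OF bij\<beta>, symmetric])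
      also have "\<dots> = J c" unfolding J_def
        using bij\<beta> by (intro sum.cong refl) (auto simp: \<rho>_def bij_betw_def the_inv_into_f_f)
      finally show ?thesis .
    qed
    have "(\<integral>\<^sup>+v. f v \<partial>lborel_subspace V) = (\<integral>\<^sup>+c. f (E c) \<partial>PiM B (\<lambda>_. lborel :: real measure))"
      unfolding lborel_subspace_def Let_def B_def[symmetric] E_def[symmetric]
      by (rule nn_integral_distr[OF Em]) (use f' in simp)
    also have "\<dots> = (\<integral>\<^sup>+c. f (E c) \<partial>distr (PiM K (\<lambda>_. lborel)) (PiM B (\<lambda>_. lborel)) \<rho>)"
    proof -
      have eq: "PiM B (\<lambda>_. lborel :: real measure) = distr (PiM K (\<lambda>_. lborel)) (PiM B (\<lambda>_. lborel)) \<rho>"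
        unfolding \<rho>_def[abs_def] by (rule PiM_reindex[OF _ bij\<beta>]) simp
      show ?thesis by (subst eq) (rule refl)
    qed
    also have "\<dots> = (\<integral>\<^sup>+c. f (E (\<rho> c)) \<partial>PiM K (\<lambda>_. lborel :: real measure))"
      by (rule nn_integral_distr[OF \<rho>m]) (use measurable_compose[OF Em f'] in simp)
    finally show ?thesis by (simp only: E\<rho>)
  qed
  moreover have "(\<integral>\<^sup>+y. f (lin_comb y) * ennreal (exp (- ((norm (complement_proj K *v y))\<^sup>2 / 2))) \<partial>lborel)
     = (\<integral>\<^sup>+c. f (J c) * ennreal pad_mass \<partial>PiM K (\<lambda>_. lborel :: real measure))"
  proof -
    define \<phi> where "\<phi> c = f (J c) * (\<Prod>i\<in>-K. ennreal (exp (- ((c i)\<^sup>2 / 2))))" for c :: "'n \<Rightarrow> real"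
    have nq: "exp (- ((norm (complement_proj K *v vec_lambda c))\<^sup>2 / 2)) = (\<Prod>i\<in>-K. exp (- ((c i)\<^sup>2 / 2)))" for c
    proof -
      have "(norm (complement_proj K *v vec_lambda c))\<^sup>2 = (\<Sum>i\<in>UNIV. if i \<in> K then 0 else (c i)\<^sup>2)"
        unfolding power2_norm_eq_inner by (simp add: complement_proj_vec inner_vec_def power2_eq_square if_distrib cong: if_cong)
      also have "\<dots> = (\<Sum>i\<in>-K. (c i)\<^sup>2)" by (simp add: sum.If_cases Collect_neg_eq)
      finally show ?thesis by (simp add: exp_sum[symmetric] sum_divide_distrib sum_negf)
    qed
    have fem: "(\<lambda>y. f (lin_comb y) * ennreal (exp (- ((norm (complement_proj K *v y))\<^sup>2 / 2)))) \<in> borel_measurable borel"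
      by measurable
    have "(\<integral>\<^sup>+y. f (lin_comb y) * ennreal (exp (- ((norm (complement_proj K *v y))\<^sup>2 / 2))) \<partial>lborel)
       = (\<integral>\<^sup>+c. f (lin_comb (vec_lambda c)) * ennreal (exp (- ((norm (complement_proj K *v vec_lambda c))\<^sup>2 / 2))) \<partial>PiM UNIV (\<lambda>_. lborel :: real measure))"
      by (subst lborel_eq_distr_PiM) (rule nn_integral_distr[OF vec_lambda_measurable], use fem in simp)
    also have "\<dots> = (\<integral>\<^sup>+c. \<phi> c \<partial>PiM (K \<union> - K) (\<lambda>_. lborel :: real measure))"
      by (simp add: \<phi>_def Je nq prod_ennreal)
    also have "\<dots> = (\<integral>\<^sup>+x. (\<integral>\<^sup>+y. \<phi> (merge K (- K) (x, y)) \<partial>PiM (- K) (\<lambda>_. lborel)) \<partial>PiM K (\<lambda>_. lborel))"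
    proof (rule real_lborel.product_nn_integral_fold)
      have "(\<lambda>c. f (lin_comb (vec_lambda c))) \<in> borel_measurable (PiM (K \<union> - K) (\<lambda>_. lborel :: real measure))"
        using measurable_compose[OF vec_lambda_measurable fe] by simp
      then show "\<phi> \<in> borel_measurable (PiM (K \<union> - K) (\<lambda>_. lborel :: real measure))"
        unfolding \<phi>_def Je by (intro borel_measurable_times_ennreal borel_measurable_prod_ennreal) auto
    qed auto
    also have "\<dots> = (\<integral>\<^sup>+x. f (J x) * ennreal pad_mass \<partial>PiM K (\<lambda>_. lborel))"
    proof (rule nn_integral_cong)
      fix x :: "'n \<Rightarrow> real"
      have "\<phi> (merge K (- K) (x, y)) = f (J x) * (\<Prod>i\<in>-K. ennreal (exp (- ((y i)\<^sup>2 / 2))))" for y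
      proof -
        have "J (merge K (- K) (x, y)) = J x" unfolding J_def by (intro sum.cong refl) simp
        moreover have "(\<Prod>i\<in>-K. ennreal (exp (- ((merge K (- K) (x, y) i)\<^sup>2 / 2)))) = (\<Prod>i\<in>-K. ennreal (exp (- ((y i)\<^sup>2 / 2))))"
          by (intro prod.cong refl) (auto simp: merge_def)
        ultimately show ?thesis by (simp add: \<phi>_def)
      qed
      then have "(\<integral>\<^sup>+y. \<phi> (merge K (- K) (x, y)) \<partial>PiM (- K) (\<lambda>_. lborel)) = (\<integral>\<^sup>+y. f (J x) * (\<Prod>i\<in>-K. ennreal (exp (- ((y i)\<^sup>2 / 2)))) \<partial>PiM (- K) (\<lambda>_. lborel :: real measure))"
        by simp
      also have "\<dots> = f (J x) * (\<integral>\<^sup>+y. (\<Prod>i\<in>-K. ennreal (exp (- ((y i)\<^sup>2 / 2)))) \<partial>PiM (- K) (\<lambda>_. lborel :: real measure))"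
        by (rule nn_integral_cmult) (intro borel_measurable_prod_ennreal, auto)
      also have "(\<integral>\<^sup>+y. (\<Prod>i\<in>-K. ennreal (exp (- ((y i)\<^sup>2 / 2)))) \<partial>PiM (- K) (\<lambda>_. lborel :: real measure)) = (\<Prod>i\<in>-K. \<integral>\<^sup>+t. ennreal (exp (- (t\<^sup>2 / 2))) \<partial>lborel)"
        by (rule real_lborel.product_nn_integral_prod) auto
      also have "\<dots> = ennreal pad_mass"
        by (simp add: nn_integral_exp_square_real pad_mass_def ennreal_power)
      finally show "(\<integral>\<^sup>+y. \<phi> (merge K (- K) (x, y)) \<partial>PiM (- K) (\<lambda>_. lborel)) = f (J x) * ennreal pad_mass" .
    qed
    finally show ?thesis .
  qed
  ultimately show ?thesis by (simp add: nn_integral_cmult[OF fJ] mult.commute)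
qed

end

section \<open>Comparison of norms\<close>

text \<open>The norm \<open>N\<close> is Lipschitz, by expansion in an orthonormal basis, and so attains a positive minimum on the compact
  unit sphere of \<open>S\<close>.\<close>

lemma norm_on_subspace_ge:
  fixes S :: "'v::euclidean_space set"
  assumes S: "subspace S" and N: "is_norm_on S N"
  shows "\<exists>c>0. \<forall>x\<in>S. c * norm x \<le> N x"
proof -
  have N0: "0 \<le> N x" and Nz: "N x = 0 \<longleftrightarrow> x = 0" and Ns: "N (t *\<^sub>R x) = \<bar>t\<bar> * N x" if "x \<in> S" for x t
    using N that by (auto simp: is_norm_on_def)
  have Nt: "N (x + y) \<le> N x + N y" if "x \<in> S" "y \<in> S" for x y
    using N that by (auto simp: is_norm_on_def)
  obtain B where B: "orthonormal_basis_of S B" using orthonormal_basis_of_exists[OF S] by blast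
  have fin: "finite B" using B by (rule orthonormal_basis_of_finite)
  have BS: "b \<in> S" if "b \<in> B" for b using that B span_base by (auto simp: orthonormal_basis_of_def)
  have b1: "norm b = 1" if "b \<in> B" for b using that B by (auto simp: orthonormal_basis_of_def)
  define M where "M = (\<Sum>b\<in>B. N b)"
  have M0: "M \<ge> 0" unfolding M_def using N0 BS by (intro sum_nonneg) auto
  have Nsum: "N (\<Sum>b\<in>F. f b *\<^sub>R b) \<le> (\<Sum>b\<in>F. \<bar>f b\<bar> * N b)" if "finite F" "F \<subseteq> B" for F f
    using that
  proof (induction F rule: finite_induct)
    case empty
    have "N 0 = 0" using Nz[of 0] subspace_0[OF S] by simp
    then show ?case by simp
  next
    case (insert b F)
    have "N (\<Sum>b\<in>insert b F. f b *\<^sub>R b) = N (f b *\<^sub>R b + (\<Sum>b\<in>F. f b *\<^sub>R b))" using insert by simp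
    also have "\<dots> \<le> N (f b *\<^sub>R b) + N (\<Sum>b\<in>F. f b *\<^sub>R b)"
      using insert.prems BS by (intro Nt subspace_scale[OF S] subspace_sum[OF S]) auto
    also have "N (f b *\<^sub>R b) = \<bar>f b\<bar> * N b" using insert.prems BS by (intro Ns) auto
    finally show ?case using insert by simp
  qed
  have up: "N x \<le> M * norm x" if x: "x \<in> S" for x
  proof -
    have ex: "x = (\<Sum>b\<in>B. (b \<bullet> x) *\<^sub>R b)"
    proof (rule vector_eq_dot_span)
      show "x \<in> span B" using x B by (simp add: orthonormal_basis_of_def)
      show "(\<Sum>b\<in>B. (b \<bullet> x) *\<^sub>R b) \<in> span B" by (intro span_sum span_scale span_base)
      fix b assume b: "b \<in> B"
      have "b \<bullet> (\<Sum>b'\<in>B. (b' \<bullet> x) *\<^sub>R b') = (\<Sum>b'\<in>B. if b' = b then b \<bullet> x else 0)"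
        unfolding inner_sum_right using b B
        by (intro sum.cong refl) (auto simp: orthonormal_basis_of_def pairwise_def orthogonal_def norm_eq_1)
      then show "b \<bullet> x = b \<bullet> (\<Sum>b\<in>B. (b \<bullet> x) *\<^sub>R b)" using b fin by simp
    qed
    have "N x \<le> (\<Sum>b\<in>B. \<bar>b \<bullet> x\<bar> * N b)" by (subst ex) (rule Nsum[OF fin order_refl])
    also have "\<dots> \<le> (\<Sum>b\<in>B. norm x * N b)"
    proof (intro sum_mono mult_right_mono)
      fix b assume "b \<in> B"
      then show "\<bar>b \<bullet> x\<bar> \<le> norm x" using Cauchy_Schwarz_ineq2[of b x] b1 by simp
      show "0 \<le> N b" using \<open>b \<in> B\<close> N0 BS by simp
    qed
    also have "\<dots> = M * norm x"
      unfolding M_def sum_distrib_right by (intro sum.cong refl mult.commute)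
    finally show ?thesis .
  qed
  define U where "U = {x \<in> S. norm x = 1}"
  show ?thesis
  proof (cases "U = {}")
    case True
    have "x = 0" if "x \<in> S" for x
    proof (rule ccontr)
      assume "x \<noteq> 0"
      then have "(1 / norm x) *\<^sub>R x \<in> U" using that subspace_scale[OF S] by (simp add: U_def)
      then show False using True by blast
    qed
    then have "1 * norm x \<le> N x" if "x \<in> S" for x using N0[OF that] that by fastforce
    then show ?thesis by (intro exI[of _ 1]) auto
  next
    case False
    have lip: "\<bar>N x - N y\<bar> \<le> M * norm (x - y)" if x: "x \<in> S" and y: "y \<in> S" for x y
    proof -
      have d: "x - y \<in> S" using x y by (rule subspace_diff[OF S])
      have "N x \<le> N (x - y) + N y" using Nt[OF d y] by simp
      moreover have "N y \<le> N ((-1) *\<^sub>R (x - y)) + N x"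
        using Nt[OF subspace_scale[OF S d, of "-1"] x] by simp
      moreover have "N ((-1) *\<^sub>R (x - y)) = N (x - y)" using Ns[OF d, of "-1"] by simp
      ultimately show ?thesis using up[OF d] by linarith
    qed
    have "compact U"
    proof -
      have "U = S \<inter> sphere 0 1" by (auto simp: U_def)
      then show ?thesis using closed_subspace[OF S] by (simp add: closed_Int_compact)
    qed
    moreover have "continuous_on U N"
    proof (rule continuous_onI)
      fix x \<epsilon> :: real and z assume "z \<in> U" "(0::real) < \<epsilon>"
      then show "\<exists>d>0. \<forall>x'\<in>U. dist x' z < d \<longrightarrow> dist (N x') (N z) \<le> \<epsilon>"
      proof (intro exI[of _ "\<epsilon> / (M + 1)"] conjI ballI impI)
        show "\<epsilon> / (M + 1) > 0" using \<open>0 < \<epsilon>\<close> M0 by simp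
        fix x' assume x': "x' \<in> U" "dist x' z < \<epsilon> / (M + 1)"
        have "\<bar>N x' - N z\<bar> \<le> M * norm (x' - z)" using lip x' \<open>z \<in> U\<close> by (simp add: U_def)
        also have "\<dots> \<le> (M + 1) * norm (x' - z)" by (simp add: mult_right_mono)
        also have "\<dots> \<le> \<epsilon>" using x' M0 by (simp add: dist_norm pos_less_divide_eq mult.commute less_imp_le)
        finally show "dist (N x') (N z) \<le> \<epsilon>" by (simp add: dist_real_def)
      qed
    qed
    ultimately obtain u where u: "u \<in> U" "\<And>x. x \<in> U \<Longrightarrow> N u \<le> N x"
      using continuous_attains_inf[of U N] False by blast
    have "u \<in> S" "u \<noteq> 0" using u(1) by (auto simp: U_def)
    then have m: "N u > 0" using N0[of u] Nz[of u] by linarith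
    have "N u * norm x \<le> N x" if x: "x \<in> S" for x
    proof (cases "x = 0")
      case True
      then show ?thesis using N0[OF x] by simp
    next
      case False
      then have "(1 / norm x) *\<^sub>R x \<in> U" using x subspace_scale[OF S] by (simp add: U_def)
      then have "N u \<le> N ((1 / norm x) *\<^sub>R x)" by (rule u(2))
      also have "\<dots> = N x / norm x" using Ns[OF x, of "1 / norm x"] by simp
      finally show ?thesis using False by (simp add: pos_le_divide_eq)
    qed
    then show ?thesis using m by blast
  qed
qed

section \<open>Data in coordinates\<close>

locale framed_subspaces =
  fixes V :: "'m::finite \<Rightarrow> 'b::euclidean_space set" and K :: "'m \<Rightarrow> 'a::euclidean_space coord set" and \<beta> :: "'m \<Rightarrow> 'a coord \<Rightarrow> 'b"
  assumes frames: "subspace_frame (V j) (K j) (\<beta> j)"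
begin

abbreviation "synthesis j \<equiv> subspace_frame.lin_comb (K j) (\<beta> j)"
abbreviation "analysis j \<equiv> subspace_frame.coords (K j) (\<beta> j)"
abbreviation "mass j \<equiv> subspace_frame.pad_mass (K j)"

text \<open>This map and the next one are inverse to each other between \<open>linear_tuples V\<close> and \<open>coordinate_matrices\<close>.\<close>

definition to_matrices :: "('a \<Rightarrow>\<^sub>L 'b) ^ 'm \<Rightarrow> (real^('a coord)^('a coord))^'m" where
  "to_matrices L = (\<chi> j. matrix (\<lambda>y. analysis j (blinfun_apply (L $ j) (of_coord y))))"

definition of_matrices :: "(real^('a coord)^('a coord))^'m \<Rightarrow> ('a \<Rightarrow>\<^sub>L 'b) ^ 'm" where
  "of_matrices A = (\<chi> j. Blinfun (\<lambda>x. synthesis j ((A $ j) *v to_coord x)))"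

definition coordinate_matrices :: "((real^('a coord)^('a coord))^'m) set" where
  "coordinate_matrices = {A. \<forall>j z. complement_proj (K j) *v ((A $ j) *v z) = 0}"

lemma complement_proj_coord_proj: "complement_proj J *v y = 0 \<longleftrightarrow> coord_proj J y = y"
  by (auto simp: complement_proj_vec coord_proj_def vec_eq_iff)

lemma to_matrices_mult: "(to_matrices L $ j) *v y = analysis j (blinfun_apply (L $ j) (of_coord y))"
proof -
  have "linear (\<lambda>y. analysis j (blinfun_apply (L $ j) (of_coord y)))"
    using linear_compose[OF linear_compose[OF linear_of_coord, of "blinfun_apply (L $ j)"] subspace_frame.linear_coords[OF frames, of j]]
    by (simp add: o_def bounded_linear.linear[OF blinfun.bounded_linear_right])
  then show ?thesis by (simp add: to_matrices_def matrix_works)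
qed

lemma of_matrices_apply: "blinfun_apply (of_matrices A $ j) x = synthesis j ((A $ j) *v to_coord x)"
proof -
  have "linear (\<lambda>x. synthesis j ((A $ j) *v to_coord x))"
    using linear_compose[OF linear_compose[OF linear_to_coord matrix_vector_mul_linear[of "A $ j"]] subspace_frame.linear_lin_comb[OF frames, of j]]
    by (simp add: o_def)
  then show ?thesis by (simp add: of_matrices_def bounded_linear_Blinfun_apply linear_conv_bounded_linear[symmetric])
qed

lemma to_matrices_in: "to_matrices L \<in> coordinate_matrices"
  by (auto simp: coordinate_matrices_def to_matrices_mult complement_proj_vec vec_eq_iff subspace_frame.coords_def[OF frames])

lemma of_to_matrices: assumes "L \<in> linear_tuples V" shows "of_matrices (to_matrices L) = L"
proof -
  have "blinfun_apply (of_matrices (to_matrices L) $ j) x = blinfun_apply (L $ j) x" for j x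
  proof -
    have "blinfun_apply (L $ j) x \<in> V j" using assms by (auto simp: linear_tuples_def)
    then show ?thesis
      by (simp add: of_matrices_apply to_matrices_mult of_to_coord subspace_frame.lin_comb_coords[OF frames])
  qed
  then show ?thesis by (simp add: vec_eq_iff blinfun_eqI)
qed

lemma to_matrices_diff: "to_matrices (L - L') = to_matrices L - to_matrices L'"
proof -
  have "(to_matrices (L - L') $ j) *v y = (to_matrices L $ j - to_matrices L' $ j) *v y" for j y
    by (simp add: to_matrices_mult matrix_vector_mult_diff_rdistrib blinfun.diff_left linear_diff[OF subspace_frame.linear_coords[OF frames]])
  then have "to_matrices (L - L') $ j = (to_matrices L - to_matrices L') $ j" for j
    unfolding vector_minus_component by (intro matrix_eq[THEN iffD2] allI)
  then show ?thesis by (rule vec_eq_iff[THEN iffD2, OF allI])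
qed

lemma of_matrices_in: "of_matrices A \<in> linear_tuples V"
  using subspace_frame.lin_comb_in[OF frames] by (auto simp: linear_tuples_def of_matrices_apply)

lemma to_of_matrices:
  assumes "A \<in> coordinate_matrices" shows "to_matrices (of_matrices A) = A"
proof -
  have "(to_matrices (of_matrices A) $ j) *v y = (A $ j) *v y" for j y
    using assms by (simp add: to_matrices_mult of_matrices_apply to_of_coord subspace_frame.coords_lin_comb[OF frames]
        coordinate_matrices_def complement_proj_coord_proj)
  then have "to_matrices (of_matrices A) $ j = A $ j" for j
    by (intro matrix_eq[THEN iffD2] allI)
  then show ?thesis by (rule vec_eq_iff[THEN iffD2, OF allI])
qed

lemma subspace_coordinate_matrices: "subspace coordinate_matrices"
  by (auto simp: subspace_def coordinate_matrices_def matrix_vector_mult_add_rdistrib matrix_vector_right_distrib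
      scaleR_matrix_vector_assoc[symmetric] matrix_vector_mult_scaleR)

text \<open>Transporting \<open>N\<close> to matrices reduces the claim to \<open>norm_on_subspace_ge\<close>: matrices form a euclidean space, unlike
  tuples of bounded linear maps with their operator norms.\<close>

lemma norm_to_matrices_le:
  assumes "is_norm_on (linear_tuples V) N"
  shows "\<exists>c>0. \<forall>L\<in>linear_tuples V. c * norm (to_matrices L) \<le> N L"
proof -
  have add: "of_matrices (A + A') = of_matrices A + of_matrices A'" for A A'
    by (simp add: vec_eq_iff, intro allI blinfun_eqI)
       (simp add: of_matrices_apply blinfun.add_left matrix_vector_mult_add_rdistrib linear_add[OF subspace_frame.linear_lin_comb[OF frames]])
  have scale: "of_matrices (t *\<^sub>R A) = t *\<^sub>R of_matrices A" for t A
    by (simp add: vec_eq_iff, intro allI blinfun_eqI)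
       (simp add: of_matrices_apply blinfun.scaleR_left scaleR_matrix_vector_assoc[symmetric] linear_scale[OF subspace_frame.linear_lin_comb[OF frames]])
  have to0: "to_matrices 0 = 0"
    using to_matrices_diff[of 0 0] by simp
  have of0: "of_matrices 0 = 0" using scale[of 0 0] by simp
  have "is_norm_on coordinate_matrices (\<lambda>A. N (of_matrices A))"
    unfolding is_norm_on_def
  proof (intro conjI ballI allI)
    fix A assume A: "A \<in> coordinate_matrices"
    show "0 \<le> N (of_matrices A)" using assms of_matrices_in by (auto simp: is_norm_on_def)
    have "of_matrices A = 0 \<longleftrightarrow> A = 0" using to_of_matrices[OF A] to0 of0 by metis
    then show "N (of_matrices A) = 0 \<longleftrightarrow> A = 0" using assms of_matrices_in by (simp add: is_norm_on_def)
    show "N (of_matrices (c *\<^sub>R A)) = \<bar>c\<bar> * N (of_matrices A)" for c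
      using assms of_matrices_in by (simp add: is_norm_on_def scale)
    show "N (of_matrices (A + A')) \<le> N (of_matrices A) + N (of_matrices A')" for A'
      using assms of_matrices_in by (simp add: is_norm_on_def add)
  qed
  then obtain c where c: "c > 0" "\<And>A. A \<in> coordinate_matrices \<Longrightarrow> c * norm A \<le> N (of_matrices A)"
    using norm_on_subspace_ge[OF subspace_coordinate_matrices] by blast
  then show ?thesis using to_matrices_in of_to_matrices by (intro exI[of _ c]) metis
qed

lemma range_to_matrices:
  assumes "range (blinfun_apply (L $ j)) = V j"
  shows "range ((*v) (to_matrices L $ j)) = {y. complement_proj (K j) *v y = 0}"
proof (intro set_eqI iffI)
  fix y assume "y \<in> range ((*v) (to_matrices L $ j))"
  then show "y \<in> {y. complement_proj (K j) *v y = 0}" using to_matrices_in by (auto simp: coordinate_matrices_def)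
next
  fix y assume "y \<in> {y. complement_proj (K j) *v y = 0}"
  then have y: "coord_proj (K j) y = y" by (simp add: complement_proj_coord_proj)
  have "synthesis j y \<in> range (blinfun_apply (L $ j))" using assms subspace_frame.lin_comb_in[OF frames] by simp
  then obtain x where x: "synthesis j y = blinfun_apply (L $ j) x" by auto
  have "(to_matrices L $ j) *v to_coord x = y"
    by (simp add: to_matrices_mult of_to_coord x[symmetric] subspace_frame.coords_lin_comb[OF frames] y)
  then show "y \<in> range ((*v) (to_matrices L $ j))" by (metis rangeI)
qed

lemma mass_pos: "mass j > 0"
  by (rule subspace_frame.pad_mass_pos[OF frames])

text \<open>The padded integral of \<open>g j\<close> is \<open>mass j\<close> times the integral of the function on \<open>V j\<close> that it represents; this accounts
  for the change of the constant.\<close>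

lemma BL_loc_bound_of_coord:
  assumes L: "L \<in> linear_tuples V" and BL: "coord_BL_bound (\<lambda>j. to_matrices L $ j) K (($) p) C" and C: "C \<ge> 0"
  shows "BL_loc_bound V L p (ennreal (C * (\<Prod>j\<in>UNIV. rpow (mass j) (p $ j))))"
  unfolding BL_loc_bound_def
proof (intro allI impI)
  fix f :: "'m \<Rightarrow> 'b \<Rightarrow> real"
  assume f: "\<forall>j. integrable (lborel_subspace (V j)) (f j) \<and> (\<forall>y\<in>V j. 0 \<le> f j y)"
  have fm: "f j \<in> borel_measurable (lborel_subspace (V j))" for j using f by auto
  define g where "g j y = f j (synthesis j y)" for j y
  have gm[measurable]: "g j \<in> borel_measurable borel" for j
    unfolding g_def[abs_def] by (rule measurable_compose[OF subspace_frame.lin_comb_measurable[OF frames] fm])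
  have g0: "0 \<le> g j y" for j y using f subspace_frame.lin_comb_in[OF frames] by (simp add: g_def)
  have gK: "g j (coord_proj (K j) y) = g j y" for j y
    by (simp add: g_def subspace_frame.lin_comb_coord_proj[OF frames])
  define J where "J j = (\<integral>y. f j y \<partial>lborel_subspace (V j))" for j
  have Jn: "(\<integral>\<^sup>+v. ennreal (f j v) \<partial>lborel_subspace (V j)) = ennreal (J j)" for j
    unfolding J_def using f by (intro nn_integral_eq_integral AE_I2) (auto simp: subspace_frame.space_lborel_subspace[OF frames])
  have J0: "J j \<ge> 0" for j
    unfolding J_def using f by (intro integral_nonneg_AE AE_I2) (auto simp: subspace_frame.space_lborel_subspace[OF frames])
  have gI: "(\<integral>\<^sup>+y. ennreal (g j y * exp (- ((norm (complement_proj (K j) *v y))\<^sup>2 / 2))) \<partial>lborel) = ennreal (mass j * J j)" for j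
  proof -
    have "(\<lambda>v. ennreal (f j v)) \<in> borel_measurable (lborel_subspace (V j))" using fm by measurable
    from subspace_frame.nn_integral_lborel_subspace[OF frames this]
    show ?thesis using g0 mass_pos[of j] J0[of j] by (simp add: g_def[symmetric] ennreal_mult Jn)
  qed
  have pt: "f j (blinfun_apply (L $ j) (of_coord y)) = g j ((to_matrices L $ j) *v y)" for j y
  proof -
    have "blinfun_apply (L $ j) (of_coord y) \<in> V j" using L by (auto simp: linear_tuples_def)
    then show ?thesis by (simp add: g_def to_matrices_mult subspace_frame.lin_comb_coords[OF frames])
  qed
  have cb: "indicator (cball 0 1) (of_coord y) = (indicator (cball 0 1) y :: ennreal)" for y :: "real^('a coord)"
    by (simp add: indicator_def norm_of_coord)
  have Lm: "(\<lambda>x. f j (blinfun_apply (L $ j) x)) \<in> borel_measurable borel" for j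
  proof -
    have eq: "(\<lambda>x. f j (blinfun_apply (L $ j) x)) = (\<lambda>x. g j ((to_matrices L $ j) *v to_coord x))"
      using pt[of j "to_coord _"] by (simp add: of_to_coord)
    have tc: "to_coord \<in> borel \<rightarrow>\<^sub>M borel"
      by (rule borel_measurable_continuous_onI) (simp add: linear_to_coord linear_continuous_on linear_conv_bounded_linear[symmetric])
    have mv: "(*v) (to_matrices L $ j) \<in> borel \<rightarrow>\<^sub>M borel"
      by (rule borel_measurable_continuous_onI) (simp add: linear_continuous_on linear_conv_bounded_linear[symmetric])
    show ?thesis unfolding eq by (rule measurable_compose[OF measurable_compose[OF tc mv] gm])
  qed
  have "(\<integral>\<^sup>+x\<in>cball 0 1. ennreal (\<Prod>j\<in>UNIV. rpow (f j (blinfun_apply (L $ j) x)) (p $ j)) \<partial>lborel)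
      = (\<integral>\<^sup>+y\<in>cball 0 1. ennreal (\<Prod>j\<in>UNIV. rpow (g j ((to_matrices L $ j) *v y)) (p $ j)) \<partial>lborel)"
  proof -
    have [measurable]: "cball (0::'a) 1 \<in> sets borel" by (rule borel_closed) simp
    note [measurable] = Lm
    show ?thesis by (subst nn_integral_of_coord) (auto simp: pt cb)
  qed
  also have "\<dots> \<le> ennreal (C * (\<Prod>j\<in>UNIV. rpow (mass j * J j) (p $ j)))"
    using gm g0 gK gI J0 mass_pos by (intro BL[unfolded coord_BL_bound_def, rule_format]) (auto simp: less_imp_le)
  also have "\<dots> = ennreal (C * (\<Prod>j\<in>UNIV. rpow (mass j) (p $ j))) * ennreal (\<Prod>j\<in>UNIV. rpow (J j) (p $ j))"
    using C J0 mass_pos by (simp add: rpow_mult less_imp_le prod.distrib ennreal_mult[symmetric] prod_nonneg mult.assoc)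
  finally show "(\<integral>\<^sup>+x\<in>cball 0 1. ennreal (\<Prod>j\<in>UNIV. rpow (f j (blinfun_apply (L $ j) x)) (p $ j)) \<partial>lborel)
     \<le> ennreal (C * (\<Prod>j\<in>UNIV. rpow (mass j) (p $ j))) * ennreal (\<Prod>j\<in>UNIV. rpow (\<integral>y. f j y \<partial>lborel_subspace (V j)) (p $ j))"
    by (simp add: J_def)
qed

lemma coord_BL_bound_of_BL_loc:
  assumes L: "L \<in> linear_tuples V" and BL: "BL_loc_bound V L p C" and C: "C < \<infinity>"
  shows "coord_BL_bound (\<lambda>j. to_matrices L $ j) K (($) p) (enn2real C * (\<Prod>j\<in>UNIV. rpow (1 / mass j) (p $ j)))"
  unfolding coord_BL_bound_def
proof (intro allI impI)
  fix g :: "'m \<Rightarrow> real^('a coord) \<Rightarrow> real" and I :: "'m \<Rightarrow> real"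
  assume gI: "\<forall>j. g j \<in> borel_measurable borel \<and> (\<forall>y. 0 \<le> g j y \<and> g j (coord_proj (K j) y) = g j y) \<and> 0 \<le> I j \<and>
       (\<integral>\<^sup>+y. ennreal (g j y * exp (- ((norm (complement_proj (K j) *v y))\<^sup>2 / 2))) \<partial>lborel) = ennreal (I j)"
  have gm[measurable]: "g j \<in> borel_measurable borel" for j using gI by blast
  have g0: "0 \<le> g j y" and gK: "g j (coord_proj (K j) y) = g j y" and I0: "0 \<le> I j" for j y using gI by auto
  define f where "f j v = g j (analysis j v)" for j v
  have am: "analysis j \<in> borel \<rightarrow>\<^sub>M borel" for j
    using subspace_frame.linear_coords[OF frames, of j]
    by (intro borel_measurable_continuous_onI) (simp add: linear_continuous_on linear_conv_bounded_linear[symmetric])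
  have fm: "f j \<in> borel_measurable (lborel_subspace (V j))" for j
  proof -
    have "f j \<in> borel_measurable borel" unfolding f_def[abs_def] by (rule measurable_compose[OF am gm])
    then have "f j \<in> borel_measurable (restrict_space borel (V j))" by (rule measurable_restrict_space1)
    then show ?thesis using measurable_cong_sets[OF subspace_frame.sets_lborel_subspace[OF frames] refl] by blast
  qed
  have fe: "f j (synthesis j y) = g j y" for j y
    by (simp add: f_def subspace_frame.coords_lin_comb[OF frames] gK)
  have "ennreal (mass j) * (\<integral>\<^sup>+v. ennreal (f j v) \<partial>lborel_subspace (V j)) = ennreal (mass j) * ennreal (I j / mass j)" for j
  proof -
    have "(\<lambda>v. ennreal (f j v)) \<in> borel_measurable (lborel_subspace (V j))" using fm by measurable
    from subspace_frame.nn_integral_lborel_subspace[OF frames this]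
    have "ennreal (mass j) * (\<integral>\<^sup>+v. ennreal (f j v) \<partial>lborel_subspace (V j))
       = (\<integral>\<^sup>+y. ennreal (g j y * exp (- ((norm (complement_proj (K j) *v y))\<^sup>2 / 2))) \<partial>lborel)"
      by (simp add: fe g0 ennreal_mult)
    also have "\<dots> = ennreal (I j)" using gI by blast
    finally show ?thesis using mass_pos[of j] I0[of j] by (simp add: ennreal_mult[symmetric])
  qed
  then have nnf: "(\<integral>\<^sup>+v. ennreal (f j v) \<partial>lborel_subspace (V j)) = ennreal (I j / mass j)" for j
    using mass_pos[of j] ennreal_mult_cancel_left[of "ennreal (mass j)" _ "ennreal (I j / mass j)"]
    by (metis ennreal_eq_zero_iff ennreal_neq_top leD less_imp_le)
  have fint: "integrable (lborel_subspace (V j)) (f j)" for j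
    by (rule integrableI_nn_integral_finite[OF fm _ nnf]) (simp add: f_def g0)
  have fI: "(\<integral>y. f j y \<partial>lborel_subspace (V j)) = I j / mass j" for j
    using nnf[of j] mass_pos[of j] I0[of j] fm by (subst integral_eq_nn_integral) (auto simp: f_def g0)
  have pt: "f j (blinfun_apply (L $ j) (of_coord y)) = g j ((to_matrices L $ j) *v y)" for j y
    by (simp add: f_def to_matrices_mult)
  have cb: "indicator (cball 0 1) (of_coord y) = (indicator (cball 0 1) y :: ennreal)" for y :: "real^('a coord)"
    by (simp add: indicator_def norm_of_coord)
  have Lm: "(\<lambda>x. f j (blinfun_apply (L $ j) x)) \<in> borel_measurable borel" for j
  proof -
    have "blinfun_apply (L $ j) \<in> borel \<rightarrow>\<^sub>M borel"
      by (intro borel_measurable_continuous_onI linear_continuous_on blinfun.bounded_linear_right)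
    from measurable_compose[OF this measurable_compose[OF am gm]] show ?thesis unfolding f_def .
  qed
  have "(\<integral>\<^sup>+y\<in>cball 0 1. ennreal (\<Prod>j\<in>UNIV. rpow (g j ((to_matrices L $ j) *v y)) (p $ j)) \<partial>lborel)
      = (\<integral>\<^sup>+x\<in>cball 0 1. ennreal (\<Prod>j\<in>UNIV. rpow (f j (blinfun_apply (L $ j) x)) (p $ j)) \<partial>lborel)"
  proof -
    have [measurable]: "cball (0::'a) 1 \<in> sets borel" by (rule borel_closed) simp
    note [measurable] = Lm
    show ?thesis by (subst nn_integral_of_coord) (auto simp: pt cb)
  qed
  also have "\<dots> \<le> C * ennreal (\<Prod>j\<in>UNIV. rpow (\<integral>y. f j y \<partial>lborel_subspace (V j)) (p $ j))"
    using fint g0 by (intro BL[unfolded BL_loc_bound_def, rule_format]) (simp add: f_def[abs_def])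
  also have "\<dots> = ennreal (enn2real C) * ennreal (\<Prod>j\<in>UNIV. rpow (1 / mass j * I j) (p $ j))"
    using C by (simp add: fI)
  also have "\<dots> = ennreal (enn2real C * (\<Prod>j\<in>UNIV. rpow (1 / mass j) (p $ j)) * (\<Prod>j\<in>UNIV. rpow (I j) (p $ j)))"
  proof -
    have "rpow (1 / mass j * I j) (p $ j) = rpow (1 / mass j) (p $ j) * rpow (I j) (p $ j)" for j
      using mass_pos[of j] I0[of j] by (intro rpow_mult) (auto simp: less_imp_le)
    then show ?thesis by (simp only: prod.distrib) (simp add: ennreal_mult[symmetric] prod_nonneg mult.assoc)
  qed
  finally show "(\<integral>\<^sup>+y\<in>cball 0 1. ennreal (\<Prod>j\<in>UNIV. rpow (g j ((to_matrices L $ j) *v y)) (p $ j)) \<partial>lborel)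
     \<le> ennreal (enn2real C * (\<Prod>j\<in>UNIV. rpow (1 / mass j) (p $ j)) * (\<Prod>j\<in>UNIV. rpow (I j) (p $ j)))" .
qed

end

text \<open>The dimension bound leaves room for \<open>dim (V j)\<close> coordinates among those of \<open>'a\<close>.\<close>

lemma framed_subspaces_exist:
  fixes V :: "'m::finite \<Rightarrow> 'b::euclidean_space set"
  assumes "\<And>j. subspace (V j)" "\<And>j. dim (V j) \<le> DIM('a::euclidean_space)"
  shows "\<exists>(K :: 'm \<Rightarrow> 'a coord set) \<beta>. framed_subspaces V K \<beta>"
proof -
  have "\<exists>(K :: 'a coord set) \<beta>. subspace_frame (V j) K \<beta>" for j
  proof -
    define B where "B = (SOME B. orthonormal_basis_of (V j) B)"
    have B: "orthonormal_basis_of (V j) B"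
      unfolding B_def using someI_ex[OF orthonormal_basis_of_exists[OF assms(1)]] .
    have fin: "finite B" using B by (rule orthonormal_basis_of_finite)
    have "0 \<notin> B" using B by (auto simp: orthonormal_basis_of_def)
    then have "independent B" using B by (intro pairwise_orthogonal_independent) (auto simp: orthonormal_basis_of_def)
    then have "card B = dim (V j)"
      using B by (metis dim_eq_card_independent dim_span orthonormal_basis_of_def)
    then have "card B \<le> card (UNIV :: 'a coord set)" using assms(2)[of j] by (simp add: card_coord)
    then obtain K :: "'a coord set" where "card K = card B" using obtain_subset_with_card_n by metis
    then obtain \<beta> where "bij_betw \<beta> K B" using fin finite_same_card_bij[of K B] by auto
    then have "subspace_frame (V j) K \<beta>" using assms(1) unfolding B_def by unfold_locales
    then show ?thesis by blast
  qed
  then obtain K :: "'m \<Rightarrow> 'a coord set" and \<beta> where "\<forall>j. subspace_frame (V j) (K j) (\<beta> j)" by metis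
  then show ?thesis unfolding framed_subspaces_def by blast
qed

theorem theorem2p1:
  fixes V :: "'m::finite \<Rightarrow> 'b::euclidean_space set"
    and L0 :: "('a::euclidean_space \<Rightarrow>\<^sub>L 'b) ^ 'm"
    and p :: "real ^ 'm"
    and N :: "('a \<Rightarrow>\<^sub>L 'b) ^ 'm \<Rightarrow> real"
  assumes "\<And>j. subspace (V j)"
    and "\<And>j. dim (V j) \<le> DIM('a)"
    and "is_norm_on (linear_tuples V) N"
    and "brascamp_lieb_datum V L0 p"
    and "BL_loc V L0 p < \<infinity>"
  shows "\<exists>\<delta>>0. \<exists>C<\<infinity>. \<forall>L :: ('a \<Rightarrow>\<^sub>L 'b) ^ 'm.
           brascamp_lieb_datum V L p \<and> N (L - L0) < \<delta> \<longrightarrow> BL_loc V L p \<le> C"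
proof -
  obtain K :: "'m \<Rightarrow> 'a coord set" and \<beta> where "framed_subspaces V K \<beta>"
    using framed_subspaces_exist[of V, OF assms(1,2)] by blast
  then interpret framed_subspaces V K \<beta> .
  have p: "p $ j \<ge> 0" for j using assms(4) by (simp add: brascamp_lieb_datum_def)
  have lt: "L \<in> linear_tuples V" if "brascamp_lieb_datum V L p" for L :: "('a \<Rightarrow>\<^sub>L 'b) ^ 'm"
    using that by (simp add: brascamp_lieb_datum_def linear_tuples_def)
  obtain C1 where C1: "BL_loc_bound V L0 p C1" "C1 < \<infinity>"
    using assms(5) unfolding BL_loc_def Inf_less_iff by blast
  have "coord_BL_bound (\<lambda>j. to_matrices L0 $ j) K (($) p) (enn2real C1 * (\<Prod>j\<in>UNIV. rpow (1 / mass j) (p $ j)))"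
    by (rule coord_BL_bound_of_BL_loc[OF lt[OF assms(4)] C1])
  moreover have "0 \<le> enn2real C1 * (\<Prod>j\<in>UNIV. rpow (1 / mass j) (p $ j))"
    by (intro mult_nonneg_nonneg prod_nonneg) auto
  moreover have "range ((*v) (to_matrices L0 $ j)) = {y. complement_proj (K j) *v y = 0}" for j
    using assms(4) by (intro range_to_matrices) (simp add: brascamp_lieb_datum_def)
  ultimately obtain \<delta> C where \<delta>: "0 < \<delta>" and C: "0 \<le> C"
    and near: "\<And>A. norm (A - to_matrices L0) < \<delta> \<Longrightarrow> (\<forall>j z. complement_proj (K j) *v ((A $ j) *v z) = 0) \<Longrightarrow> coord_BL_bound (\<lambda>j. A $ j) K (($) p) C"
    using coord_BL_bound_stable[of "to_matrices L0" K "($) p", OF _ _ p] by blast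
  obtain c where c: "c > 0" and cN: "\<And>L. L \<in> linear_tuples V \<Longrightarrow> c * norm (to_matrices L) \<le> N L"
    using norm_to_matrices_le[OF assms(3)] by blast
  have "BL_loc V L p \<le> ennreal (C * (\<Prod>j\<in>UNIV. rpow (mass j) (p $ j)))"
    if L: "brascamp_lieb_datum V L p" and close: "N (L - L0) < c * \<delta>" for L :: "('a \<Rightarrow>\<^sub>L 'b) ^ 'm"
  proof -
    have "L - L0 \<in> linear_tuples V"
      using lt[OF L] lt[OF assms(4)] subspace_diff[OF assms(1)]
      by (auto simp: linear_tuples_def blinfun.diff_left image_subset_iff)
    from cN[OF this] close have "c * norm (to_matrices L - to_matrices L0) < c * \<delta>"
      by (simp add: to_matrices_diff)
    then have "norm (to_matrices L - to_matrices L0) < \<delta>" using c by simp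
    moreover have "\<forall>j z. complement_proj (K j) *v ((to_matrices L $ j) *v z) = 0"
      using to_matrices_in[of L] unfolding coordinate_matrices_def by blast
    ultimately have "coord_BL_bound (\<lambda>j. to_matrices L $ j) K (($) p) C" by (rule near)
    then have "BL_loc_bound V L p (ennreal (C * (\<Prod>j\<in>UNIV. rpow (mass j) (p $ j))))"
      by (rule BL_loc_bound_of_coord[OF lt[OF L] _ C])
    then show ?thesis unfolding BL_loc_def by (intro Inf_lower) simp
  qed
  then show ?thesis using c \<delta>
    by (intro exI[of _ "c * \<delta>"] conjI exI[of _ "ennreal (C * (\<Prod>j\<in>UNIV. rpow (mass j) (p $ j)))"]) auto
qed

end
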